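(* Let $R$ be a quasilocal domain with quotient field $F$. The following statements are equivalent. (1) $R$ is a bad stable domain. (2) $\overline R$ is a DVR and $\overline R/R\cong\bigoplus_{i\in I}F/\overline R$ as $R$-modules for some index set $I$. (3) $\overline R$ is a DVR and $\overline R/R$ is a direct sum of divisible Artinian uniserial $R$-modules.
   Context: All rings are commutative with identity. A quasilocal ring is a ring with a unique maximal ideal (not necessarily Noetherian). $\overline R$ denotes the integral closure of $R$ in its total ring of quotients (here $F$). An $R$-module $K$ is uniserial if the set of all $R$-submodules of $K$ is linearly ordered by inclusion. An $R$-module $L$ over a domain $R$ is divisible if $rL=L$ for all nonzero $r\in R$. An ideal is stable if it is projective over its ring of endomorphisms; a domain is stable if every nonzero ideal is stable. $R$ has finite normalization if $\overline R$ is a finite (that is, finitely generated) $R$-module. A bad stable domain is a quasilocal stable domain of Krull dimension $1$ that does not have finite normalization.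
   Formalization: The index set in (2) is required to be nonempty and the direct sum in (3) to be a nonempty sum of nonzero modules; otherwise a DVR R, where the quotient of its integral closure by R is 0 (the empty sum), satisfies (2) and (3) but is not bad. *)

theory Defs
  imports
    "HOL-Algebra.Module"
    "HOL-Algebra.Polynomials"
    "HOL-Algebra.Ring_Divisibility"
    "HOL-Library.Extended_Nat"
begin

section \<open>Rings\<close>

definition quasilocal :: "('a, 'b) ring_scheme \<Rightarrow> bool" where
  "quasilocal A \<longleftrightarrow> cring A \<and> (\<exists>!M. maximalideal M A)"

text \<open>A discrete valuation ring: a quasilocal principal ideal domain that is not a field.\<close>

definition DVR :: "('a, 'b) ring_scheme \<Rightarrow> bool" where
  "DVR A \<longleftrightarrow> principal_domain A \<and> quasilocal A \<and> \<not> field A"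

definition krull_dim :: "('a, 'b) ring_scheme \<Rightarrow> enat" where
  "krull_dim A =
     Sup {enat n | n. \<exists>P. (\<forall>i\<le>n. primeideal (P i) A) \<and> (\<forall>i<n. P i \<subset> P (Suc i))}"

text \<open>
  A domain and its quotient field are represented by a field \<open>F\<close> and a subset \<open>R\<close> of its
  carrier; the domain itself is the ring \<open>F\<lparr>carrier := R\<rparr>\<close>.
\<close>

definition quotient_field_of :: "('a, 'b) ring_scheme \<Rightarrow> 'a set \<Rightarrow> bool" where
  "quotient_field_of F R \<longleftrightarrow> field F \<and> subdomain R F \<and>
     (\<forall>x\<in>carrier F. \<exists>a\<in>R. \<exists>b\<in>R - {\<zero>\<^bsub>F\<^esub>}. x = a \<otimes>\<^bsub>F\<^esub> inv\<^bsub>F\<^esub> b)"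

text \<open>
  Elements of \<open>F\<close> that are roots of a monic polynomial over \<open>R\<close>. Polynomials are coefficient
  lists with the leading coefficient first, and the empty list is the zero polynomial.
\<close>

definition integral_closure :: "('a, 'b) ring_scheme \<Rightarrow> 'a set \<Rightarrow> 'a set" where
  "integral_closure F R = {x \<in> carrier F. \<exists>p.
     polynomial\<^bsub>F\<^esub> R p \<and> p \<noteq> [] \<and> hd p = \<one>\<^bsub>F\<^esub> \<and> ring.eval F p x = \<zero>\<^bsub>F\<^esub>}"


section \<open>Modules\<close>

text \<open>
  The record type of modules has the ring multiplication and unit as components; they play no
  role in the module structure, and are \<open>undefined\<close> where there is no natural choice.
\<close>

text \<open>
  A subset \<open>S\<close> of a ring \<open>A\<close> with the addition of \<open>A\<close> and with scalars acting by the
  multiplication of \<open>A\<close>. It is used for ideals of \<open>A\<close>, and for \<open>R\<close>-submodules of \<open>A\<close> where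
  \<open>R\<close> is a subring of \<open>A\<close>.
\<close>

definition module_in :: "('a, 'b) ring_scheme \<Rightarrow> 'a set \<Rightarrow> ('a, 'a) module" where
  "module_in A S = \<lparr>carrier = S, mult = mult A, one = one A, zero = zero A, add = add A,
     smult = mult A\<rparr>"

definition mod_hom ::
  "('r, 'b) ring_scheme \<Rightarrow> ('r, 'm, 'c) module_scheme \<Rightarrow> ('r, 'n, 'd) module_scheme \<Rightarrow> ('m \<Rightarrow> 'n) set"
  where
  "mod_hom A M N = {f \<in> carrier M \<rightarrow> carrier N.
     (\<forall>x\<in>carrier M. \<forall>y\<in>carrier M. f (x \<oplus>\<^bsub>M\<^esub> y) = f x \<oplus>\<^bsub>N\<^esub> f y) \<and>
     (\<forall>a\<in>carrier A. \<forall>x\<in>carrier M. f (a \<odot>\<^bsub>M\<^esub> x) = a \<odot>\<^bsub>N\<^esub> f x)}"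

definition mod_isomorphic ::
  "('r, 'b) ring_scheme \<Rightarrow> ('r, 'm, 'c) module_scheme \<Rightarrow> ('r, 'n, 'd) module_scheme \<Rightarrow> bool" where
  "mod_isomorphic A M N \<longleftrightarrow> (\<exists>f\<in>mod_hom A M N. bij_betw f (carrier M) (carrier N))"

definition quotient_mod :: "('r, 'm, 'c) module_scheme \<Rightarrow> 'm set \<Rightarrow> ('r, 'm set) module" where
  "quotient_mod M N = \<lparr>carrier = a_rcosets\<^bsub>M\<^esub> N, mult = undefined, one = undefined,
     zero = N, add = set_add M, smult = (\<lambda>a C. \<Union>x\<in>C. N +>\<^bsub>M\<^esub> (a \<odot>\<^bsub>M\<^esub> x))\<rparr>"

definition direct_sum ::
  "'i set \<Rightarrow> ('i \<Rightarrow> ('r, 'm, 'c) module_scheme) \<Rightarrow> ('r, 'i \<Rightarrow> 'm) module" where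
  "direct_sum I L =
     \<lparr>carrier = {f \<in> \<Pi>\<^sub>E i\<in>I. carrier (L i). finite {i\<in>I. f i \<noteq> \<zero>\<^bsub>L i\<^esub>}},
      mult = undefined, one = undefined,
      zero = (\<lambda>i\<in>I. \<zero>\<^bsub>L i\<^esub>),
      add = (\<lambda>f g. \<lambda>i\<in>I. f i \<oplus>\<^bsub>L i\<^esub> g i),
      smult = (\<lambda>a f. \<lambda>i\<in>I. a \<odot>\<^bsub>L i\<^esub> f i)\<rparr>"

definition fin_gen_mod :: "('r, 'b) ring_scheme \<Rightarrow> ('r, 'm, 'c) module_scheme \<Rightarrow> bool" where
  "fin_gen_mod A M \<longleftrightarrow>
     (\<exists>S\<subseteq>carrier M. finite S \<and> \<Inter>{N. submodule N A M \<and> S \<subseteq> N} = carrier M)"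

definition uniserial :: "('r, 'b) ring_scheme \<Rightarrow> ('r, 'm, 'c) module_scheme \<Rightarrow> bool" where
  "uniserial A M \<longleftrightarrow> (\<forall>N N'. submodule N A M \<longrightarrow> submodule N' A M \<longrightarrow> N \<subseteq> N' \<or> N' \<subseteq> N)"

definition artinian_mod :: "('r, 'b) ring_scheme \<Rightarrow> ('r, 'm, 'c) module_scheme \<Rightarrow> bool" where
  "artinian_mod A M \<longleftrightarrow> (\<forall>N::nat \<Rightarrow> 'm set.
     (\<forall>n. submodule (N n) A M \<and> N (Suc n) \<subseteq> N n) \<longrightarrow> (\<exists>k. \<forall>n\<ge>k. N n = N k))"

definition divisible_mod :: "('r, 'b) ring_scheme \<Rightarrow> ('r, 'm, 'c) module_scheme \<Rightarrow> bool" where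
  "divisible_mod A M \<longleftrightarrow>
     (\<forall>a\<in>carrier A - {\<zero>\<^bsub>A\<^esub>}. (\<lambda>x. a \<odot>\<^bsub>M\<^esub> x) ` carrier M = carrier M)"

text \<open>
  \<open>M\<close> is projective if it is isomorphic to a direct summand \<open>P\<close> of a free module. The basis of
  the free module may be indexed by a set of elements of \<open>M\<close> without loss of generality, since
  the canonical surjection onto a projective \<open>M\<close> from the free module on \<open>carrier M\<close> splits.
\<close>

definition projective_mod :: "('r, 'b) ring_scheme \<Rightarrow> ('r, 'm, 'c) module_scheme \<Rightarrow> bool" where
  "projective_mod A M \<longleftrightarrow> module A M \<and>
     (\<exists>(B :: 'm set) P Q.
        let E = direct_sum B (\<lambda>_. module_in A (carrier A)) in
        submodule P A E \<and> submodule Q A E \<and>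
        P <+>\<^bsub>E\<^esub> Q = carrier E \<and> P \<inter> Q = {\<zero>\<^bsub>E\<^esub>} \<and>
        mod_isomorphic A M (E\<lparr>carrier := P\<rparr>))"


section \<open>Stable domains\<close>

text \<open>
  Endomorphisms are represented by functions that are \<open>undefined\<close> outside the carrier, so that
  equality in the endomorphism ring is equality of maps on the carrier.
\<close>

definition End_ring :: "('r, 'b) ring_scheme \<Rightarrow> ('r, 'm, 'c) module_scheme \<Rightarrow> ('m \<Rightarrow> 'm) ring" where
  "End_ring A M =
     \<lparr>carrier = mod_hom A M M \<inter> extensional (carrier M),
      mult = (\<lambda>f g. compose (carrier M) f g),
      one = (\<lambda>x\<in>carrier M. x),
      zero = (\<lambda>x\<in>carrier M. \<zero>\<^bsub>M\<^esub>),
      add = (\<lambda>f g. \<lambda>x\<in>carrier M. f x \<oplus>\<^bsub>M\<^esub> g x)\<rparr>"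

definition over_End :: "('r, 'm, 'c) module_scheme \<Rightarrow> ('m \<Rightarrow> 'm, 'm) module" where
  "over_End M = \<lparr>carrier = carrier M, mult = mult M, one = one M, zero = zero M, add = add M,
     smult = (\<lambda>f x. f x)\<rparr>"

definition stable_ideal :: "('a, 'b) ring_scheme \<Rightarrow> 'a set \<Rightarrow> bool" where
  "stable_ideal A J \<longleftrightarrow> ideal J A \<and>
     projective_mod (End_ring A (module_in A J)) (over_End (module_in A J))"

definition stable_domain :: "('a, 'b) ring_scheme \<Rightarrow> bool" where
  "stable_domain A \<longleftrightarrow> domain A \<and> (\<forall>J. ideal J A \<longrightarrow> J \<noteq> {\<zero>\<^bsub>A\<^esub>} \<longrightarrow> stable_ideal A J)"

text \<open>In the next two definitions, \<open>F\<close> is meant to be the quotient field of \<open>R\<close>.\<close>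

definition finite_normalization :: "('a, 'b) ring_scheme \<Rightarrow> 'a set \<Rightarrow> bool" where
  "finite_normalization F R \<longleftrightarrow>
     fin_gen_mod (F\<lparr>carrier := R\<rparr>) (module_in F (integral_closure F R))"

definition bad_stable_domain :: "('a, 'b) ring_scheme \<Rightarrow> 'a set \<Rightarrow> bool" where
  "bad_stable_domain F R \<longleftrightarrow>
     quasilocal (F\<lparr>carrier := R\<rparr>) \<and> stable_domain (F\<lparr>carrier := R\<rparr>) \<and>
     krull_dim (F\<lparr>carrier := R\<rparr>) = 1 \<and> \<not> finite_normalization F R"


section \<open>Direct sum decompositions\<close>

text \<open>
  The next two predicates express that \<open>M\<close> is a direct sum of copies of \<open>L\<close>, and that \<open>M\<close> is a
  direct sum of modules with the property \<open>Q\<close>. Direct sums are over nonempty index sets and, in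
  the second predicate, of nonzero modules. The degenerate sums have to be excluded: if \<open>R\<close>
  is a DVR, its integral closure modulo \<open>R\<close> is zero, hence the empty sum, but \<open>R\<close> is not bad.

  Index sets can be taken in the type \<open>'m\<close> of elements of \<open>M\<close>, as \<open>M\<close> has at least as many
  elements as a direct sum decomposition has nonzero summands; and each summand, being
  isomorphic to a submodule of \<open>M\<close>, can be taken to have its elements in \<open>'m\<close>.
\<close>

definition nonempty_direct_sum_of_copies ::
  "('r, 'b) ring_scheme \<Rightarrow> ('r, 'm, 'c) module_scheme \<Rightarrow> ('r, 'n, 'd) module_scheme \<Rightarrow> bool" where
  "nonempty_direct_sum_of_copies A M L \<longleftrightarrow>
     (\<exists>I :: 'm set. I \<noteq> {} \<and> mod_isomorphic A M (direct_sum I (\<lambda>_. L)))"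

definition nonempty_direct_sum_of_nonzero ::
  "('r, 'b) ring_scheme \<Rightarrow> ('r, 'm) module \<Rightarrow> (('r, 'm) module \<Rightarrow> bool) \<Rightarrow> bool" where
  "nonempty_direct_sum_of_nonzero A M Q \<longleftrightarrow>
     (\<exists>(I :: 'm set) (L :: 'm \<Rightarrow> ('r, 'm) module). I \<noteq> {} \<and>
        (\<forall>i\<in>I. module A (L i) \<and> carrier (L i) \<noteq> {\<zero>\<^bsub>L i\<^esub>} \<and> Q (L i)) \<and>
        mod_isomorphic A M (direct_sum I L))"

end

theory Submission
  imports Defs "HOL-Decision_Procs.Commutative_Ring" "HOL-Library.Reflection"
begin

section \<open>Identities in commutative rings\<close>

datatype ring_term = RVar nat | RZero | ROne | RNeg ring_term
  | RAdd ring_term ring_term | RSub ring_term ring_term | RMul ring_term ring_term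

datatype ring_equation = REq ring_term ring_term

primrec polex_of :: "ring_term \<Rightarrow> polex" where
  "polex_of (RVar n) = Var n"
| "polex_of RZero = Const 0"
| "polex_of ROne = Const 1"
| "polex_of (RNeg s) = Neg (polex_of s)"
| "polex_of (RAdd s t) = Add (polex_of s) (polex_of t)"
| "polex_of (RSub s t) = Sub (polex_of s) (polex_of t)"
| "polex_of (RMul s t) = Mul (polex_of s) (polex_of t)"

primrec var_bound :: "ring_term \<Rightarrow> nat" where
  "var_bound (RVar n) = Suc n"
| "var_bound RZero = 0"
| "var_bound ROne = 0"
| "var_bound (RNeg s) = var_bound s"
| "var_bound (RAdd s t) = max (var_bound s) (var_bound t)"
| "var_bound (RSub s t) = max (var_bound s) (var_bound t)"
| "var_bound (RMul s t) = max (var_bound s) (var_bound t)"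

context cring
begin

primrec term_val :: "'a list \<Rightarrow> ring_term \<Rightarrow> 'a" where
  "term_val xs (RVar n) = xs ! n"
| "term_val xs RZero = \<zero>"
| "term_val xs ROne = \<one>"
| "term_val xs (RNeg s) = \<ominus> term_val xs s"
| "term_val xs (RAdd s t) = term_val xs s \<oplus> term_val xs t"
| "term_val xs (RSub s t) = term_val xs s \<ominus> term_val xs t"
| "term_val xs (RMul s t) = term_val xs s \<otimes> term_val xs t"

primrec equation_val :: "'a list \<Rightarrow> ring_equation \<Rightarrow> bool" where
  "equation_val xs (REq s t) \<longleftrightarrow> term_val xs s = term_val xs t"

lemmas ring_reify = term_val.simps equation_val.simps

lemma term_val_eq_Ipolex:
  "var_bound t \<le> length xs \<Longrightarrow> term_val xs t = Ipolex xs (polex_of t)"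
proof (induction t)
  case (RVar n)
  then show ?case by (simp flip: Cons_nth_drop_Suc)
qed auto

lemma ring_identityI:
  assumes "set xs \<subseteq> carrier R" "var_bound (RSub s t) \<le> length xs"
    and "norm (polex_of s) = norm (polex_of t)"
  shows "equation_val xs (REq s t)"
  using assms term_val_eq_Ipolex[of s xs] term_val_eq_Ipolex[of t xs]
    norm_eq[of xs "polex_of s" "polex_of t"]
  by (auto simp: in_carrier_def)

lemma minus_self: "x \<in> carrier R \<Longrightarrow> x \<ominus> x = \<zero>"
  by (simp add: a_minus_def r_neg)

lemma eq_by_combination:
  assumes "a = b" "x \<ominus> y = c \<otimes> (a \<ominus> b)"
    and "x \<in> carrier R" "y \<in> carrier R" "b \<in> carrier R" "c \<in> carrier R"
  shows "x = y"
proof -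
  have "x \<ominus> y = \<zero>" using assms by (simp add: minus_self)
  then show ?thesis using assms r_right_minus_eq[of x y] by blast
qed

lemma eq_by_combination2:
  assumes "a = b" "c = d" "x \<ominus> y = e \<otimes> (a \<ominus> b) \<oplus> f \<otimes> (c \<ominus> d)"
    and "x \<in> carrier R" "y \<in> carrier R" "b \<in> carrier R" "d \<in> carrier R" "e \<in> carrier R" "f \<in> carrier R"
  shows "x = y"
proof -
  have "x \<ominus> y = \<zero>" using assms by (simp add: minus_self)
  then show ?thesis using assms r_right_minus_eq[of x y] by blast
qed

end

section \<open>Subrings of a field\<close>

locale fraction_field = F?: field F for F (structure) +
  fixes R
  assumes quotient_field: "quotient_field_of F R"
begin

lemma subring_R: "subring R F"
  using quotient_field unfolding quotient_field_of_def subdomain_def subcring_def by blast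

lemmas R_closed [simp, intro] = subringE(2,3,5-7)[OF subring_R]

lemma R_carrier [simp, intro]: "x \<in> R \<Longrightarrow> x \<in> carrier F"
  using subringE(1)[OF subring_R] by blast

lemma R_minus [simp, intro]: "x \<in> R \<Longrightarrow> y \<in> R \<Longrightarrow> x \<ominus> y \<in> R"
  by (simp add: a_minus_def)

lemma inverse_exists:
  assumes "x \<in> carrier F" "x \<noteq> \<zero>"
  obtains i where "i \<in> carrier F" "x \<otimes> i = \<one>" "i \<noteq> \<zero>"
proof -
  have "x \<in> Units F" using assms field_Units by blast
  then show ?thesis using that[of "inv x"] assms by (metis Units_inv_closed Units_r_inv r_null one_not_zero)
qed

lemma fraction:
  assumes "x \<in> carrier F"
  obtains a b where "a \<in> R" "b \<in> R" "b \<noteq> \<zero>" "x \<otimes> b = a"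
proof -
  obtain a b where ab: "a \<in> R" "b \<in> R - {\<zero>}" "x = a \<otimes> inv b"
    using quotient_field assms unfolding quotient_field_of_def by blast
  then have "b \<in> Units F" using field_Units by auto
  then have "x \<otimes> b = a" using ab by (simp add: m_assoc)
  then show ?thesis using that ab by blast
qed

definition M :: "'a set" where
  "M = {r \<in> R. \<forall>s \<in> R. r \<otimes> s \<noteq> \<one>}"

definition rmod :: "'a set \<Rightarrow> bool" where
  "rmod J \<longleftrightarrow> J \<subseteq> carrier F \<and> \<zero> \<in> J \<and> (\<forall>x\<in>J. \<forall>y\<in>J. x \<oplus> y \<in> J) \<and> (\<forall>r\<in>R. \<forall>x\<in>J. r \<otimes> x \<in> J)"

definition span2 :: "'a \<Rightarrow> 'a \<Rightarrow> 'a set" where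
  "span2 x y = {a \<otimes> x \<oplus> b \<otimes> y |a b. a \<in> R \<and> b \<in> R}"

definition Inv :: "'a set \<Rightarrow> 'a set" where
  "Inv J = {y \<in> carrier F. \<forall>i\<in>J. \<forall>j\<in>J. y \<otimes> i \<otimes> j \<in> J}"

definition S :: "'a set" where
  "S = integral_closure F R"

lemma rmodD:
  assumes "rmod J"
  shows "x \<in> J \<Longrightarrow> x \<in> carrier F" "\<zero> \<in> J" "x \<in> J \<Longrightarrow> y \<in> J \<Longrightarrow> x \<oplus> y \<in> J"
    "r \<in> R \<Longrightarrow> x \<in> J \<Longrightarrow> r \<otimes> x \<in> J"
  using assms unfolding rmod_def by blast+

lemma rmod_minus:
  assumes "rmod J" "x \<in> J" "y \<in> J" shows "x \<ominus> y \<in> J"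
proof -
  have xy: "x \<in> carrier F" "y \<in> carrier F" using rmodD[OF assms(1)] assms by auto
  have "x \<oplus> (\<ominus> \<one>) \<otimes> y \<in> J" using rmodD[OF assms(1)] assms by auto
  then show ?thesis using xy by (simp add: l_minus a_minus_def)
qed

lemma M_R: "m \<in> M \<Longrightarrow> m \<in> R"
  by (simp add: M_def)

lemma unit_R: "r \<in> R \<Longrightarrow> r \<notin> M \<Longrightarrow> \<exists>s\<in>R. r \<otimes> s = \<one>"
  by (auto simp: M_def)

lemma zero_M [simp, intro]: "\<zero> \<in> M"
  by (simp add: M_def)

lemma one_M [simp]: "\<one> \<notin> M"
  by (auto simp: M_def)

lemma M_mult [simp, intro]: "m \<in> M \<Longrightarrow> r \<in> R \<Longrightarrow> m \<otimes> r \<in> M"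
  unfolding M_def by (auto simp: m_assoc)

declare M_R [simp]

lemma M_mult2 [simp, intro]: "m \<in> M \<Longrightarrow> r \<in> R \<Longrightarrow> r \<otimes> m \<in> M"
  using M_mult[of m r] by (simp add: m_comm)

lemma M_neg [simp, intro]: "m \<in> M \<Longrightarrow> \<ominus> m \<in> M"
  using M_mult2[of m "\<ominus> \<one>"] by (simp add: l_minus)

lemma rmod_R: "rmod R"
  by (auto simp: rmod_def)

lemma span2I [intro]: "a \<in> R \<Longrightarrow> b \<in> R \<Longrightarrow> z = a \<otimes> x \<oplus> b \<otimes> y \<Longrightarrow> z \<in> span2 x y"
  by (auto simp: span2_def)

lemma span2_rmod:
  assumes [simp]: "x \<in> carrier F" "y \<in> carrier F"
  shows "rmod (span2 x y)"
proof -
  have 1: "\<exists>a b. (a1 \<otimes> x \<oplus> b1 \<otimes> y) \<oplus> (a2 \<otimes> x \<oplus> b2 \<otimes> y) = a \<otimes> x \<oplus> b \<otimes> y \<and> a \<in> R \<and> b \<in> R"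
    if [simp]: "a1 \<in> R" "b1 \<in> R" "a2 \<in> R" "b2 \<in> R" for a1 b1 a2 b2
    by (rule exI[of _ "a1 \<oplus> a2"], rule exI[of _ "b1 \<oplus> b2"], rule conjI)
      (reify ring_reify, rule ring_identityI, simp, simp, code_simp, simp)
  have 2: "\<exists>a b. r \<otimes> (a1 \<otimes> x \<oplus> b1 \<otimes> y) = a \<otimes> x \<oplus> b \<otimes> y \<and> a \<in> R \<and> b \<in> R"
    if [simp]: "a1 \<in> R" "b1 \<in> R" "r \<in> R" for a1 b1 r
    by (rule exI[of _ "r \<otimes> a1"], rule exI[of _ "r \<otimes> b1"]) (simp add: r_distr m_assoc)
  have 3: "\<exists>a b. \<zero> = a \<otimes> x \<oplus> b \<otimes> y \<and> a \<in> R \<and> b \<in> R"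
    by (rule exI[of _ \<zero>], rule exI[of _ \<zero>]) simp
  show ?thesis unfolding rmod_def span2_def using 1 2 3 by auto
qed

lemma span2_gens:
  assumes "x \<in> carrier F" "y \<in> carrier F"
  shows "x \<in> span2 x y" "y \<in> span2 x y"
  by (rule span2I[of \<one> \<zero>], use assms in simp_all) (rule span2I[of \<zero> \<one>], use assms in simp_all)

lemma span2_commute:
  assumes "x \<in> carrier F" "y \<in> carrier F"
  shows "span2 x y = span2 y x"
  unfolding span2_def using assms by (auto, (metis a_comm m_closed R_carrier)+)

lemma characteristic_polynomial:
  assumes [simp]: "e \<in> carrier F" "x \<in> carrier F" "y \<in> carrier F" "a \<in> carrier F" "b \<in> carrier F" "c \<in> carrier F" "d \<in> carrier F"
    and ex: "e \<otimes> x = a \<otimes> x \<oplus> b \<otimes> y" and ey: "e \<otimes> y = c \<otimes> x \<oplus> d \<otimes> y"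
    and nz: "x \<noteq> \<zero> \<or> y \<noteq> \<zero>"
  shows "e \<otimes> e = (a \<oplus> d) \<otimes> e \<ominus> (a \<otimes> d \<ominus> b \<otimes> c)"
proof -
  let ?d = "e \<otimes> e \<ominus> ((a \<oplus> d) \<otimes> e \<ominus> (a \<otimes> d \<ominus> b \<otimes> c))"
  have "?d \<otimes> x = (e \<ominus> d) \<otimes> (e \<otimes> x \<ominus> (a \<otimes> x \<oplus> b \<otimes> y)) \<oplus> b \<otimes> (e \<otimes> y \<ominus> (c \<otimes> x \<oplus> d \<otimes> y))"
    by (reify ring_reify, rule ring_identityI, simp, simp, code_simp)
  then have 1: "?d \<otimes> x = \<zero>" using ex ey by (simp add: minus_self)
  have "?d \<otimes> y = (e \<ominus> a) \<otimes> (e \<otimes> y \<ominus> (c \<otimes> x \<oplus> d \<otimes> y)) \<oplus> c \<otimes> (e \<otimes> x \<ominus> (a \<otimes> x \<oplus> b \<otimes> y))"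
    by (reify ring_reify, rule ring_identityI, simp, simp, code_simp)
  then have 2: "?d \<otimes> y = \<zero>" using ex ey by (simp add: minus_self)
  have "?d = \<zero>" using nz integral[OF 1] integral[OF 2] by auto
  then show ?thesis by (simp add: r_right_minus_eq)
qed

lemma quadratic_unit:
  assumes C: "subring C F" "R \<subseteq> C" and e: "e \<in> C" "q \<in> R" "p \<in> R" "p \<notin> M" "e \<otimes> e = q \<otimes> e \<ominus> p"
  obtains f where "f \<in> C" "e \<otimes> f = \<one>"
proof -
  obtain p' where p': "p' \<in> R" "p \<otimes> p' = \<one>" using unit_R e by blast
  have [simp]: "e \<in> carrier F" "q \<in> carrier F" "p \<in> carrier F" "p' \<in> carrier F" using e p' subringE(1)[OF C(1)] by auto
  have "e \<otimes> ((q \<ominus> e) \<otimes> p') \<ominus> p \<otimes> p' = (\<ominus> p') \<otimes> (e \<otimes> e \<ominus> (q \<otimes> e \<ominus> p))"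
    by (reify ring_reify, rule ring_identityI, simp, simp, code_simp)
  from eq_by_combination[OF e(5) this] have "e \<otimes> ((q \<ominus> e) \<otimes> p') = \<one>" using p' by simp
  moreover have "q \<in> C" "p' \<in> C" using C e p' by auto
  then have "(q \<ominus> e) \<otimes> p' \<in> C" using e by (simp add: a_minus_def subringE(5-7)[OF C(1)])
  ultimately show ?thesis using that by blast
qed

lemma quadratic_integral:
  assumes "x \<in> carrier F" "q \<in> R" "p \<in> R" "x \<otimes> x = q \<otimes> x \<ominus> p"
  shows "x \<in> S"
proof -
  have [simp]: "x \<in> carrier F" "q \<in> carrier F" "p \<in> carrier F" using assms by auto
  have "x \<otimes> x \<oplus> (\<ominus> q \<otimes> x \<oplus> p) = \<zero>"
    by (rule eq_by_combination[OF assms(4), of _ _ \<one>])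
      (reify ring_reify, rule ring_identityI, simp, simp, code_simp, simp_all)
  then have "eval [\<one>, \<ominus> q, p] x = \<zero>" by (simp add: numeral_2_eq_2)
  then show ?thesis unfolding S_def integral_closure_def polynomial_def using assms
    by (auto intro!: exI[of _ "[\<one>, \<ominus> q, p]"] simp del: eval.simps)
qed

lemma cubic_integral:
  assumes "x \<in> carrier F" "a \<in> R" "b \<in> R" "c \<in> R" "x \<otimes> x \<otimes> x \<ominus> a \<otimes> (x \<otimes> x) \<oplus> b \<otimes> x \<ominus> c = \<zero>"
  shows "x \<in> S"
proof -
  have [simp]: "x \<in> carrier F" "a \<in> carrier F" "b \<in> carrier F" "c \<in> carrier F" using assms by auto
  have "x \<otimes> x \<otimes> x \<oplus> (\<ominus> a \<otimes> (x \<otimes> x) \<oplus> (b \<otimes> x \<oplus> \<ominus> c)) = \<zero>"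
    by (rule eq_by_combination[OF assms(5), of _ _ \<one>])
      (reify ring_reify, rule ring_identityI, simp, simp, code_simp, simp_all)
  then have "eval [\<one>, \<ominus> a, b, \<ominus> c] x = \<zero>" by (simp add: numeral_2_eq_2 numeral_3_eq_3)
  then show ?thesis unfolding S_def integral_closure_def polynomial_def using assms
    by (auto intro!: exI[of _ "[\<one>, \<ominus> a, b, \<ominus> c]"] simp del: eval.simps)
qed

lemma S_carrier [simp, intro]: "x \<in> S \<Longrightarrow> x \<in> carrier F"
  by (simp add: S_def integral_closure_def)

lemma R_S [simp, intro]: "r \<in> R \<Longrightarrow> r \<in> S"
proof (rule quadratic_integral[of r r \<zero>])
qed (auto simp: a_minus_def)

text \<open>homogenization\<close>

fun homogenize :: "'a list \<Rightarrow> 'a \<Rightarrow> 'a \<Rightarrow> 'a" where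
  "homogenize [] a b = \<zero>"
| "homogenize (c # p) a b = c \<otimes> a [^] length p \<oplus> b \<otimes> homogenize p a b"

lemma homogenize_closed [simp]:
  "set p \<subseteq> carrier F \<Longrightarrow> a \<in> carrier F \<Longrightarrow> b \<in> carrier F \<Longrightarrow> homogenize p a b \<in> carrier F"
  by (induction p) auto

lemma homogenize_eval:
  assumes "set p \<subseteq> carrier F" "x \<in> carrier F" "b \<in> carrier F"
  shows "b \<otimes> homogenize p (x \<otimes> b) b = b [^] length p \<otimes> eval p x"
  using assms(1)
proof (induction p)
  case (Cons c p)
  have [simp]: "c \<in> carrier F" "eval p x \<in> carrier F" "homogenize p (x \<otimes> b) b \<in> carrier F"
    using Cons.prems assms by (auto intro: eval_in_carrier)
  note [simp] = assms(2,3)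
  let ?X = "x [^] length p" and ?B = "b [^] length p"
  have "b \<otimes> (c \<otimes> (?X \<otimes> ?B) \<oplus> b \<otimes> homogenize p (x \<otimes> b) b) \<ominus> ?B \<otimes> b \<otimes> (c \<otimes> ?X \<oplus> eval p x)
      = b \<otimes> (b \<otimes> homogenize p (x \<otimes> b) b \<ominus> ?B \<otimes> eval p x)"
    by (reify ring_reify, rule ring_identityI, simp, simp, code_simp)
  from eq_by_combination[OF Cons.IH this] show ?case using Cons.prems
    by (simp add: nat_pow_distrib)
qed (use assms in auto)

lemma integral_homogeneous_equation:
  assumes "x \<in> S" "a \<in> carrier F" "b \<in> carrier F" "b \<noteq> \<zero>" "a = x \<otimes> b"
  obtains p where "set p \<subseteq> R" "homogenize (\<one> # p) a b = \<zero>"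
proof -
  obtain p where p: "set p \<subseteq> R" "p \<noteq> []" "hd p = \<one>" "eval p x = \<zero>"
    using assms(1) unfolding S_def integral_closure_def polynomial_def by auto
  have "set p \<subseteq> carrier F" using p by auto
  then have "b \<otimes> homogenize p a b = \<zero>" using homogenize_eval[of p x b] p assms by simp
  then have "homogenize p a b = \<zero>" using assms \<open>set p \<subseteq> carrier F\<close> by (auto dest!: integral)
  moreover obtain p' where "p = \<one> # p'" using p by (cases p) auto
  ultimately show ?thesis using that[of p'] p by auto
qed

end

context fraction_field
begin

lemma subring_pow:
  assumes "subring C F" "c \<in> C" shows "c [^] (n::nat) \<in> C"
  using subringE[OF assms(1)] assms(2) by (induction n) auto

lemma homogenize_subring:
  assumes C: "subring C F" and "a \<in> C" "b \<in> C" and "set p \<subseteq> C"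
  shows "homogenize p a b \<in> C"
  using \<open>set p \<subseteq> C\<close> by (induction p) (auto simp: subringE[OF C] subring_pow[OF C] assms)

definition mult_ring :: "'a set \<Rightarrow> 'a set" where
  "mult_ring J = {e \<in> carrier F. \<forall>j\<in>J. e \<otimes> j \<in> J}"

lemma mult_ring_subring:
  assumes "rmod J"
  shows "subring (mult_ring J) F" "R \<subseteq> mult_ring J"
proof -
  note J = rmodD[OF assms] rmod_minus[OF assms]
  show "subring (mult_ring J) F"
  proof (rule subringI)
    fix h assume h: "h \<in> mult_ring J"
    have "\<ominus> h \<otimes> j \<in> J" if "j \<in> J" for j
    proof -
      have "h \<otimes> j \<in> J" "h \<in> carrier F" using h that by (auto simp: mult_ring_def)
      then show ?thesis using J(5)[OF J(2), of "h \<otimes> j"] J(1)[OF that] by (simp add: a_minus_def l_minus)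
    qed
    then show "\<ominus> h \<in> mult_ring J" using h by (simp add: mult_ring_def)
  qed (use J in \<open>auto simp: mult_ring_def l_distr m_assoc\<close>)
  show "R \<subseteq> mult_ring J" using J by (auto simp: mult_ring_def)
qed

lemma Inv_mult:
  assumes "rmod J" "y \<in> Inv J" "i \<in> J" shows "y \<otimes> i \<in> mult_ring J"
  using assms rmodD(1)[OF assms(1)] by (auto simp: Inv_def mult_ring_def)

lemma Inv_mult_ring:
  assumes J: "rmod J" and "e \<in> mult_ring J" "y \<in> Inv J" shows "e \<otimes> y \<in> Inv J"
proof -
  have "e \<otimes> y \<otimes> i \<otimes> j \<in> J" if "i \<in> J" "j \<in> J" for i j
  proof -
    have "e \<otimes> (y \<otimes> i \<otimes> j) \<in> J" using assms that by (auto simp: Inv_def mult_ring_def)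
    moreover have "e \<otimes> y \<otimes> i \<otimes> j = e \<otimes> (y \<otimes> i \<otimes> j)"
      using assms that rmodD(1)[OF J] by (simp add: Inv_def mult_ring_def m_assoc)
    ultimately show ?thesis by simp
  qed
  then show ?thesis using assms by (auto simp: Inv_def mult_ring_def)
qed

lemma Inv_rmod:
  assumes J: "rmod J" shows "rmod (Inv J)"
proof -
  have "(y \<oplus> y') \<otimes> i \<otimes> j \<in> J" if "y \<in> Inv J" "y' \<in> Inv J" "i \<in> J" "j \<in> J" for y y' i j
    using that rmodD[OF J] by (simp add: Inv_def l_distr)
  moreover have "r \<otimes> y \<in> Inv J" if "y \<in> Inv J" "r \<in> R" for y r
    using Inv_mult_ring[OF J] that mult_ring_subring[OF J] by blast
  moreover have "\<zero> \<in> Inv J" using rmodD[OF J] by (auto simp: Inv_def)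
  ultimately show ?thesis by (auto simp: rmod_def Inv_def)
qed

lemma common_denominator:
  assumes "x \<in> carrier F" "y \<in> carrier F"
  obtains d where "d \<in> R" "d \<noteq> \<zero>" "d \<otimes> x \<in> R" "d \<otimes> y \<in> R"
proof -
  obtain a b where ab: "a \<in> R" "b \<in> R" "b \<noteq> \<zero>" "x \<otimes> b = a" using fraction[OF assms(1)] by metis
  obtain c d where cd: "c \<in> R" "d \<in> R" "d \<noteq> \<zero>" "y \<otimes> d = c" using fraction[OF assms(2)] by metis
  have "b \<otimes> d \<otimes> x = a \<otimes> d" "b \<otimes> d \<otimes> y = b \<otimes> c"
    using ab cd assms by (auto simp: m_ac)
  moreover have "b \<otimes> d \<noteq> \<zero>" using ab cd integral[of b d] by auto
  ultimately show ?thesis using that[of "b \<otimes> d"] ab cd by auto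
qed

lemma one_minus_quadratic_unit:
  assumes C: "subring C F" "R \<subseteq> C" and e: "e \<in> C" "q \<in> R" "p \<in> R" "\<one> \<ominus> q \<oplus> p \<notin> M" "e \<otimes> e = q \<otimes> e \<ominus> p"
  obtains f where "f \<in> C" "(\<one> \<ominus> e) \<otimes> f = \<one>"
proof (rule quadratic_unit[OF C, of "\<one> \<ominus> e" "\<one> \<oplus> \<one> \<ominus> q" "\<one> \<ominus> q \<oplus> p"])
  have [simp]: "e \<in> carrier F" "q \<in> carrier F" "p \<in> carrier F" using e subringE(1)[OF C(1)] by auto
  have "(\<one> \<ominus> e) \<otimes> (\<one> \<ominus> e) \<ominus> ((\<one> \<oplus> \<one> \<ominus> q) \<otimes> (\<one> \<ominus> e) \<ominus> (\<one> \<ominus> q \<oplus> p)) = \<one> \<otimes> (e \<otimes> e \<ominus> (q \<otimes> e \<ominus> p))"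
    by (reify ring_reify, rule ring_identityI, simp, simp, code_simp)
  from eq_by_combination[OF e(5) this]
  show "(\<one> \<ominus> e) \<otimes> (\<one> \<ominus> e) = (\<one> \<oplus> \<one> \<ominus> q) \<otimes> (\<one> \<ominus> e) \<ominus> (\<one> \<ominus> q \<oplus> p)" by simp
  show "\<one> \<ominus> e \<in> C" using e subringE(3,5,7)[OF C(1)] by (simp add: a_minus_def)
qed (use e in simp_all)

lemma mult_ring_span2_coeffs:
  assumes "e \<in> mult_ring (span2 x y)" "x \<in> carrier F" "y \<in> carrier F"
  obtains a b c d where "a \<in> R" "b \<in> R" "c \<in> R" "d \<in> R"
    "e \<otimes> x = a \<otimes> x \<oplus> b \<otimes> y" "e \<otimes> y = c \<otimes> x \<oplus> d \<otimes> y"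
proof -
  have "e \<otimes> x \<in> span2 x y" "e \<otimes> y \<in> span2 x y"
    using assms(1) span2_gens[OF assms(2,3)] by (simp_all add: mult_ring_def)
  then show ?thesis using that unfolding span2_def by blast
qed

lemma mult_ring_span2_quadratic:
  assumes "e \<in> mult_ring (span2 x y)" "x \<in> carrier F" "y \<in> carrier F" "x \<noteq> \<zero> \<or> y \<noteq> \<zero>"
  obtains q p where "q \<in> R" "p \<in> R" "e \<otimes> e = q \<otimes> e \<ominus> p"
proof -
  obtain a b c d where abcd: "a \<in> R" "b \<in> R" "c \<in> R" "d \<in> R"
    "e \<otimes> x = a \<otimes> x \<oplus> b \<otimes> y" "e \<otimes> y = c \<otimes> x \<oplus> d \<otimes> y"
    using mult_ring_span2_coeffs[OF assms(1-3)] by metis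
  have "e \<in> carrier F" using assms by (simp add: mult_ring_def)
  then have "e \<otimes> e = (a \<oplus> d) \<otimes> e \<ominus> (a \<otimes> d \<ominus> b \<otimes> c)"
    using characteristic_polynomial[of e x y a b c d] abcd assms by simp
  then show ?thesis using that[of "a \<oplus> d" "a \<otimes> d \<ominus> b \<otimes> c"] abcd by simp
qed

lemma mult_ring_span2_integral:
  assumes "x \<in> carrier F" "y \<in> carrier F" "x \<noteq> \<zero> \<or> y \<noteq> \<zero>"
  shows "mult_ring (span2 x y) \<subseteq> S"
proof
  fix e assume e: "e \<in> mult_ring (span2 x y)"
  then have "e \<in> carrier F" by (simp add: mult_ring_def)
  then show "e \<in> S" using mult_ring_span2_quadratic[OF e assms] quadratic_integral by metis
qed

end

locale stable_local_ring = fraction_field +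
  assumes M_add [simp, intro]: "m \<in> M \<Longrightarrow> n \<in> M \<Longrightarrow> m \<oplus> n \<in> M"
    and invertible: "\<lbrakk>rmod J; j \<in> J; j \<noteq> \<zero>; d \<in> R; d \<noteq> \<zero>; \<And>x. x \<in> J \<Longrightarrow> d \<otimes> x \<in> R; rmod G;
      \<And>x y. x \<in> J \<Longrightarrow> y \<in> Inv J \<Longrightarrow> x \<otimes> y \<in> G\<rbrakk> \<Longrightarrow> \<one> \<in> G"
begin

lemma M_minus [simp, intro]: "m \<in> M \<Longrightarrow> n \<in> M \<Longrightarrow> m \<ominus> n \<in> M"
  by (simp add: a_minus_def)

lemma unit_add_M: 
  assumes "u \<in> R" "u \<notin> M" "m \<in> M" shows "u \<oplus> m \<notin> M"
proof
  assume "u \<oplus> m \<in> M"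
  then have "(u \<oplus> m) \<ominus> m \<in> M" using assms by blast
  moreover have "(u \<oplus> m) \<ominus> m = u" using assms by (simp add: a_minus_def a_assoc r_neg)
  ultimately show False using assms by simp
qed

lemma M_eq: "rmod M"
  using M_R by (auto simp: rmod_def)

lemma invertible_span2:
  assumes [simp]: "x \<in> carrier F" "y \<in> carrier F" and nz: "x \<noteq> \<zero> \<or> y \<noteq> \<zero>"
  obtains a b where "a \<in> Inv (span2 x y)" "b \<in> Inv (span2 x y)" "a \<otimes> x \<oplus> b \<otimes> y = \<one>"
proof -
  let ?J = "span2 x y"
  define G where "G = {a \<otimes> x \<oplus> b \<otimes> y |a b. a \<in> Inv ?J \<and> b \<in> Inv ?J}"
  have J: "rmod ?J" using span2_rmod by simp
  note IJ = rmodD[OF Inv_rmod[OF J]]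
  obtain d where d: "d \<in> R" "d \<noteq> \<zero>" "d \<otimes> x \<in> R" "d \<otimes> y \<in> R" using common_denominator assms by metis
  have dJ: "d \<otimes> z \<in> R" if z: "z \<in> ?J" for z
  proof -
    obtain a b where [simp]: "a \<in> R" "b \<in> R" and z: "z = a \<otimes> x \<oplus> b \<otimes> y" using z by (auto simp: span2_def)
    have "d \<otimes> z = a \<otimes> (d \<otimes> x) \<oplus> b \<otimes> (d \<otimes> y)" using d(1) unfolding z by (simp add: r_distr) (simp add: m_ac)
    then show ?thesis using d by simp
  qed
  have sum: "(a \<otimes> x \<oplus> b \<otimes> y) \<oplus> (a' \<otimes> x \<oplus> b' \<otimes> y) = (a \<oplus> a') \<otimes> x \<oplus> (b \<oplus> b') \<otimes> y"
    if [simp]: "a \<in> carrier F" "b \<in> carrier F" "a' \<in> carrier F" "b' \<in> carrier F" for a b a' b'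
    by (reify ring_reify, rule ring_identityI, simp, simp, code_simp)
  have GI: "z \<in> G" if "a \<in> Inv ?J" "b \<in> Inv ?J" "z = a \<otimes> x \<oplus> b \<otimes> y" for z a b
    using that by (auto simp: G_def)
  have G: "rmod G"
    unfolding rmod_def
  proof (intro conjI ballI)
    show "\<zero> \<in> G" unfolding G_def using IJ(2) by (intro CollectI exI[of _ \<zero>]) simp
    show "z \<oplus> z' \<in> G" if z: "z \<in> G" "z' \<in> G" for z z'
    proof -
      obtain a b a' b' where "a \<in> Inv ?J" "b \<in> Inv ?J" "a' \<in> Inv ?J" "b' \<in> Inv ?J"
        "z = a \<otimes> x \<oplus> b \<otimes> y" "z' = a' \<otimes> x \<oplus> b' \<otimes> y" using z by (auto simp: G_def)
      then show ?thesis using IJ(1,3) sum[of a b a' b'] by (intro GI[of "a \<oplus> a'" "b \<oplus> b'"]) auto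
    qed
    show "r \<otimes> z \<in> G" if "r \<in> R" "z \<in> G" for r z
    proof -
      obtain a b where ab: "a \<in> Inv ?J" "b \<in> Inv ?J" "z = a \<otimes> x \<oplus> b \<otimes> y" using \<open>z \<in> G\<close> by (auto simp: G_def)
      then have "r \<otimes> z = (r \<otimes> a) \<otimes> x \<oplus> (r \<otimes> b) \<otimes> y" using that IJ(1) by (simp add: r_distr m_assoc)
      then show ?thesis using IJ(4)[OF \<open>r \<in> R\<close>] ab GI by blast
    qed
  qed (use IJ(1) in \<open>auto simp: G_def\<close>)
  have "z \<otimes> v \<in> G" if z: "z \<in> ?J" and v: "v \<in> Inv ?J" for z v
  proof -
    obtain a b where [simp]: "a \<in> R" "b \<in> R" and z: "z = a \<otimes> x \<oplus> b \<otimes> y" using z by (auto simp: span2_def)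
    have "z \<otimes> v = (a \<otimes> v) \<otimes> x \<oplus> (b \<otimes> v) \<otimes> y" using IJ(1)[OF v] unfolding z by (simp add: l_distr) (simp add: m_ac)
    then show ?thesis using IJ(4)[OF _ v] GI by simp
  qed
  moreover obtain j where "j \<in> ?J" "j \<noteq> \<zero>" using nz span2_gens[OF assms(1,2)] by blast
  ultimately have "\<one> \<in> G" using invertible[OF J _ _ d(1,2) dJ G] by blast
  then show ?thesis using that by (auto simp: G_def)
qed

lemma span2_principal:
  assumes x[simp]: "x \<in> carrier F" and y[simp]: "y \<in> carrier F" and nz: "x \<noteq> \<zero> \<or> y \<noteq> \<zero>"
  obtains z w where "z \<in> span2 x y" "w \<in> Inv (span2 x y)" "z \<otimes> w = \<one>"
proof -
  let ?J = "span2 x y" and ?E = "mult_ring (span2 x y)"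
  have J: "rmod ?J" using span2_rmod by simp
  note C = mult_ring_subring[OF J]
  note E = subringE[OF C(1)]
  obtain \<alpha> \<beta> where ab: "\<alpha> \<in> Inv ?J" "\<beta> \<in> Inv ?J" "\<alpha> \<otimes> x \<oplus> \<beta> \<otimes> y = \<one>"
    using invertible_span2[OF assms] by metis
  have [simp]: "\<alpha> \<in> carrier F" "\<beta> \<in> carrier F" using ab by (auto simp: Inv_def)
  define \<epsilon> where "\<epsilon> = \<alpha> \<otimes> x"
  have \<epsilon>: "\<epsilon> \<in> ?E" unfolding \<epsilon>_def using Inv_mult[OF J] ab span2_gens by simp
  then have [simp]: "\<epsilon> \<in> carrier F" using E(1) by blast
  have \<beta>y: "\<beta> \<otimes> y = \<one> \<ominus> \<epsilon>"
    using ab(3) unfolding \<epsilon>_def by (metis \<open>\<alpha> \<in> carrier F\<close> \<open>\<beta> \<in> carrier F\<close> a_comm add.inv_solve_right' m_closed minus_eq x y one_closed)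
  obtain a b c d where [simp]: "a \<in> R" "b \<in> R" "c \<in> R" "d \<in> R"
    and \<epsilon>x: "\<epsilon> \<otimes> x = a \<otimes> x \<oplus> b \<otimes> y" and \<epsilon>y: "\<epsilon> \<otimes> y = c \<otimes> x \<oplus> d \<otimes> y"
    using mult_ring_span2_coeffs[OF \<epsilon> x y] by metis
  define q where "q = a \<oplus> d"
  define p where "p = a \<otimes> d \<ominus> b \<otimes> c"
  have [simp]: "q \<in> R" "p \<in> R" by (auto simp: q_def p_def)
  have \<epsilon>2: "\<epsilon> \<otimes> \<epsilon> = q \<otimes> \<epsilon> \<ominus> p"
    unfolding q_def p_def using characteristic_polynomial[of \<epsilon> x y a b c d] \<epsilon>x \<epsilon>y nz by simp
  show ?thesis
  proof (cases "p \<in> M \<and> \<one> \<ominus> q \<oplus> p \<in> M")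
    case False
    then consider "p \<notin> M" | "\<one> \<ominus> q \<oplus> p \<notin> M" by blast
    then show ?thesis
    proof cases
      case 1
      then obtain f where f: "f \<in> ?E" "\<epsilon> \<otimes> f = \<one>" using quadratic_unit[OF C \<epsilon>] \<epsilon>2 by (metis \<open>q \<in> R\<close> \<open>p \<in> R\<close>)
      have "x \<otimes> (f \<otimes> \<alpha>) = \<one>" using f E(1) unfolding \<epsilon>_def by (simp add: m_ac subset_iff)
      then show ?thesis using that[of x "f \<otimes> \<alpha>"] Inv_mult_ring[OF J f(1) ab(1)] span2_gens by simp
    next
      case 2
      then obtain f where f: "f \<in> ?E" "(\<one> \<ominus> \<epsilon>) \<otimes> f = \<one>"
        using one_minus_quadratic_unit[OF C \<epsilon>] \<epsilon>2 by (metis \<open>q \<in> R\<close> \<open>p \<in> R\<close>)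
      have "y \<otimes> (f \<otimes> \<beta>) = \<one>" using f E(1) unfolding \<beta>y[symmetric] by (simp add: m_ac subset_iff)
      then show ?thesis using that[of y "f \<otimes> \<beta>"] Inv_mult_ring[OF J f(1) ab(2)] span2_gens by simp
    qed
  next
    case True
    define s where "s = \<one> \<ominus> q"
    have sM: "s \<in> M"
    proof -
      have "s = (\<one> \<ominus> q \<oplus> p) \<ominus> p" unfolding s_def
        by (reify ring_reify, rule ring_identityI, simp, simp, code_simp)
      then show ?thesis using True by simp
    qed
    define \<theta> where "\<theta> = \<alpha> \<otimes> y \<oplus> \<beta> \<otimes> x"
    define \<kappa> where "\<kappa> = \<one> \<oplus> \<one> \<oplus> \<one> \<ominus> \<theta>"
    have "\<theta> \<in> ?E" unfolding \<theta>_def using Inv_mult[OF J] ab span2_gens E(7) by simp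
    then have \<kappa>: "\<kappa> \<in> ?E" unfolding \<kappa>_def using E(3,5,7) by (simp add: a_minus_def)
    have [simp]: "\<theta> \<in> carrier F" "\<kappa> \<in> carrier F" using \<open>\<theta> \<in> ?E\<close> \<kappa> E(1) by auto
    define z where "z = \<epsilon> \<otimes> x \<oplus> (\<one> \<ominus> \<epsilon>) \<otimes> y"
    define w where "w = \<epsilon> \<otimes> \<alpha> \<oplus> (\<one> \<ominus> \<epsilon>) \<otimes> \<beta>"
    have \<epsilon>': "\<one> \<ominus> \<epsilon> \<in> ?E" using E(3,5,7) \<epsilon> by (simp add: a_minus_def)
    have z: "z \<in> ?J" unfolding z_def using \<epsilon> \<epsilon>' rmodD[OF J] span2_gens by (simp add: mult_ring_def)
    have w: "w \<in> Inv ?J" unfolding w_def using Inv_mult_ring[OF J] rmodD[OF Inv_rmod[OF J]] \<epsilon> \<epsilon>' ab by simp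
    define \<delta> where "\<delta> = (s \<otimes> \<epsilon> \<oplus> p) \<otimes> \<kappa>"
    have [simp]: "s \<in> R" "z \<in> carrier F" "w \<in> carrier F" using sM by (auto simp: z_def w_def)
    have "z \<otimes> w = \<epsilon> \<otimes> \<epsilon> \<otimes> (\<alpha> \<otimes> x) \<oplus> \<epsilon> \<otimes> (\<one> \<ominus> \<epsilon>) \<otimes> \<theta> \<oplus> (\<one> \<ominus> \<epsilon>) \<otimes> (\<one> \<ominus> \<epsilon>) \<otimes> (\<beta> \<otimes> y)"
      unfolding z_def w_def \<theta>_def by (reify ring_reify, rule ring_identityI, simp, simp, code_simp)
    then have zw: "z \<otimes> w = \<epsilon> \<otimes> \<epsilon> \<otimes> \<epsilon> \<oplus> \<epsilon> \<otimes> (\<one> \<ominus> \<epsilon>) \<otimes> \<theta> \<oplus> (\<one> \<ominus> \<epsilon>) \<otimes> (\<one> \<ominus> \<epsilon>) \<otimes> (\<one> \<ominus> \<epsilon>)"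
      unfolding \<beta>y unfolding \<epsilon>_def .
    have "\<epsilon> \<otimes> \<epsilon> \<otimes> \<epsilon> \<oplus> \<epsilon> \<otimes> (\<one> \<ominus> \<epsilon>) \<otimes> \<theta> \<oplus> (\<one> \<ominus> \<epsilon>) \<otimes> (\<one> \<ominus> \<epsilon>) \<otimes> (\<one> \<ominus> \<epsilon>) \<ominus> (\<one> \<ominus> \<delta>)
      = (\<one> \<oplus> \<one> \<oplus> \<one> \<ominus> \<theta>) \<otimes> (\<epsilon> \<otimes> \<epsilon> \<ominus> (q \<otimes> \<epsilon> \<ominus> p))"
      unfolding \<delta>_def s_def \<kappa>_def by (reify ring_reify, rule ring_identityI, simp, simp, code_simp)
    from eq_by_combination[OF \<epsilon>2 this] have zw': "z \<otimes> w = \<one> \<ominus> \<delta>" unfolding zw by (simp add: \<delta>_def)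
    obtain k1 k2 k3 k4 where [simp]: "k1 \<in> R" "k2 \<in> R" "k3 \<in> R" "k4 \<in> R"
      and \<kappa>x: "\<kappa> \<otimes> x = k1 \<otimes> x \<oplus> k2 \<otimes> y" and \<kappa>y: "\<kappa> \<otimes> y = k3 \<otimes> x \<oplus> k4 \<otimes> y"
      using mult_ring_span2_coeffs[OF \<kappa> x y] by metis
    have \<delta>E: "\<delta> \<in> ?E" unfolding \<delta>_def using \<kappa> \<epsilon> E(6,7) C(2) sM by (simp add: subset_iff)
    then have [simp]: "\<delta> \<in> carrier F" using E(1) by blast
    have *: "\<delta> \<otimes> u = (l1 \<otimes> (s \<otimes> a \<oplus> p) \<oplus> l2 \<otimes> s \<otimes> c) \<otimes> x \<oplus> (l1 \<otimes> s \<otimes> b \<oplus> l2 \<otimes> (s \<otimes> d \<oplus> p)) \<otimes> y"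
      if [simp]: "u \<in> carrier F" "l1 \<in> R" "l2 \<in> R" and u: "\<kappa> \<otimes> u = l1 \<otimes> x \<oplus> l2 \<otimes> y" for u l1 l2
    proof -
      have "\<delta> \<otimes> u = s \<otimes> \<epsilon> \<otimes> (\<kappa> \<otimes> u) \<oplus> p \<otimes> (\<kappa> \<otimes> u)" unfolding \<delta>_def
        by (reify ring_reify, rule ring_identityI, simp, simp, code_simp)
      also have "\<dots> = s \<otimes> (l1 \<otimes> (\<epsilon> \<otimes> x) \<oplus> l2 \<otimes> (\<epsilon> \<otimes> y)) \<oplus> p \<otimes> (l1 \<otimes> x \<oplus> l2 \<otimes> y)" unfolding u
        by (reify ring_reify, rule ring_identityI, simp, simp, code_simp)
      also have "\<dots> = (l1 \<otimes> (s \<otimes> a \<oplus> p) \<oplus> l2 \<otimes> s \<otimes> c) \<otimes> x \<oplus> (l1 \<otimes> s \<otimes> b \<oplus> l2 \<otimes> (s \<otimes> d \<oplus> p)) \<otimes> y"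
        unfolding \<epsilon>x \<epsilon>y by (reify ring_reify, rule ring_identityI, simp, simp, code_simp)
      finally show ?thesis .
    qed
    define m1 where "m1 = k1 \<otimes> (s \<otimes> a \<oplus> p) \<oplus> k2 \<otimes> s \<otimes> c"
    define m2 where "m2 = k1 \<otimes> s \<otimes> b \<oplus> k2 \<otimes> (s \<otimes> d \<oplus> p)"
    define m3 where "m3 = k3 \<otimes> (s \<otimes> a \<oplus> p) \<oplus> k4 \<otimes> s \<otimes> c"
    define m4 where "m4 = k3 \<otimes> s \<otimes> b \<oplus> k4 \<otimes> (s \<otimes> d \<oplus> p)"
    have [simp]: "m1 \<in> M" "m2 \<in> M" "m3 \<in> M" "m4 \<in> M"
      unfolding m1_def m2_def m3_def m4_def using sM True by auto
    have \<delta>2: "\<delta> \<otimes> \<delta> = (m1 \<oplus> m4) \<otimes> \<delta> \<ominus> (m1 \<otimes> m4 \<ominus> m2 \<otimes> m3)"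
      using characteristic_polynomial[of \<delta> x y m1 m2 m3 m4] nz *[OF x _ _ \<kappa>x] *[OF y _ _ \<kappa>y]
      unfolding m1_def[symmetric] m2_def[symmetric] m3_def[symmetric] m4_def[symmetric] by simp
    have "\<one> \<oplus> (\<ominus> (m1 \<oplus> m4) \<oplus> (m1 \<otimes> m4 \<ominus> m2 \<otimes> m3)) \<notin> M" by (rule unit_add_M) auto
    then have "\<one> \<ominus> (m1 \<oplus> m4) \<oplus> (m1 \<otimes> m4 \<ominus> m2 \<otimes> m3) \<notin> M" by (simp add: a_minus_def a_assoc)
    then obtain f where f: "f \<in> ?E" "(\<one> \<ominus> \<delta>) \<otimes> f = \<one>"
      using one_minus_quadratic_unit[OF C \<delta>E _ _ _ \<delta>2] by (metis M_R R_closed(4,5) R_minus \<open>m1 \<in> M\<close> \<open>m2 \<in> M\<close> \<open>m3 \<in> M\<close> \<open>m4 \<in> M\<close>)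
    have [simp]: "f \<in> carrier F" using f E(1) by blast
    have "z \<otimes> (f \<otimes> w) = (z \<otimes> w) \<otimes> f" by (simp add: m_ac)
    then have "z \<otimes> (f \<otimes> w) = \<one>" using f zw' by simp
    then show ?thesis using that[OF z Inv_mult_ring[OF J f(1) w]] by blast
  qed
qed

end

context stable_local_ring
begin

lemma common_divisor:
  assumes "x \<in> carrier F" "y \<in> carrier F" and nz: "x \<noteq> \<zero> \<or> y \<noteq> \<zero>"
  obtains z \<sigma> \<tau> where "z \<in> span2 x y" "z \<noteq> \<zero>" "\<sigma> \<in> S" "\<tau> \<in> S" "x = z \<otimes> \<sigma>" "y = z \<otimes> \<tau>"
proof -
  have J: "rmod (span2 x y)" using span2_rmod assms by simp
  obtain z w where zw: "z \<in> span2 x y" "w \<in> Inv (span2 x y)" "z \<otimes> w = \<one>"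
    using span2_principal[OF assms] by metis
  have c: "z \<in> carrier F" "w \<in> carrier F" using zw rmodD(1)[OF J] by (auto simp: Inv_def)
  have "w \<otimes> x \<in> S" "w \<otimes> y \<in> S"
    using Inv_mult[OF J zw(2)] span2_gens[OF assms(1,2)] mult_ring_span2_integral[OF assms] by auto
  moreover have "x = z \<otimes> (w \<otimes> x)" "y = z \<otimes> (w \<otimes> y)"
    using zw(3) c assms by (simp_all flip: m_assoc)
  moreover have "z \<noteq> \<zero>" using zw(3) c by auto
  ultimately show ?thesis using that zw(1) by blast
qed

lemma integral_quadratic:
  assumes x: "x \<in> S"
  obtains a b where "a \<in> R" "b \<in> R" "x \<otimes> x = a \<oplus> b \<otimes> x"
proof -
  let ?J = "span2 \<one> x"
  have [simp]: "x \<in> carrier F" using x by simp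
  have J: "rmod ?J" using span2_rmod by simp
  note C = mult_ring_subring[OF J]
  note E = subringE[OF C(1)]
  obtain z w where zw: "z \<in> ?J" "w \<in> Inv ?J" "z \<otimes> w = \<one>"
    using span2_principal[of \<one> x] by auto
  obtain a b where ab[simp]: "a \<in> R" "b \<in> R" and z: "z = a \<otimes> \<one> \<oplus> b \<otimes> x" using zw by (auto simp: span2_def)
  have [simp]: "w \<in> carrier F" "z \<in> carrier F" using zw rmodD(1)[OF J] by (auto simp: Inv_def)
  define \<xi> where "\<xi> = w \<otimes> x"
  have w: "w \<in> mult_ring ?J" using Inv_mult[OF J zw(2) span2_gens(1)[of \<one> x]] by simp
  have \<xi>: "\<xi> \<in> mult_ring ?J" unfolding \<xi>_def using Inv_mult[OF J zw(2) span2_gens(2)[of \<one> x]] by simp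
  have [simp]: "\<xi> \<in> carrier F" by (simp add: \<xi>_def)
  have "w \<noteq> \<zero>" using zw(3) by auto
  then obtain p where p: "set p \<subseteq> R" "homogenize (\<one> # p) \<xi> w = \<zero>"
    using integral_homogeneous_equation[OF x, of \<xi> w] by (auto simp: \<xi>_def m_comm)
  define h where "h = homogenize p \<xi> w"
  have h: "h \<in> mult_ring ?J" unfolding h_def using homogenize_subring[OF C(1) \<xi> w] p C(2) by auto
  then have [simp]: "h \<in> carrier F" using E(1) by auto
  let ?n = "length p"
  have eq: "\<xi> [^] ?n \<oplus> w \<otimes> h = \<zero>" using p(2) by (simp add: h_def)
  have b\<xi>: "b \<otimes> \<xi> = \<one> \<ominus> w \<otimes> a"
  proof -
    have "b \<otimes> \<xi> \<ominus> (\<one> \<ominus> w \<otimes> a) = \<one> \<otimes> (z \<otimes> w \<ominus> \<one>)" unfolding z \<xi>_def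
      by (reify ring_reify, rule ring_identityI, simp, simp, code_simp)
    from eq_by_combination[OF zw(3) this] show ?thesis by simp
  qed
  have pow: "\<exists>c\<in>mult_ring ?J. (b \<otimes> \<xi>) [^] k = \<one> \<ominus> w \<otimes> c" for k :: nat
  proof (induction k)
    case 0
    show ?case using E(2) by (intro bexI[of _ \<zero>]) (auto simp: minus_eq)
  next
    case (Suc k)
    then obtain c where c: "c \<in> mult_ring ?J" "(b \<otimes> \<xi>) [^] k = \<one> \<ominus> w \<otimes> c" by blast
    have [simp]: "c \<in> carrier F" using c E(1) by auto
    have "(b \<otimes> \<xi>) [^] Suc k = (\<one> \<ominus> w \<otimes> c) \<otimes> (\<one> \<ominus> w \<otimes> a)" using c b\<xi> by simp
    also have "\<dots> = \<one> \<ominus> w \<otimes> (c \<oplus> a \<ominus> c \<otimes> w \<otimes> a)"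
      by (reify ring_reify, rule ring_identityI, simp, simp, code_simp)
    finally have "(b \<otimes> \<xi>) [^] Suc k = \<one> \<ominus> w \<otimes> (c \<oplus> a \<ominus> c \<otimes> w \<otimes> a)" .
    moreover have "a \<in> mult_ring ?J" using C(2) by auto
    then have "c \<oplus> a \<ominus> c \<otimes> w \<otimes> a \<in> mult_ring ?J" unfolding minus_eq by (intro E(5-7) c(1) w)
    ultimately show ?case by blast
  qed
  obtain c where c: "c \<in> mult_ring ?J" "(b \<otimes> \<xi>) [^] ?n = \<one> \<ominus> w \<otimes> c" using pow by blast
  have [simp]: "c \<in> carrier F" using c E(1) by auto
  define u where "u = c \<ominus> b [^] ?n \<otimes> h"
  have bn: "b [^] ?n \<in> mult_ring ?J" by (rule subsetD[OF C(2)], rule subring_pow[OF subring_R]) simp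
  have u: "u \<in> mult_ring ?J" unfolding u_def using c h bn E(5-7) by (simp add: minus_eq)
  have [simp]: "u \<in> carrier F" using u E(1) by auto
  have 1: "b [^] ?n \<otimes> \<xi> [^] ?n = \<one> \<ominus> w \<otimes> c" using c(2) by (simp add: nat_pow_distrib)
  let ?B = "b [^] ?n" and ?X = "\<xi> [^] ?n"
  have "w \<otimes> u \<ominus> \<one> = (\<ominus> \<one>) \<otimes> (\<one> \<ominus> w \<otimes> c \<ominus> ?B \<otimes> ?X) \<oplus> (\<ominus> ?B) \<otimes> (?X \<oplus> w \<otimes> h \<ominus> \<zero>)"
    unfolding u_def by (reify ring_reify, rule ring_identityI, simp, simp, code_simp)
  from eq_by_combination2[OF 1[symmetric] eq this] have wu: "w \<otimes> u = \<one>" by simp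
  have "z = z \<otimes> (w \<otimes> u)" using wu by simp
  also have "\<dots> = u" using zw(3) by (simp flip: m_assoc)
  finally have "z \<in> mult_ring ?J" using u by simp
  moreover have "x = z \<otimes> \<xi>" unfolding \<xi>_def using zw(3) by (simp flip: m_assoc)
  ultimately have "x \<in> mult_ring ?J" using \<xi> E(6) by simp
  then have "x \<otimes> x \<in> ?J" using span2_gens(2)[of \<one> x] by (simp add: mult_ring_def)
  then show ?thesis using that unfolding span2_def by auto
qed

lemma integral_quadratic':
  assumes x: "x \<in> S"
  obtains q p where "q \<in> R" "p \<in> R" "x \<otimes> x = q \<otimes> x \<ominus> p"
proof -
  obtain a b where "a \<in> R" "b \<in> R" "x \<otimes> x = a \<oplus> b \<otimes> x" using integral_quadratic[OF x] by metis
  then show ?thesis using that[of b "\<ominus> a"] x by (simp add: minus_eq a_comm)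
qed

lemma integral_product:
  assumes x: "x \<in> S" and y: "y \<in> S"
  obtains a b c where "a \<in> R" "b \<in> R" "c \<in> R" "x \<otimes> y = a \<oplus> b \<otimes> x \<oplus> c \<otimes> y"
proof -
  have [simp]: "x \<in> carrier F" "y \<in> carrier F" using x y by auto
  obtain p0 p1 where p[simp]: "p0 \<in> R" "p1 \<in> R" and x2: "x \<otimes> x = p0 \<oplus> p1 \<otimes> x" using integral_quadratic[OF x] by metis
  obtain q0 q1 where q[simp]: "q0 \<in> R" "q1 \<in> R" and y2: "y \<otimes> y = q0 \<oplus> q1 \<otimes> y" using integral_quadratic[OF y] by metis
  define J where "J = {a \<oplus> b \<otimes> x \<oplus> c \<otimes> y |a b c. a \<in> R \<and> b \<in> R \<and> c \<in> R}"
  have JI: "z \<in> J" if "a \<in> R" "b \<in> R" "c \<in> R" "z = a \<oplus> b \<otimes> x \<oplus> c \<otimes> y" for z a b c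
    using that by (auto simp: J_def)
  have J: "rmod J"
    unfolding rmod_def
  proof (intro conjI ballI)
    show "z \<oplus> z' \<in> J" if z: "z \<in> J" "z' \<in> J" for z z'
    proof -
      obtain a b c a' b' c' where [simp]: "a \<in> R" "b \<in> R" "c \<in> R" "a' \<in> R" "b' \<in> R" "c' \<in> R"
        and zz: "z = a \<oplus> b \<otimes> x \<oplus> c \<otimes> y" "z' = a' \<oplus> b' \<otimes> x \<oplus> c' \<otimes> y" using z unfolding J_def by blast
      have "z \<oplus> z' = (a \<oplus> a') \<oplus> (b \<oplus> b') \<otimes> x \<oplus> (c \<oplus> c') \<otimes> y" unfolding zz
        by (reify ring_reify, rule ring_identityI, simp, simp, code_simp)
      then show ?thesis by (intro JI) auto
    qed
    show "r \<otimes> z \<in> J" if r: "r \<in> R" and z: "z \<in> J" for r z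
    proof -
      obtain a b c where [simp]: "a \<in> R" "b \<in> R" "c \<in> R"
        and zz: "z = a \<oplus> b \<otimes> x \<oplus> c \<otimes> y" using z by (auto simp: J_def)
      have "r \<otimes> z = (r \<otimes> a) \<oplus> (r \<otimes> b) \<otimes> x \<oplus> (r \<otimes> c) \<otimes> y" unfolding zz using r
        by (simp add: r_distr m_assoc)
      then show ?thesis using r by (intro JI) auto
    qed
    show "\<zero> \<in> J" by (rule JI[of \<zero> \<zero> \<zero>]) auto
  qed (auto simp: J_def)
  have gens: "\<one> \<in> J" "x \<in> J" "y \<in> J"
    using JI[of \<one> \<zero> \<zero>] JI[of \<zero> \<one> \<zero>] JI[of \<zero> \<zero> \<one>] by simp_all
  define G where "G = {g \<in> carrier F. g \<otimes> (x \<otimes> y) \<in> J}"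
  have G: "rmod G" using rmodD[OF J] by (auto simp: rmod_def G_def l_distr m_assoc)
  have "z \<otimes> v \<in> G" if z: "z \<in> J" and v: "v \<in> Inv J" for z v
  proof -
    obtain a b c where [simp]: "a \<in> R" "b \<in> R" "c \<in> R"
      and zz: "z = a \<oplus> b \<otimes> x \<oplus> c \<otimes> y" using z by (auto simp: J_def)
    have v': "v \<in> carrier F" "v \<otimes> x \<otimes> y \<in> J" "v \<otimes> \<one> \<otimes> y \<in> J" "v \<otimes> \<one> \<otimes> x \<in> J"
      using v gens by (auto simp: Inv_def)
    note [simp] = v'(1)
    have "z \<otimes> v \<otimes> (x \<otimes> y) = a \<otimes> (v \<otimes> x \<otimes> y) \<oplus> b \<otimes> (v \<otimes> (x \<otimes> x) \<otimes> y) \<oplus> c \<otimes> (v \<otimes> x \<otimes> (y \<otimes> y))"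
      unfolding zz by (reify ring_reify, rule ring_identityI, simp, simp, code_simp)
    also have "\<dots> = (a \<oplus> b \<otimes> p1 \<oplus> c \<otimes> q1) \<otimes> (v \<otimes> x \<otimes> y) \<oplus> b \<otimes> p0 \<otimes> (v \<otimes> \<one> \<otimes> y) \<oplus> c \<otimes> q0 \<otimes> (v \<otimes> \<one> \<otimes> x)"
      unfolding x2 y2 by (reify ring_reify, rule ring_identityI, simp, simp, code_simp)
    also have "\<dots> \<in> J" using v'(2-) rmodD[OF J] by auto
    finally show ?thesis using rmodD(1)[OF J z] by (simp add: G_def)
  qed
  moreover obtain d where d: "d \<in> R" "d \<noteq> \<zero>" "d \<otimes> x \<in> R" "d \<otimes> y \<in> R" using common_denominator[of x y] by auto
  have "d \<otimes> z \<in> R" if z: "z \<in> J" for z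
  proof -
    obtain a b c where [simp]: "a \<in> R" "b \<in> R" "c \<in> R"
      and zz: "z = a \<oplus> b \<otimes> x \<oplus> c \<otimes> y" using z by (auto simp: J_def)
    have "d \<otimes> z = d \<otimes> a \<oplus> b \<otimes> (d \<otimes> x) \<oplus> c \<otimes> (d \<otimes> y)" using d(1) unfolding zz
      by (simp add: r_distr) (simp add: m_ac)
    then show ?thesis using d by simp
  qed
  ultimately have "\<one> \<in> G" using invertible[OF J gens(1) one_not_zero d(1,2) _ G] by blast
  then have "x \<otimes> y \<in> J" by (simp add: G_def)
  then show ?thesis using that by (auto simp: J_def)
qed

lemma integral_scale:
  assumes [simp]: "r \<in> R" and x: "x \<in> S" shows "r \<otimes> x \<in> S"
proof -
  obtain q p where [simp]: "q \<in> R" "p \<in> R" and x2: "x \<otimes> x = q \<otimes> x \<ominus> p" using integral_quadratic'[OF x] by metis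
  have [simp]: "x \<in> carrier F" using x by simp
  have "(r \<otimes> x) \<otimes> (r \<otimes> x) \<ominus> ((r \<otimes> q) \<otimes> (r \<otimes> x) \<ominus> (r \<otimes> r \<otimes> p)) = r \<otimes> r \<otimes> (x \<otimes> x \<ominus> (q \<otimes> x \<ominus> p))"
    by (reify ring_reify, rule ring_identityI, simp, simp, code_simp)
  from eq_by_combination[OF x2 this] show ?thesis
    by (intro quadratic_integral[of _ "r \<otimes> q" "r \<otimes> r \<otimes> p"]) auto
qed

lemma integral_add:
  assumes x: "x \<in> S" and y: "y \<in> S" shows "x \<oplus> y \<in> S"
proof -
  obtain p0 p1 where [simp]: "p0 \<in> R" "p1 \<in> R" and x2: "x \<otimes> x = p0 \<oplus> p1 \<otimes> x" using integral_quadratic[OF x] by metis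
  obtain q0 q1 where [simp]: "q0 \<in> R" "q1 \<in> R" and y2: "y \<otimes> y = q0 \<oplus> q1 \<otimes> y" using integral_quadratic[OF y] by metis
  obtain a b c where [simp]: "a \<in> R" "b \<in> R" "c \<in> R" and xy: "x \<otimes> y = a \<oplus> b \<otimes> x \<oplus> c \<otimes> y"
    using integral_product[OF x y] by metis
  have [simp]: "x \<in> carrier F" "y \<in> carrier F" using x y by auto
  define v where "v = x \<oplus> y"
  have [simp]: "v \<in> carrier F" by (simp add: v_def)
  \<comment> \<open>shift\<close>
  define x' y' where "x' = x \<ominus> c" and "y' = y \<ominus> b"
  define P Q where "P = p1 \<oplus> b \<ominus> c" and "Q = q1 \<oplus> c \<ominus> b"
  define g where "g = a \<oplus> b \<otimes> c \<oplus> (p0 \<oplus> p1 \<otimes> c \<ominus> c \<otimes> c)"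
  define h where "h = a \<oplus> b \<otimes> c \<oplus> (q0 \<oplus> q1 \<otimes> b \<ominus> b \<otimes> b)"
  define s where "s = b \<oplus> c"
  have [simp]: "P \<in> R" "Q \<in> R" "g \<in> R" "h \<in> R" "s \<in> R" "x' \<in> carrier F" "y' \<in> carrier F"
    by (simp_all add: P_def Q_def g_def h_def s_def x'_def y'_def)
  have "(v \<ominus> P) \<otimes> x' \<ominus> g = \<one> \<otimes> (x \<otimes> x \<ominus> (p0 \<oplus> p1 \<otimes> x)) \<oplus> \<one> \<otimes> (x \<otimes> y \<ominus> (a \<oplus> b \<otimes> x \<oplus> c \<otimes> y))"
    unfolding v_def P_def g_def x'_def by (reify ring_reify, rule ring_identityI, simp, simp, code_simp)
  from eq_by_combination2[OF x2 xy this] have vx: "(v \<ominus> P) \<otimes> x' = g" by simp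
  have "(v \<ominus> Q) \<otimes> y' \<ominus> h = \<one> \<otimes> (y \<otimes> y \<ominus> (q0 \<oplus> q1 \<otimes> y)) \<oplus> \<one> \<otimes> (x \<otimes> y \<ominus> (a \<oplus> b \<otimes> x \<oplus> c \<otimes> y))"
    unfolding v_def Q_def h_def y'_def by (reify ring_reify, rule ring_identityI, simp, simp, code_simp)
  from eq_by_combination2[OF y2 xy this] have vy: "(v \<ominus> Q) \<otimes> y' = h" by simp
  have vs: "v = x' \<oplus> y' \<oplus> s" unfolding v_def x'_def y'_def s_def
    by (reify ring_reify, rule ring_identityI, simp, simp, code_simp)
  have "v \<otimes> v \<otimes> v \<ominus> (P \<oplus> Q \<oplus> s) \<otimes> (v \<otimes> v) \<oplus> (P \<otimes> Q \<oplus> P \<otimes> s \<oplus> Q \<otimes> s \<ominus> g \<ominus> h) \<otimes> v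
      \<ominus> (P \<otimes> Q \<otimes> s \<ominus> Q \<otimes> g \<ominus> P \<otimes> h) \<ominus> (v \<ominus> P) \<otimes> (v \<ominus> Q) \<otimes> (v \<ominus> (x' \<oplus> y' \<oplus> s))
    = (v \<ominus> Q) \<otimes> ((v \<ominus> P) \<otimes> x' \<ominus> g) \<oplus> (v \<ominus> P) \<otimes> ((v \<ominus> Q) \<otimes> y' \<ominus> h)"
    by (reify ring_reify, rule ring_identityI, simp, simp, code_simp)
  from eq_by_combination2[OF vx vy this]
  have "v \<otimes> v \<otimes> v \<ominus> (P \<oplus> Q \<oplus> s) \<otimes> (v \<otimes> v) \<oplus> (P \<otimes> Q \<oplus> P \<otimes> s \<oplus> Q \<otimes> s \<ominus> g \<ominus> h) \<otimes> v
      \<ominus> (P \<otimes> Q \<otimes> s \<ominus> Q \<otimes> g \<ominus> P \<otimes> h) = (v \<ominus> P) \<otimes> (v \<ominus> Q) \<otimes> (v \<ominus> v)" unfolding vs[symmetric] by simp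
  then have "v \<otimes> v \<otimes> v \<ominus> (P \<oplus> Q \<oplus> s) \<otimes> (v \<otimes> v) \<oplus> (P \<otimes> Q \<oplus> P \<otimes> s \<oplus> Q \<otimes> s \<ominus> g \<ominus> h) \<otimes> v
      \<ominus> (P \<otimes> Q \<otimes> s \<ominus> Q \<otimes> g \<ominus> P \<otimes> h) = \<zero>" by (simp add: minus_self)
  from cubic_integral[OF _ _ _ _ this] have "v \<in> S" by simp
  then show ?thesis by (simp add: v_def)
qed

lemma S_subring: "subring S F"
proof (rule subringI)
  show "\<ominus> x \<in> S" if "x \<in> S" for x using integral_scale[of "\<ominus> \<one>" x] that by (simp add: l_minus)
  show "x \<otimes> y \<in> S" if x: "x \<in> S" and y: "y \<in> S" for x y
  proof -
    obtain a b c where "a \<in> R" "b \<in> R" "c \<in> R" "x \<otimes> y = a \<oplus> b \<otimes> x \<oplus> c \<otimes> y"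
      using integral_product[OF x y] by metis
    then show ?thesis using integral_add integral_scale x y by simp
  qed
qed (use integral_add in auto)

end

context stable_local_ring
begin

lemma span2_eqI: "z = a \<otimes> x \<oplus> b \<otimes> y \<Longrightarrow> a \<in> R \<Longrightarrow> b \<in> R \<Longrightarrow> z \<in> span2 x y"
  by (rule span2I)

lemmas S_closed [simp] = subringE(2,3,5-7)[OF S_subring]

lemma S_minus [simp]: "x \<in> S \<Longrightarrow> y \<in> S \<Longrightarrow> x \<ominus> y \<in> S"
  by (simp add: minus_eq)

definition Sunit :: "'a \<Rightarrow> bool" where
  "Sunit x \<longleftrightarrow> x \<in> S \<and> (\<exists>y\<in>S. x \<otimes> y = \<one>)"

definition Jac :: "'a set" where
  "Jac = {x \<in> S. \<forall>s\<in>S. Sunit (\<one> \<ominus> x \<otimes> s)}"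

lemma SunitI: "x \<in> S \<Longrightarrow> y \<in> S \<Longrightarrow> x \<otimes> y = \<one> \<Longrightarrow> Sunit x"
  by (auto simp: Sunit_def)

lemma Sunit_S: "Sunit x \<Longrightarrow> x \<in> S"
  by (simp add: Sunit_def)

lemma SunitE:
  assumes "Sunit x" obtains y where "y \<in> S" "x \<otimes> y = \<one>"
  using assms by (auto simp: Sunit_def)

lemma not_Sunit_zero [simp]: "\<not> Sunit \<zero>"
  by (auto simp: Sunit_def)

lemma Jac_S: "x \<in> Jac \<Longrightarrow> x \<in> S"
  by (simp add: Jac_def)

lemma JacI: "x \<in> S \<Longrightarrow> (\<And>s. s \<in> S \<Longrightarrow> Sunit (\<one> \<ominus> x \<otimes> s)) \<Longrightarrow> x \<in> Jac"
  by (simp add: Jac_def)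

lemma JacD: "x \<in> Jac \<Longrightarrow> s \<in> S \<Longrightarrow> Sunit (\<one> \<ominus> x \<otimes> s)"
  by (simp add: Jac_def)

declare Sunit_S [simp] Jac_S [simp]

lemma Sunit_mult:
  assumes "x \<in> S" "y \<in> S" shows "Sunit (x \<otimes> y) \<longleftrightarrow> Sunit x \<and> Sunit y"
proof
  assume "Sunit (x \<otimes> y)"
  then obtain t where t: "t \<in> S" "x \<otimes> y \<otimes> t = \<one>" by (elim SunitE)
  have "x \<otimes> (y \<otimes> t) = \<one>" "y \<otimes> (x \<otimes> t) = \<one>" using t assms by (simp_all add: m_ac)
  then show "Sunit x \<and> Sunit y" using t assms SunitI[of x "y \<otimes> t"] SunitI[of y "x \<otimes> t"] by simp
next
  assume "Sunit x \<and> Sunit y"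
  then obtain s t where st: "s \<in> S" "x \<otimes> s = \<one>" "t \<in> S" "y \<otimes> t = \<one>" by (elim conjE SunitE)
  have "x \<otimes> y \<otimes> (s \<otimes> t) = (x \<otimes> s) \<otimes> (y \<otimes> t)" using st(1,3) assms by (simp add: m_ac)
  then show "Sunit (x \<otimes> y)" using st assms SunitI[of "x \<otimes> y" "s \<otimes> t"] by simp
qed

lemma Sunit_one [simp]: "Sunit \<one>"
  by (rule SunitI[of _ \<one>]) auto

lemma Sunit_R:
  assumes r: "r \<in> R" shows "Sunit r \<longleftrightarrow> r \<notin> M"
proof
  assume "Sunit r"
  then obtain s where s: "s \<in> S" "r \<otimes> s = \<one>" by (elim SunitE)
  obtain q p where [simp]: "q \<in> R" "p \<in> R" and s2: "s \<otimes> s = q \<otimes> s \<ominus> p" using integral_quadratic'[OF s(1)] by metis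
  note [simp] = r
  have [simp]: "s \<in> carrier F" using s by simp
  have "s \<ominus> (q \<ominus> r \<otimes> p) = r \<otimes> (s \<otimes> s \<ominus> (q \<otimes> s \<ominus> p)) \<oplus> (q \<ominus> s) \<otimes> (r \<otimes> s \<ominus> \<one>)"
    by (reify ring_reify, rule ring_identityI, simp, simp, code_simp)
  from eq_by_combination2[OF s2 s(2) this] have "s \<in> R" by simp
  then show "r \<notin> M" using s unfolding M_def by blast
next
  assume "r \<notin> M"
  then show "Sunit r" using unit_R[OF r] r SunitI by auto
qed

lemma R_subset_S: "R \<subseteq> S"
  using R_S by (rule subsetI)

lemma quadratic_Sunit:
  assumes "e \<in> S" "q \<in> R" "p \<in> R" "p \<notin> M" "e \<otimes> e = q \<otimes> e \<ominus> p"
  shows "Sunit e"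
  by (rule quadratic_unit[OF S_subring R_subset_S assms]) (rule SunitI[OF assms(1)])

lemma one_minus_quadratic_Sunit:
  assumes "e \<in> S" "q \<in> R" "p \<in> R" "\<one> \<ominus> q \<oplus> p \<notin> M" "e \<otimes> e = q \<otimes> e \<ominus> p"
  shows "Sunit (\<one> \<ominus> e)"
  by (rule one_minus_quadratic_unit[OF S_subring R_subset_S assms]) (rule SunitI, use assms in simp_all)

lemma M_Jac [simp]: "m \<in> M \<Longrightarrow> m \<in> Jac"
proof -
  assume m: "m \<in> M"
  have "Sunit (\<one> \<ominus> m \<otimes> s)" if s: "s \<in> S" for s
  proof -
    obtain q p where [simp]: "q \<in> R" "p \<in> R" and s2: "s \<otimes> s = q \<otimes> s \<ominus> p" using integral_quadratic'[OF s] by metis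
    note [simp] = m
    have [simp]: "s \<in> carrier F" using s by simp
    have "(m \<otimes> s) \<otimes> (m \<otimes> s) \<ominus> ((m \<otimes> q) \<otimes> (m \<otimes> s) \<ominus> m \<otimes> (m \<otimes> p)) = m \<otimes> m \<otimes> (s \<otimes> s \<ominus> (q \<otimes> s \<ominus> p))"
      by (reify ring_reify, rule ring_identityI, simp, simp, code_simp)
    from eq_by_combination[OF s2 this]
    have "(m \<otimes> s) \<otimes> (m \<otimes> s) = (m \<otimes> q) \<otimes> (m \<otimes> s) \<ominus> m \<otimes> (m \<otimes> p)" by simp
    moreover have "\<one> \<oplus> (\<ominus> (m \<otimes> q) \<oplus> m \<otimes> (m \<otimes> p)) \<notin> M" by (rule unit_add_M) auto
    then have "\<one> \<ominus> m \<otimes> q \<oplus> m \<otimes> (m \<otimes> p) \<notin> M" by (simp add: minus_eq a_assoc)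
    ultimately show ?thesis using one_minus_quadratic_Sunit[of "m \<otimes> s" "m \<otimes> q" "m \<otimes> (m \<otimes> p)"] s by simp
  qed
  then show ?thesis using m by (intro JacI) auto
qed

lemma Sunit_add_Jac:
  assumes u: "Sunit u" and x: "x \<in> Jac" shows "Sunit (u \<oplus> x)"
proof -
  obtain v where v: "v \<in> S" "u \<otimes> v = \<one>" using u by (elim SunitE)
  have [simp]: "u \<in> carrier F" "v \<in> carrier F" "x \<in> carrier F" using u v x by auto
  have "u \<oplus> x \<ominus> u \<otimes> (\<one> \<ominus> x \<otimes> (\<ominus> v)) = (\<ominus> x) \<otimes> (u \<otimes> v \<ominus> \<one>)"
    by (reify ring_reify, rule ring_identityI, simp, simp, code_simp)
  from eq_by_combination[OF v(2) this] have "u \<oplus> x = u \<otimes> (\<one> \<ominus> x \<otimes> (\<ominus> v))" by simp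
  moreover have "Sunit (\<one> \<ominus> x \<otimes> (\<ominus> v))" using x v by (intro JacD) auto
  ultimately show ?thesis using Sunit_mult[of u "\<one> \<ominus> x \<otimes> (\<ominus> v)"] u by simp
qed

lemma Jac_mult [simp]: "x \<in> Jac \<Longrightarrow> s \<in> S \<Longrightarrow> x \<otimes> s \<in> Jac"
  by (rule JacI) (auto simp: m_assoc JacD)

lemma Jac_mult2 [simp]: "x \<in> Jac \<Longrightarrow> s \<in> S \<Longrightarrow> s \<otimes> x \<in> Jac"
  using Jac_mult[of x s] by (simp add: m_comm)

lemma Jac_neg [simp]: "x \<in> Jac \<Longrightarrow> \<ominus> x \<in> Jac"
  using Jac_mult2[of x "\<ominus> \<one>"] by (simp add: l_minus)

lemma Jac_add [simp]:
  assumes x: "x \<in> Jac" and y: "y \<in> Jac" shows "x \<oplus> y \<in> Jac"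
proof -
  have "Sunit (\<one> \<ominus> (x \<oplus> y) \<otimes> s)" if s: "s \<in> S" for s
  proof -
    have [simp]: "x \<in> carrier F" "y \<in> carrier F" "s \<in> carrier F" using x y s by auto
    have "\<one> \<ominus> (x \<oplus> y) \<otimes> s = (\<one> \<ominus> x \<otimes> s) \<oplus> (\<ominus> (y \<otimes> s))"
      by (reify ring_reify, rule ring_identityI, simp, simp, code_simp)
    then show ?thesis using x y s Sunit_add_Jac[of "\<one> \<ominus> x \<otimes> s" "\<ominus> (y \<otimes> s)"] by (simp add: JacD)
  qed
  then show ?thesis using x y by (intro JacI) auto
qed

lemma Jac_minus [simp]: "x \<in> Jac \<Longrightarrow> y \<in> Jac \<Longrightarrow> x \<ominus> y \<in> Jac"
  by (simp add: minus_eq)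

lemma Sunit_cong_Jac:
  assumes "x \<ominus> y \<in> Jac" "x \<in> S" "y \<in> S" "Sunit x" shows "Sunit y"
proof -
  have [simp]: "x \<in> carrier F" "y \<in> carrier F" using assms by auto
  have "y = x \<oplus> (\<ominus> (x \<ominus> y))" by (reify ring_reify, rule ring_identityI, simp, simp, code_simp)
  then show ?thesis using Sunit_add_Jac[of x "\<ominus> (x \<ominus> y)"] assms by simp
qed

lemma Jac_R: "r \<in> R \<Longrightarrow> r \<in> Jac \<Longrightarrow> r \<in> M"
proof (rule ccontr)
  assume r: "r \<in> R" "r \<in> Jac" "r \<notin> M"
  then obtain s where s: "s \<in> R" "r \<otimes> s = \<one>" using unit_R by blast
  have "Sunit (\<one> \<ominus> r \<otimes> s)" using r s by (intro JacD) auto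
  then show False using s by (simp add: minus_self)
qed

lemma Jac_unit_mult:
  assumes "u \<otimes> x \<in> Jac" "Sunit u" "x \<in> S" shows "x \<in> Jac"
proof -
  obtain v where v: "v \<in> S" "u \<otimes> v = \<one>" using assms by (elim SunitE)
  have "v \<otimes> (u \<otimes> x) = (u \<otimes> v) \<otimes> x" using v(1) assms by (simp add: m_ac)
  also have "\<dots> = x" using v assms by simp
  finally show ?thesis using Jac_mult2[OF assms(1) v(1)] by simp
qed

lemma span2_one_subring:
  assumes x: "x \<in> S" shows "subring (span2 \<one> x) F" "R \<subseteq> span2 \<one> x"
proof -
  obtain p0 p1 where p[simp]: "p0 \<in> R" "p1 \<in> R" and x2: "x \<otimes> x = p0 \<oplus> p1 \<otimes> x" using integral_quadratic[OF x] by metis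
  have [simp]: "x \<in> carrier F" using x by simp
  have J: "rmod (span2 \<one> x)" using span2_rmod by simp
  show "subring (span2 \<one> x) F"
  proof (rule subringI)
    show "\<ominus> h \<in> span2 \<one> x" if "h \<in> span2 \<one> x" for h
      using rmodD(4)[OF J, of "\<ominus> \<one>" h] that rmodD(1)[OF J that] by (simp add: l_minus)
    show "h \<otimes> h' \<in> span2 \<one> x" if h: "h \<in> span2 \<one> x" "h' \<in> span2 \<one> x" for h h'
    proof -
      obtain a b a' b' where [simp]: "a \<in> R" "b \<in> R" "a' \<in> R" "b' \<in> R" and
        hh: "h = a \<otimes> \<one> \<oplus> b \<otimes> x" "h' = a' \<otimes> \<one> \<oplus> b' \<otimes> x" using h unfolding span2_def by blast
      have "h \<otimes> h' \<ominus> ((a \<otimes> a' \<oplus> b \<otimes> b' \<otimes> p0) \<otimes> \<one> \<oplus> (a \<otimes> b' \<oplus> b \<otimes> a' \<oplus> b \<otimes> b' \<otimes> p1) \<otimes> x)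
         = b \<otimes> b' \<otimes> (x \<otimes> x \<ominus> (p0 \<oplus> p1 \<otimes> x))" unfolding hh
        by (reify ring_reify, rule ring_identityI, simp, simp, code_simp)
      from span2_eqI[OF eq_by_combination[OF x2 this]] show ?thesis using rmodD(1)[OF J] h by simp
    qed
  qed (use rmodD[OF J] span2_gens[of \<one> x] in auto)
  show "R \<subseteq> span2 \<one> x" using span2I[of _ \<zero> _ \<one> x] by auto
qed

lemma span2_one_subset:
  assumes x: "x \<in> S" and y: "y \<in> span2 \<one> x" shows "span2 \<one> y \<subseteq> span2 \<one> x"
proof
  note T = subringE(3,6,7)[OF span2_one_subring(1)[OF x]] subsetD[OF span2_one_subring(2)[OF x]]
  fix z assume "z \<in> span2 \<one> y"
  then obtain a b where "a \<in> R" "b \<in> R" "z = a \<otimes> \<one> \<oplus> b \<otimes> y" by (auto simp: span2_def)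
  then show "z \<in> span2 \<one> x" using y by (simp only: T)
qed

text \<open>inverse of a unit x lies in R+Rx\<close>
lemma Sunit_inverse:
  assumes x: "Sunit x" obtains y where "y \<in> span2 \<one> x" "x \<otimes> y = \<one>"
proof -
  obtain y where y: "y \<in> S" "x \<otimes> y = \<one>" using x by (elim SunitE)
  obtain q p where [simp]: "q \<in> R" "p \<in> R" and y2: "y \<otimes> y = q \<otimes> y \<ominus> p" using integral_quadratic'[OF y(1)] by metis
  have [simp]: "x \<in> carrier F" "y \<in> carrier F" using x y by auto
  have "y \<ominus> (q \<otimes> \<one> \<oplus> (\<ominus> p) \<otimes> x) = x \<otimes> (y \<otimes> y \<ominus> (q \<otimes> y \<ominus> p)) \<oplus> (q \<ominus> y) \<otimes> (x \<otimes> y \<ominus> \<one>)"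
    by (reify ring_reify, rule ring_identityI, simp, simp, code_simp)
  from span2_eqI[OF eq_by_combination2[OF y2 y(2) this]] have "y \<in> span2 \<one> x" by simp
  then show ?thesis using that y by blast
qed

lemma idempotent_quadratic:
  assumes e: "e \<in> S" "\<not> Sunit e" "\<not> Sunit (\<one> \<ominus> e)"
  obtains q p where "q \<in> R" "p \<in> M" "\<one> \<ominus> q \<in> M" "e \<otimes> e = q \<otimes> e \<ominus> p"
proof -
  obtain q p where [simp]: "q \<in> R" "p \<in> R" and e2: "e \<otimes> e = q \<otimes> e \<ominus> p" using integral_quadratic'[OF e(1)] by metis
  have p: "p \<in> M" "\<one> \<ominus> q \<oplus> p \<in> M" using quadratic_Sunit[of e q p] one_minus_quadratic_Sunit[of e q p] e2 e by auto
  have "\<one> \<ominus> q = (\<one> \<ominus> q \<oplus> p) \<ominus> p" by (reify ring_reify, rule ring_identityI, simp, simp, code_simp)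
  then have "\<one> \<ominus> q \<in> M" using p by (metis M_minus)
  then show ?thesis by (rule that[OF \<open>q \<in> R\<close> p(1) _ e2])
qed

lemma trace_one:
  assumes e: "e \<in> S" "\<not> Sunit e" "\<not> Sunit (\<one> \<ominus> e)"
    and s: "s \<in> S" "e \<otimes> s \<in> R" "s \<notin> span2 \<one> e"
    and [simp]: "q' \<in> R" "p' \<in> R" and s2: "s \<otimes> s = q' \<otimes> s \<ominus> p'"
  shows "q' \<ominus> \<one> \<in> M"
proof -
  obtain q p where qp[simp]: "q \<in> R" "p \<in> M" "\<one> \<ominus> q \<in> M" and e2: "e \<otimes> e = q \<otimes> e \<ominus> p"
    using idempotent_quadratic[OF e] by metis
  have [simp]: "e \<in> carrier F" "s \<in> carrier F" using e s by auto
  have T: "subring (span2 \<one> e) F" "R \<subseteq> span2 \<one> e" using span2_one_subring e by auto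
  obtain \<beta> \<gamma> where [simp]: "\<beta> \<in> R" "\<gamma> \<in> R" and es2: "(e \<oplus> s) \<otimes> (e \<oplus> s) = \<beta> \<otimes> (e \<oplus> s) \<ominus> \<gamma>"
    using integral_quadratic'[of "e \<oplus> s"] e s by auto
  define \<rho> where "\<rho> = p \<oplus> p' \<ominus> e \<otimes> s \<ominus> e \<otimes> s \<ominus> \<gamma>"
  have [simp]: "\<rho> \<in> R" unfolding \<rho>_def using s by simp
  have "(q \<ominus> \<beta>) \<otimes> e \<oplus> (q' \<ominus> \<beta>) \<otimes> s \<ominus> \<rho> \<ominus> ((e \<oplus> s) \<otimes> (e \<oplus> s) \<ominus> (\<beta> \<otimes> (e \<oplus> s) \<ominus> \<gamma>))
    = (\<ominus> \<one>) \<otimes> (e \<otimes> e \<ominus> (q \<otimes> e \<ominus> p)) \<oplus> (\<ominus> \<one>) \<otimes> (s \<otimes> s \<ominus> (q' \<otimes> s \<ominus> p'))"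
    unfolding \<rho>_def by (reify ring_reify, rule ring_identityI, simp, simp, code_simp)
  from eq_by_combination2[OF e2 s2 this]
  have "(q \<ominus> \<beta>) \<otimes> e \<oplus> (q' \<ominus> \<beta>) \<otimes> s \<ominus> \<rho> = \<zero>" unfolding es2 by (simp add: minus_self)
  then have lin: "(q \<ominus> \<beta>) \<otimes> e \<oplus> (q' \<ominus> \<beta>) \<otimes> s = \<rho>" by (simp add: r_right_minus_eq)
  have q'\<beta>: "q' \<ominus> \<beta> \<in> M"
  proof (rule ccontr)
    assume "q' \<ominus> \<beta> \<notin> M"
    then obtain i where [simp]: "i \<in> R" and i: "(q' \<ominus> \<beta>) \<otimes> i = \<one>" using unit_R[of "q' \<ominus> \<beta>"] by auto
    have "s \<ominus> (i \<otimes> \<rho> \<otimes> \<one> \<oplus> (\<ominus> (i \<otimes> (q \<ominus> \<beta>))) \<otimes> e)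
       = (\<ominus> s) \<otimes> ((q' \<ominus> \<beta>) \<otimes> i \<ominus> \<one>) \<oplus> i \<otimes> ((q \<ominus> \<beta>) \<otimes> e \<oplus> (q' \<ominus> \<beta>) \<otimes> s \<ominus> \<rho>)"
      by (reify ring_reify, rule ring_identityI, simp, simp, code_simp)
    from span2_eqI[OF eq_by_combination2[OF i lin this]] have "s \<in> span2 \<one> e" by simp
    then show False using s by simp
  qed
  have q\<beta>: "q \<ominus> \<beta> \<in> M"
  proof (rule ccontr)
    assume "q \<ominus> \<beta> \<notin> M"
    then obtain i where [simp]: "i \<in> R" and i: "(q \<ominus> \<beta>) \<otimes> i = \<one>" using unit_R[of "q \<ominus> \<beta>"] by auto
    have "e \<ominus> (i \<otimes> \<rho> \<ominus> i \<otimes> (q' \<ominus> \<beta>) \<otimes> s)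
       = (\<ominus> e) \<otimes> ((q \<ominus> \<beta>) \<otimes> i \<ominus> \<one>) \<oplus> i \<otimes> ((q \<ominus> \<beta>) \<otimes> e \<oplus> (q' \<ominus> \<beta>) \<otimes> s \<ominus> \<rho>)"
      by (reify ring_reify, rule ring_identityI, simp, simp, code_simp)
    from eq_by_combination2[OF i lin this] have eq: "e = i \<otimes> \<rho> \<ominus> i \<otimes> (q' \<ominus> \<beta>) \<otimes> s" by simp
    have j: "i \<otimes> (q' \<ominus> \<beta>) \<otimes> s \<in> Jac" using q'\<beta> s by simp
    have "i \<otimes> \<rho> \<in> M"
    proof (rule ccontr)
      assume "i \<otimes> \<rho> \<notin> M"
      then have "Sunit (i \<otimes> \<rho>)" using Sunit_R by simp
      then show False using Sunit_add_Jac[of "i \<otimes> \<rho>" "\<ominus> (i \<otimes> (q' \<ominus> \<beta>) \<otimes> s)"] j eq e by (simp add: minus_eq)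
    qed
    then have "e \<in> Jac" using j eq by simp
    then have "Sunit (\<one> \<ominus> e \<otimes> \<one>)" by (rule JacD) simp
    then show False using e by simp
  qed
  have "q' \<ominus> \<one> = (q' \<ominus> \<beta>) \<ominus> (q \<ominus> \<beta>) \<ominus> (\<one> \<ominus> q)"
    by (reify ring_reify, rule ring_identityI, simp, simp, code_simp)
  then show ?thesis using q\<beta> q'\<beta> qp(3) by (metis M_minus)
qed

lemma not_in_Jac:
  assumes e: "e \<in> S" "\<not> Sunit e" "\<not> Sunit (\<one> \<ominus> e)"
    and s: "s \<in> S" "e \<otimes> s \<in> R" "s \<notin> span2 \<one> e"
  shows "s \<notin> Jac"
proof
  assume sJ: "s \<in> Jac"
  obtain q' p' where [simp]: "q' \<in> R" "p' \<in> R" and s2: "s \<otimes> s = q' \<otimes> s \<ominus> p'" using integral_quadratic'[OF s(1)] by metis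
  have [simp]: "s \<in> carrier F" using s by auto
  have q': "q' \<ominus> \<one> \<in> M" using trace_one[OF e s _ _ s2] by simp
  have "q' \<notin> M"
  proof
    assume "q' \<in> M"
    then have "q' \<ominus> (q' \<ominus> \<one>) \<in> M" using q' by simp
    moreover have "q' \<ominus> (q' \<ominus> \<one>) = \<one>" by (reify ring_reify, rule ring_identityI, simp, simp, code_simp)
    ultimately show False by simp
  qed
  then have u: "Sunit (q' \<ominus> s)" using Sunit_add_Jac[of q' "\<ominus> s"] sJ Sunit_R by (simp add: minus_eq)
  then obtain w where w: "w \<in> span2 \<one> (q' \<ominus> s)" "(q' \<ominus> s) \<otimes> w = \<one>" using Sunit_inverse by metis
  obtain a b where [simp]: "a \<in> R" "b \<in> R" and wab: "w = a \<otimes> \<one> \<oplus> b \<otimes> (q' \<ominus> s)" using w(1) unfolding span2_def by blast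
  have "p' = s \<otimes> (q' \<ominus> s)"
  proof -
    have "p' \<ominus> s \<otimes> (q' \<ominus> s) = \<one> \<otimes> (s \<otimes> s \<ominus> (q' \<otimes> s \<ominus> p'))" by (reify ring_reify, rule ring_identityI, simp, simp, code_simp)
    from eq_by_combination[OF s2 this] show ?thesis by simp
  qed
  moreover have "s \<otimes> (q' \<ominus> s) \<in> Jac" using sJ u by simp
  ultimately have "p' \<in> Jac" by (rule ssubst)
  then have p': "p' \<in> M" by (intro Jac_R) simp_all
  have [simp]: "w \<in> carrier F" by (simp add: wab)
  have "s \<otimes> (\<one> \<oplus> p' \<otimes> b) \<ominus> p' \<otimes> (a \<oplus> b \<otimes> q') = (\<ominus> s) \<otimes> ((q' \<ominus> s) \<otimes> w \<ominus> \<one>) \<oplus> (\<ominus> w) \<otimes> (s \<otimes> s \<ominus> (q' \<otimes> s \<ominus> p'))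
      \<oplus> p' \<otimes> (w \<ominus> (a \<otimes> \<one> \<oplus> b \<otimes> (q' \<ominus> s)))"
    by (reify ring_reify, rule ring_identityI, simp, simp, code_simp)
  also have "w \<ominus> (a \<otimes> \<one> \<oplus> b \<otimes> (q' \<ominus> s)) = \<zero>" unfolding wab by (simp add: minus_self)
  finally have "s \<otimes> (\<one> \<oplus> p' \<otimes> b) \<ominus> p' \<otimes> (a \<oplus> b \<otimes> q') = (\<ominus> s) \<otimes> ((q' \<ominus> s) \<otimes> w \<ominus> \<one>) \<oplus> (\<ominus> w) \<otimes> (s \<otimes> s \<ominus> (q' \<otimes> s \<ominus> p'))"
    by simp
  from eq_by_combination2[OF w(2) s2 this] have eq: "s \<otimes> (\<one> \<oplus> p' \<otimes> b) = p' \<otimes> (a \<oplus> b \<otimes> q')" by simp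
  have "\<one> \<oplus> p' \<otimes> b \<notin> M" using p' unit_add_M[of \<one> "p' \<otimes> b"] by simp
  then obtain i where i: "i \<in> R" "(\<one> \<oplus> p' \<otimes> b) \<otimes> i = \<one>" using unit_R[of "\<one> \<oplus> p' \<otimes> b"] by auto
  have "s = s \<otimes> ((\<one> \<oplus> p' \<otimes> b) \<otimes> i)" using i by simp
  also have "\<dots> = p' \<otimes> (a \<oplus> b \<otimes> q') \<otimes> i" using eq i(1) by (simp flip: m_assoc)
  finally have "s \<in> R" using i by simp
  then show False using s span2_one_subring e by auto
qed

end

context stable_local_ring
begin

lemma nonunit_R_mult:
  assumes "e \<in> S" "\<not> Sunit e" "s \<in> S" "e \<otimes> s \<in> R" shows "e \<otimes> s \<in> M"
  using assms Sunit_R[of "e \<otimes> s"] Sunit_mult[of e s] by blast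

lemma split_product_case:
  assumes e: "e \<in> S" "\<not> Sunit e" "\<not> Sunit (\<one> \<ominus> e)"
    and s: "s \<in> S" "e \<otimes> s \<in> R"
  shows "s \<in> span2 \<one> e"
proof (rule ccontr)
  assume sT: "s \<notin> span2 \<one> e"
  obtain q p where qp[simp]: "q \<in> R" "p \<in> M" "\<one> \<ominus> q \<in> M" and e2: "e \<otimes> e = q \<otimes> e \<ominus> p"
    using idempotent_quadratic[OF e] by metis
  obtain q' p' where q'p'[simp]: "q' \<in> R" "p' \<in> R" and s2: "s \<otimes> s = q' \<otimes> s \<ominus> p'" using integral_quadratic'[OF s(1)] by metis
  have [simp]: "e \<in> carrier F" "s \<in> carrier F" using e s by auto
  note T = subringE[OF span2_one_subring(1)[OF e(1)]]
  note RT = subsetD[OF span2_one_subring(2)[OF e(1)]]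
  have eT: "e \<in> span2 \<one> e" using span2_gens[of \<one> e] by simp
  define a where "a = e \<otimes> s"
  have a[simp]: "a \<in> M" unfolding a_def using nonunit_R_mult[OF e(1,2) s] .
  have q': "q' \<ominus> \<one> \<in> M" using trace_one[OF e s sT q'p' s2] .
  \<comment> \<open>the residue field has two elements\<close>
  have F2: "r \<ominus> \<one> \<in> M" if r[simp]: "r \<in> R" and rM: "r \<notin> M" for r
  proof -
    obtain i where i: "i \<in> R" "r \<otimes> i = \<one>" using unit_R[OF r rM] by blast
    have "r \<otimes> s \<notin> span2 \<one> e"
    proof
      assume "r \<otimes> s \<in> span2 \<one> e"
      then have "i \<otimes> (r \<otimes> s) \<in> span2 \<one> e" using T(6) RT[OF i(1)] by blast
      moreover have "i \<otimes> (r \<otimes> s) = (r \<otimes> i) \<otimes> s" using i(1) by (simp add: m_ac)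
      ultimately show False using i sT by simp
    qed
    moreover have "e \<otimes> (r \<otimes> s) \<in> R"
    proof -
      have "e \<otimes> (r \<otimes> s) = r \<otimes> a" unfolding a_def by (simp add: m_ac)
      then show ?thesis using a by simp
    qed
    moreover have "(r \<otimes> s) \<otimes> (r \<otimes> s) = (r \<otimes> q') \<otimes> (r \<otimes> s) \<ominus> r \<otimes> r \<otimes> p'"
    proof -
      have "(r \<otimes> s) \<otimes> (r \<otimes> s) \<ominus> ((r \<otimes> q') \<otimes> (r \<otimes> s) \<ominus> r \<otimes> r \<otimes> p') = r \<otimes> r \<otimes> (s \<otimes> s \<ominus> (q' \<otimes> s \<ominus> p'))"
        by (reify ring_reify, rule ring_identityI, simp, simp, code_simp)
      from eq_by_combination[OF s2 this] show ?thesis by simp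
    qed
    ultimately have "r \<otimes> q' \<ominus> \<one> \<in> M" using trace_one[OF e, of "r \<otimes> s" "r \<otimes> q'" "r \<otimes> r \<otimes> p'"] s by simp
    moreover have "r \<ominus> \<one> = (r \<otimes> q' \<ominus> \<one>) \<ominus> r \<otimes> (q' \<ominus> \<one>)"
      by (reify ring_reify, rule ring_identityI, simp, simp, code_simp)
    ultimately show ?thesis using q' by (metis M_minus M_mult2 r)
  qed
  have ee: "e \<ominus> e \<otimes> e \<in> Jac"
  proof -
    have "e \<ominus> e \<otimes> e = (\<one> \<ominus> q) \<otimes> e \<oplus> p" unfolding e2 by (reify ring_reify, rule ring_identityI, simp, simp, code_simp)
    then show ?thesis using e by simp
  qed
  have ss: "s \<ominus> s \<otimes> s \<in> Jac"
  proof -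
    have "p' \<in> M"
    proof (rule ccontr)
      assume p': "p' \<notin> M"
      have "p' \<otimes> e \<ominus> (q' \<otimes> a \<ominus> a \<otimes> s) = e \<otimes> (s \<otimes> s \<ominus> (q' \<otimes> s \<ominus> p'))" unfolding a_def
        by (reify ring_reify, rule ring_identityI, simp, simp, code_simp)
      from eq_by_combination[OF s2 this] have "p' \<otimes> e = q' \<otimes> a \<ominus> a \<otimes> s" using s by simp
      also have "\<dots> \<in> Jac" using s by simp
      finally have "e \<in> Jac" using Jac_unit_mult[of p' e] p' Sunit_R e by simp
      then have "Sunit (\<one> \<ominus> e \<otimes> \<one>)" by (rule JacD) simp
      then show False using e by simp
    qed
    moreover have "s \<ominus> s \<otimes> s = p' \<ominus> (q' \<ominus> \<one>) \<otimes> s" unfolding s2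
      by (reify ring_reify, rule ring_identityI, simp, simp, code_simp)
    ultimately show ?thesis using s q' by simp
  qed
  have sJ: "s \<notin> Jac" using not_in_Jac[OF e s sT] .
  define g where "g = \<one> \<ominus> e \<ominus> s"
  have [simp]: "g \<in> S" using e s by (simp add: g_def)
  then have [simp]: "g \<in> carrier F" by simp
  show False
  proof (cases "g \<in> Jac")
    case True
    define t where "t = \<ominus> g \<ominus> (q \<ominus> \<one>)"
    have q1: "q \<ominus> \<one> \<in> M"
    proof -
      have "q \<ominus> \<one> = \<ominus> (\<one> \<ominus> q)" by (reify ring_reify, rule ring_identityI, simp, simp, code_simp)
      then show ?thesis using qp(3) by (metis M_neg)
    qed
    have t: "t \<in> Jac" unfolding t_def using True q1 by simp
    have "e \<otimes> t \<ominus> (a \<ominus> p) = \<one> \<otimes> (e \<otimes> e \<ominus> (q \<otimes> e \<ominus> p))" unfolding t_def g_def a_def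
      by (reify ring_reify, rule ring_identityI, simp, simp, code_simp)
    from eq_by_combination[OF e2 this] have "e \<otimes> t = a \<ominus> p" using t by simp
    then have et: "e \<otimes> t \<in> R" using a by simp
    have "t \<notin> span2 \<one> e"
    proof
      assume "t \<in> span2 \<one> e"
      moreover have "q \<ominus> e \<in> span2 \<one> e" using T(5,7) RT[OF qp(1)] eT by (simp add: minus_eq)
      ultimately have "t \<oplus> (q \<ominus> e) \<in> span2 \<one> e" using T(7) by blast
      moreover have "s = t \<oplus> (q \<ominus> e)" unfolding t_def g_def
        by (reify ring_reify, rule ring_identityI, simp, simp, code_simp)
      ultimately show False using sT by simp
    qed
    then show False using not_in_Jac[OF e _ et] t by simp
  next
    case False
    have "\<one> \<ominus> e \<noteq> \<zero>"
    proof
      assume "\<one> \<ominus> e = \<zero>"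
      then have "\<one> = e" by (simp add: r_right_minus_eq)
      then show False using e(2) Sunit_one by simp
    qed
    moreover have "e \<oplus> s \<in> carrier F" "\<one> \<ominus> e \<in> carrier F" by simp_all
    ultimately obtain z \<sigma> \<tau> where z: "z \<in> span2 (e \<oplus> s) (\<one> \<ominus> e)" "\<sigma> \<in> S" "\<tau> \<in> S"
      "e \<oplus> s = z \<otimes> \<sigma>" "\<one> \<ominus> e = z \<otimes> \<tau>"
      using common_divisor[of "e \<oplus> s" "\<one> \<ominus> e"] by metis
    obtain \<alpha> \<beta> where ab[simp]: "\<alpha> \<in> R" "\<beta> \<in> R" and zab: "z = \<alpha> \<otimes> (e \<oplus> s) \<oplus> \<beta> \<otimes> (\<one> \<ominus> e)"
      using z(1) by (auto simp: span2_def)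
    have zS[simp]: "z \<in> S" using e s by (simp add: zab)
    have [simp]: "z \<in> carrier F" "\<sigma> \<in> carrier F" "\<tau> \<in> carrier F" using z by auto
    have 1: "\<one> \<ominus> (z \<otimes> \<sigma> \<otimes> (z \<otimes> \<sigma>) \<oplus> z \<otimes> \<tau> \<otimes> (z \<otimes> \<tau>) \<ominus> z \<otimes> \<sigma> \<otimes> (z \<otimes> \<tau>)) \<in> Jac"
    proof -
      have "\<one> \<ominus> ((e \<oplus> s) \<otimes> (e \<oplus> s) \<oplus> (\<one> \<ominus> e) \<otimes> (\<one> \<ominus> e) \<ominus> (e \<oplus> s) \<otimes> (\<one> \<ominus> e))
        = (e \<ominus> e \<otimes> e) \<oplus> (e \<ominus> e \<otimes> e) \<oplus> (e \<ominus> e \<otimes> e) \<oplus> (s \<ominus> s \<otimes> s) \<ominus> a \<ominus> a \<ominus> a"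
        unfolding a_def by (reify ring_reify, rule ring_identityI, simp, simp, code_simp)
      also have "\<dots> \<in> Jac" using ee ss a by simp
      finally show ?thesis unfolding z .
    qed
    have "z \<otimes> \<sigma> \<otimes> (z \<otimes> \<sigma>) \<oplus> z \<otimes> \<tau> \<otimes> (z \<otimes> \<tau>) \<ominus> z \<otimes> \<sigma> \<otimes> (z \<otimes> \<tau>)
      = z \<otimes> (\<sigma> \<otimes> (z \<otimes> \<sigma>) \<oplus> \<tau> \<otimes> (z \<otimes> \<tau>) \<ominus> \<sigma> \<otimes> (z \<otimes> \<tau>))"
      by (reify ring_reify, rule ring_identityI, simp, simp, code_simp)
    then have "Sunit (z \<otimes> (\<sigma> \<otimes> (z \<otimes> \<sigma>) \<oplus> \<tau> \<otimes> (z \<otimes> \<tau>) \<ominus> \<sigma> \<otimes> (z \<otimes> \<tau>)))"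
      using Sunit_cong_Jac[OF 1] z by simp
    then have zu: "Sunit z" using Sunit_mult z by simp
    have "\<alpha> \<notin> M"
    proof
      assume "\<alpha> \<in> M"
      then have "\<alpha> \<otimes> (e \<oplus> s) \<in> Jac" using e s by simp
      moreover have "z \<ominus> \<beta> \<otimes> (\<one> \<ominus> e) = \<alpha> \<otimes> (e \<oplus> s)" unfolding zab
        by (reify ring_reify, rule ring_identityI, simp, simp, code_simp)
      ultimately have "Sunit (\<beta> \<otimes> (\<one> \<ominus> e))" using Sunit_cong_Jac[OF _ _ _ zu] e by simp
      then show False using e Sunit_mult by simp
    qed
    have "\<beta> \<notin> M"
    proof
      assume "\<beta> \<in> M"
      then have "\<beta> \<otimes> (\<one> \<ominus> e) \<in> Jac" using e by simp
      moreover have "z \<ominus> \<alpha> \<otimes> (e \<oplus> s) = \<beta> \<otimes> (\<one> \<ominus> e)" unfolding zab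
        by (reify ring_reify, rule ring_identityI, simp, simp, code_simp)
      ultimately have "Sunit (\<alpha> \<otimes> (e \<oplus> s))" using Sunit_cong_Jac[OF _ _ _ zu] e s by simp
      then have u: "Sunit (e \<oplus> s)" using Sunit_mult e s by simp
      have "(e \<oplus> s) \<otimes> g = (e \<ominus> e \<otimes> e) \<oplus> (s \<ominus> s \<otimes> s) \<ominus> a \<ominus> a" unfolding g_def a_def
        by (reify ring_reify, rule ring_identityI, simp, simp, code_simp)
      also have "\<dots> \<in> Jac" using ee ss a by simp
      finally have "g \<in> Jac" by (rule Jac_unit_mult[OF _ u]) simp
      then show False using False by simp
    qed
    have two: "\<ominus> \<one> \<ominus> \<one> \<in> M"
    proof (rule F2)
      show "\<ominus> \<one> \<notin> M" using M_neg[of "\<ominus> \<one>"] by auto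
    qed simp
    define j where "j = (\<alpha> \<ominus> \<one>) \<otimes> (e \<oplus> s) \<oplus> (\<beta> \<ominus> \<one>) \<otimes> (\<one> \<ominus> e) \<ominus> (\<ominus> \<one> \<ominus> \<one>) \<otimes> s"
    have "j \<in> Jac" unfolding j_def using two F2[OF ab(1) \<open>\<alpha> \<notin> M\<close>] F2[OF ab(2) \<open>\<beta> \<notin> M\<close>] e s by simp
    moreover have "z \<ominus> (\<one> \<ominus> s) = j" unfolding zab j_def
      by (reify ring_reify, rule ring_identityI, simp, simp, code_simp)
    ultimately have "Sunit (\<one> \<ominus> s)" using Sunit_cong_Jac[OF _ _ _ zu, of "\<one> \<ominus> s"] s by simp
    moreover have "(\<one> \<ominus> s) \<otimes> s = s \<ominus> s \<otimes> s" by (reify ring_reify, rule ring_identityI, simp, simp, code_simp)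
    ultimately have "s \<in> Jac" using Jac_unit_mult[of "\<one> \<ominus> s" s] ss s by simp
    then show False using sJ by simp
  qed
qed

lemma idempotent_shift_case:
  assumes e: "e \<in> S" "\<not> Sunit e" "\<not> Sunit (\<one> \<ominus> e)"
    and s: "s \<in> S" and [simp]: "a \<in> R" "b \<in> R" and c[simp]: "c \<in> M" and es: "e \<otimes> s = a \<oplus> b \<otimes> e \<oplus> c \<otimes> s"
  shows "s \<in> span2 \<one> e"
proof -
  have [simp]: "e \<in> carrier F" "s \<in> carrier F" using e s by auto
  note T = subringE[OF span2_one_subring(1)[OF e(1)]]
  note RT = subsetD[OF span2_one_subring(2)[OF e(1)]]
  have eT: "e \<in> span2 \<one> e" using span2_gens[of \<one> e] by simp
  have "(e \<ominus> c) \<otimes> (s \<ominus> b) \<ominus> (a \<oplus> c \<otimes> b) = \<one> \<otimes> (e \<otimes> s \<ominus> (a \<oplus> b \<otimes> e \<oplus> c \<otimes> s))"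
    by (reify ring_reify, rule ring_identityI, simp, simp, code_simp)
  from eq_by_combination[OF es this] have R: "(e \<ominus> c) \<otimes> (s \<ominus> b) \<in> R" by simp
  have 1: "\<not> Sunit (e \<ominus> c)"
  proof
    assume "Sunit (e \<ominus> c)"
    moreover have "(e \<ominus> c) \<ominus> e = \<ominus> c" by (reify ring_reify, rule ring_identityI, simp, simp, code_simp)
    ultimately show False using Sunit_cong_Jac[of "e \<ominus> c" e] e by simp
  qed
  have 2: "\<not> Sunit (\<one> \<ominus> (e \<ominus> c))"
  proof
    assume "Sunit (\<one> \<ominus> (e \<ominus> c))"
    moreover have "(\<one> \<ominus> (e \<ominus> c)) \<ominus> (\<one> \<ominus> e) = c" by (reify ring_reify, rule ring_identityI, simp, simp, code_simp)
    ultimately show False using Sunit_cong_Jac[of "\<one> \<ominus> (e \<ominus> c)" "\<one> \<ominus> e"] e by simp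
  qed
  have "s \<ominus> b \<in> span2 \<one> (e \<ominus> c)" using split_product_case[OF _ 1 2 _ R] e s by simp
  moreover have "e \<ominus> c \<in> span2 \<one> e" using T(5,7) eT RT[of c] by (simp add: minus_eq)
  ultimately have "s \<ominus> b \<in> span2 \<one> e" using span2_one_subset[OF e(1)] by blast
  then have "(s \<ominus> b) \<oplus> b \<in> span2 \<one> e" using T(7) RT[of b] by simp
  moreover have "(s \<ominus> b) \<oplus> b = s" by (reify ring_reify, rule ring_identityI, simp, simp, code_simp)
  ultimately show ?thesis by simp
qed

lemma unit_multiple_in_span:
  assumes e: "e \<in> S" and s: "s \<in> S" and [simp]: "a \<in> R" "b \<in> R" "c \<in> R" and u: "Sunit (e \<ominus> c)"
    and es: "e \<otimes> s = a \<oplus> b \<otimes> e \<oplus> c \<otimes> s"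
  shows "s \<in> span2 \<one> e"
proof -
  have [simp]: "e \<in> carrier F" "s \<in> carrier F" using e s by auto
  note T = subringE[OF span2_one_subring(1)[OF e]]
  note RT = subsetD[OF span2_one_subring(2)[OF e]]
  have eT: "e \<in> span2 \<one> e" using span2_gens[of \<one> e] by simp
  have ec: "e \<ominus> c \<in> span2 \<one> e" using T(5,7) eT RT[of c] by (simp add: minus_eq)
  obtain t where t: "t \<in> span2 \<one> (e \<ominus> c)" "(e \<ominus> c) \<otimes> t = \<one>" using Sunit_inverse[OF u] by metis
  have tT: "t \<in> span2 \<one> e" using t(1) span2_one_subset[OF e ec] by blast
  then have [simp]: "t \<in> carrier F" using T(1) by blast
  have "s \<ominus> t \<otimes> (a \<oplus> b \<otimes> e) = (\<ominus> s) \<otimes> ((e \<ominus> c) \<otimes> t \<ominus> \<one>) \<oplus> t \<otimes> (e \<otimes> s \<ominus> (a \<oplus> b \<otimes> e \<oplus> c \<otimes> s))"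
    by (reify ring_reify, rule ring_identityI, simp, simp, code_simp)
  from eq_by_combination2[OF t(2) es this] have "s = t \<otimes> (a \<oplus> b \<otimes> e)" by simp
  also have "\<dots> \<in> span2 \<one> e" by (intro T(6,7) tT eT RT) auto
  finally show ?thesis .
qed

lemma not_quasilocal_imp_finite:
  assumes e: "e \<in> S" "\<not> Sunit e" "\<not> Sunit (\<one> \<ominus> e)"
  shows "S = span2 \<one> e"
proof (intro equalityI subsetI)
  have [simp]: "e \<in> carrier F" using e by auto
  note T = subringE[OF span2_one_subring(1)[OF e(1)]]
  note RT = subsetD[OF span2_one_subring(2)[OF e(1)]]
  have eT: "e \<in> span2 \<one> e" using span2_gens[of \<one> e] by simp
  show "s \<in> S" if "s \<in> span2 \<one> e" for s using that e by (auto simp: span2_def)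
  fix s assume s: "s \<in> S"
  then have [simp]: "s \<in> carrier F" by simp
  obtain q p where qp[simp]: "q \<in> R" "p \<in> M" "\<one> \<ominus> q \<in> M" and e2: "e \<otimes> e = q \<otimes> e \<ominus> p"
    using idempotent_quadratic[OF e] by metis
  obtain a b c where [simp]: "a \<in> R" "b \<in> R" "c \<in> R" and es: "e \<otimes> s = a \<oplus> b \<otimes> e \<oplus> c \<otimes> s"
    using integral_product[OF e(1) s] by metis
  consider "c \<in> M" | "\<one> \<ominus> c \<in> M" | "c \<notin> M" "\<one> \<ominus> c \<notin> M" by blast
  then show "s \<in> span2 \<one> e"
  proof cases
    case 1
    then show ?thesis using idempotent_shift_case[OF e s _ _ _ es] by simp
  next
    case 2
    have "(\<one> \<ominus> e) \<otimes> s \<ominus> (\<ominus> (a \<oplus> b) \<oplus> b \<otimes> (\<one> \<ominus> e) \<oplus> (\<one> \<ominus> c) \<otimes> s)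
       = (\<ominus> \<one>) \<otimes> (e \<otimes> s \<ominus> (a \<oplus> b \<otimes> e \<oplus> c \<otimes> s))"
      by (reify ring_reify, rule ring_identityI, simp, simp, code_simp)
    from eq_by_combination[OF es this]
    have eq: "(\<one> \<ominus> e) \<otimes> s = \<ominus> (a \<oplus> b) \<oplus> b \<otimes> (\<one> \<ominus> e) \<oplus> (\<one> \<ominus> c) \<otimes> s" by simp
    have "\<one> \<ominus> (\<one> \<ominus> e) = e" by (reify ring_reify, rule ring_identityI, simp, simp, code_simp)
    then have "s \<in> span2 \<one> (\<one> \<ominus> e)" using idempotent_shift_case[OF _ e(3) _ s _ _ 2 eq] e by simp
    moreover have "\<one> \<ominus> e \<in> span2 \<one> e" using T(3,5,7) eT by (simp add: minus_eq)
    ultimately show ?thesis using span2_one_subset[OF e(1)] by blast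
  next
    case 3
    define n where "n = p \<oplus> (\<one> \<ominus> q) \<otimes> c \<ominus> c \<otimes> (\<one> \<ominus> c)"
    have "c \<otimes> (\<one> \<ominus> c) \<notin> M" using 3 Sunit_R Sunit_mult[of c "\<one> \<ominus> c"] by simp
    have n: "n \<notin> M"
    proof
      assume "n \<in> M"
      then have "p \<oplus> (\<one> \<ominus> q) \<otimes> c \<ominus> n \<in> M" by simp
      moreover have "p \<oplus> (\<one> \<ominus> q) \<otimes> c \<ominus> n = c \<otimes> (\<one> \<ominus> c)" unfolding n_def
        by (reify ring_reify, rule ring_identityI, simp, simp, code_simp)
      ultimately show False using \<open>c \<otimes> (\<one> \<ominus> c) \<notin> M\<close> by simp
    qed
    have "(e \<ominus> c) \<otimes> (e \<ominus> c) \<ominus> ((q \<ominus> (c \<oplus> c)) \<otimes> (e \<ominus> c) \<ominus> n) = \<one> \<otimes> (e \<otimes> e \<ominus> (q \<otimes> e \<ominus> p))"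
      unfolding n_def by (reify ring_reify, rule ring_identityI, simp, simp, code_simp)
    from eq_by_combination[OF e2 this]
    have "(e \<ominus> c) \<otimes> (e \<ominus> c) = (q \<ominus> (c \<oplus> c)) \<otimes> (e \<ominus> c) \<ominus> n" by (simp add: n_def)
    then have "Sunit (e \<ominus> c)" using quadratic_Sunit[of "e \<ominus> c" "q \<ominus> (c \<oplus> c)" n] n e by (simp add: n_def)
    then show ?thesis using unit_multiple_in_span[OF e(1) s _ _ _ _ es] by simp
  qed
qed

end

context fraction_field
begin

definition sdvd :: "'a \<Rightarrow> 'a \<Rightarrow> bool" where
  "sdvd y x \<longleftrightarrow> (\<exists>s\<in>S. x = y \<otimes> s)"

lemma sdvdI: "s \<in> S \<Longrightarrow> x = y \<otimes> s \<Longrightarrow> sdvd y x"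
  by (auto simp: sdvd_def)

lemma sdvdE:
  assumes "sdvd y x" obtains s where "s \<in> S" "x = y \<otimes> s"
  using assms by (auto simp: sdvd_def)

end

locale infinite_stable_local_ring = stable_local_ring +
  assumes dimension_one: "r \<in> R \<Longrightarrow> r \<noteq> \<zero> \<Longrightarrow> m \<in> M \<Longrightarrow> \<exists>k::nat. \<exists>s\<in>R. m [^] k = r \<otimes> s"
    and not_finite: "e \<in> S \<Longrightarrow> S \<noteq> span2 \<one> e"
begin

lemma S_local: "s \<in> S \<Longrightarrow> Sunit s \<or> Sunit (\<one> \<ominus> s)"
  using not_quasilocal_imp_finite not_finite by blast

lemma valuation:
  assumes x: "x \<in> carrier F" "x \<noteq> \<zero>" and xS: "x \<notin> S"
  obtains y where "y \<in> S" "x \<otimes> y = \<one>"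
proof -
  obtain z \<sigma> \<tau> where z: "z \<in> span2 \<one> x" "\<sigma> \<in> S" "\<tau> \<in> S" "\<one> = z \<otimes> \<sigma>" "x = z \<otimes> \<tau>"
    using common_divisor[OF one_closed x(1)] one_not_zero by metis
  obtain \<alpha> \<beta> where ab[simp]: "\<alpha> \<in> R" "\<beta> \<in> R" and zab: "z = \<alpha> \<otimes> \<one> \<oplus> \<beta> \<otimes> x"
    using z(1) by (auto simp: span2_def)
  note [simp] = x(1)
  have [simp]: "z \<in> carrier F" by (simp add: zab)
  have [simp]: "\<sigma> \<in> carrier F" "\<tau> \<in> carrier F" using z by auto
  have "\<one> \<ominus> \<alpha> \<otimes> \<sigma> \<ominus> \<beta> \<otimes> \<tau> = (\<one> \<ominus> \<beta> \<otimes> \<tau>) \<otimes> (\<one> \<ominus> z \<otimes> \<sigma>) \<oplus> \<beta> \<otimes> \<sigma> \<otimes> (x \<ominus> z \<otimes> \<tau>) \<oplus> \<sigma> \<otimes> (z \<ominus> (\<alpha> \<otimes> \<one> \<oplus> \<beta> \<otimes> x))"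
    by (reify ring_reify, rule ring_identityI, simp, simp, code_simp)
  also have "z \<ominus> (\<alpha> \<otimes> \<one> \<oplus> \<beta> \<otimes> x) = \<zero>" unfolding zab by (simp add: minus_self)
  finally have "\<one> \<ominus> \<alpha> \<otimes> \<sigma> \<ominus> \<beta> \<otimes> \<tau> = (\<one> \<ominus> \<beta> \<otimes> \<tau>) \<otimes> (\<one> \<ominus> z \<otimes> \<sigma>) \<oplus> \<beta> \<otimes> \<sigma> \<otimes> (x \<ominus> z \<otimes> \<tau>)" by simp
  from eq_by_combination2[OF z(4,5) this] have 1: "\<one> \<ominus> \<alpha> \<otimes> \<sigma> = \<beta> \<otimes> \<tau>" by simp
  have "Sunit (\<alpha> \<otimes> \<sigma>) \<or> Sunit (\<beta> \<otimes> \<tau>)" using S_local[of "\<alpha> \<otimes> \<sigma>"] z unfolding 1 by simp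
  then have "Sunit \<sigma> \<or> Sunit \<tau>" using Sunit_mult z by auto
  then show ?thesis
  proof
    assume "Sunit \<sigma>"
    then obtain \<rho> where \<rho>: "\<rho> \<in> S" "\<sigma> \<otimes> \<rho> = \<one>" by (elim SunitE)
    have "z = z \<otimes> (\<sigma> \<otimes> \<rho>)" using \<rho> by simp
    also have "\<dots> = \<rho>" using z(4)[symmetric] \<rho>(1) by (simp flip: m_assoc)
    finally have "x \<in> S" using z \<rho> by simp
    then show ?thesis using xS by simp
  next
    assume "Sunit \<tau>"
    then obtain \<rho> where \<rho>: "\<rho> \<in> S" "\<tau> \<otimes> \<rho> = \<one>" by (elim SunitE)
    have "x \<otimes> (\<sigma> \<otimes> \<rho>) = (z \<otimes> \<sigma>) \<otimes> (\<tau> \<otimes> \<rho>)" unfolding z(5) using \<rho>(1) by (simp add: m_ac)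
    then have "x \<otimes> (\<sigma> \<otimes> \<rho>) = \<one>" using z(4)[symmetric] \<rho> by simp
    then show ?thesis using that[of "\<sigma> \<otimes> \<rho>"] z \<rho> by simp
  qed
qed

lemma sdvd_total:
  assumes x: "x \<in> carrier F" and y: "y \<in> carrier F" shows "sdvd x y \<or> sdvd y x"
proof (cases "y = \<zero>")
  case True
  then show ?thesis using x by (intro disjI1 sdvdI[of \<zero>]) auto
next
  case False
  then obtain i where i: "i \<in> carrier F" "y \<otimes> i = \<one>" using inverse_exists[OF y] by metis
  show ?thesis
  proof (cases "x \<otimes> i \<in> S")
    case True
    have "y \<otimes> (x \<otimes> i) = x \<otimes> (y \<otimes> i)" using i(1) x y by (simp add: m_ac)
    then show ?thesis using True i x by (intro disjI2 sdvdI[of "x \<otimes> i"]) auto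
  next
    case nS: False
    then have "x \<otimes> i \<noteq> \<zero>" by auto
    then obtain w where w: "w \<in> S" "x \<otimes> i \<otimes> w = \<one>" using valuation[of "x \<otimes> i"] nS x i by auto
    have "x \<otimes> w = x \<otimes> w \<otimes> (y \<otimes> i)" using i x w by simp
    also have "\<dots> = y \<otimes> (x \<otimes> i \<otimes> w)" using i(1) x y w(1) by (simp add: m_ac)
    finally show ?thesis using w y by (intro disjI1 sdvdI[of w]) auto
  qed
qed

lemma nonunit_mult: "x \<in> S \<Longrightarrow> y \<in> S \<Longrightarrow> \<not> Sunit x \<Longrightarrow> \<not> Sunit (x \<otimes> y)"
  using Sunit_mult by simp

lemma nonunit_add:
  assumes x: "x \<in> S" "\<not> Sunit x" and y: "y \<in> S" "\<not> Sunit y" shows "\<not> Sunit (x \<oplus> y)"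
proof -
  have *: "\<not> Sunit (x \<oplus> y)" if x: "x \<in> S" "\<not> Sunit x" and y: "y \<in> S" and d: "sdvd x y" for x y
  proof -
    obtain s where s: "s \<in> S" "y = x \<otimes> s" using d by (elim sdvdE)
    have "x \<oplus> y = x \<otimes> (\<one> \<oplus> s)" using s x by (simp add: r_distr)
    then show ?thesis using nonunit_mult[of x "\<one> \<oplus> s"] x s by simp
  qed
  show ?thesis using sdvd_total[of x y] *[OF x y(1)] *[OF y x(1)] x y by (auto simp: a_comm)
qed

lemma nonunit_minus:
  assumes x: "x \<in> S" "\<not> Sunit x" and y: "y \<in> S" "\<not> Sunit y" shows "\<not> Sunit (x \<ominus> y)"
proof -
  have "\<not> Sunit (y \<otimes> (\<ominus> \<one>))" using nonunit_mult y by simp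
  then have "\<not> Sunit (\<ominus> y)" using y by (simp add: r_minus)
  then show ?thesis using nonunit_add[OF x, of "\<ominus> y"] y by (simp add: minus_eq)
qed

lemma nonunit_square:
  assumes y: "y \<in> S" "\<not> Sunit y"
  obtains m s where "m \<in> M" "s \<in> S" "y \<otimes> y = m \<otimes> s"
proof -
  obtain q p where qp[simp]: "q \<in> R" "p \<in> R" and y2: "y \<otimes> y = q \<otimes> y \<ominus> p" using integral_quadratic'[OF y(1)] by metis
  have p: "p \<in> M" using quadratic_Sunit[OF y(1) qp _ y2] y by blast
  have [simp]: "y \<in> carrier F" using y by simp
  show ?thesis
  proof (cases "q \<in> M")
    case True
    have "sdvd q p \<or> sdvd p q" using sdvd_total by simp
    then show ?thesis
    proof
      assume "sdvd q p"
      then obtain s where s: "s \<in> S" "p = q \<otimes> s" by (elim sdvdE)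
      then have "y \<otimes> y = q \<otimes> (y \<ominus> s)" unfolding y2 using y by (simp add: minus_eq r_distr r_minus)
      then show ?thesis using that[OF True, of "y \<ominus> s"] s y by simp
    next
      assume "sdvd p q"
      then obtain s where s: "s \<in> S" "q = p \<otimes> s" by (elim sdvdE)
      then have "y \<otimes> y = p \<otimes> (s \<otimes> y \<ominus> \<one>)" unfolding y2 using y p by (simp add: minus_eq r_distr r_minus m_assoc)
      then show ?thesis using that[OF p, of "s \<otimes> y \<ominus> \<one>"] s y by simp
    qed
  next
    case False
    have "Sunit (q \<ominus> y)"
    proof (rule ccontr)
      assume "\<not> Sunit (q \<ominus> y)"
      then have "\<not> Sunit ((q \<ominus> y) \<oplus> y)" using nonunit_add y by simp
      moreover have "(q \<ominus> y) \<oplus> y = q" by (reify ring_reify, rule ring_identityI, simp, simp, code_simp)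
      ultimately show False using False Sunit_R by simp
    qed
    then obtain t where t: "t \<in> S" "(q \<ominus> y) \<otimes> t = \<one>" by (elim SunitE)
    have [simp]: "t \<in> carrier F" using t by simp
    have "y \<otimes> y \<ominus> p \<otimes> (t \<otimes> y) = (\<ominus> (y \<otimes> y)) \<otimes> ((q \<ominus> y) \<otimes> t \<ominus> \<one>) \<oplus> (\<ominus> (t \<otimes> y)) \<otimes> (y \<otimes> y \<ominus> (q \<otimes> y \<ominus> p))"
      by (reify ring_reify, rule ring_identityI, simp, simp, code_simp)
    from eq_by_combination2[OF t(2) y2 this] have "y \<otimes> y = p \<otimes> (t \<otimes> y)" by simp
    then show ?thesis using that[OF p, of "t \<otimes> y"] t y by simp
  qed
qed

lemma endomorphism_M_integral: "mult_ring M \<subseteq> S"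
proof
  fix e assume e: "e \<in> mult_ring M"
  then have [simp]: "e \<in> carrier F" and eM: "\<And>m. m \<in> M \<Longrightarrow> e \<otimes> m \<in> M" by (auto simp: mult_ring_def)
  show "e \<in> S"
  proof (rule ccontr)
    assume n: "e \<notin> S"
    then have "e \<noteq> \<zero>" by auto
    then obtain y where y: "y \<in> S" "e \<otimes> y = \<one>" using valuation[of e] n by auto
    have [simp]: "y \<in> carrier F" using y by simp
    have "\<not> Sunit y"
    proof
      assume "Sunit y"
      then obtain t where t: "t \<in> S" "y \<otimes> t = \<one>" by (elim SunitE)
      have "e = e \<otimes> (y \<otimes> t)" using t by simp
      also have "\<dots> = t" using y(2) t(1) by (simp flip: m_assoc)
      finally show False using n t by simp
    qed
    then obtain m s where ms: "m \<in> M" "s \<in> S" "y \<otimes> y = m \<otimes> s" using nonunit_square[OF y(1)] by metis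
    have "e \<otimes> (e \<otimes> m) \<otimes> s = e \<otimes> e \<otimes> (m \<otimes> s)" using ms(1,2) by (simp add: m_ac)
    also have "\<dots> = (e \<otimes> y) \<otimes> (e \<otimes> y)" unfolding ms(3)[symmetric] by (simp add: m_ac)
    finally have "e \<otimes> (e \<otimes> m) \<otimes> s = \<one>" using y by simp
    moreover have em: "e \<otimes> (e \<otimes> m) \<in> M" using eM ms by simp
    ultimately have "Sunit (e \<otimes> (e \<otimes> m))" using SunitI[of "e \<otimes> (e \<otimes> m)" s] ms by simp
    then show False using Sunit_R em by simp
  qed
qed

lemma M_nonzero: "\<exists>m\<in>M. m \<noteq> \<zero>"
proof (rule ccontr)
  assume n: "\<not> ?thesis"
  have "s \<in> R" if s: "s \<in> S" for s
  proof -
    obtain a b where ab: "a \<in> R" "b \<in> R" "b \<noteq> \<zero>" "s \<otimes> b = a" using fraction[of s] s by auto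
    then obtain i where i: "i \<in> R" "b \<otimes> i = \<one>" using unit_R[of b] n by blast
    have "s = s \<otimes> (b \<otimes> i)" using i s by simp
    also have "\<dots> = a \<otimes> i" using ab s i(1) by (simp flip: m_assoc)
    finally show ?thesis using ab i by simp
  qed
  then have "S \<subseteq> span2 \<one> \<one>" using span2_one_subring(2)[of \<one>] by auto
  moreover have "span2 \<one> \<one> \<subseteq> S" by (auto simp: span2_def)
  ultimately show False using not_finite[of \<one>] by simp
qed

lemma M_extends_to_principal:
  obtains x where "x \<in> M" "x \<noteq> \<zero>" "\<And>m. m \<in> M \<Longrightarrow> sdvd x m"
proof -
  define G where "G = {\<gamma> \<in> carrier F. \<exists>x\<in>M. \<forall>m\<in>M. sdvd x (\<gamma> \<otimes> m)}"
  have G: "rmod G"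
    unfolding rmod_def
  proof (intro conjI ballI)
    show "G \<subseteq> carrier F" by (auto simp: G_def)
    have "sdvd \<zero> (\<zero> \<otimes> m)" if "m \<in> M" for m using that by (intro sdvdI[of \<zero>]) auto
    then show "\<zero> \<in> G" unfolding G_def by blast
    show "\<gamma> \<oplus> \<gamma>' \<in> G" if \<gamma>: "\<gamma> \<in> G" "\<gamma>' \<in> G" for \<gamma> \<gamma>'
    proof -
      have *: "\<gamma> \<oplus> \<gamma>' \<in> G" if c: "\<gamma> \<in> carrier F" "\<gamma>' \<in> carrier F" and x: "x \<in> M" "x' \<in> M" "sdvd x x'"
        and d: "\<forall>m\<in>M. sdvd x (\<gamma> \<otimes> m)" "\<forall>m\<in>M. sdvd x' (\<gamma>' \<otimes> m)" for \<gamma> \<gamma>' x x'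
      proof -
        obtain s where s: "s \<in> S" "x' = x \<otimes> s" using x(3) by (elim sdvdE)
        have "sdvd x ((\<gamma> \<oplus> \<gamma>') \<otimes> m)" if m: "m \<in> M" for m
        proof -
          obtain u where u: "u \<in> S" "\<gamma> \<otimes> m = x \<otimes> u" using d(1) m by (auto elim: sdvdE)
          obtain u' where u': "u' \<in> S" "\<gamma>' \<otimes> m = x' \<otimes> u'" using d(2) m by (auto elim: sdvdE)
          have "(\<gamma> \<oplus> \<gamma>') \<otimes> m = x \<otimes> u \<oplus> x \<otimes> s \<otimes> u'" using u u' s c m by (simp add: l_distr)
          also have "\<dots> = x \<otimes> (u \<oplus> s \<otimes> u')" using u(1) u'(1) s(1) x(1) by (simp add: r_distr m_assoc)
          finally show ?thesis using u u' s by (intro sdvdI[of "u \<oplus> s \<otimes> u'"]) auto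
        qed
        then show ?thesis using c x unfolding G_def by blast
      qed
      obtain x x' where "\<gamma> \<in> carrier F" "\<gamma>' \<in> carrier F" "x \<in> M" "x' \<in> M"
        "\<forall>m\<in>M. sdvd x (\<gamma> \<otimes> m)" "\<forall>m\<in>M. sdvd x' (\<gamma>' \<otimes> m)" using \<gamma> unfolding G_def by blast
      then show ?thesis using *[of \<gamma> \<gamma>' x x'] *[of \<gamma>' \<gamma> x' x] sdvd_total[of x x'] by (auto simp: a_comm)
    qed
    show "r \<otimes> \<gamma> \<in> G" if r: "r \<in> R" and \<gamma>: "\<gamma> \<in> G" for r \<gamma>
    proof -
      obtain x where x: "\<gamma> \<in> carrier F" "x \<in> M" "\<forall>m\<in>M. sdvd x (\<gamma> \<otimes> m)" using \<gamma> unfolding G_def by blast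
      have "sdvd x (r \<otimes> \<gamma> \<otimes> m)" if m: "m \<in> M" for m
      proof -
        obtain u where u: "u \<in> S" "\<gamma> \<otimes> m = x \<otimes> u" using x(3) m by (auto elim: sdvdE)
        have "r \<otimes> \<gamma> \<otimes> m = r \<otimes> (\<gamma> \<otimes> m)" using r x(1) m by (simp add: m_assoc)
        also have "\<dots> = x \<otimes> (r \<otimes> u)" unfolding u(2) using r x(2) u(1) by (simp add: m_ac)
        finally show ?thesis using u r by (intro sdvdI[of "r \<otimes> u"]) auto
      qed
      then show ?thesis using x r unfolding G_def by auto
    qed
  qed
  obtain j where j: "j \<in> M" "j \<noteq> \<zero>" using M_nonzero by blast
  have "x \<otimes> y \<in> G" if x: "x \<in> M" and y: "y \<in> Inv M" for x y
  proof -
    have y': "y \<in> carrier F" using y by (simp add: Inv_def)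
    have "sdvd x (x \<otimes> y \<otimes> m)" if m: "m \<in> M" for m
    proof -
      have "y \<otimes> m \<in> S" using Inv_mult[OF M_eq y m] endomorphism_M_integral by blast
      then show ?thesis using x m y' by (intro sdvdI[of "y \<otimes> m"]) (auto simp: m_assoc)
    qed
    then show ?thesis using x y' unfolding G_def by auto
  qed
  then have "\<one> \<in> G" using invertible[OF M_eq j, of \<one> G] G by auto
  then obtain x where x: "x \<in> M" "\<forall>m\<in>M. sdvd x (\<one> \<otimes> m)" unfolding G_def by blast
  then have d: "sdvd x m" if "m \<in> M" for m using that by auto
  have "x \<noteq> \<zero>" using d[OF j(1)] j(2) by (auto elim!: sdvdE)
  then show ?thesis using that x d by blast
qed

end

context infinite_stable_local_ring
begin

lemma sdvd_trans:
  assumes "sdvd x y" "sdvd y z" "x \<in> carrier F" shows "sdvd x z"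
proof -
  obtain s where s: "s \<in> S" "y = x \<otimes> s" using assms(1) by (elim sdvdE)
  obtain t where t: "t \<in> S" "z = y \<otimes> t" using assms(2) by (elim sdvdE)
  have "z = x \<otimes> (s \<otimes> t)" using s t assms(3) by (simp add: m_assoc)
  then show ?thesis using s t by (intro sdvdI[of "s \<otimes> t"]) auto
qed

lemma square_zero_mod_M:
  assumes x: "x \<in> M" "\<forall>m\<in>M. sdvd x m"
    and y: "y \<in> S" "\<not> Sunit y" "y' \<in> S" "\<not> Sunit y'"
  shows "sdvd x (y \<otimes> y')"
proof -
  have *: "sdvd x (y \<otimes> y')" if y: "y \<in> S" "\<not> Sunit y" "y' \<in> S" "sdvd y y'" for y y'
  proof -
    obtain s where s: "s \<in> S" "y' = y \<otimes> s" using y by (elim sdvdE)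
    obtain m u where m: "m \<in> M" "u \<in> S" "y \<otimes> y = m \<otimes> u" using nonunit_square[OF y(1,2)] by metis
    have "y \<otimes> y' = (y \<otimes> y) \<otimes> s" unfolding s using s(1) y(1) by (simp add: m_assoc)
    also have "\<dots> = m \<otimes> (u \<otimes> s)" unfolding m(3) using m(1,2) s(1) by (simp add: m_assoc)
    finally have "sdvd m (y \<otimes> y')" using m s by (intro sdvdI[of "u \<otimes> s"]) auto
    then show ?thesis using sdvd_trans[OF bspec[OF x(2) m(1)]] x by simp
  qed
  have "y' \<otimes> y = y \<otimes> y'" using y by (simp add: m_comm)
  then show ?thesis using *[OF y(1-3)] *[OF y(3,4,1)] sdvd_total[of y y'] y by auto
qed

lemma uniformizer_of_not_dvd:
  assumes x: "x \<in> M" "\<forall>m\<in>M. sdvd x m"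
    and y: "y \<in> S" "\<not> Sunit y" "\<not> sdvd x y" and y': "y' \<in> S" "\<not> Sunit y'"
  shows "sdvd y y'"
proof (rule ccontr)
  assume n: "\<not> ?thesis"
  then obtain \<tau> where \<tau>: "\<tau> \<in> S" "y = y' \<otimes> \<tau>" using sdvd_total[of y y'] y y' by (auto elim: sdvdE)
  have "\<not> Sunit \<tau>"
  proof
    assume "Sunit \<tau>"
    then obtain \<rho> where \<rho>: "\<rho> \<in> S" "\<tau> \<otimes> \<rho> = \<one>" by (elim SunitE)
    have "y' = y' \<otimes> (\<tau> \<otimes> \<rho>)" using \<rho> y' by simp
    also have "\<dots> = y \<otimes> \<rho>" unfolding \<tau>(2) using \<tau>(1) \<rho>(1) y'(1) by (simp add: m_assoc)
    finally show False using n \<rho> by (auto intro: sdvdI)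
  qed
  then show False using square_zero_mod_M[OF x y' \<tau>(1)] \<tau>(2) y(3) by simp
qed

lemma x_divisible:
  assumes x: "x \<in> M" "x \<noteq> \<zero>" "\<And>m. m \<in> M \<Longrightarrow> sdvd x m" and s: "s \<in> S"
  shows "\<exists>a\<in>R. \<exists>s'\<in>S. s = a \<oplus> x \<otimes> s'"
proof (rule ccontr)
  have x': "x \<in> M" "\<forall>m\<in>M. sdvd x m" using x by blast+
  assume n: "\<not> ?thesis"
  define e where "e = s"
  have e: "e \<in> S" using s by (simp add: e_def)
  have ne: "\<not> sdvd x (e \<ominus> c)" if c: "c \<in> R" for c
  proof
    assume "sdvd x (e \<ominus> c)"
    then obtain u where u: "u \<in> S" "e \<ominus> c = x \<otimes> u" by (elim sdvdE)
    have [simp]: "e \<in> carrier F" "c \<in> carrier F" using e c by auto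
    have "e = c \<oplus> (e \<ominus> c)" by (reify ring_reify, rule ring_identityI, simp, simp, code_simp)
    then have "e = c \<oplus> x \<otimes> u" unfolding u(2) .
    then show False using n c u unfolding e_def by blast
  qed
  have [simp]: "e \<in> carrier F" using e by simp
  note T = subringE[OF span2_one_subring(1)[OF e]]
  note RT = subsetD[OF span2_one_subring(2)[OF e]]
  have eT: "e \<in> span2 \<one> e" using span2_gens[of \<one> e] by simp
  have xS: "x \<otimes> s \<in> span2 \<one> e" if s: "s \<in> S" for s
  proof -
    have [simp]: "s \<in> carrier F" using s by simp
    obtain a b c where [simp]: "a \<in> R" "b \<in> R" "c \<in> R" and es: "e \<otimes> s = a \<oplus> b \<otimes> e \<oplus> c \<otimes> s"
      using integral_product[OF e s] by metis
    define d where "d = e \<ominus> c"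
    have [simp]: "d \<in> carrier F" by (simp add: d_def)
    have "d \<otimes> s \<ominus> (a \<oplus> b \<otimes> e) = \<one> \<otimes> (e \<otimes> s \<ominus> (a \<oplus> b \<otimes> e \<oplus> c \<otimes> s))" unfolding d_def
      by (reify ring_reify, rule ring_identityI, simp, simp, code_simp)
    from eq_by_combination[OF es this] have ds: "d \<otimes> s = a \<oplus> b \<otimes> e" by simp
    obtain \<sigma> where \<sigma>: "\<sigma> \<in> S" "x = d \<otimes> \<sigma>" using ne[of c] sdvd_total[of x d] x unfolding d_def by (auto elim: sdvdE)
    obtain a' b' c' where [simp]: "a' \<in> R" "b' \<in> R" "c' \<in> R" and ss: "\<sigma> \<otimes> s = a' \<oplus> b' \<otimes> \<sigma> \<oplus> c' \<otimes> s"
      using integral_product[OF \<sigma>(1) s] by metis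
    have [simp]: "\<sigma> \<in> carrier F" using \<sigma> by simp
    have "x \<otimes> s = d \<otimes> (\<sigma> \<otimes> s)" unfolding \<sigma>(2) by (simp add: m_assoc)
    also have "\<dots> = a' \<otimes> d \<oplus> b' \<otimes> (d \<otimes> \<sigma>) \<oplus> c' \<otimes> (d \<otimes> s)" unfolding ss
      by (reify ring_reify, rule ring_identityI, simp, simp, code_simp)
    also have "\<dots> = a' \<otimes> d \<oplus> b' \<otimes> x \<oplus> c' \<otimes> (a \<oplus> b \<otimes> e)" using ds \<sigma>(2) by simp
    also have "\<dots> \<in> span2 \<one> e" unfolding d_def minus_eq by (intro T(5-7) eT RT) (use x in auto)
    finally show ?thesis .
  qed
  have "S \<subseteq> span2 \<one> e"
  proof (cases "\<forall>c\<in>R. Sunit (e \<ominus> c)")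
    case True
    show ?thesis
    proof
      fix s assume s: "s \<in> S"
      obtain a b c where abc: "a \<in> R" "b \<in> R" "c \<in> R" and es: "e \<otimes> s = a \<oplus> b \<otimes> e \<oplus> c \<otimes> s"
        using integral_product[OF e s] by metis
      then show "s \<in> span2 \<one> e" using unit_multiple_in_span[OF e s abc _ es] True by blast
    qed
  next
    case False
    then obtain c0 where c0: "c0 \<in> R" "\<not> Sunit (e \<ominus> c0)" by blast
    define f where "f = e \<ominus> c0"
    have f: "f \<in> S" "\<not> Sunit f" "\<not> sdvd x f" using c0 ne e by (auto simp: f_def)
    have fT: "f \<in> span2 \<one> e" unfolding f_def minus_eq by (intro T(5,7) eT RT) (use c0 in auto)
    have [simp]: "f \<in> carrier F" using f by simp
    note unif = uniformizer_of_not_dvd[OF x' f]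
    have decomp: "\<exists>r\<in>R. \<exists>s'\<in>S. s = r \<oplus> f \<otimes> s'" if s: "s \<in> S" for s
    proof -
      have [simp]: "s \<in> carrier F" using s by simp
      obtain a b c where abc[simp]: "a \<in> R" "b \<in> R" "c \<in> R" and fs: "f \<otimes> s = a \<oplus> b \<otimes> f \<oplus> c \<otimes> s"
        using integral_product[OF f(1) s] by metis
      show ?thesis
      proof (cases "c \<in> M")
        case False
        then obtain i where i[simp]: "i \<in> R" "c \<otimes> i = \<one>" using unit_R[OF abc(3)] by blast
        have "s \<ominus> (\<ominus> (i \<otimes> a) \<oplus> f \<otimes> (i \<otimes> s \<ominus> i \<otimes> b)) = (\<ominus> s) \<otimes> (c \<otimes> i \<ominus> \<one>) \<oplus> (\<ominus> i) \<otimes> (f \<otimes> s \<ominus> (a \<oplus> b \<otimes> f \<oplus> c \<otimes> s))"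
          by (reify ring_reify, rule ring_identityI, simp, simp, code_simp)
        from eq_by_combination2[OF i(2) fs this] have "s = \<ominus> (i \<otimes> a) \<oplus> f \<otimes> (i \<otimes> s \<ominus> i \<otimes> b)" by simp
        moreover have "\<ominus> (i \<otimes> a) \<in> R" "i \<otimes> s \<ominus> i \<otimes> b \<in> S" using s by auto
        ultimately show ?thesis by blast
      next
        case True
        have "a \<ominus> (f \<otimes> (s \<ominus> b) \<ominus> c \<otimes> s) = (\<ominus> \<one>) \<otimes> (f \<otimes> s \<ominus> (a \<oplus> b \<otimes> f \<oplus> c \<otimes> s))"
          by (reify ring_reify, rule ring_identityI, simp, simp, code_simp)
        from eq_by_combination[OF fs this] have a: "a = f \<otimes> (s \<ominus> b) \<ominus> c \<otimes> s" using s by simp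
        have "\<not> Sunit (f \<otimes> (s \<ominus> b) \<ominus> c \<otimes> s)"
        proof (rule nonunit_minus)
          show "\<not> Sunit (f \<otimes> (s \<ominus> b))" "\<not> Sunit (c \<otimes> s)" using nonunit_mult f s True Sunit_R by auto
        qed (use f s in auto)
        then have aM: "a \<in> M" unfolding a[symmetric] using Sunit_R by auto
        obtain u where u: "u \<in> S" "a = x \<otimes> u" using x(3)[OF aM] by (elim sdvdE)
        obtain v where v: "v \<in> S" "c = x \<otimes> v" using x(3)[OF True] by (elim sdvdE)
        have "\<not> Sunit (s \<ominus> b)"
        proof
          assume "Sunit (s \<ominus> b)"
          then obtain w where w: "w \<in> S" "(s \<ominus> b) \<otimes> w = \<one>" by (elim SunitE)
          have [simp]: "w \<in> carrier F" using w by simp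
          have "f \<ominus> (a \<oplus> c \<otimes> s) \<otimes> w = f \<otimes> (\<one> \<ominus> (s \<ominus> b) \<otimes> w) \<oplus> w \<otimes> (f \<otimes> s \<ominus> (a \<oplus> b \<otimes> f \<oplus> c \<otimes> s))"
            by (reify ring_reify, rule ring_identityI, simp, simp, code_simp)
          from eq_by_combination2[OF w(2)[symmetric] fs this] have "f = (a \<oplus> c \<otimes> s) \<otimes> w" using w s by simp
          also have "\<dots> = x \<otimes> ((u \<oplus> v \<otimes> s) \<otimes> w)" unfolding u(2) v(2) using x(1) u(1) v(1)
            by (simp add: r_distr l_distr m_assoc)
          finally have "sdvd x f" by (rule sdvdI[rotated]) (use u v w s in simp)
          then show False using f(3) by simp
        qed
        then obtain s' where s': "s' \<in> S" "s \<ominus> b = f \<otimes> s'" using unif[of "s \<ominus> b"] s by (auto elim: sdvdE)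
        have "s = b \<oplus> (s \<ominus> b)" by (reify ring_reify, rule ring_identityI, simp, simp, code_simp)
        then have "s = b \<oplus> f \<otimes> s'" unfolding s'(2) .
        then show ?thesis using s' abc by blast
      qed
    qed
    obtain \<sigma> where \<sigma>: "\<sigma> \<in> S" "f \<otimes> f = x \<otimes> \<sigma>" using square_zero_mod_M[OF x' f(1,2) f(1,2)] by (elim sdvdE)
    show ?thesis
    proof
      fix s assume s: "s \<in> S"
      obtain r s1 where 1: "r \<in> R" "s1 \<in> S" "s = r \<oplus> f \<otimes> s1" using decomp[OF s] by blast
      obtain r' s2 where 2: "r' \<in> R" "s2 \<in> S" "s1 = r' \<oplus> f \<otimes> s2" using decomp[OF 1(2)] by blast
      have "s = r \<oplus> f \<otimes> r' \<oplus> (f \<otimes> f) \<otimes> s2" unfolding 1(3) 2(3) using 1(1) 2(1,2)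
        by (simp add: r_distr m_assoc a_assoc)
      also have "(f \<otimes> f) \<otimes> s2 = x \<otimes> (\<sigma> \<otimes> s2)" unfolding \<sigma>(2) using x(1) \<sigma>(1) 2(2) by (simp add: m_assoc)
      also have "r \<oplus> f \<otimes> r' \<oplus> x \<otimes> (\<sigma> \<otimes> s2) \<in> span2 \<one> e"
        by (intro T(6,7) fT RT 1 2 xS) (use \<sigma> 2 in auto)
      finally show "s \<in> span2 \<one> e" .
    qed
  qed
  moreover have "span2 \<one> e \<subseteq> S" using e by (auto simp: span2_def)
  ultimately show False using not_finite[OF e] by blast
qed

lemma divisible:
  assumes r: "r \<in> R" "r \<noteq> \<zero>" and s: "s \<in> S"
  obtains a s' where "a \<in> R" "s' \<in> S" "s = a \<oplus> r \<otimes> s'"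
proof -
  obtain x where x: "x \<in> M" "x \<noteq> \<zero>" "\<And>m. m \<in> M \<Longrightarrow> sdvd x m" using M_extends_to_principal by metis
  have pow: "\<exists>a\<in>R. \<exists>s'\<in>S. s = a \<oplus> x [^] k \<otimes> s'" for k :: nat
  proof (induction k)
    case 0
    have "s = \<zero> \<oplus> x [^] (0::nat) \<otimes> s" using s by simp
    then show ?case using s R_closed(1) by blast
  next
    case (Suc k)
    then obtain a s' where 1: "a \<in> R" "s' \<in> S" "s = a \<oplus> x [^] k \<otimes> s'" by blast
    obtain a' s'' where 2: "a' \<in> R" "s'' \<in> S" "s' = a' \<oplus> x \<otimes> s''" using x_divisible[OF x 1(2)] by blast
    have "s = (a \<oplus> x [^] k \<otimes> a') \<oplus> x [^] Suc k \<otimes> s''" unfolding 1(3) 2(3) using 1(1) 2(1,2) x(1)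
      by (simp add: r_distr m_assoc a_assoc)
    moreover have "a \<oplus> x [^] k \<otimes> a' \<in> R" using subring_pow[OF subring_R] 1 2 x by simp
    ultimately show ?case using 2 by blast
  qed
  obtain k q where k: "q \<in> R" "x [^] (k::nat) = r \<otimes> q" using dimension_one[OF r x(1)] by blast
  obtain a s' where "a \<in> R" "s' \<in> S" "s = a \<oplus> x [^] k \<otimes> s'" using pow by blast
  then have "a \<in> R" "q \<otimes> s' \<in> S" "s = a \<oplus> r \<otimes> (q \<otimes> s')" using k r by (auto simp: m_assoc)
  then show ?thesis using that by blast
qed

lemma uniformizer:
  obtains x where "x \<in> M" "x \<noteq> \<zero>" "\<And>y. y \<in> S \<Longrightarrow> \<not> Sunit y \<Longrightarrow> sdvd x y"
proof -
  obtain x where x: "x \<in> M" "x \<noteq> \<zero>" "\<And>m. m \<in> M \<Longrightarrow> sdvd x m" using M_extends_to_principal by metis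
  have nx: "\<not> Sunit x" using Sunit_R x by simp
  show ?thesis
  proof (cases "\<forall>y\<in>S. \<not> Sunit y \<longrightarrow> sdvd x y")
    case True
    then show ?thesis using that[OF x(1,2)] by blast
  next
    case False
    then obtain y where y: "y \<in> S" "\<not> Sunit y" "\<not> sdvd x y" by blast
    obtain a s where as: "a \<in> R" "s \<in> S" "y = a \<oplus> x \<otimes> s" using divisible[OF _ x(2) y(1)] x(1) by (metis M_R)
    have "\<not> Sunit a"
    proof -
      have "\<not> Sunit (y \<ominus> x \<otimes> s)" using nonunit_minus[OF y(1,2)] nonunit_mult[of x s] nx x(1) as by simp
      moreover have "y \<ominus> x \<otimes> s = a" unfolding as(3) using as(1,2) x(1) by (simp add: minus_eq a_assoc r_neg)
      ultimately show ?thesis by simp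
    qed
    then obtain u where u: "u \<in> S" "a = x \<otimes> u" using x(3) Sunit_R as(1) by (auto elim: sdvdE)
    have "y = x \<otimes> (u \<oplus> s)" unfolding as(3) u(2) using u(1) as(2) x(1) by (simp add: r_distr)
    then have "sdvd x y" by (rule sdvdI[rotated]) (use u(1) as(2) in simp)
    then show ?thesis using y(3) by simp
  qed
qed

lemma uniformizer_power:
  assumes x: "x \<in> M" "x \<noteq> \<zero>" "\<And>y. y \<in> S \<Longrightarrow> \<not> Sunit y \<Longrightarrow> sdvd x y" and s: "s \<in> S" "s \<noteq> \<zero>"
  obtains u k where "Sunit u" "s = x [^] (k::nat) \<otimes> u"
proof -
  have x': "\<And>m. m \<in> M \<Longrightarrow> sdvd x m" using x(3) Sunit_R by simp
  have nx: "\<not> Sunit x" using Sunit_R x by simp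
  have factor: "\<exists>u k. Sunit u \<and> s = x [^] (k::nat) \<otimes> u" if "s \<in> S" "\<not> sdvd (x [^] n) s" for s and n :: nat
    using that
  proof (induction n arbitrary: s)
    case 0
    then have "sdvd (x [^] (0::nat)) s" by (intro sdvdI[of s]) auto
    then show ?case using 0 by simp
  next
    case (Suc n)
    show ?case
    proof (cases "Sunit s")
      case True
      then show ?thesis by (intro exI[of _ s] exI[of _ 0]) simp
    next
      case False
      then obtain s' where s': "s' \<in> S" "s = x \<otimes> s'" using x(3) Suc.prems by (auto elim: sdvdE)
      have "\<not> sdvd (x [^] n) s'"
      proof
        assume "sdvd (x [^] n) s'"
        then obtain t where t: "t \<in> S" "s' = x [^] n \<otimes> t" by (elim sdvdE)
        have "s = x [^] Suc n \<otimes> t" unfolding s'(2) t(2) using x(1) t(1) by (simp add: m_ac)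
        then show False using Suc.prems t by (auto intro: sdvdI)
      qed
      then obtain u k where u: "Sunit u" "s' = x [^] (k::nat) \<otimes> u" using Suc.IH[OF s'(1)] by blast
      have "s = x [^] Suc k \<otimes> u" unfolding s'(2) u(2) using u(1) x(1) by (simp add: m_ac)
      then show ?thesis using u by blast
    qed
  qed
  obtain a b where ab: "a \<in> R" "b \<in> R" "b \<noteq> \<zero>" "s \<otimes> b = a" using fraction[of s] s by auto
  have "a \<noteq> \<zero>" using ab s integral[of s b] by auto
  then obtain k q where k: "q \<in> R" "x [^] (k::nat) = a \<otimes> q" using dimension_one[OF ab(1) _ x(1)] by blast
  have pc: "x [^] n \<in> carrier F" for n :: nat using x(1) by simp
  have "\<not> sdvd (x [^] Suc k) s"
  proof
    assume "sdvd (x [^] Suc k) s"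
    then obtain t where t: "t \<in> S" "s = x [^] Suc k \<otimes> t" by (elim sdvdE)
    have "x [^] k \<otimes> \<one> = s \<otimes> b \<otimes> q" using k ab pc by simp
    also have "\<dots> = x [^] k \<otimes> (x \<otimes> t \<otimes> b \<otimes> q)" unfolding t(2) using t(1) ab(2) k(1) x(1) by (simp add: m_ac)
    finally have "x [^] k \<otimes> \<one> = x [^] k \<otimes> (x \<otimes> t \<otimes> b \<otimes> q)" .
    moreover have "x [^] k \<noteq> \<zero>" using x by (induction k) (auto dest: integral)
    ultimately have "\<one> = x \<otimes> (t \<otimes> b \<otimes> q)" using m_lcancel[of "x [^] k" \<one> "x \<otimes> t \<otimes> b \<otimes> q"] pc t(1) ab(2) k(1) x(1)
      by (simp add: m_assoc)
    then have "Sunit x" using SunitI[of x "t \<otimes> b \<otimes> q"] x(1) t(1) ab(2) k(1) by simp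
    then show False using nx by simp
  qed
  then show ?thesis using factor[OF s(1)] that by blast
qed

lemma product_of_conductors:
  assumes "v \<in> S" "s \<in> S" "b \<in> R" "b \<otimes> v \<in> R" "b \<otimes> s \<in> R" shows "b \<otimes> (v \<otimes> s) \<in> R"
proof -
  obtain c d e where cde: "c \<in> R" "d \<in> R" "e \<in> R" "v \<otimes> s = c \<oplus> d \<otimes> v \<oplus> e \<otimes> s"
    using integral_product[OF assms(1,2)] by metis
  have "b \<otimes> (v \<otimes> s) = b \<otimes> c \<oplus> d \<otimes> (b \<otimes> v) \<oplus> e \<otimes> (b \<otimes> s)"
    unfolding cde(4) using cde(1-3) assms(1-3) by (simp add: r_distr) (simp add: m_ac)
  then show ?thesis using cde assms by simp
qed

end

section \<open>Prime ideals avoiding a multiplicative set\<close>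

context cring
begin

lemma exists_ideal_avoiding_powers:
  assumes r: "r \<in> carrier R" and m: "m \<in> carrier R" and avoid: "\<And>k::nat. m [^] k \<notin> PIdl r"
  obtains P where "ideal P R" "r \<in> P" "\<And>k::nat. m [^] k \<notin> P"
    "\<And>J. ideal J R \<Longrightarrow> P \<subseteq> J \<Longrightarrow> (\<And>k::nat. m [^] k \<notin> J) \<Longrightarrow> J = P"
proof -
  define \<A> where "\<A> = {J. ideal J R \<and> r \<in> J \<and> (\<forall>k::nat. m [^] k \<notin> J)}"
  have "\<exists>P\<in>\<A>. \<forall>J\<in>\<A>. P \<subseteq> J \<longrightarrow> J = P"
  proof (rule subset_Zorn_nonempty)
    have "PIdl r \<in> \<A>" using cgenideal_ideal[OF r] cgenideal_self[OF r] avoid by (simp add: \<A>_def)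
    then show "\<A> \<noteq> {}" by blast
    fix \<C> assume C: "\<C> \<noteq> {}" "subset.chain \<A> \<C>"
    then have "subset.chain {I. ideal I R} \<C>" unfolding pred_on.chain_def \<A>_def by blast
    from chain_Union_is_ideal[OF this] have "ideal (\<Union>\<C>) R" using C by simp
    moreover have "r \<in> \<Union>\<C>" "\<forall>k::nat. m [^] k \<notin> \<Union>\<C>" using C unfolding pred_on.chain_def \<A>_def by blast+
    ultimately show "\<Union>\<C> \<in> \<A>" by (simp add: \<A>_def)
  qed
  then obtain P where P: "P \<in> \<A>" "\<And>J. J \<in> \<A> \<Longrightarrow> P \<subseteq> J \<Longrightarrow> J = P" by blast
  show ?thesis
  proof (rule that[of P])
    show "J = P" if "ideal J R" "P \<subseteq> J" "\<And>k::nat. m [^] k \<notin> J" for J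
      using P that unfolding \<A>_def by blast
  qed (use P(1) in \<open>auto simp: \<A>_def\<close>)
qed

lemma exists_prime_avoiding_powers:
  assumes r: "r \<in> carrier R" and m: "m \<in> carrier R" and avoid: "\<And>k::nat. m [^] k \<notin> PIdl r"
  obtains P where "primeideal P R" "r \<in> P" "m \<notin> P"
proof -
  obtain P where P: "ideal P R" "r \<in> P" "\<And>k::nat. m [^] k \<notin> P"
    "\<And>J. ideal J R \<Longrightarrow> P \<subseteq> J \<Longrightarrow> (\<And>k::nat. m [^] k \<notin> J) \<Longrightarrow> J = P"
    using exists_ideal_avoiding_powers[OF assms] by metis
  interpret P: ideal P R by fact
  have hit: "\<exists>p\<in>P. \<exists>x\<in>carrier R. \<exists>k::nat. m [^] k = p \<oplus> x \<otimes> a" if a: "a \<in> carrier R" "a \<notin> P" for a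
  proof -
    have J: "ideal (P <+> PIdl a) R" using add_ideals[OF P(1) cgenideal_ideal[OF a(1)]] .
    have sub: "P \<subseteq> P <+> PIdl a"
    proof
      fix p assume "p \<in> P"
      then have "p \<oplus> \<zero> \<in> P <+> PIdl a"
        using additive_subgroup.zero_closed[OF ideal.axioms(1)[OF cgenideal_ideal[OF a(1)]]] unfolding set_add_def' by blast
      then show "p \<in> P <+> PIdl a" using \<open>p \<in> P\<close> by simp
    qed
    have "a \<in> P <+> PIdl a"
    proof -
      have "\<zero> \<oplus> a \<in> P <+> PIdl a" using cgenideal_self[OF a(1)] P.zero_closed unfolding set_add_def' by blast
      then show ?thesis using a by simp
    qed
    then have "\<not> (\<forall>k::nat. m [^] k \<notin> P <+> PIdl a)" using P(4)[OF J sub] a by blast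
    then show ?thesis unfolding set_add_def' cgenideal_def by blast
  qed
  have "primeideal P R"
  proof (rule primeidealI)
    show "ideal P R" "cring R" using P is_cring by auto
    show "carrier R \<noteq> P" using P(3)[of 0] by auto
    fix a b assume ab: "a \<in> carrier R" "b \<in> carrier R" "a \<otimes> b \<in> P"
    show "a \<in> P \<or> b \<in> P"
    proof (rule ccontr)
      assume "\<not> ?thesis"
      then obtain p x k p' y l where px: "p \<in> P" "x \<in> carrier R" "m [^] (k::nat) = p \<oplus> x \<otimes> a"
        "p' \<in> P" "y \<in> carrier R" "m [^] (l::nat) = p' \<oplus> y \<otimes> b" using hit[OF ab(1)] hit[OF ab(2)] by blast
      have [simp]: "p \<in> carrier R" "p' \<in> carrier R" using px by auto
      note [simp] = ab(1,2) px(2,5)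
      have "m [^] (k + l) = (p \<oplus> x \<otimes> a) \<otimes> (p' \<oplus> y \<otimes> b)" using m px by (simp flip: nat_pow_mult)
      also have "\<dots> = p \<otimes> (p' \<oplus> y \<otimes> b) \<oplus> (x \<otimes> a \<otimes> p' \<oplus> x \<otimes> y \<otimes> (a \<otimes> b))"
        by (reify ring_reify, rule ring_identityI, simp, simp, code_simp)
      also have "\<dots> \<in> P" using px ab by (simp add: P.I_l_closed P.I_r_closed)
      finally show False using P(3) by blast
    qed
  qed
  moreover have "m \<notin> P" using P(3)[of 1] m by simp
  ultimately show ?thesis using that P(2) by blast
qed

lemma nonunit_in_maximal_ideal:
  assumes a: "a \<in> carrier R" "a \<notin> Units R"
  obtains P where "maximalideal P R" "a \<in> P"
proof -
  have "\<one> [^] (k::nat) \<notin> PIdl a" for k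
  proof
    assume "\<one> [^] k \<in> PIdl a"
    then obtain x where "x \<in> carrier R" "x \<otimes> a = \<one>" unfolding cgenideal_def by auto
    then show False using a unfolding Units_def by (auto simp: m_comm)
  qed
  then obtain P where P: "ideal P R" "a \<in> P" "\<And>k::nat. \<one> [^] k \<notin> P"
    "\<And>J. ideal J R \<Longrightarrow> P \<subseteq> J \<Longrightarrow> (\<And>k::nat. \<one> [^] k \<notin> J) \<Longrightarrow> J = P"
    using exists_ideal_avoiding_powers[OF a(1) one_closed] by metis
  have "maximalideal P R"
  proof (rule maximalidealI[OF P(1)])
    show "carrier R \<noteq> P" using P(3)[of 0] by auto
    show "J = P \<or> J = carrier R" if "ideal J R" "P \<subseteq> J" "J \<subseteq> carrier R" for J
      using P(4)[OF that(1,2)] ideal.one_imp_carrier[OF that(1)] by auto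
  qed
  then show ?thesis using that P by blast
qed

lemma quasilocal_nonunit_add:
  assumes q: "quasilocal R" and a: "a \<in> carrier R" "a \<notin> Units R" and b: "b \<in> carrier R" "b \<notin> Units R"
  shows "a \<oplus> b \<notin> Units R"
proof
  assume u: "a \<oplus> b \<in> Units R"
  obtain P where P: "maximalideal P R" "\<And>P'. maximalideal P' R \<Longrightarrow> P' = P" using q unfolding quasilocal_def by metis
  interpret P: maximalideal P R by fact
  have "a \<in> P" "b \<in> P" using nonunit_in_maximal_ideal[OF a] nonunit_in_maximal_ideal[OF b] P(2) by metis+
  then have "a \<oplus> b \<in> P" by simp
  then have "inv (a \<oplus> b) \<otimes> (a \<oplus> b) \<in> P" using u by (intro P.I_l_closed) auto
  then show False using u P.I_notcarr P.one_imp_carrier by simp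
qed

end

section \<open>Modules\<close>

lemma direct_sum_simps [simp]:
  "carrier (direct_sum I L) = {f \<in> \<Pi>\<^sub>E i\<in>I. carrier (L i). finite {i\<in>I. f i \<noteq> \<zero>\<^bsub>L i\<^esub>}}"
  "\<zero>\<^bsub>direct_sum I L\<^esub> = (\<lambda>i\<in>I. \<zero>\<^bsub>L i\<^esub>)"
  "f \<oplus>\<^bsub>direct_sum I L\<^esub> g = (\<lambda>i\<in>I. f i \<oplus>\<^bsub>L i\<^esub> g i)"
  "a \<odot>\<^bsub>direct_sum I L\<^esub> f = (\<lambda>i\<in>I. a \<odot>\<^bsub>L i\<^esub> f i)"
  by (simp_all add: direct_sum_def)

lemma direct_sum_module:
  assumes A: "cring A" and L: "\<And>i. i \<in> I \<Longrightarrow> module A (L i)"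
  shows "module A (direct_sum I L)"
proof (rule moduleI[OF A])
  interpret A: cring A by fact
  have G: "abelian_group (L i)" if "i \<in> I" for i using L[OF that] by (simp add: module_def)
  have M: "abelian_monoid (L i)" if "i \<in> I" for i using G[OF that] by (simp add: abelian_group_def)
  have mz: "\<ominus>\<^bsub>L i\<^esub> \<zero>\<^bsub>L i\<^esub> = \<zero>\<^bsub>L i\<^esub>" if "i \<in> I" for i
    using abelian_group.l_neg[OF G[OF that] abelian_monoid.zero_closed[OF M[OF that]]]
      abelian_monoid.r_zero[OF M[OF that] abelian_group.a_inv_closed[OF G[OF that] abelian_monoid.zero_closed[OF M[OF that]]]] by simp
  show "abelian_group (direct_sum I L)"
  proof (rule abelian_groupI)
    fix f g assume fg: "f \<in> carrier (direct_sum I L)" "g \<in> carrier (direct_sum I L)"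
    have "{i\<in>I. f i \<oplus>\<^bsub>L i\<^esub> g i \<noteq> \<zero>\<^bsub>L i\<^esub>} \<subseteq> {i\<in>I. f i \<noteq> \<zero>\<^bsub>L i\<^esub>} \<union> {i\<in>I. g i \<noteq> \<zero>\<^bsub>L i\<^esub>}"
      using abelian_monoid.l_zero[OF M] abelian_monoid.zero_closed[OF M] by auto
    then have fin: "finite {i\<in>I. f i \<oplus>\<^bsub>L i\<^esub> g i \<noteq> \<zero>\<^bsub>L i\<^esub>}" using fg by (auto intro: finite_subset)
    have "{i\<in>I. (\<lambda>i\<in>I. f i \<oplus>\<^bsub>L i\<^esub> g i) i \<noteq> \<zero>\<^bsub>L i\<^esub>} = {i\<in>I. f i \<oplus>\<^bsub>L i\<^esub> g i \<noteq> \<zero>\<^bsub>L i\<^esub>}" by auto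
    then show "f \<oplus>\<^bsub>direct_sum I L\<^esub> g \<in> carrier (direct_sum I L)" using fg fin abelian_monoid.a_closed[OF M]
      by (auto simp: PiE_iff)
    show "f \<oplus>\<^bsub>direct_sum I L\<^esub> g = g \<oplus>\<^bsub>direct_sum I L\<^esub> f"
      using fg abelian_monoid.a_comm[OF M] by (auto simp: PiE_iff intro!: restrict_ext)
  next
    fix f g h assume fgh: "f \<in> carrier (direct_sum I L)" "g \<in> carrier (direct_sum I L)" "h \<in> carrier (direct_sum I L)"
    then show "f \<oplus>\<^bsub>direct_sum I L\<^esub> g \<oplus>\<^bsub>direct_sum I L\<^esub> h = f \<oplus>\<^bsub>direct_sum I L\<^esub> (g \<oplus>\<^bsub>direct_sum I L\<^esub> h)"
      using abelian_monoid.a_assoc[OF M] by (auto simp: PiE_iff intro!: restrict_ext)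
  next
    have "{i\<in>I. (\<lambda>i\<in>I. \<zero>\<^bsub>L i\<^esub>) i \<noteq> \<zero>\<^bsub>L i\<^esub>} = {}" by auto
    then show "\<zero>\<^bsub>direct_sum I L\<^esub> \<in> carrier (direct_sum I L)" using abelian_monoid.zero_closed[OF M] by auto
  next
    fix f assume f: "f \<in> carrier (direct_sum I L)"
    then show "\<zero>\<^bsub>direct_sum I L\<^esub> \<oplus>\<^bsub>direct_sum I L\<^esub> f = f"
      using abelian_monoid.l_zero[OF M] by (auto simp: PiE_iff fun_eq_iff restrict_def extensional_def)
    have "{i\<in>I. (\<lambda>i\<in>I. \<ominus>\<^bsub>L i\<^esub> f i) i \<noteq> \<zero>\<^bsub>L i\<^esub>} \<subseteq> {i\<in>I. f i \<noteq> \<zero>\<^bsub>L i\<^esub>}"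
      using mz by auto
    then have "finite {i\<in>I. (\<lambda>i\<in>I. \<ominus>\<^bsub>L i\<^esub> f i) i \<noteq> \<zero>\<^bsub>L i\<^esub>}" by (rule finite_subset) (use f in simp)
    then have "(\<lambda>i\<in>I. \<ominus>\<^bsub>L i\<^esub> f i) \<in> carrier (direct_sum I L)" using f abelian_group.a_inv_closed[OF G] by (auto simp: PiE_iff)
    moreover have "(\<lambda>i\<in>I. \<ominus>\<^bsub>L i\<^esub> f i) \<oplus>\<^bsub>direct_sum I L\<^esub> f = \<zero>\<^bsub>direct_sum I L\<^esub>"
      using f abelian_group.l_neg[OF G] by (auto simp: PiE_iff intro!: restrict_ext)
    ultimately show "\<exists>g\<in>carrier (direct_sum I L). g \<oplus>\<^bsub>direct_sum I L\<^esub> f = \<zero>\<^bsub>direct_sum I L\<^esub>" by blast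
  qed
  show "a \<odot>\<^bsub>direct_sum I L\<^esub> f \<in> carrier (direct_sum I L)" if "a \<in> carrier A" "f \<in> carrier (direct_sum I L)" for a f
  proof -
    have "{i\<in>I. (\<lambda>i\<in>I. a \<odot>\<^bsub>L i\<^esub> f i) i \<noteq> \<zero>\<^bsub>L i\<^esub>} \<subseteq> {i\<in>I. f i \<noteq> \<zero>\<^bsub>L i\<^esub>}"
      using module.smult_r_null[OF L that(1)] by auto
    then have "finite {i\<in>I. (\<lambda>i\<in>I. a \<odot>\<^bsub>L i\<^esub> f i) i \<noteq> \<zero>\<^bsub>L i\<^esub>}" by (rule finite_subset) (use that in simp)
    then show ?thesis using that module.smult_closed[OF L] by (auto simp: PiE_iff)
  qed
qed (use module.smult_l_distr[OF L] module.smult_r_distr[OF L] module.smult_assoc1[OF L] module.smult_one[OF L] in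
      \<open>auto simp: PiE_iff fun_eq_iff restrict_def extensional_def\<close>)

lemma regular_module:
  assumes "cring A" shows "module A (module_in A (carrier A))"
proof -
  interpret cring A by fact
  show ?thesis
  proof (rule moduleI[OF assms])
    show "abelian_group (module_in A (carrier A))"
      by (rule abelian_groupI) (auto simp: module_in_def a_ac intro: l_neg bexI[of _ "\<ominus>\<^bsub>A\<^esub> _"])
  qed (auto simp: module_in_def l_distr r_distr m_assoc)
qed

lemma mod_hom_zero:
  assumes "module A M" "module A N" "f \<in> mod_hom A M N"
  shows "f \<zero>\<^bsub>M\<^esub> = \<zero>\<^bsub>N\<^esub>"
proof -
  interpret M: module A M by fact
  interpret N: module A N by fact
  have "f (\<zero>\<^bsub>A\<^esub> \<odot>\<^bsub>M\<^esub> \<zero>\<^bsub>M\<^esub>) = \<zero>\<^bsub>A\<^esub> \<odot>\<^bsub>N\<^esub> f \<zero>\<^bsub>M\<^esub>"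
    using assms(3) M.M.zero_closed M.R.zero_closed unfolding mod_hom_def by blast
  moreover have "f \<zero>\<^bsub>M\<^esub> \<in> carrier N" using assms(3) M.M.zero_closed unfolding mod_hom_def by blast
  ultimately show ?thesis by simp
qed

lemma module_in_simps [simp]:
  "carrier (module_in B J) = J" "\<zero>\<^bsub>module_in B J\<^esub> = \<zero>\<^bsub>B\<^esub>"
  "x \<oplus>\<^bsub>module_in B J\<^esub> y = x \<oplus>\<^bsub>B\<^esub> y" "a \<odot>\<^bsub>module_in B J\<^esub> x = a \<otimes>\<^bsub>B\<^esub> x"
  by (simp_all add: module_in_def)

lemma over_End_simps [simp]:
  "carrier (over_End N) = carrier N" "\<zero>\<^bsub>over_End N\<^esub> = \<zero>\<^bsub>N\<^esub>"
  "x \<oplus>\<^bsub>over_End N\<^esub> y = x \<oplus>\<^bsub>N\<^esub> y" "\<phi> \<odot>\<^bsub>over_End N\<^esub> x = \<phi> x"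
  by (simp_all add: over_End_def)

lemma End_ring_simps [simp]:
  "carrier (End_ring B N) = mod_hom B N N \<inter> extensional (carrier N)"
  "\<phi> \<otimes>\<^bsub>End_ring B N\<^esub> \<psi> = compose (carrier N) \<phi> \<psi>"
  "\<one>\<^bsub>End_ring B N\<^esub> = (\<lambda>x\<in>carrier N. x)"
  "\<zero>\<^bsub>End_ring B N\<^esub> = (\<lambda>x\<in>carrier N. \<zero>\<^bsub>N\<^esub>)"
  "\<phi> \<oplus>\<^bsub>End_ring B N\<^esub> \<psi> = (\<lambda>x\<in>carrier N. \<phi> x \<oplus>\<^bsub>N\<^esub> \<psi> x)"
  by (simp_all add: End_ring_def)

lemma (in abelian_group) minus_eq_minusI:
  assumes [simp]: "a \<in> carrier G" "b \<in> carrier G" "p \<in> carrier G" "q \<in> carrier G" and eq: "a \<oplus> p = b \<oplus> q"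
  shows "a \<ominus> b = q \<ominus> p"
proof -
  have "(a \<ominus> b) \<oplus> (b \<oplus> p) = a \<oplus> p" by (simp add: minus_eq a_assoc r_neg1)
  also have "\<dots> = q \<oplus> b" unfolding eq by (rule a_comm) auto
  also have "\<dots> = (q \<ominus> p) \<oplus> (p \<oplus> b)" by (simp add: minus_eq a_assoc r_neg1)
  also have "p \<oplus> b = b \<oplus> p" by (rule a_comm) auto
  finally show ?thesis by simp
qed

context fraction_field
begin

abbreviation A :: "('a, 'b) ring_scheme" where
  "A \<equiv> F\<lparr>carrier := R\<rparr>"

lemma A_domain: "domain A"
  by (rule subring_is_domain[OF subring_R])

lemma A_cring: "cring A"
  using A_domain by (simp add: domain_def)

lemma ideal_subring_iff:
  assumes C: "subring C F"
  shows "ideal J (F\<lparr>carrier := C\<rparr>) \<longleftrightarrow>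
    J \<subseteq> C \<and> \<zero> \<in> J \<and> (\<forall>x\<in>J. \<forall>y\<in>J. x \<oplus> y \<in> J) \<and> (\<forall>c\<in>C. \<forall>x\<in>J. c \<otimes> x \<in> J)"
proof
  assume "ideal J (F\<lparr>carrier := C\<rparr>)"
  then interpret J: ideal J "F\<lparr>carrier := C\<rparr>" .
  show "J \<subseteq> C \<and> \<zero> \<in> J \<and> (\<forall>x\<in>J. \<forall>y\<in>J. x \<oplus> y \<in> J) \<and> (\<forall>c\<in>C. \<forall>x\<in>J. c \<otimes> x \<in> J)"
    using J.a_subset additive_subgroup.zero_closed[OF J.is_additive_subgroup]
      additive_subgroup.a_closed[OF J.is_additive_subgroup] J.I_l_closed by simp
next
  assume J: "J \<subseteq> C \<and> \<zero> \<in> J \<and> (\<forall>x\<in>J. \<forall>y\<in>J. x \<oplus> y \<in> J) \<and> (\<forall>c\<in>C. \<forall>x\<in>J. c \<otimes> x \<in> J)"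
  note E = subringE[OF C]
  interpret C: ring "F\<lparr>carrier := C\<rparr>" by (rule subring_is_ring[OF C])
  have car: "x \<in> carrier F" if "x \<in> J" for x using that J E(1) by blast
  show "ideal J (F\<lparr>carrier := C\<rparr>)"
  proof (rule idealI[OF C.ring_axioms])
    show "subgroup J (add_monoid (F\<lparr>carrier := C\<rparr>))"
    proof (rule C.add.subgroupI)
      fix x assume x: "x \<in> J"
      have "\<ominus> \<one> \<in> C" using E(3,5) by blast
      then have "(\<ominus> \<one>) \<otimes> x \<in> J" using J x by blast
      moreover have "x \<oplus> (\<ominus> \<one>) \<otimes> x = \<zero>" "(\<ominus> \<one>) \<otimes> x \<oplus> x = \<zero>" using car[OF x] by (simp_all add: l_minus r_neg l_neg)
      moreover have "x \<in> C" "(\<ominus> \<one>) \<otimes> x \<in> C" using J x \<open>(\<ominus> \<one>) \<otimes> x \<in> J\<close> by auto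
      ultimately have "\<ominus>\<^bsub>F\<lparr>carrier := C\<rparr>\<^esub> x = (\<ominus> \<one>) \<otimes> x" by (intro C.minus_equality) auto
      then show "\<ominus>\<^bsub>F\<lparr>carrier := C\<rparr>\<^esub> x \<in> J" using \<open>(\<ominus> \<one>) \<otimes> x \<in> J\<close> by simp
    qed (use J in auto)
    show "a \<otimes>\<^bsub>F\<lparr>carrier := C\<rparr>\<^esub> x \<in> J" if "a \<in> J" "x \<in> carrier (F\<lparr>carrier := C\<rparr>)" for a x
    proof -
      have "a \<otimes> x = x \<otimes> a" using that car E(1) by (auto intro: m_comm)
      then show ?thesis using J that by simp
    qed
  qed (use J in simp)
qed

lemma ideal_A_iff: "ideal J A \<longleftrightarrow> J \<subseteq> R \<and> rmod J"
  using ideal_subring_iff[OF subring_R, of J] R_carrier unfolding rmod_def by blast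

lemma Units_subring:
  assumes C: "subring C F" shows "Units (F\<lparr>carrier := C\<rparr>) = {c \<in> C. \<exists>d\<in>C. c \<otimes> d = \<one>}"
proof -
  have "c \<otimes> d = d \<otimes> c" if "c \<in> C" "d \<in> C" for c d using that subringE(1)[OF C] by (auto intro: m_comm)
  then show ?thesis unfolding Units_def by auto
qed

lemma Units_A: "Units A = R - M"
  unfolding Units_subring[OF subring_R] M_def by auto

lemma pow_A: "x [^]\<^bsub>F\<lparr>carrier := C\<rparr>\<^esub> (k::nat) = x [^] k"
  unfolding nat_pow_def by simp

lemma End_apply:
  assumes J: "rmod J" "J \<subseteq> R" and \<phi>: "\<phi> \<in> carrier (End_ring A (module_in A J))" and x: "x \<in> J" "y \<in> J"
  shows "\<phi> x \<in> J" "x \<otimes> \<phi> y = y \<otimes> \<phi> x"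
proof -
  show \<phi>J: "\<phi> x \<in> J" using \<phi> x by (auto simp: mod_hom_def)
  have lin: "\<phi> (a \<otimes> z) = a \<otimes> \<phi> z" if "a \<in> R" "z \<in> J" for a z using \<phi> that by (simp add: mod_hom_def)
  have "x \<otimes> \<phi> y = \<phi> (x \<otimes> y)" using lin[of x y] x J by auto
  also have "x \<otimes> y = y \<otimes> x" using x J by (auto intro: m_comm)
  also have "\<phi> \<dots> = y \<otimes> \<phi> x" using lin[of y x] x J by auto
  finally show "x \<otimes> \<phi> y = y \<otimes> \<phi> x" .
qed

lemma mult_in_End:
  assumes J: "rmod J" "J \<subseteq> R" and e: "e \<in> mult_ring J"
  shows "(\<lambda>x\<in>J. e \<otimes> x) \<in> carrier (End_ring A (module_in A J))"
proof -
  have 1: "e \<in> carrier F" "\<And>x. x \<in> J \<Longrightarrow> e \<otimes> x \<in> J" using e by (auto simp: mult_ring_def)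
  have "e \<otimes> (a \<otimes> x) = a \<otimes> (e \<otimes> x)" if "a \<in> R" "x \<in> J" for a x using 1 that rmodD(1)[OF J(1)] by (simp add: m_lcomm)
  then show ?thesis using 1 rmodD[OF J(1)] by (auto simp: mod_hom_def r_distr)
qed

lemma stable_ideal_invertible:
  assumes stable: "stable_ideal A J" and c: "c \<in> J" "c \<noteq> \<zero>"
    and G: "rmod G" "\<And>x y. x \<in> J \<Longrightarrow> y \<in> Inv J \<Longrightarrow> x \<otimes> y \<in> G"
  shows "\<one> \<in> G"
proof -
  have J: "rmod J" "J \<subseteq> R" using stable ideal_A_iff by (auto simp: stable_ideal_def)
  note JD = rmodD[OF J(1)]
  define N where "N = module_in A J"
  define E where "E = End_ring A N"
  have stable': "projective_mod E (over_End N)" using stable by (simp add: stable_ideal_def E_def N_def)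
  then have modN: "module E (over_End N)" by (simp add: projective_mod_def)
  interpret E: cring E using modN by (simp add: module_def)
  note End = End_apply[OF J, folded N_def E_def]
  have NJ: "carrier N = J" "\<And>x y. x \<oplus>\<^bsub>N\<^esub> y = x \<oplus> y" "\<zero>\<^bsub>N\<^esub> = \<zero>" by (simp_all add: N_def)
  obtain B P Q where BPQ: "submodule P E (direct_sum (B :: 'a set) (\<lambda>_. module_in E (carrier E)))"
      "submodule Q E (direct_sum B (\<lambda>_. module_in E (carrier E)))"
      "P <+>\<^bsub>direct_sum B (\<lambda>_. module_in E (carrier E))\<^esub> Q = carrier (direct_sum B (\<lambda>_. module_in E (carrier E)))"
      "P \<inter> Q = {\<zero>\<^bsub>direct_sum B (\<lambda>_. module_in E (carrier E))\<^esub>}"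
      "mod_isomorphic E (over_End N) ((direct_sum B (\<lambda>_. module_in E (carrier E)))\<lparr>carrier := P\<rparr>)"
    using stable' unfolding projective_mod_def Let_def by blast
  define D where "D = direct_sum B (\<lambda>_. module_in E (carrier E))"
  note BPQ' = BPQ[folded D_def]
  interpret D: module E D unfolding D_def
    by (rule direct_sum_module[OF E.is_cring]) (rule regular_module[OF E.is_cring])
  have Dc: "carrier D = {f \<in> B \<rightarrow>\<^sub>E carrier E. finite {i\<in>B. f i \<noteq> \<zero>\<^bsub>E\<^esub>}}"
    and Dadd: "\<And>f g. f \<oplus>\<^bsub>D\<^esub> g = (\<lambda>i\<in>B. f i \<oplus>\<^bsub>E\<^esub> g i)"
    and Dsm: "\<And>a f. a \<odot>\<^bsub>D\<^esub> f = (\<lambda>i\<in>B. a \<otimes>\<^bsub>E\<^esub> f i)"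
    and D0: "\<zero>\<^bsub>D\<^esub> = (\<lambda>i\<in>B. \<zero>\<^bsub>E\<^esub>)"
    by (simp_all add: D_def)
  note P = D.submoduleE[OF BPQ'(1)] and Q = D.submoduleE[OF BPQ'(2)]
  obtain f where f: "f \<in> mod_hom E (over_End N) (D\<lparr>carrier := P\<rparr>)" "bij_betw f J P"
    using BPQ'(5) unfolding mod_isomorphic_def by (auto simp: NJ)
  have fP: "\<And>x. x \<in> J \<Longrightarrow> f x \<in> P" using f(2) by (auto simp: bij_betw_def)
  have fD: "\<And>x. x \<in> J \<Longrightarrow> f x \<in> carrier D" using fP P(1) by blast
  have fadd: "f (x \<oplus> y) = f x \<oplus>\<^bsub>D\<^esub> f y" if "x \<in> J" "y \<in> J" for x y
    using f(1) that by (simp add: mod_hom_def NJ)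
  have fsm: "f (\<phi> x) = \<phi> \<odot>\<^bsub>D\<^esub> f x" if "\<phi> \<in> carrier E" "x \<in> J" for \<phi> x
    using f(1) that by (simp add: mod_hom_def NJ)
  \<comment> \<open>The projection to P along Q, followed by the inverse of f\<close>
  define h where "h u = (THE x. x \<in> J \<and> (\<exists>q\<in>Q. u = f x \<oplus>\<^bsub>D\<^esub> q))" for u
  have unique: "x = y" if "x \<in> J" "y \<in> J" "q \<in> Q" "q' \<in> Q" "f x \<oplus>\<^bsub>D\<^esub> q = f y \<oplus>\<^bsub>D\<^esub> q'" for x y q q'
  proof -
    have car: "f x \<in> carrier D" "f y \<in> carrier D" "q \<in> carrier D" "q' \<in> carrier D" using that fD Q(1) by auto
    have eq: "f x \<ominus>\<^bsub>D\<^esub> f y = q' \<ominus>\<^bsub>D\<^esub> q" using D.minus_eq_minusI car that(5) by blast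
    have "f x \<ominus>\<^bsub>D\<^esub> f y \<in> P" using P(3,5) fP that by (simp add: D.minus_eq)
    moreover have "q' \<ominus>\<^bsub>D\<^esub> q \<in> Q" using Q(3,5) that by (simp add: D.minus_eq)
    ultimately have "f x \<ominus>\<^bsub>D\<^esub> f y = \<zero>\<^bsub>D\<^esub>" using BPQ'(4) eq by auto
    moreover have "(f x \<ominus>\<^bsub>D\<^esub> f y) \<oplus>\<^bsub>D\<^esub> f y = f x" using car by (simp add: D.minus_eq D.a_assoc D.l_neg)
    ultimately have "f x = f y" using car by simp
    then show "x = y" using f(2) that unfolding bij_betw_def inj_on_def by blast
  qed
  have hI: "h u = x" if "x \<in> J" "q \<in> Q" "u = f x \<oplus>\<^bsub>D\<^esub> q" for u x q
    unfolding h_def using that unique by (intro the_equality) blast+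
  have hE: "\<exists>q\<in>Q. u = f (h u) \<oplus>\<^bsub>D\<^esub> q" "h u \<in> J" if u: "u \<in> carrier D" for u
  proof -
    have "u \<in> P <+>\<^bsub>D\<^esub> Q" using BPQ'(3) u by simp
    then obtain p q where "p \<in> P" "q \<in> Q" "u = p \<oplus>\<^bsub>D\<^esub> q" unfolding set_add_def' by blast
    moreover then obtain x where "x \<in> J" "p = f x" using f(2) unfolding bij_betw_def by blast
    ultimately show "\<exists>q\<in>Q. u = f (h u) \<oplus>\<^bsub>D\<^esub> q" "h u \<in> J" using hI by auto
  qed
  have hadd: "h (u \<oplus>\<^bsub>D\<^esub> v) = h u \<oplus> h v" if u: "u \<in> carrier D" and v: "v \<in> carrier D" for u v
  proof -
    obtain q where q: "q \<in> Q" "u = f (h u) \<oplus>\<^bsub>D\<^esub> q" using hE[OF u] by blast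
    obtain q' where q': "q' \<in> Q" "v = f (h v) \<oplus>\<^bsub>D\<^esub> q'" using hE[OF v] by blast
    have car: "f (h u) \<in> carrier D" "f (h v) \<in> carrier D" "q \<in> carrier D" "q' \<in> carrier D" using q q' hE(2) u v fD Q(1) by auto
    have "u \<oplus>\<^bsub>D\<^esub> v = (f (h u) \<oplus>\<^bsub>D\<^esub> q) \<oplus>\<^bsub>D\<^esub> (f (h v) \<oplus>\<^bsub>D\<^esub> q')" using q q' by simp
    also have "\<dots> = f (h u \<oplus> h v) \<oplus>\<^bsub>D\<^esub> (q \<oplus>\<^bsub>D\<^esub> q')" using car hE(2) u v by (simp add: fadd D.a_ac)
    finally show ?thesis by (rule hI[OF JD(3)[OF hE(2)[OF u] hE(2)[OF v]] Q(5)[OF q(1) q'(1)]])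
  qed
  have hsm: "h (\<phi> \<odot>\<^bsub>D\<^esub> u) = \<phi> (h u)" if \<phi>: "\<phi> \<in> carrier E" and u: "u \<in> carrier D" for \<phi> u
  proof -
    obtain q where q: "q \<in> Q" "u = f (h u) \<oplus>\<^bsub>D\<^esub> q" using hE[OF u] by blast
    have "\<phi> \<odot>\<^bsub>D\<^esub> u = \<phi> \<odot>\<^bsub>D\<^esub> (f (h u) \<oplus>\<^bsub>D\<^esub> q)" using q by simp
    also have "\<dots> = f (\<phi> (h u)) \<oplus>\<^bsub>D\<^esub> (\<phi> \<odot>\<^bsub>D\<^esub> q)" using \<phi> hE(2)[OF u] q(1) Q(1) fD
      by (simp add: D.smult_r_distr fsm subset_iff)
    finally show ?thesis by (rule hI[OF End(1)[OF \<phi> hE(2)[OF u] hE(2)[OF u]] Q(4)[OF \<phi> q(1)]])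
  qed
  define u where "u = f c"
  have u: "u \<in> carrier D" using fD c by (simp add: u_def)
  have uE: "u b \<in> carrier E" if "b \<in> B" for b using u that by (auto simp: Dc PiE_iff)
  obtain d where d: "d \<in> carrier F" "c \<otimes> d = \<one>" using inverse_exists[of c] c JD(1) by metis
  note [simp] = d(1) JD(1)[OF c(1)]
  define y where "y b = d \<otimes> d \<otimes> u b c" for b
  have fxE: "f x b \<in> carrier E" if "b \<in> B" "x \<in> J" for x b using fD[OF that(2)] that by (auto simp: Dc PiE_iff)
  have coord: "f i b j = y b \<otimes> i \<otimes> j" if b: "b \<in> B" and i: "i \<in> J" and j: "j \<in> J" for b i j
  proof -
    have ijc[simp]: "i \<in> carrier F" "j \<in> carrier F" using i j JD by auto
    have mE: "(\<lambda>x\<in>J. r \<otimes> x) \<in> carrier E" if "r \<in> R" for r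
      using mult_in_End[OF J, of r] mult_ring_subring(2)[OF J(1)] that by (auto simp: E_def N_def)
    have ev: "f (r \<otimes> x) b j = r \<otimes> f x b j" if r: "r \<in> R" and x: "x \<in> J" for r x
    proof -
      have "f (r \<otimes> x) = (\<lambda>x\<in>J. r \<otimes> x) \<odot>\<^bsub>D\<^esub> f x" using fsm[OF mE[OF r] x] x by simp
      then have "f (r \<otimes> x) b = compose J (\<lambda>x\<in>J. r \<otimes> x) (f x b)" using b by (simp add: Dsm E_def N_def)
      then show ?thesis using End(1)[OF fxE[OF b x] j j] j by (simp add: compose_def)
    qed
    have cR: "c \<in> R" "i \<in> R" using c i J by auto
    have fj[simp]: "f i b j \<in> carrier F" "u b c \<in> carrier F" "u b j \<in> carrier F"
      using End(1)[OF fxE[OF b i] j j] End(1)[OF uE[OF b] c(1) c(1)] End(1)[OF uE[OF b] j j] JD(1) by auto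
    have 1: "c \<otimes> f i b j = i \<otimes> u b j" using ev[OF cR(1) i] ev[OF cR(2) c(1)] by (simp add: u_def m_comm)
    have 2: "c \<otimes> u b j = j \<otimes> u b c" using End(2)[OF uE[OF b] c(1) j] .
    have "f i b j = d \<otimes> d \<otimes> (c \<otimes> (c \<otimes> f i b j))"
    proof -
      have "d \<otimes> d \<otimes> (c \<otimes> (c \<otimes> f i b j)) = (c \<otimes> d) \<otimes> (c \<otimes> d) \<otimes> f i b j" by (simp add: m_ac)
      then show ?thesis using d by simp
    qed
    also have "c \<otimes> (c \<otimes> f i b j) = i \<otimes> (c \<otimes> u b j)" unfolding 1 by (simp add: m_lcomm)
    also have "\<dots> = i \<otimes> (j \<otimes> u b c)" unfolding 2 ..
    also have "d \<otimes> d \<otimes> (i \<otimes> (j \<otimes> u b c)) = y b \<otimes> i \<otimes> j" unfolding y_def by (simp add: m_ac)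
    finally show ?thesis .
  qed
  have yInv: "y b \<in> Inv J" if b: "b \<in> B" for b
  proof -
    have "y b \<in> carrier F" unfolding y_def using End(1)[OF uE[OF b] c(1) c(1)] JD(1) by simp
    moreover have "y b \<otimes> i \<otimes> j \<in> J" if "i \<in> J" "j \<in> J" for i j
      using coord[OF b that] End(1)[OF fxE[OF b that(1)] that(2) that(2)] by simp
    ultimately show ?thesis by (simp add: Inv_def)
  qed
  define trunc where "trunc W = (\<lambda>i\<in>B. if i \<in> W then u i else \<zero>\<^bsub>E\<^esub>)" for W
  define e where "e b = (\<lambda>i\<in>B. if i = b then \<one>\<^bsub>E\<^esub> else \<zero>\<^bsub>E\<^esub>)" for b
  have trunc: "trunc W \<in> carrier D" if "finite W" for W
  proof -
    have "{i\<in>B. trunc W i \<noteq> \<zero>\<^bsub>E\<^esub>} \<subseteq> W" by (auto simp: trunc_def)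
    then have "finite {i\<in>B. trunc W i \<noteq> \<zero>\<^bsub>E\<^esub>}" using that by (rule finite_subset)
    moreover have "trunc W \<in> B \<rightarrow>\<^sub>E carrier E" using uE E.zero_closed unfolding trunc_def by (simp del: End_ring_simps)
    ultimately show ?thesis unfolding Dc by blast
  qed
  have e: "e b \<in> carrier D" for b
  proof -
    have "{i\<in>B. e b i \<noteq> \<zero>\<^bsub>E\<^esub>} \<subseteq> {b}" by (auto simp: e_def)
    then have "finite {i\<in>B. e b i \<noteq> \<zero>\<^bsub>E\<^esub>}" by (rule finite_subset) simp
    moreover have "e b \<in> B \<rightarrow>\<^sub>E carrier E" using E.one_closed E.zero_closed unfolding e_def by (simp del: End_ring_simps)
    ultimately show ?thesis unfolding Dc by blast
  qed
  have "d \<otimes> h (trunc W) \<in> G" if "finite W" "W \<subseteq> B" for W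
    using that
  proof (induction W rule: finite_induct)
    case empty
    have "trunc {} = \<zero>\<^bsub>D\<^esub>" by (simp add: trunc_def D0)
    moreover have "h \<zero>\<^bsub>D\<^esub> = \<zero>"
    proof -
      have hz: "h \<zero>\<^bsub>D\<^esub> \<in> carrier F" using hE(2)[OF D.zero_closed] JD(1) by simp
      have "h \<zero>\<^bsub>D\<^esub> = h \<zero>\<^bsub>D\<^esub> \<oplus> h \<zero>\<^bsub>D\<^esub>" using hadd[OF D.zero_closed D.zero_closed] by simp
      then show ?thesis using hz by (metis add.r_cancel_one')
    qed
    ultimately show ?case using rmodD(2)[OF G(1)] by simp
  next
    case (insert b W)
    then have b: "b \<in> B" and W: "finite W" "W \<subseteq> B" by auto
    have sm: "u b \<odot>\<^bsub>D\<^esub> e b \<in> carrier D" using e uE[OF b] by simp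
    have "trunc (insert b W) = trunc W \<oplus>\<^bsub>D\<^esub> (u b \<odot>\<^bsub>D\<^esub> e b)"
    proof
      fix i
      show "trunc (insert b W) i = (trunc W \<oplus>\<^bsub>D\<^esub> (u b \<odot>\<^bsub>D\<^esub> e b)) i"
      proof (cases "i \<in> B")
        case True
        then have "u i \<in> carrier E" using uE by blast
        then show ?thesis using True insert.hyps uE[OF b] unfolding trunc_def e_def Dadd Dsm
          by (simp del: End_ring_simps)
      qed (simp add: trunc_def Dadd)
    qed
    then have "h (trunc (insert b W)) = h (trunc W) \<oplus> u b (h (e b))"
      using hadd[OF trunc[OF W(1)] sm] hsm[OF uE[OF b] e] by simp
    moreover have he: "h (e b) \<in> J" using hE(2)[OF e] .
    moreover have "d \<otimes> u b (h (e b)) = h (e b) \<otimes> y b"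
    proof -
      have [simp]: "h (e b) \<in> carrier F" "u b (h (e b)) \<in> carrier F" "u b c \<in> carrier F"
        using he End(1)[OF uE[OF b]] c(1) JD(1) by auto
      have "h (e b) \<otimes> y b = d \<otimes> d \<otimes> (h (e b) \<otimes> u b c)" unfolding y_def by (simp add: m_ac)
      also have "h (e b) \<otimes> u b c = c \<otimes> u b (h (e b))" using End(2)[OF uE[OF b] he c(1)] .
      also have "d \<otimes> d \<otimes> (c \<otimes> u b (h (e b))) = (c \<otimes> d) \<otimes> (d \<otimes> u b (h (e b)))" by (simp add: m_ac)
      finally show ?thesis using d by simp
    qed
    moreover have "h (e b) \<otimes> y b \<in> G" using G(2)[OF he yInv[OF b]] .
    moreover have "d \<otimes> h (trunc W) \<in> G" using insert.IH W by simp
    moreover have "h (trunc W) \<in> carrier F" "u b (h (e b)) \<in> carrier F"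
      using hE(2)[OF trunc[OF W(1)]] End(1)[OF uE[OF b] he he] JD(1) by auto
    ultimately show ?case using rmodD(3)[OF G(1)] by (simp add: r_distr)
  qed
  moreover have "finite {i\<in>B. u i \<noteq> \<zero>\<^bsub>E\<^esub>}" using u unfolding Dc by blast
  moreover have "trunc {i\<in>B. u i \<noteq> \<zero>\<^bsub>E\<^esub>} = u"
  proof
    fix i show "trunc {i\<in>B. u i \<noteq> \<zero>\<^bsub>E\<^esub>} i = u i"
      using u unfolding Dc trunc_def by (cases "i \<in> B") (auto simp: PiE_iff extensional_def simp del: End_ring_simps)
  qed
  moreover have "h u = c"
  proof (rule hI[OF c(1)])
    show "\<zero>\<^bsub>D\<^esub> \<in> Q" using Q(2,3,5) D.r_neg Q(1) by (metis all_not_in_conv subset_iff)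
    show "u = f c \<oplus>\<^bsub>D\<^esub> \<zero>\<^bsub>D\<^esub>" using u by (simp add: u_def)
  qed
  ultimately have "d \<otimes> c \<in> G" by (metis (no_types, lifting) mem_Collect_eq subsetI)
  then show ?thesis using d by (simp add: m_comm)
qed

end

context fraction_field
begin

lemma rmod_neg:
  assumes "rmod J" "x \<in> J" shows "\<ominus> x \<in> J"
  using rmodD(4)[OF assms(1), of "\<ominus> \<one>" x] rmodD(1)[OF assms] assms(2) by (simp add: l_minus)

lemma rmod_module:
  assumes J: "rmod J" shows "module A (module_in F J)"
proof (rule moduleI[OF A_cring])
  note JD = rmodD[OF J]
  show "abelian_group (module_in F J)"
  proof (rule abelian_groupI)
    show "\<exists>y\<in>carrier (module_in F J). y \<oplus>\<^bsub>module_in F J\<^esub> x = \<zero>\<^bsub>module_in F J\<^esub>" if "x \<in> carrier (module_in F J)" for x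
      using that rmod_neg[OF J, of x] JD(1) by (auto intro!: bexI[of _ "\<ominus> x"] simp: l_neg)
  qed (use JD in \<open>auto simp: a_ac\<close>)
qed (use rmodD[OF J] in \<open>auto simp: l_distr r_distr m_assoc\<close>)

lemma submodule_iff_rmod:
  assumes J: "rmod J"
  shows "submodule N A (module_in F J) \<longleftrightarrow> N \<subseteq> J \<and> rmod N"
proof
  interpret J: module A "module_in F J" by (rule rmod_module[OF J])
  assume N: "submodule N A (module_in F J)"
  note NE = J.submoduleE[OF N]
  have "\<zero> \<in> N" using subgroup.one_closed[OF submodule.axioms(1)[OF N]] by simp
  then show "N \<subseteq> J \<and> rmod N" using NE(1,4,5) rmodD(1)[OF J] by (auto simp: rmod_def)
next
  interpret J: module A "module_in F J" by (rule rmod_module[OF J])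
  assume N: "N \<subseteq> J \<and> rmod N"
  show "submodule N A (module_in F J)"
  proof (rule J.submoduleI)
    fix a assume a: "a \<in> N"
    have "\<ominus>\<^bsub>module_in F J\<^esub> a = \<ominus> a"
      using a N rmod_neg[OF J] rmodD(1)[OF J] by (intro J.minus_equality) (auto simp: l_neg)
    then show "\<ominus>\<^bsub>module_in F J\<^esub> a \<in> N" using rmod_neg a N by auto
  qed (use N rmodD in auto)
qed

lemma finite_normalization_if_span:
  assumes e: "e \<in> S" and S: "S = span2 \<one> e"
  shows "finite_normalization F R"
proof -
  have [simp]: "e \<in> carrier F" using e by simp
  have rS: "rmod S" unfolding S by (rule span2_rmod) auto
  have "\<Inter>{N. submodule N A (module_in F S) \<and> {\<one>, e} \<subseteq> N} = S"
  proof (rule equalityI)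
    show "\<Inter>{N. submodule N A (module_in F S) \<and> {\<one>, e} \<subseteq> N} \<subseteq> S"
      using submodule_iff_rmod[OF rS] rS e by (intro Inter_lower) auto
    have "S \<subseteq> N" if "submodule N A (module_in F S)" "{\<one>, e} \<subseteq> N" for N
    proof -
      have N: "rmod N" using that submodule_iff_rmod[OF rS] by blast
      show ?thesis
      proof
        fix s assume "s \<in> S"
        then obtain a b where ab: "a \<in> R" "b \<in> R" "s = a \<otimes> \<one> \<oplus> b \<otimes> e" unfolding S span2_def by blast
        show "s \<in> N" unfolding ab(3) by (intro rmodD(3,4)[OF N] ab) (use that(2) in auto)
      qed
    qed
    then show "S \<subseteq> \<Inter>{N. submodule N A (module_in F S) \<and> {\<one>, e} \<subseteq> N}" by blast
  qed
  moreover have "{\<one>, e} \<subseteq> S" "finite {\<one>, e}" using e by auto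
  ultimately have "\<exists>S'\<subseteq>S. finite S' \<and> \<Inter>{N. submodule N A (module_in F S) \<and> S' \<subseteq> N} = S" by blast
  then show ?thesis unfolding finite_normalization_def fin_gen_mod_def S_def[symmetric] module_in_simps .
qed

lemma bad_imp_nonunit_add:
  assumes "quasilocal A" "m \<in> M" "n \<in> M" shows "m \<oplus> n \<in> M"
proof -
  interpret A: cring A by (rule A_cring)
  have "m \<oplus>\<^bsub>A\<^esub> n \<notin> Units A" using assms Units_A by (intro A.quasilocal_nonunit_add) auto
  then show ?thesis using assms Units_A by auto
qed

lemma stable_imp_invertible:
  assumes stable: "stable_domain A"
    and J: "rmod J" and j: "j \<in> J" "j \<noteq> \<zero>" and d: "d \<in> R" "d \<noteq> \<zero>" and dJ: "\<And>x. x \<in> J \<Longrightarrow> d \<otimes> x \<in> R"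
    and G: "rmod G" "\<And>x y. x \<in> J \<Longrightarrow> y \<in> Inv J \<Longrightarrow> x \<otimes> y \<in> G"
  shows "\<one> \<in> G"
proof -
  note JD = rmodD[OF J]
  define J' where "J' = (\<lambda>x. d \<otimes> x) ` J"
  have "rmod J'"
    unfolding rmod_def
  proof (intro conjI ballI)
    show "J' \<subseteq> carrier F" using JD d by (auto simp: J'_def)
    show "\<zero> \<in> J'" using JD(2) d unfolding J'_def by (intro image_eqI[of _ _ \<zero>]) auto
    show "x \<oplus> y \<in> J'" if xy: "x \<in> J'" "y \<in> J'" for x y
    proof -
      obtain x0 y0 where "x0 \<in> J" "y0 \<in> J" "x = d \<otimes> x0" "y = d \<otimes> y0" using xy by (auto simp: J'_def)
      then show ?thesis unfolding J'_def using JD d by (intro image_eqI[of _ _ "x0 \<oplus> y0"]) (auto simp: r_distr)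
    qed
    show "r \<otimes> x \<in> J'" if r: "r \<in> R" and x: "x \<in> J'" for r x
    proof -
      obtain x0 where "x0 \<in> J" "x = d \<otimes> x0" using x by (auto simp: J'_def)
      then show ?thesis unfolding J'_def using JD d r by (intro image_eqI[of _ _ "r \<otimes> x0"]) (auto simp: m_lcomm)
    qed
  qed
  moreover have "J' \<subseteq> R" using dJ by (auto simp: J'_def)
  ultimately have ideal: "ideal J' A" by (simp add: ideal_A_iff)
  have dj: "d \<otimes> j \<in> J'" "d \<otimes> j \<noteq> \<zero>" using j d JD(1) integral[of d j] by (auto simp: J'_def)
  then have "J' \<noteq> {\<zero>\<^bsub>A\<^esub>}" by auto
  then have "stable_ideal A J'" using stable ideal by (simp add: stable_domain_def)
  then show ?thesis
  proof (rule stable_ideal_invertible[OF _ dj G(1)])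
    fix x' y' assume x': "x' \<in> J'" and y': "y' \<in> Inv J'"
    obtain x where x: "x \<in> J" "x' = d \<otimes> x" using x' by (auto simp: J'_def)
    have c: "y' \<in> carrier F" "d \<in> carrier F" using y' d by (auto simp: Inv_def)
    have "d \<otimes> y' \<otimes> i \<otimes> k \<in> J" if i: "i \<in> J" and k: "k \<in> J" for i k
    proof -
      have ik: "i \<in> carrier F" "k \<in> carrier F" using i k JD(1) by auto
      have "y' \<otimes> (d \<otimes> i) \<otimes> (d \<otimes> k) \<in> J'" using y' i k unfolding Inv_def J'_def by blast
      then obtain l where l: "l \<in> J" "y' \<otimes> (d \<otimes> i) \<otimes> (d \<otimes> k) = d \<otimes> l" by (auto simp: J'_def)
      have "d \<otimes> (d \<otimes> y' \<otimes> i \<otimes> k) = y' \<otimes> (d \<otimes> i) \<otimes> (d \<otimes> k)" using c ik by (simp add: m_ac)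
      then have "d \<otimes> (d \<otimes> y' \<otimes> i \<otimes> k) = d \<otimes> l" using l by simp
      then have "d \<otimes> y' \<otimes> i \<otimes> k = l" using m_lcancel[OF d(2) c(2)] c ik l(1) JD(1) by simp
      then show ?thesis using l by simp
    qed
    then have "d \<otimes> y' \<in> Inv J" using c by (simp add: Inv_def)
    then have "x \<otimes> (d \<otimes> y') \<in> G" using G(2) x by blast
    moreover have "x' \<otimes> y' = x \<otimes> (d \<otimes> y')" unfolding x(2) using c x(1) JD(1) by (simp add: m_ac)
    ultimately show "x' \<otimes> y' \<in> G" by simp
  qed
qed

lemma M_prime:
  assumes add: "\<And>m n. m \<in> M \<Longrightarrow> n \<in> M \<Longrightarrow> m \<oplus> n \<in> M"
  shows "primeideal M A"
proof (rule primeidealI)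
  have "rmod M" using add by (auto simp: rmod_def)
  then show "ideal M A" using M_R by (auto simp: ideal_A_iff)
  show "cring A" by (rule A_cring)
  show "carrier A \<noteq> M"
  proof
    assume "carrier A = M"
    then have "R = M" by simp
    then have "\<one> \<in> M" using R_closed(2) by (rule subst)
    then show False by simp
  qed
  fix a b assume ab: "a \<in> carrier A" "b \<in> carrier A" "a \<otimes>\<^bsub>A\<^esub> b \<in> M"
  show "a \<in> M \<or> b \<in> M"
  proof (rule ccontr)
    assume n: "\<not> ?thesis"
    then obtain i j where ij: "i \<in> R" "a \<otimes> i = \<one>" "j \<in> R" "b \<otimes> j = \<one>" using ab unit_R[of a] unit_R[of b] by auto
    have "a \<otimes> b \<otimes> (i \<otimes> j) \<in> M" using ab ij by simp
    moreover have "a \<otimes> b \<otimes> (i \<otimes> j) = (a \<otimes> i) \<otimes> (b \<otimes> j)" using ab ij(1,3) by (simp add: m_ac)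
    ultimately show False using ij by simp
  qed
qed

lemma krull_dim_one_imp:
  assumes add: "\<And>m n. m \<in> M \<Longrightarrow> n \<in> M \<Longrightarrow> m \<oplus> n \<in> M"
    and dim: "krull_dim A = 1" and r: "r \<in> R" "r \<noteq> \<zero>" and m: "m \<in> M"
  shows "\<exists>k::nat. \<exists>s\<in>R. m [^] k = r \<otimes> s"
proof (rule ccontr)
  assume n: "\<not> ?thesis"
  interpret A: domain A by (rule A_domain)
  have "m [^]\<^bsub>A\<^esub> (k::nat) \<notin> PIdl\<^bsub>A\<^esub> r" for k
  proof
    assume "m [^]\<^bsub>A\<^esub> k \<in> PIdl\<^bsub>A\<^esub> r"
    then obtain x where x: "x \<in> R" "m [^] k = x \<otimes> r" unfolding cgenideal_def pow_A by auto
    then have "m [^] k = r \<otimes> x" using r by (simp add: m_comm)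
    then show False using n x by blast
  qed
  then obtain P where P: "primeideal P A" "r \<in> P" "m \<notin> P"
    using A.exists_prime_avoiding_powers[of r m] r m by auto
  interpret P: primeideal P A by fact
  have "P \<subset> M"
  proof
    show "P \<subseteq> M"
    proof
      fix p assume p: "p \<in> P"
      show "p \<in> M"
      proof (rule ccontr)
        assume "p \<notin> M"
        moreover have pR: "p \<in> R" using p P.a_subset by auto
        ultimately obtain i where "i \<in> R" "p \<otimes> i = \<one>" using unit_R by blast
        then have "\<one> \<in> P" using P.I_r_closed[OF p, of i] by simp
        then show False using P.one_imp_carrier P.I_notcarr by simp
      qed
    qed
    show "P \<noteq> M" using P m by blast
  qed
  moreover have "{\<zero>} \<subset> P" using P r additive_subgroup.zero_closed[OF P.is_additive_subgroup] by auto
  moreover have "primeideal {\<zero>} A" using A.zeroprimeideal by simp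
  moreover have "primeideal M A" using M_prime add by blast
  ultimately have "(\<forall>i\<le>2. primeideal (((\<lambda>_. M)(0 := {\<zero>}, 1 := P)) i) A) \<and>
      (\<forall>i<2. ((\<lambda>_. M)(0 := {\<zero>}, 1 := P)) i \<subset> ((\<lambda>_. M)(0 := {\<zero>}, 1 := P)) (Suc i))"
    using P(1) by (auto simp: less_2_cases_iff)
  then have "enat 2 \<le> krull_dim A" unfolding krull_dim_def by (intro Sup_upper) blast
  then show False using dim by (simp add: one_enat_def)
qed

lemma bad_imp_infinite_stable_local_ring:
  assumes bad: "bad_stable_domain F R"
  shows "infinite_stable_local_ring F R"
proof -
  have q: "quasilocal A" and s: "stable_domain A" and k: "krull_dim A = 1" and f: "\<not> finite_normalization F R"
    using bad by (auto simp: bad_stable_domain_def)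
  show ?thesis
  proof unfold_locales
    show "m \<oplus> n \<in> M" if "m \<in> M" "n \<in> M" for m n using bad_imp_nonunit_add[OF q that] .
    then show "\<exists>k::nat. \<exists>s\<in>R. m [^] k = r \<otimes> s" if "r \<in> R" "r \<noteq> \<zero>" "m \<in> M" for r m
      using krull_dim_one_imp k that by blast
    show "S \<noteq> span2 \<one> e" if "e \<in> S" for e using finite_normalization_if_span[OF that] f by blast
  qed (rule stable_imp_invertible[OF s])
qed

end

context infinite_stable_local_ring
begin

lemma Units_S: "Units (F\<lparr>carrier := S\<rparr>) = {s. Sunit s}"
  unfolding Units_subring[OF S_subring] Sunit_def by auto

lemma S_DVR: "DVR (F\<lparr>carrier := S\<rparr>)"
proof -
  let ?V = "F\<lparr>carrier := S\<rparr>"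
  interpret V: domain ?V by (rule subring_is_domain[OF S_subring])
  obtain x where x: "x \<in> M" "x \<noteq> \<zero>" "\<And>y. y \<in> S \<Longrightarrow> \<not> Sunit y \<Longrightarrow> sdvd x y" using uniformizer by metis
  have xS: "x [^] (k::nat) \<in> S" for k using subring_pow[OF S_subring] x by simp
  have "\<exists>a\<in>carrier ?V. J = PIdl\<^bsub>?V\<^esub> a" if J: "ideal J ?V" for J
  proof (cases "J = {\<zero>}")
    case True
    have "PIdl\<^bsub>?V\<^esub> \<zero> = {\<zero>}" unfolding cgenideal_def using S_closed(1) by (auto intro!: exI[of _ \<zero>])
    then show ?thesis using True by (intro bexI[of _ \<zero>]) simp_all
  next
    case False
    note J' = J[unfolded ideal_subring_iff[OF S_subring]]
    then obtain s where "s \<in> J" "s \<noteq> \<zero>" using False by blast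
    moreover then obtain u k where "Sunit u" "s = x [^] (k::nat) \<otimes> u" using uniformizer_power[OF x] J' by blast
    ultimately have ex: "\<exists>k u. Sunit u \<and> x [^] (k::nat) \<otimes> u \<in> J" by blast
    define k where "k = (LEAST k. \<exists>u. Sunit u \<and> x [^] (k::nat) \<otimes> u \<in> J)"
    obtain u where u: "Sunit u" "x [^] k \<otimes> u \<in> J" using LeastI_ex[OF ex] unfolding k_def by blast
    obtain v where v: "v \<in> S" "u \<otimes> v = \<one>" using u(1) by (elim SunitE)
    have "v \<otimes> (x [^] k \<otimes> u) \<in> J" using J' u v by blast
    moreover have "v \<otimes> (x [^] k \<otimes> u) = x [^] k \<otimes> (u \<otimes> v)" using v(1) u(1) xS by (simp add: m_ac)
    ultimately have xk: "x [^] k \<in> J" using v xS by simp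
    have "J = PIdl\<^bsub>?V\<^esub> (x [^] k)"
    proof (intro equalityI subsetI)
      fix s assume s: "s \<in> J"
      have sS: "s \<in> S" using s J' by blast
      show "s \<in> PIdl\<^bsub>?V\<^esub> (x [^] k)"
      proof (cases "s = \<zero>")
        case True
        then show ?thesis unfolding cgenideal_def using xS by (auto intro!: exI[of _ \<zero>])
      next
        case False
        then obtain w l where wl: "Sunit w" "s = x [^] (l::nat) \<otimes> w" using uniformizer_power[OF x sS] by blast
        have "k \<le> l" unfolding k_def using wl s by (intro Least_le) blast
        then have "x [^] l = x [^] k \<otimes> x [^] (l - k)" using x(1) by (simp add: nat_pow_mult)
        then have "s = (x [^] (l - k) \<otimes> w) \<otimes> x [^] k" unfolding wl(2) using wl(1) xS by (simp add: m_ac)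
        then show ?thesis unfolding cgenideal_def using wl(1) xS by auto
      qed
    next
      fix s assume "s \<in> PIdl\<^bsub>?V\<^esub> (x [^] k)"
      then show "s \<in> J" unfolding cgenideal_def using J' xk by auto
    qed
    then show ?thesis using xS by (intro bexI[of _ "x [^] k"]) simp_all
  qed
  then have "principal_domain ?V" by unfold_locales
  moreover have "quasilocal ?V"
  proof -
    define N where "N = {s \<in> S. \<not> Sunit s}"
    have one_N: "\<one> \<notin> N" by (simp add: N_def)
    have Nid: "ideal N ?V" unfolding ideal_subring_iff[OF S_subring] N_def
      using nonunit_add Sunit_mult by auto
    have sub: "P \<subseteq> N" if P: "ideal P ?V" "P \<noteq> carrier ?V" for P
    proof
      fix p assume p: "p \<in> P"
      note P' = P(1)[unfolded ideal_subring_iff[OF S_subring]]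
      show "p \<in> N"
      proof (rule ccontr)
        assume "p \<notin> N"
        then have "Sunit p" using p P' unfolding N_def by blast
        then obtain v where v: "v \<in> S" "p \<otimes> v = \<one>" by (elim SunitE)
        have "p \<in> carrier F" using p P' by blast
        then have "v \<otimes> p = \<one>" using v by (simp add: m_comm)
        moreover have "v \<otimes> p \<in> P" using P' p v(1) by blast
        ultimately have "P = carrier ?V" using ideal.one_imp_carrier[OF P(1)] by simp
        then show False using P(2) by simp
      qed
    qed
    have NC: "N \<subseteq> carrier ?V" by (auto simp: N_def)
    have NnC: "N \<noteq> carrier ?V"
    proof
      assume "N = carrier ?V"
      then have "N = S" by simp
      then have "\<one> \<in> N" using S_closed(2) by (rule ssubst)
      then show False using one_N by blast
    qed
    have "maximalideal N ?V"
    proof (rule maximalidealI[OF Nid])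
      show "carrier ?V \<noteq> N" using NnC by blast
      show "J = N \<or> J = carrier ?V" if "ideal J ?V" "N \<subseteq> J" "J \<subseteq> carrier ?V" for J
        using sub[OF that(1)] that by blast
    qed
    moreover have "P = N" if P: "maximalideal P ?V" for P
    proof -
      interpret P: maximalideal P ?V by fact
      have "P \<subseteq> N" using sub[OF P.is_ideal] P.I_notcarr by blast
      then have "N = P \<or> N = carrier ?V" using P.I_maximal[OF Nid] NC by blast
      then show ?thesis using NnC by blast
    qed
    ultimately show ?thesis unfolding quasilocal_def using V.is_cring by blast
  qed
  moreover have "\<not> field ?V"
  proof
    assume "field ?V"
    then have "x \<in> Units ?V" using field.field_Units[of ?V] x(1,2) by simp
    then show False unfolding Units_S using Sunit_R x by simp
  qed
  ultimately show ?thesis by (simp add: DVR_def)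
qed

end

locale divisible_torsion_module = infinite_stable_local_ring F R + K: module "F\<lparr>carrier := R\<rparr>" K
  for F :: "('a, 'b) ring_scheme" (structure) and R and K :: "('a, 'c) module" +
  fixes x :: 'a
  assumes x: "x \<in> M" "x \<noteq> \<zero>" and uniformizing: "\<And>y. y \<in> S \<Longrightarrow> \<not> Sunit y \<Longrightarrow> sdvd x y"
    and divisible_K: "\<And>k. k \<in> carrier K \<Longrightarrow> \<exists>k'\<in>carrier K. x \<odot>\<^bsub>K\<^esub> k' = k"
    and torsion_K: "\<And>k. k \<in> carrier K \<Longrightarrow> \<exists>n::nat. x [^] n \<odot>\<^bsub>K\<^esub> k = \<zero>\<^bsub>K\<^esub>"
    and S_linear_K: "\<And>a b s k. \<lbrakk>a \<in> R; b \<in> R; s \<in> S; a = b \<otimes> s; k \<in> carrier K; b \<odot>\<^bsub>K\<^esub> k = \<zero>\<^bsub>K\<^esub>\<rbrakk> \<Longrightarrow> a \<odot>\<^bsub>K\<^esub> k = \<zero>\<^bsub>K\<^esub>"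
begin

lemma xpow_R [simp]: "x [^] (n::nat) \<in> R"
  using subring_pow[OF subring_R] x by simp

lemma x_R [simp]: "x \<in> R"
  using x by simp

lemma xpow_nonzero: "x [^] (n::nat) \<noteq> \<zero>"
  using x by (induction n) (auto dest: integral)

lemma smult_R [simp]: "a \<in> R \<Longrightarrow> k \<in> carrier K \<Longrightarrow> a \<odot>\<^bsub>K\<^esub> k \<in> carrier K"
  using K.smult_closed by simp

lemma smult_assoc: "a \<in> R \<Longrightarrow> b \<in> R \<Longrightarrow> k \<in> carrier K \<Longrightarrow> (a \<otimes> b) \<odot>\<^bsub>K\<^esub> k = a \<odot>\<^bsub>K\<^esub> (b \<odot>\<^bsub>K\<^esub> k)"
  using K.smult_assoc1 by simp

lemma smult_ladd: "a \<in> R \<Longrightarrow> b \<in> R \<Longrightarrow> k \<in> carrier K \<Longrightarrow> (a \<oplus> b) \<odot>\<^bsub>K\<^esub> k = a \<odot>\<^bsub>K\<^esub> k \<oplus>\<^bsub>K\<^esub> b \<odot>\<^bsub>K\<^esub> k"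
  using K.smult_l_distr by simp

lemma smult_radd: "a \<in> R \<Longrightarrow> k \<in> carrier K \<Longrightarrow> l \<in> carrier K \<Longrightarrow> a \<odot>\<^bsub>K\<^esub> (k \<oplus>\<^bsub>K\<^esub> l) = a \<odot>\<^bsub>K\<^esub> k \<oplus>\<^bsub>K\<^esub> a \<odot>\<^bsub>K\<^esub> l"
  using K.smult_r_distr by simp

lemma smult_1 [simp]: "k \<in> carrier K \<Longrightarrow> \<one> \<odot>\<^bsub>K\<^esub> k = k"
  using K.smult_one by simp

lemma smult_0 [simp]: "a \<in> R \<Longrightarrow> a \<odot>\<^bsub>K\<^esub> \<zero>\<^bsub>K\<^esub> = \<zero>\<^bsub>K\<^esub>" "k \<in> carrier K \<Longrightarrow> \<zero> \<odot>\<^bsub>K\<^esub> k = \<zero>\<^bsub>K\<^esub>"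
  using K.smult_r_null K.smult_l_null by simp_all

lemma smult_eqI:
  assumes "a \<in> R" "b \<in> R" "k \<in> carrier K" "(a \<ominus> b) \<odot>\<^bsub>K\<^esub> k = \<zero>\<^bsub>K\<^esub>"
  shows "a \<odot>\<^bsub>K\<^esub> k = b \<odot>\<^bsub>K\<^esub> k"
proof -
  have "a = (a \<ominus> b) \<oplus> b" using assms by (simp add: minus_eq a_assoc l_neg)
  then have "a \<odot>\<^bsub>K\<^esub> k = (a \<ominus> b) \<odot>\<^bsub>K\<^esub> k \<oplus>\<^bsub>K\<^esub> b \<odot>\<^bsub>K\<^esub> k" using smult_ladd[of "a \<ominus> b" b k] assms by simp
  then show ?thesis using assms by simp
qed

definition root :: "'c \<Rightarrow> 'c" where
  "root k = (SOME k'. k' \<in> carrier K \<and> x \<odot>\<^bsub>K\<^esub> k' = k)"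

lemma root: "k \<in> carrier K \<Longrightarrow> root k \<in> carrier K" "k \<in> carrier K \<Longrightarrow> x \<odot>\<^bsub>K\<^esub> root k = k"
  using someI_ex[of "\<lambda>k'. k' \<in> carrier K \<and> x \<odot>\<^bsub>K\<^esub> k' = k"] divisible_K[of k] unfolding root_def by blast+

primrec tower :: "'c \<Rightarrow> nat \<Rightarrow> 'c" where
  "tower k 0 = \<zero>\<^bsub>K\<^esub>"
| "tower k (Suc n) = (if n = 0 then k else root (tower k n))"

definition socle :: "'c set" where
  "socle = {k \<in> carrier K. x \<odot>\<^bsub>K\<^esub> k = \<zero>\<^bsub>K\<^esub>}"

lemma tower_closed: "k \<in> socle \<Longrightarrow> tower k n \<in> carrier K"
  by (induction n) (auto simp: socle_def root)

lemma x_tower: "k \<in> socle \<Longrightarrow> x \<odot>\<^bsub>K\<^esub> tower k (Suc n) = tower k n"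
  using tower_closed[of k n] by (cases n) (auto simp: socle_def root)

lemma xpow_tower: "k \<in> socle \<Longrightarrow> x [^] (m::nat) \<odot>\<^bsub>K\<^esub> tower k (n + m) = tower k n"
proof (induction m)
  case (Suc m)
  have "x [^] Suc m \<odot>\<^bsub>K\<^esub> tower k (n + Suc m) = x [^] m \<odot>\<^bsub>K\<^esub> (x \<odot>\<^bsub>K\<^esub> tower k (Suc (n + m)))"
    using Suc.prems tower_closed by (simp only: nat_pow_Suc add_Suc_right smult_assoc xpow_R x_R)
  also have "x \<odot>\<^bsub>K\<^esub> tower k (Suc (n + m)) = tower k (n + m)" by (rule x_tower[OF Suc.prems])
  also have "x [^] m \<odot>\<^bsub>K\<^esub> tower k (n + m) = tower k n" by (rule Suc.IH[OF Suc.prems])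
  finally show ?case .
qed (simp add: tower_closed)

lemma xpow_tower_zero: "k \<in> socle \<Longrightarrow> x [^] n \<odot>\<^bsub>K\<^esub> tower k n = \<zero>\<^bsub>K\<^esub>"
  using xpow_tower[of k n 0] by simp

text \<open>\<open>z\<close> is congruent to \<open>a / x\<^sup>n\<close> modulo \<open>S\<close>\<close>
definition rep :: "'a \<Rightarrow> nat \<Rightarrow> 'a \<Rightarrow> bool" where
  "rep z n a \<longleftrightarrow> z \<in> carrier F \<and> a \<in> R \<and> (\<exists>s\<in>S. x [^] n \<otimes> z = a \<oplus> x [^] n \<otimes> s)"

lemma repI: "z \<in> carrier F \<Longrightarrow> a \<in> R \<Longrightarrow> s \<in> S \<Longrightarrow> x [^] n \<otimes> z = a \<oplus> x [^] n \<otimes> s \<Longrightarrow> rep z n a"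
  by (auto simp: rep_def)

lemma repE:
  assumes "rep z n a" obtains s where "z \<in> carrier F" "a \<in> R" "s \<in> S" "x [^] n \<otimes> z = a \<oplus> x [^] n \<otimes> s"
  using assms by (auto simp: rep_def)

lemma rep_raise:
  assumes "rep z n a" shows "rep z (n + m) (x [^] m \<otimes> a)"
proof -
  obtain s where s: "z \<in> carrier F" "a \<in> R" "s \<in> S" "x [^] n \<otimes> z = a \<oplus> x [^] n \<otimes> s" using assms by (elim repE)
  have "x [^] (n + m) \<otimes> z = x [^] m \<otimes> (x [^] n \<otimes> z)" using s(1) by (simp flip: nat_pow_mult add: m_ac)
  also have "\<dots> = x [^] m \<otimes> a \<oplus> x [^] (n + m) \<otimes> s" unfolding s(4) using s(2,3)
    by (simp flip: nat_pow_mult add: r_distr m_ac)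
  finally show ?thesis using s by (intro repI) auto
qed

lemma rep_add:
  assumes "rep z n a" "rep w n b" shows "rep (z \<oplus> w) n (a \<oplus> b)"
proof -
  obtain s where s: "z \<in> carrier F" "a \<in> R" "s \<in> S" "x [^] n \<otimes> z = a \<oplus> x [^] n \<otimes> s" using assms(1) by (elim repE)
  obtain t where t: "w \<in> carrier F" "b \<in> R" "t \<in> S" "x [^] n \<otimes> w = b \<oplus> x [^] n \<otimes> t" using assms(2) by (elim repE)
  have "x [^] n \<otimes> (z \<oplus> w) = x [^] n \<otimes> z \<oplus> x [^] n \<otimes> w" using s(1) t(1) by (simp add: r_distr)
  also have "\<dots> = (a \<oplus> b) \<oplus> x [^] n \<otimes> (s \<oplus> t)" unfolding s(4) t(4) using s(2,3) t(2,3) by (simp add: r_distr a_ac)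
  finally show ?thesis using s t by (intro repI[of _ _ "s \<oplus> t"]) auto
qed

lemma rep_smult:
  assumes "rep z n a" "r \<in> R" shows "rep (r \<otimes> z) n (r \<otimes> a)"
proof -
  obtain s where s: "z \<in> carrier F" "a \<in> R" "s \<in> S" "x [^] n \<otimes> z = a \<oplus> x [^] n \<otimes> s" using assms(1) by (elim repE)
  have "x [^] n \<otimes> (r \<otimes> z) = r \<otimes> (x [^] n \<otimes> z)" using s(1) assms(2) by (simp add: m_ac)
  also have "\<dots> = r \<otimes> a \<oplus> x [^] n \<otimes> (r \<otimes> s)" unfolding s(4) using s(2,3) assms(2) by (simp add: r_distr m_lcomm)
  finally show ?thesis using s assms(2) by (intro repI[of _ _ "r \<otimes> s"]) auto
qed

lemma rep_exists:
  assumes z: "z \<in> carrier F" obtains n a where "rep z n a"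
proof -
  obtain a b where ab: "a \<in> R" "b \<in> R" "b \<noteq> \<zero>" "z \<otimes> b = a" using fraction[OF z] by metis
  obtain u n where un: "Sunit u" "b = x [^] (n::nat) \<otimes> u" using uniformizer_power[OF x uniformizing, of b] ab by auto
  obtain v where v: "v \<in> S" "u \<otimes> v = \<one>" using un(1) by (elim SunitE)
  have "x [^] n \<otimes> z = x [^] n \<otimes> z \<otimes> (u \<otimes> v)" using v z by simp
  also have "\<dots> = (z \<otimes> b) \<otimes> v" unfolding un(2) using z un(1) v(1) by (simp add: m_ac)
  finally have "x [^] n \<otimes> z \<in> S" using ab v by simp
  then obtain c s where "c \<in> R" "s \<in> S" "x [^] n \<otimes> z = c \<oplus> x [^] n \<otimes> s" using divisible[OF xpow_R xpow_nonzero] by metis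
  then show ?thesis using that repI[OF z] by blast
qed

lemma rep_unique_aux:
  assumes k: "k \<in> socle" and "rep z n a" "rep w (n + m) b" and zw: "z \<ominus> w \<in> S"
  shows "a \<odot>\<^bsub>K\<^esub> tower k n = b \<odot>\<^bsub>K\<^esub> tower k (n + m)"
proof -
  let ?X = "x [^] (n + m)"
  obtain s where s: "z \<in> carrier F" "x [^] m \<otimes> a \<in> R" "s \<in> S" "?X \<otimes> z = x [^] m \<otimes> a \<oplus> ?X \<otimes> s"
    using rep_raise[OF assms(2), of m] by (elim repE)
  obtain t where t: "w \<in> carrier F" "b \<in> R" "t \<in> S" "?X \<otimes> w = b \<oplus> ?X \<otimes> t" using assms(3) by (elim repE)
  have a: "a \<in> R" using assms(2) by (simp add: rep_def)
  define c where "c = x [^] m \<otimes> a"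
  have [simp]: "?X \<in> carrier F" "c \<in> carrier F" "z \<in> carrier F" "w \<in> carrier F" "b \<in> carrier F" "s \<in> carrier F" "t \<in> carrier F"
    using s t unfolding c_def by auto
  have "c \<ominus> b \<ominus> ?X \<otimes> ((z \<ominus> w) \<ominus> s \<oplus> t) = (\<ominus> \<one>) \<otimes> (?X \<otimes> z \<ominus> (c \<oplus> ?X \<otimes> s)) \<oplus> \<one> \<otimes> (?X \<otimes> w \<ominus> (b \<oplus> ?X \<otimes> t))"
    by (reify ring_reify, rule ring_identityI, simp, simp, code_simp)
  from eq_by_combination2[OF s(4)[folded c_def] t(4) this] have cb: "c \<ominus> b = ?X \<otimes> ((z \<ominus> w) \<ominus> s \<oplus> t)" by simp
  have "(c \<ominus> b) \<odot>\<^bsub>K\<^esub> tower k (n + m) = \<zero>\<^bsub>K\<^esub>"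
    by (rule S_linear_K[OF _ _ _ cb tower_closed[OF k] xpow_tower_zero[OF k]]) (use s t zw in \<open>auto simp: c_def\<close>)
  then have "c \<odot>\<^bsub>K\<^esub> tower k (n + m) = b \<odot>\<^bsub>K\<^esub> tower k (n + m)"
    by (intro smult_eqI) (use s t tower_closed[OF k] in \<open>auto simp: c_def\<close>)
  moreover have "c = a \<otimes> x [^] m" unfolding c_def using a by (simp add: m_comm)
  ultimately show ?thesis using xpow_tower[OF k, of m n] a tower_closed[OF k] by (simp add: smult_assoc)
qed

lemma rep_unique:
  assumes k: "k \<in> socle" and "rep z n a" "rep w m b" and zw: "z \<ominus> w \<in> S"
  shows "a \<odot>\<^bsub>K\<^esub> tower k n = b \<odot>\<^bsub>K\<^esub> tower k m"
proof (cases "n \<le> m")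
  case True
  then show ?thesis using rep_unique_aux[OF assms(1,2) _ zw, of "m - n" b] assms(3) by simp
next
  case False
  have c: "z \<in> carrier F" "w \<in> carrier F" using assms by (auto simp: rep_def)
  have "\<ominus> (z \<ominus> w) \<in> S" using zw by simp
  moreover have "\<ominus> (z \<ominus> w) = w \<ominus> z" using c by (simp add: minus_eq minus_add a_comm)
  ultimately have "w \<ominus> z \<in> S" by simp
  then show ?thesis using rep_unique_aux[OF k assms(3), of z "n - m" a] assms(2) False by simp
qed

text \<open>The embedding of F/S determined by a tower: here on representatives\<close>
definition emb :: "'c \<Rightarrow> 'a \<Rightarrow> 'c" where
  "emb k z = (SOME l. \<exists>n a. rep z n a \<and> l = a \<odot>\<^bsub>K\<^esub> tower k n)"

lemma emb_eq:
  assumes k: "k \<in> socle" and r: "rep z n a" shows "emb k z = a \<odot>\<^bsub>K\<^esub> tower k n"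
proof -
  have "\<exists>m b. rep z m b \<and> emb k z = b \<odot>\<^bsub>K\<^esub> tower k m"
    unfolding emb_def by (rule someI_ex) (use r in blast)
  then obtain m b where mb: "rep z m b" "emb k z = b \<odot>\<^bsub>K\<^esub> tower k m" by blast
  have "z \<in> carrier F" using r by (simp add: rep_def)
  then have "z \<ominus> z \<in> S" by (simp add: minus_self)
  then show ?thesis using rep_unique[OF k r mb(1)] mb(2) by simp
qed

lemma emb_closed: "k \<in> socle \<Longrightarrow> z \<in> carrier F \<Longrightarrow> emb k z \<in> carrier K"
  using rep_exists[of z] emb_eq tower_closed by (metis rep_def smult_R)

lemma emb_cong:
  assumes k: "k \<in> socle" and "z \<in> carrier F" "w \<in> carrier F" "z \<ominus> w \<in> S" shows "emb k z = emb k w"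
proof -
  obtain n a where 1: "rep z n a" using rep_exists[OF assms(2)] by metis
  obtain m b where 2: "rep w m b" using rep_exists[OF assms(3)] by metis
  show ?thesis using emb_eq[OF k 1] emb_eq[OF k 2] rep_unique[OF k 1 2 assms(4)] by simp
qed

lemma emb_add:
  assumes k: "k \<in> socle" and "z \<in> carrier F" "w \<in> carrier F" shows "emb k (z \<oplus> w) = emb k z \<oplus>\<^bsub>K\<^esub> emb k w"
proof -
  obtain n a where 1: "rep z n a" using rep_exists[OF assms(2)] by metis
  obtain m b where 2: "rep w m b" using rep_exists[OF assms(3)] by metis
  have 3: "rep z (n + m) (x [^] m \<otimes> a)" "rep w (n + m) (x [^] n \<otimes> b)"
    using rep_raise[OF 1, of m] rep_raise[OF 2, of n] by (simp_all add: add.commute)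
  show ?thesis using emb_eq[OF k 3(1)] emb_eq[OF k 3(2)] emb_eq[OF k rep_add[OF 3]] 1 2 tower_closed[OF k]
    by (simp add: smult_ladd rep_def)
qed

lemma emb_smult:
  assumes k: "k \<in> socle" and "z \<in> carrier F" "r \<in> R" shows "emb k (r \<otimes> z) = r \<odot>\<^bsub>K\<^esub> emb k z"
proof -
  obtain n a where 1: "rep z n a" using rep_exists[OF assms(2)] by metis
  show ?thesis using emb_eq[OF k 1] emb_eq[OF k rep_smult[OF 1 assms(3)]] 1 tower_closed[OF k] assms(3)
    by (simp add: smult_assoc rep_def)
qed

lemma emb_zero:
  assumes k: "k \<in> socle" and z: "z \<in> S" shows "emb k z = \<zero>\<^bsub>K\<^esub>"
proof -
  have "rep z 0 \<zero>" using z by (intro repI[of _ _ z]) auto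
  then show ?thesis using emb_eq[OF k] tower_closed[OF k] by simp
qed

definition independent :: "'c set \<Rightarrow> bool" where
  "independent B \<longleftrightarrow> B \<subseteq> socle \<and> (\<forall>W a. finite W \<longrightarrow> W \<subseteq> B \<longrightarrow> a \<in> W \<rightarrow> R \<longrightarrow>
     finsum K (\<lambda>i. a i \<odot>\<^bsub>K\<^esub> i) W = \<zero>\<^bsub>K\<^esub> \<longrightarrow> (\<forall>i\<in>W. a i \<in> M))"

lemma socle_closed [simp]: "i \<in> socle \<Longrightarrow> i \<in> carrier K"
  by (simp add: socle_def)

lemma M_socle: "m \<in> M \<Longrightarrow> k \<in> socle \<Longrightarrow> m \<odot>\<^bsub>K\<^esub> k = \<zero>\<^bsub>K\<^esub>"
proof -
  assume m: "m \<in> M" and k: "k \<in> socle"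
  obtain s where s: "s \<in> S" "m = x \<otimes> s" using uniformizing[of m] Sunit_R[of m] m by (auto elim: sdvdE)
  have "x \<odot>\<^bsub>K\<^esub> k = \<zero>\<^bsub>K\<^esub>" using k unfolding socle_def by blast
  then show ?thesis by (intro S_linear_K[OF _ _ s]) (use m k in simp_all)
qed

lemma socle_basis:
  obtains B where "independent B"
    "\<And>k. k \<in> socle \<Longrightarrow> \<exists>W a. finite W \<and> W \<subseteq> B \<and> a \<in> W \<rightarrow> R \<and> k = finsum K (\<lambda>i. a i \<odot>\<^bsub>K\<^esub> i) W"
proof -
  have "\<exists>B\<in>{B. independent B}. \<forall>B'\<in>{B. independent B}. B \<subseteq> B' \<longrightarrow> B' = B"
  proof (rule subset_Zorn_nonempty)
    have "independent {}" by (auto simp: independent_def)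
    then show "{B. independent B} \<noteq> {}" by blast
    fix C assume C: "C \<noteq> {}" "subset.chain {B. independent B} C"
    have "independent (\<Union>C)"
      unfolding independent_def
    proof (intro conjI allI impI)
      show "\<Union>C \<subseteq> socle"
      proof (rule Union_least)
        fix B assume "B \<in> C"
        then have "independent B" using C(2) by (auto simp: pred_on.chain_def)
        then show "B \<subseteq> socle" by (simp add: independent_def)
      qed
      fix W a assume W: "finite W" "W \<subseteq> \<Union>C" "a \<in> W \<rightarrow> R" "finsum K (\<lambda>i. a i \<odot>\<^bsub>K\<^esub> i) W = \<zero>\<^bsub>K\<^esub>"
      obtain B where B: "B \<in> C" "W \<subseteq> B" by (rule finite_subset_Union_chain[OF W(1,2) C])
      have "independent B" using subsetD[of C "{B. independent B}" B] C(2) B(1) by (simp add: pred_on.chain_def)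
      then show "\<forall>i\<in>W. a i \<in> M" using W(1,3,4) B(2) unfolding independent_def by (elim conjE allE[of _ W] allE[of _ a]) simp
    qed
    then show "\<Union>C \<in> {B. independent B}" by simp
  qed
  then obtain B where B: "independent B" "\<And>B'. independent B' \<Longrightarrow> B \<subseteq> B' \<Longrightarrow> B' = B" by blast
  have Bs: "B \<subseteq> socle" using B(1) by (simp add: independent_def)
  have "\<exists>W a. finite W \<and> W \<subseteq> B \<and> a \<in> W \<rightarrow> R \<and> k = finsum K (\<lambda>i. a i \<odot>\<^bsub>K\<^esub> i) W" if k: "k \<in> socle" for k
  proof (cases "k \<in> B")
    case True
    then show ?thesis using k by (intro exI[of _ "{k}"] exI[of _ "\<lambda>_. \<one>"]) simp
  next
    case False
    have "\<not> independent (insert k B)" using B(2)[of "insert k B"] False by blast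
    then obtain W a i where W: "finite W" "W \<subseteq> insert k B" "a \<in> W \<rightarrow> R" "finsum K (\<lambda>i. a i \<odot>\<^bsub>K\<^esub> i) W = \<zero>\<^bsub>K\<^esub>"
      and i: "i \<in> W" "a i \<notin> M" using Bs k unfolding independent_def by blast
    define W' where "W' = W - {k}"
    have W': "finite W'" "W' \<subseteq> B" "a \<in> W' \<rightarrow> R" "k \<notin> W'" using W by (auto simp: W'_def)
    have cl: "(\<lambda>i. a i \<odot>\<^bsub>K\<^esub> i) \<in> W' \<rightarrow> carrier K" using W' Bs by (auto simp: Pi_def subset_iff)
    have kW: "k \<in> W"
    proof (rule ccontr)
      assume "k \<notin> W"
      then have "W \<subseteq> B" using W(2) by blast
      then show False using B(1) W i unfolding independent_def by blast
    qed
    have ak: "a k \<in> R" using W(3) kW by auto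
    have "W = insert k W'" using kW by (auto simp: W'_def)
    then have sum: "a k \<odot>\<^bsub>K\<^esub> k \<oplus>\<^bsub>K\<^esub> finsum K (\<lambda>i. a i \<odot>\<^bsub>K\<^esub> i) W' = \<zero>\<^bsub>K\<^esub>"
      using W(4) K.finsum_insert[OF W'(1,4) cl] ak k by simp
    let ?s = "finsum K (\<lambda>i. a i \<odot>\<^bsub>K\<^esub> i) W'"
    have s: "?s \<in> carrier K" using cl by (rule K.finsum_closed)
    have akM: "a k \<notin> M"
    proof
      assume akM: "a k \<in> M"
      then have "?s = \<zero>\<^bsub>K\<^esub>" using sum M_socle[OF akM k] s by simp
      then have "\<forall>i\<in>W'. a i \<in> M" using B(1) W' unfolding independent_def by blast
      then show False using i akM by (auto simp: W'_def)
    qed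
    then obtain j where j: "j \<in> R" "a k \<otimes> j = \<one>" using unit_R[OF ak] by blast
    have "j \<odot>\<^bsub>K\<^esub> (a k \<odot>\<^bsub>K\<^esub> k \<oplus>\<^bsub>K\<^esub> ?s) = k \<oplus>\<^bsub>K\<^esub> j \<odot>\<^bsub>K\<^esub> ?s"
    proof -
      have "j \<odot>\<^bsub>K\<^esub> (a k \<odot>\<^bsub>K\<^esub> k) = (a k \<otimes> j) \<odot>\<^bsub>K\<^esub> k" using j(1) ak k by (simp add: m_comm[of "a k" j] flip: smult_assoc)
      then show ?thesis using j ak k s by (simp add: smult_radd)
    qed
    then have k0: "k \<oplus>\<^bsub>K\<^esub> j \<odot>\<^bsub>K\<^esub> ?s = \<zero>\<^bsub>K\<^esub>" using sum j by simp
    have "(\<ominus> j) \<odot>\<^bsub>K\<^esub> ?s = k"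
    proof -
      have js: "(\<ominus> j) \<odot>\<^bsub>K\<^esub> ?s \<oplus>\<^bsub>K\<^esub> j \<odot>\<^bsub>K\<^esub> ?s = \<zero>\<^bsub>K\<^esub>" using smult_ladd[of "\<ominus> j" j ?s] j s by (simp add: l_neg)
      have cs: "(\<ominus> j) \<odot>\<^bsub>K\<^esub> ?s \<in> carrier K" "j \<odot>\<^bsub>K\<^esub> ?s \<in> carrier K" using j(1) s by (auto intro!: smult_R)
      have "(\<ominus> j) \<odot>\<^bsub>K\<^esub> ?s \<oplus>\<^bsub>K\<^esub> j \<odot>\<^bsub>K\<^esub> ?s = k \<oplus>\<^bsub>K\<^esub> j \<odot>\<^bsub>K\<^esub> ?s" by (simp only: js k0)
      then show ?thesis using K.M.add.right_cancel[OF cs(2,1) socle_closed[OF k]] by blast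
    qed
    moreover have "(\<ominus> j) \<odot>\<^bsub>K\<^esub> ?s = finsum K (\<lambda>i. (\<ominus> j) \<odot>\<^bsub>K\<^esub> (a i \<odot>\<^bsub>K\<^esub> i)) W'"
      by (rule K.finsum_smult_ldistr[OF W'(1) _ cl]) (use j in simp)
    moreover have "\<dots> = finsum K (\<lambda>i. (\<ominus> j \<otimes> a i) \<odot>\<^bsub>K\<^esub> i) W'"
      by (rule K.finsum_cong'[OF refl]) (use j W' Bs in \<open>auto simp: Pi_def smult_assoc subset_iff\<close>)
    ultimately have "k = finsum K (\<lambda>i. (\<ominus> j \<otimes> a i) \<odot>\<^bsub>K\<^esub> i) W'" by simp
    moreover have "(\<lambda>i. \<ominus> j \<otimes> a i) \<in> W' \<rightarrow> R" using j W' by auto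
    ultimately show ?thesis using W' by (intro exI[of _ W'] exI[of _ "\<lambda>i. \<ominus> j \<otimes> a i"]) simp
  qed
  then show ?thesis using that B(1) by blast
qed

end

lemma mod_isomorphic_sym:
  assumes M: "module B M" and N: "module B N" and iso: "mod_isomorphic B M N"
  shows "mod_isomorphic B N M"
proof -
  interpret M: module B M by fact
  interpret N: module B N by fact
  obtain f where f: "f \<in> mod_hom B M N" "bij_betw f (carrier M) (carrier N)" using iso by (auto simp: mod_isomorphic_def)
  define g where "g = inv_into (carrier M) f"
  have g: "g y \<in> carrier M" "f (g y) = y" if "y \<in> carrier N" for y
    using f(2) that unfolding g_def bij_betw_def by (auto intro: inv_into_into f_inv_into_f)
  have gf: "g (f x) = x" if "x \<in> carrier M" for x using f(2) that unfolding g_def bij_betw_def by simp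
  have "g (x \<oplus>\<^bsub>N\<^esub> y) = g x \<oplus>\<^bsub>M\<^esub> g y" if "x \<in> carrier N" "y \<in> carrier N" for x y
  proof -
    have "f (g x \<oplus>\<^bsub>M\<^esub> g y) = x \<oplus>\<^bsub>N\<^esub> y" using f(1) g that by (simp add: mod_hom_def)
    then show ?thesis using gf[of "g x \<oplus>\<^bsub>M\<^esub> g y"] g that by simp
  qed
  moreover have "g (a \<odot>\<^bsub>N\<^esub> x) = a \<odot>\<^bsub>M\<^esub> g x" if "a \<in> carrier B" "x \<in> carrier N" for a x
  proof -
    have "f (a \<odot>\<^bsub>M\<^esub> g x) = a \<odot>\<^bsub>N\<^esub> x" using f(1) g that by (simp add: mod_hom_def)
    then show ?thesis using gf[of "a \<odot>\<^bsub>M\<^esub> g x"] g that by simp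
  qed
  ultimately have "g \<in> mod_hom B N M" using g by (simp add: mod_hom_def)
  moreover have "bij_betw g (carrier N) (carrier M)" unfolding g_def using f(2) by (rule bij_betw_inv_into)
  ultimately show ?thesis unfolding mod_isomorphic_def by blast
qed

context fraction_field
begin

definition cs :: "'a set \<Rightarrow> 'a \<Rightarrow> 'a set" where
  "cs Y x = {h \<oplus> x |h. h \<in> Y}"

abbreviation Quo :: "'a set \<Rightarrow> 'a set \<Rightarrow> ('a, 'a set) module" where
  "Quo Z Y \<equiv> quotient_mod (module_in F Z) Y"

lemma r_coset_module_in: "Y +>\<^bsub>module_in F Z\<^esub> x = cs Y x"
  by (auto simp: a_r_coset_def' cs_def)

lemma cs_eq_iff:
  assumes Y: "rmod Y" and [simp]: "x \<in> carrier F" "y \<in> carrier F"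
  shows "cs Y x = cs Y y \<longleftrightarrow> x \<ominus> y \<in> Y"
proof
  assume eq: "cs Y x = cs Y y"
  have "\<zero> \<oplus> x \<in> cs Y x" using rmodD(2)[OF Y] unfolding cs_def by blast
  then obtain h where h: "h \<in> Y" "x = h \<oplus> y" unfolding eq by (auto simp: cs_def)
  then have "x \<ominus> y = h" using rmodD(1)[OF Y h(1)] by (simp add: minus_eq a_assoc r_neg)
  then show "x \<ominus> y \<in> Y" using h by simp
next
  assume d: "x \<ominus> y \<in> Y"
  have *: "cs Y x \<subseteq> cs Y y" if [simp]: "x \<in> carrier F" "y \<in> carrier F" and d: "x \<ominus> y \<in> Y" for x y
  proof
    fix z assume "z \<in> cs Y x"
    then obtain h where h: "h \<in> Y" "z = h \<oplus> x" by (auto simp: cs_def)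
    have [simp]: "h \<in> carrier F" using h rmodD(1)[OF Y] by blast
    have "z = (h \<oplus> (x \<ominus> y)) \<oplus> y" unfolding h(2) by (reify ring_reify, rule ring_identityI, simp, simp, code_simp)
    then show "z \<in> cs Y y" using rmodD(3)[OF Y h(1) d] unfolding cs_def by blast
  qed
  have "y \<ominus> x = \<ominus> (x \<ominus> y)" by (reify ring_reify, rule ring_identityI, simp, simp, code_simp)
  then have "y \<ominus> x \<in> Y" using rmod_neg[OF Y d] by simp
  then show "cs Y x = cs Y y" using *[of x y] *[of y x] d by auto
qed

lemma cs_zero: assumes "rmod Y" shows "cs Y \<zero> = Y"
  using rmodD(1)[OF assms] by (force simp: cs_def)

lemma Quo_carrier: "carrier (Quo Z Y) = cs Y ` Z"
  unfolding quotient_mod_def A_RCOSETS_def' r_coset_module_in by auto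

lemma Quo_zero: "\<zero>\<^bsub>Quo Z Y\<^esub> = Y"
  by (simp add: quotient_mod_def)

lemma Quo_add:
  assumes Y: "rmod Y" and [simp]: "x \<in> carrier F" "y \<in> carrier F"
  shows "cs Y x \<oplus>\<^bsub>Quo Z Y\<^esub> cs Y y = cs Y (x \<oplus> y)"
proof -
  have "cs Y x \<oplus>\<^bsub>Quo Z Y\<^esub> cs Y y = {(h \<oplus> x) \<oplus> (k \<oplus> y) |h k. h \<in> Y \<and> k \<in> Y}"
    unfolding quotient_mod_def by (auto simp: set_add_def' cs_def)
  also have "\<dots> = cs Y (x \<oplus> y)"
  proof (intro equalityI subsetI)
    fix z assume "z \<in> {(h \<oplus> x) \<oplus> (k \<oplus> y) |h k. h \<in> Y \<and> k \<in> Y}"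
    then obtain h k where hk: "h \<in> Y" "k \<in> Y" "z = (h \<oplus> x) \<oplus> (k \<oplus> y)" by blast
    then have "z = (h \<oplus> k) \<oplus> (x \<oplus> y)" using rmodD(1)[OF Y] by (simp add: a_ac)
    then show "z \<in> cs Y (x \<oplus> y)" using rmodD(3)[OF Y hk(1,2)] unfolding cs_def by blast
  next
    fix z assume "z \<in> cs Y (x \<oplus> y)"
    then obtain h where h: "h \<in> Y" "z = h \<oplus> (x \<oplus> y)" by (auto simp: cs_def)
    then have "z = (h \<oplus> x) \<oplus> (\<zero> \<oplus> y)" using rmodD(1)[OF Y] by (simp add: a_assoc)
    then show "z \<in> {(h \<oplus> x) \<oplus> (k \<oplus> y) |h k. h \<in> Y \<and> k \<in> Y}" using h(1) rmodD(2)[OF Y] by blast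
  qed
  finally show ?thesis .
qed

lemma Quo_smult:
  assumes Y: "rmod Y" and x[simp]: "x \<in> carrier F" and r[simp]: "r \<in> R"
  shows "r \<odot>\<^bsub>Quo Z Y\<^esub> cs Y x = cs Y (r \<otimes> x)"
proof -
  have "r \<odot>\<^bsub>Quo Z Y\<^esub> cs Y x = (\<Union>z\<in>cs Y x. cs Y (r \<otimes> z))"
    unfolding quotient_mod_def by (simp add: r_coset_module_in)
  moreover have "cs Y (r \<otimes> z) = cs Y (r \<otimes> x)" if z: "z \<in> cs Y x" for z
  proof -
    obtain h where h: "h \<in> Y" "z = h \<oplus> x" using z by (auto simp: cs_def)
    have [simp]: "h \<in> carrier F" using h rmodD(1)[OF Y] by blast
    have "r \<otimes> z \<ominus> r \<otimes> x = r \<otimes> h" unfolding h(2) by (reify ring_reify, rule ring_identityI, simp, simp, code_simp)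
    then show ?thesis using cs_eq_iff[OF Y, of "r \<otimes> z" "r \<otimes> x"] rmodD(4)[OF Y r h(1)] by (simp add: h(2))
  qed
  moreover have "cs Y x \<noteq> {}" using rmodD(2)[OF Y] by (auto simp: cs_def)
  ultimately show ?thesis by auto
qed

lemma Quo_module:
  assumes Y: "rmod Y" and Z: "rmod Z" and sub: "Y \<subseteq> Z"
  shows "module A (Quo Z Y)"
proof -
  note ZD = rmodD[OF Z]
  have rep: "\<exists>x\<in>Z. C = cs Y x" if "C \<in> carrier (Quo Z Y)" for C using that by (auto simp: Quo_carrier)
  have cl: "cs Y x \<in> carrier (Quo Z Y)" if "x \<in> Z" for x using that by (simp add: Quo_carrier)
  note add = Quo_add[OF Y ZD(1) ZD(1)] and sm = Quo_smult[OF Y ZD(1)]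
  have zero: "\<zero>\<^bsub>Quo Z Y\<^esub> = cs Y \<zero>" by (simp add: Quo_zero cs_zero[OF Y])
  show ?thesis
  proof (rule moduleI[OF A_cring])
    show "abelian_group (Quo Z Y)"
    proof (rule abelian_groupI)
      show "C \<oplus>\<^bsub>Quo Z Y\<^esub> D \<in> carrier (Quo Z Y)" if CD: "C \<in> carrier (Quo Z Y)" "D \<in> carrier (Quo Z Y)" for C D
        using rep[OF CD(1)] rep[OF CD(2)] add cl ZD(3) by auto
      show "C \<oplus>\<^bsub>Quo Z Y\<^esub> D = D \<oplus>\<^bsub>Quo Z Y\<^esub> C" if CD: "C \<in> carrier (Quo Z Y)" "D \<in> carrier (Quo Z Y)" for C D
        using rep[OF CD(1)] rep[OF CD(2)] add ZD(1) by (auto simp: a_comm)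
      show "C \<oplus>\<^bsub>Quo Z Y\<^esub> D \<oplus>\<^bsub>Quo Z Y\<^esub> G = C \<oplus>\<^bsub>Quo Z Y\<^esub> (D \<oplus>\<^bsub>Quo Z Y\<^esub> G)"
        if CD: "C \<in> carrier (Quo Z Y)" "D \<in> carrier (Quo Z Y)" "G \<in> carrier (Quo Z Y)" for C D G
        using rep[OF CD(1)] rep[OF CD(2)] rep[OF CD(3)] add ZD(1,3) by (auto simp: a_assoc)
      show "\<zero>\<^bsub>Quo Z Y\<^esub> \<in> carrier (Quo Z Y)" unfolding zero by (rule cl[OF ZD(2)])
      show "\<zero>\<^bsub>Quo Z Y\<^esub> \<oplus>\<^bsub>Quo Z Y\<^esub> C = C" if C: "C \<in> carrier (Quo Z Y)" for C
        unfolding zero using rep[OF C] add[OF ZD(2)] ZD(1) by auto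
      show "\<exists>D\<in>carrier (Quo Z Y). D \<oplus>\<^bsub>Quo Z Y\<^esub> C = \<zero>\<^bsub>Quo Z Y\<^esub>" if C: "C \<in> carrier (Quo Z Y)" for C
      proof -
        obtain x where x: "x \<in> Z" "C = cs Y x" using rep[OF C] by blast
        have "cs Y (\<ominus> x) \<oplus>\<^bsub>Quo Z Y\<^esub> cs Y x = cs Y \<zero>" using add[OF rmod_neg[OF Z x(1)] x(1)] ZD(1)[OF x(1)] by (simp add: l_neg)
        then show ?thesis unfolding zero x(2) using cl[OF rmod_neg[OF Z x(1)]] by blast
      qed
    qed
    show "a \<odot>\<^bsub>Quo Z Y\<^esub> C \<in> carrier (Quo Z Y)" if a: "a \<in> carrier A" and C: "C \<in> carrier (Quo Z Y)" for a C
    proof -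
      obtain x where x: "x \<in> Z" "C = cs Y x" using rep[OF C] by blast
      show ?thesis unfolding x(2) using sm[OF x(1)] cl[OF ZD(4)[OF _ x(1)]] a by simp
    qed
    show "(a \<oplus>\<^bsub>A\<^esub> b) \<odot>\<^bsub>Quo Z Y\<^esub> C = a \<odot>\<^bsub>Quo Z Y\<^esub> C \<oplus>\<^bsub>Quo Z Y\<^esub> b \<odot>\<^bsub>Quo Z Y\<^esub> C"
      if ab: "a \<in> carrier A" "b \<in> carrier A" and C: "C \<in> carrier (Quo Z Y)" for a b C
    proof -
      obtain x where x: "x \<in> Z" "C = cs Y x" using rep[OF C] by blast
      show ?thesis unfolding x(2) using ab by (simp add: x(1) sm add ZD l_distr)
    qed
    show "a \<odot>\<^bsub>Quo Z Y\<^esub> (C \<oplus>\<^bsub>Quo Z Y\<^esub> D) = a \<odot>\<^bsub>Quo Z Y\<^esub> C \<oplus>\<^bsub>Quo Z Y\<^esub> a \<odot>\<^bsub>Quo Z Y\<^esub> D"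
      if a: "a \<in> carrier A" and C: "C \<in> carrier (Quo Z Y)" and D: "D \<in> carrier (Quo Z Y)" for a C D
    proof -
      obtain x y where x: "x \<in> Z" "C = cs Y x" and y: "y \<in> Z" "D = cs Y y" using rep[OF C] rep[OF D] by blast
      show ?thesis unfolding x(2) y(2) using a by (simp add: x(1) y(1) sm add ZD r_distr)
    qed
    show "(a \<otimes>\<^bsub>A\<^esub> b) \<odot>\<^bsub>Quo Z Y\<^esub> C = a \<odot>\<^bsub>Quo Z Y\<^esub> (b \<odot>\<^bsub>Quo Z Y\<^esub> C)"
      if ab: "a \<in> carrier A" "b \<in> carrier A" and C: "C \<in> carrier (Quo Z Y)" for a b C
    proof -
      obtain x where x: "x \<in> Z" "C = cs Y x" using rep[OF C] by blast
      show ?thesis unfolding x(2) using ab by (simp add: x(1) sm ZD m_assoc)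
    qed
    show "\<one>\<^bsub>A\<^esub> \<odot>\<^bsub>Quo Z Y\<^esub> C = C" if C: "C \<in> carrier (Quo Z Y)" for C
    proof -
      obtain x where x: "x \<in> Z" "C = cs Y x" using rep[OF C] by blast
      show ?thesis unfolding x(2) using sm[OF x(1), of \<one>] ZD(1)[OF x(1)] by simp
    qed
  qed
qed

lemma carrier_rmod: "rmod (carrier F)"
  by (auto simp: rmod_def)

end

context stable_local_ring
begin

lemma S_rmod: "rmod S"
  by (auto simp: rmod_def)

lemma Quo_F_S_module: "module A (Quo (carrier F) S)"
  by (rule Quo_module[OF S_rmod carrier_rmod]) auto

lemma Quo_S_R_module: "module A (Quo S R)"
  by (rule Quo_module[OF rmod_R S_rmod R_subset_S])

end

context divisible_torsion_module
begin

abbreviation "L \<equiv> Quo (carrier F) S"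

definition pick :: "'a set \<Rightarrow> 'a" where
  "pick C = (SOME z. z \<in> carrier F \<and> C = cs S z)"

lemma pick: "C \<in> carrier L \<Longrightarrow> pick C \<in> carrier F" "C \<in> carrier L \<Longrightarrow> cs S (pick C) = C"
  using someI_ex[of "\<lambda>z. z \<in> carrier F \<and> C = cs S z"] unfolding pick_def Quo_carrier by blast+

definition emb_Quo :: "'c \<Rightarrow> 'a set \<Rightarrow> 'c" where
  "emb_Quo k C = emb k (pick C)"

lemma emb_Quo_cs:
  assumes k: "k \<in> socle" and z: "z \<in> carrier F" shows "emb_Quo k (cs S z) = emb k z"
proof -
  have C: "cs S z \<in> carrier L" using z by (simp add: Quo_carrier)
  have "pick (cs S z) \<ominus> z \<in> S" using pick[OF C] z cs_eq_iff[OF S_rmod, of "pick (cs S z)" z] by simp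
  then show ?thesis unfolding emb_Quo_def using emb_cong[OF k pick(1)[OF C] z] by blast
qed

lemma emb_Quo_closed: "k \<in> socle \<Longrightarrow> C \<in> carrier L \<Longrightarrow> emb_Quo k C \<in> carrier K"
  unfolding emb_Quo_def using emb_closed pick by blast

lemma emb_Quo_add:
  assumes k: "k \<in> socle" and C: "C \<in> carrier L" and D: "D \<in> carrier L"
  shows "emb_Quo k (C \<oplus>\<^bsub>L\<^esub> D) = emb_Quo k C \<oplus>\<^bsub>K\<^esub> emb_Quo k D"
proof -
  obtain z w where z: "z \<in> carrier F" "C = cs S z" and w: "w \<in> carrier F" "D = cs S w" using C D by (auto simp: Quo_carrier)
  have "C \<oplus>\<^bsub>L\<^esub> D = cs S (z \<oplus> w)" unfolding z(2) w(2) by (rule Quo_add[OF S_rmod z(1) w(1)])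
  then show ?thesis using z w by (simp add: emb_Quo_cs[OF k] emb_add[OF k])
qed

lemma emb_Quo_smult:
  assumes k: "k \<in> socle" and C: "C \<in> carrier L" and r: "r \<in> R"
  shows "emb_Quo k (r \<odot>\<^bsub>L\<^esub> C) = r \<odot>\<^bsub>K\<^esub> emb_Quo k C"
proof -
  obtain z where z: "z \<in> carrier F" "C = cs S z" using C by (auto simp: Quo_carrier)
  have "r \<odot>\<^bsub>L\<^esub> C = cs S (r \<otimes> z)" unfolding z(2) by (rule Quo_smult[OF S_rmod z(1) r])
  then show ?thesis using z r by (simp add: emb_Quo_cs[OF k] emb_smult[OF k])
qed

lemma emb_Quo_zero: "k \<in> socle \<Longrightarrow> emb_Quo k \<zero>\<^bsub>L\<^esub> = \<zero>\<^bsub>K\<^esub>"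
  using emb_Quo_cs[of k \<zero>] emb_zero[of k \<zero>] cs_zero[OF S_rmod] by (simp add: Quo_zero)

definition sum_map :: "'c set \<Rightarrow> ('c \<Rightarrow> 'a set) \<Rightarrow> 'c" where
  "sum_map B f = finsum K (\<lambda>i. emb_Quo i (f i)) {i \<in> B. f i \<noteq> \<zero>\<^bsub>L\<^esub>}"

lemma sum_map_eq:
  assumes B: "B \<subseteq> socle" and f: "f \<in> carrier (direct_sum B (\<lambda>_. L))"
    and W: "finite W" "{i \<in> B. f i \<noteq> \<zero>\<^bsub>L\<^esub>} \<subseteq> W" "W \<subseteq> B"
  shows "sum_map B f = finsum K (\<lambda>i. emb_Quo i (f i)) W"
  unfolding sum_map_def
proof (rule K.M.add.finprod_mono_neutral_cong_left[OF W(1,2)])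
  show "emb_Quo i (f i) = \<zero>\<^bsub>K\<^esub>" if "i \<in> W - {i \<in> B. f i \<noteq> \<zero>\<^bsub>L\<^esub>}" for i
    using that W(3) B emb_Quo_zero by auto
  show "(\<lambda>i. emb_Quo i (f i)) \<in> W \<rightarrow> carrier K"
  proof
    fix i assume "i \<in> W"
    then have i: "i \<in> B" using W(3) by blast
    then have "f i \<in> carrier L" using f by (auto simp: PiE_iff)
    then show "emb_Quo i (f i) \<in> carrier K" using B i emb_Quo_closed by blast
  qed
qed auto

lemma sum_map_hom:
  assumes B: "B \<subseteq> socle"
  shows "sum_map B \<in> mod_hom A (direct_sum B (\<lambda>_. L)) K"
proof -
  let ?D = "direct_sum B (\<lambda>_. L)"
  interpret D: module A ?D by (rule direct_sum_module[OF A_cring Quo_F_S_module])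
  have cl: "(\<lambda>i. emb_Quo i (f i)) \<in> W \<rightarrow> carrier K" if f: "f \<in> carrier ?D" and W: "W \<subseteq> B" for f W
  proof
    fix i assume "i \<in> W"
    then have i: "i \<in> B" using W by blast
    then have "f i \<in> carrier L" using f by (auto simp: PiE_iff)
    then show "emb_Quo i (f i) \<in> carrier K" using B i emb_Quo_closed by blast
  qed
  let ?supp = "\<lambda>f. {i \<in> B. f i \<noteq> \<zero>\<^bsub>L\<^esub>}"
  have fin: "finite (?supp f)" if "f \<in> carrier ?D" for f using that by simp
  have "sum_map B f \<in> carrier K" if "f \<in> carrier ?D" for f
    unfolding sum_map_def using cl[OF that] by (intro K.finsum_closed) auto
  moreover have "sum_map B (f \<oplus>\<^bsub>?D\<^esub> g) = sum_map B f \<oplus>\<^bsub>K\<^esub> sum_map B g" if f: "f \<in> carrier ?D" and g: "g \<in> carrier ?D" for f g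
  proof -
    define W where "W = ?supp f \<union> ?supp g \<union> ?supp (f \<oplus>\<^bsub>?D\<^esub> g)"
    have fg: "f \<oplus>\<^bsub>?D\<^esub> g \<in> carrier ?D" using f g by (rule D.M.a_closed)
    have W: "finite W" "W \<subseteq> B" using fin[OF f] fin[OF g] fin[OF fg] unfolding W_def by auto
    have "sum_map B (f \<oplus>\<^bsub>?D\<^esub> g) = finsum K (\<lambda>i. emb_Quo i ((f \<oplus>\<^bsub>?D\<^esub> g) i)) W"
      by (rule sum_map_eq[OF B fg W(1) _ W(2)]) (auto simp: W_def)
    also have "\<dots> = finsum K (\<lambda>i. emb_Quo i (f i) \<oplus>\<^bsub>K\<^esub> emb_Quo i (g i)) W"
    proof (rule K.finsum_cong'[OF refl])
      show "(\<lambda>i. emb_Quo i (f i) \<oplus>\<^bsub>K\<^esub> emb_Quo i (g i)) \<in> W \<rightarrow> carrier K" using cl[OF f W(2)] cl[OF g W(2)] by auto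
      fix i assume "i \<in> W"
      then have i: "i \<in> B" using W(2) by blast
      then show "emb_Quo i ((f \<oplus>\<^bsub>?D\<^esub> g) i) = emb_Quo i (f i) \<oplus>\<^bsub>K\<^esub> emb_Quo i (g i)"
        using emb_Quo_add[of i "f i" "g i"] B f g by (auto simp: PiE_iff)
    qed
    also have "\<dots> = finsum K (\<lambda>i. emb_Quo i (f i)) W \<oplus>\<^bsub>K\<^esub> finsum K (\<lambda>i. emb_Quo i (g i)) W"
      by (rule K.finsum_addf[OF cl[OF f W(2)] cl[OF g W(2)]])
    also have "finsum K (\<lambda>i. emb_Quo i (f i)) W = sum_map B f" by (rule sum_map_eq[OF B f W(1) _ W(2), symmetric]) (auto simp: W_def)
    also have "finsum K (\<lambda>i. emb_Quo i (g i)) W = sum_map B g" by (rule sum_map_eq[OF B g W(1) _ W(2), symmetric]) (auto simp: W_def)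
    finally show ?thesis .
  qed
  moreover have "sum_map B (r \<odot>\<^bsub>?D\<^esub> f) = r \<odot>\<^bsub>K\<^esub> sum_map B f" if f: "f \<in> carrier ?D" and r: "r \<in> carrier A" for f r
  proof -
    define W where "W = ?supp f \<union> ?supp (r \<odot>\<^bsub>?D\<^esub> f)"
    have rf: "r \<odot>\<^bsub>?D\<^esub> f \<in> carrier ?D" using r f by (rule D.smult_closed)
    have W: "finite W" "W \<subseteq> B" using fin[OF f] fin[OF rf] unfolding W_def by auto
    have "sum_map B (r \<odot>\<^bsub>?D\<^esub> f) = finsum K (\<lambda>i. emb_Quo i ((r \<odot>\<^bsub>?D\<^esub> f) i)) W"
      by (rule sum_map_eq[OF B rf W(1) _ W(2)]) (auto simp: W_def)
    also have "\<dots> = finsum K (\<lambda>i. r \<odot>\<^bsub>K\<^esub> emb_Quo i (f i)) W"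
    proof (rule K.finsum_cong'[OF refl])
      show "(\<lambda>i. r \<odot>\<^bsub>K\<^esub> emb_Quo i (f i)) \<in> W \<rightarrow> carrier K" using cl[OF f W(2)] r by (auto simp: Pi_iff)
      fix i assume "i \<in> W"
      then have i: "i \<in> B" using W(2) by blast
      then show "emb_Quo i ((r \<odot>\<^bsub>?D\<^esub> f) i) = r \<odot>\<^bsub>K\<^esub> emb_Quo i (f i)"
        using emb_Quo_smult[of i "f i" r] B f r by (auto simp: PiE_iff)
    qed
    also have "\<dots> = r \<odot>\<^bsub>K\<^esub> finsum K (\<lambda>i. emb_Quo i (f i)) W"
      by (rule K.finsum_smult_ldistr[OF W(1) r cl[OF f W(2)], symmetric])
    also have "finsum K (\<lambda>i. emb_Quo i (f i)) W = sum_map B f" by (rule sum_map_eq[OF B f W(1) _ W(2), symmetric]) (auto simp: W_def)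
    finally show ?thesis .
  qed
  ultimately show ?thesis by (auto simp: mod_hom_def simp del: direct_sum_simps)
qed

lemma sum_map_single:
  assumes B: "B \<subseteq> socle" and i: "i \<in> B" and C: "C \<in> carrier L"
  shows "(\<lambda>j\<in>B. if j = i then C else \<zero>\<^bsub>L\<^esub>) \<in> carrier (direct_sum B (\<lambda>_. L))"
    "sum_map B (\<lambda>j\<in>B. if j = i then C else \<zero>\<^bsub>L\<^esub>) = emb_Quo i C"
proof -
  let ?f = "\<lambda>j\<in>B. if j = i then C else \<zero>\<^bsub>L\<^esub>"
  interpret L: module A L by (rule Quo_F_S_module)
  have sub: "{j \<in> B. ?f j \<noteq> \<zero>\<^bsub>L\<^esub>} \<subseteq> {i}" by auto
  then have "finite {j \<in> B. ?f j \<noteq> \<zero>\<^bsub>L\<^esub>}" by (rule finite_subset) simp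
  moreover have "?f \<in> B \<rightarrow>\<^sub>E carrier L" using C L.M.zero_closed by auto
  ultimately show f: "?f \<in> carrier (direct_sum B (\<lambda>_. L))" unfolding direct_sum_simps by blast
  have "sum_map B ?f = finsum K (\<lambda>j. emb_Quo j (?f j)) {i}" by (rule sum_map_eq[OF B f _ sub]) (use i in auto)
  then show "sum_map B ?f = emb_Quo i C" using i B C emb_Quo_closed[of i C] by auto
qed

lemma L_xpow_zero_iff:
  assumes "C \<in> carrier L" obtains n where "x [^] (n::nat) \<odot>\<^bsub>L\<^esub> C = \<zero>\<^bsub>L\<^esub>"
proof -
  obtain z where z: "z \<in> carrier F" "C = cs S z" using assms by (auto simp: Quo_carrier)
  obtain n a where "rep z n a" using rep_exists[OF z(1)] by metis
  then obtain s where s: "a \<in> R" "s \<in> S" "x [^] n \<otimes> z = a \<oplus> x [^] n \<otimes> s" by (elim repE)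
  then have "x [^] n \<otimes> z \<in> S" by simp
  then have "cs S (x [^] n \<otimes> z) = cs S \<zero>" using cs_eq_iff[OF S_rmod, of "x [^] n \<otimes> z" \<zero>] z(1) by (simp add: minus_eq)
  then show ?thesis using that Quo_smult[OF S_rmod z(1) xpow_R] cs_zero[OF S_rmod] by (simp add: Quo_zero z(2))
qed

lemma sum_map_bij:
  assumes ind: "independent B"
    and span: "\<And>k. k \<in> socle \<Longrightarrow> \<exists>W a. finite W \<and> W \<subseteq> B \<and> a \<in> W \<rightarrow> R \<and> k = finsum K (\<lambda>i. a i \<odot>\<^bsub>K\<^esub> i) W"
  shows "bij_betw (sum_map B) (carrier (direct_sum B (\<lambda>_. L))) (carrier K)"
proof -
  let ?D = "direct_sum B (\<lambda>_. L)"
  interpret D: module A ?D by (rule direct_sum_module[OF A_cring Quo_F_S_module])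
  interpret L: module A L by (rule Quo_F_S_module)
  have B: "B \<subseteq> socle" using ind by (simp add: independent_def)
  note hom = sum_map_hom[OF B]
  have hadd: "sum_map B (f \<oplus>\<^bsub>?D\<^esub> g) = sum_map B f \<oplus>\<^bsub>K\<^esub> sum_map B g" if "f \<in> carrier ?D" "g \<in> carrier ?D" for f g
    using hom that unfolding mod_hom_def by blast
  have hsm: "sum_map B (r \<odot>\<^bsub>?D\<^esub> f) = r \<odot>\<^bsub>K\<^esub> sum_map B f" if "f \<in> carrier ?D" "r \<in> R" for f r
    using hom that unfolding mod_hom_def by simp
  have hcl: "sum_map B f \<in> carrier K" if "f \<in> carrier ?D" for f using hom that unfolding mod_hom_def by blast
  \<comment> \<open>injectivity\<close>
  have killed: "\<exists>n::nat. x [^] n \<odot>\<^bsub>?D\<^esub> f = \<zero>\<^bsub>?D\<^esub>" if f: "f \<in> carrier ?D" for f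
  proof -
    let ?W = "{i \<in> B. f i \<noteq> \<zero>\<^bsub>L\<^esub>}"
    have fL: "f i \<in> carrier L" if "i \<in> B" for i using f that by (auto simp: PiE_iff)
    have "\<exists>n::nat. \<forall>i\<in>W. x [^] n \<odot>\<^bsub>L\<^esub> f i = \<zero>\<^bsub>L\<^esub>" if "finite W" "W \<subseteq> B" for W
      using that
    proof (induction W rule: finite_induct)
      case (insert i W)
      then obtain n where n: "\<forall>j\<in>W. x [^] (n::nat) \<odot>\<^bsub>L\<^esub> f j = \<zero>\<^bsub>L\<^esub>" by auto
      obtain m where m: "x [^] (m::nat) \<odot>\<^bsub>L\<^esub> f i = \<zero>\<^bsub>L\<^esub>" using L_xpow_zero_iff[OF fL[of i]] insert.prems by auto
      have *: "x [^] (p + q) \<odot>\<^bsub>L\<^esub> f j = \<zero>\<^bsub>L\<^esub>" if j: "j \<in> B" and p: "x [^] p \<odot>\<^bsub>L\<^esub> f j = \<zero>\<^bsub>L\<^esub>" for p q :: nat and j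
      proof -
        have "x [^] (p + q) = x [^] q \<otimes> x [^] p" using x(1) by (simp add: nat_pow_mult add.commute)
        then have "x [^] (p + q) \<odot>\<^bsub>L\<^esub> f j = x [^] q \<odot>\<^bsub>L\<^esub> (x [^] p \<odot>\<^bsub>L\<^esub> f j)"
          using L.smult_assoc1[of "x [^] q" "x [^] p" "f j"] fL[OF j] by simp
        then show ?thesis using p L.smult_r_null[of "x [^] q"] by simp
      qed
      have "\<forall>j\<in>insert i W. x [^] (n + m) \<odot>\<^bsub>L\<^esub> f j = \<zero>\<^bsub>L\<^esub>"
        using *[of i m n] *[of _ n m] n m insert.prems by (auto simp: add.commute)
      then show ?case by blast
    qed simp
    moreover have "finite ?W" "?W \<subseteq> B" using f by auto
    ultimately obtain n where n: "\<forall>i\<in>?W. x [^] (n::nat) \<odot>\<^bsub>L\<^esub> f i = \<zero>\<^bsub>L\<^esub>" by blast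
    have "x [^] n \<odot>\<^bsub>L\<^esub> f i = \<zero>\<^bsub>L\<^esub>" if "i \<in> B" for i
      using n that L.smult_r_null[of "x [^] n"] by (cases "f i = \<zero>\<^bsub>L\<^esub>") auto
    then have "x [^] n \<odot>\<^bsub>?D\<^esub> f = \<zero>\<^bsub>?D\<^esub>" by (auto intro!: restrict_ext)
    then show ?thesis by blast
  qed
  have ker: "f = \<zero>\<^bsub>?D\<^esub>" if f: "f \<in> carrier ?D" and z: "sum_map B f = \<zero>\<^bsub>K\<^esub>" for f
  proof (rule ccontr)
    assume nz: "f \<noteq> \<zero>\<^bsub>?D\<^esub>"
    define n where "n = (LEAST n::nat. x [^] n \<odot>\<^bsub>?D\<^esub> f = \<zero>\<^bsub>?D\<^esub>)"
    have n: "x [^] n \<odot>\<^bsub>?D\<^esub> f = \<zero>\<^bsub>?D\<^esub>" unfolding n_def using killed[OF f] by (rule LeastI_ex)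
    have "\<one> \<odot>\<^bsub>?D\<^esub> f = f" using D.smult_one[OF f] by (simp del: direct_sum_simps)
    then have "n \<noteq> 0" using n nz by (auto simp del: direct_sum_simps)
    then obtain m where m: "n = Suc m" by (cases n) auto
    define g where "g = x [^] m \<odot>\<^bsub>?D\<^esub> f"
    have g: "g \<in> carrier ?D" unfolding g_def using f D.smult_closed by (simp del: direct_sum_simps)
    have gnz: "g \<noteq> \<zero>\<^bsub>?D\<^esub>"
    proof
      assume "g = \<zero>\<^bsub>?D\<^esub>"
      then have "n \<le> m" unfolding n_def g_def by (rule Least_le)
      then show False using m by simp
    qed
    have "x \<odot>\<^bsub>?D\<^esub> g = x [^] n \<odot>\<^bsub>?D\<^esub> f"
    proof -
      have "x [^] n = x \<otimes> x [^] m" using x(1) by (simp add: m m_comm)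
      then show ?thesis unfolding g_def using D.smult_assoc1[of x "x [^] m" f] f x(1) by (simp del: direct_sum_simps)
    qed
    then have xg: "x \<odot>\<^bsub>?D\<^esub> g = \<zero>\<^bsub>?D\<^esub>" using n by simp
    have zg: "sum_map B g = \<zero>\<^bsub>K\<^esub>" unfolding g_def using hsm[OF f xpow_R] z by simp
    let ?W = "{i \<in> B. g i \<noteq> \<zero>\<^bsub>L\<^esub>}"
    have W: "finite ?W" "?W \<subseteq> B" using g by auto
    have gL: "g i \<in> carrier L" if "i \<in> B" for i using g that by (auto simp: PiE_iff)
    have "\<exists>a z. rep z 1 a \<and> g i = cs S z" if i: "i \<in> B" for i
    proof -
      obtain w where w: "w \<in> carrier F" "g i = cs S w" using gL[OF i] by (auto simp: Quo_carrier)
      have "(x \<odot>\<^bsub>?D\<^esub> g) i = \<zero>\<^bsub>?D\<^esub> i" using xg by simp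
      then have "x \<odot>\<^bsub>L\<^esub> g i = \<zero>\<^bsub>L\<^esub>" using i by simp
      then have "cs S (x \<otimes> w) = cs S \<zero>" using Quo_smult[OF S_rmod w(1) x_R] cs_zero[OF S_rmod] by (simp add: w(2) Quo_zero)
      then have "x \<otimes> w \<ominus> \<zero> \<in> S" using cs_eq_iff[OF S_rmod, of "x \<otimes> w" \<zero>] w(1) by simp
      then have "x \<otimes> w \<in> S" using w(1) by (simp add: minus_eq)
      then obtain a s where as: "a \<in> R" "s \<in> S" "x \<otimes> w = a \<oplus> x \<otimes> s" using divisible[OF x_R x(2)] by metis
      then have "rep w 1 a" using w(1) by (intro repI[of _ _ s]) auto
      then show ?thesis using w(2) by blast
    qed
    then obtain a z where az: "\<And>i. i \<in> B \<Longrightarrow> rep (z i) 1 (a i)" "\<And>i. i \<in> B \<Longrightarrow> g i = cs S (z i)" by metis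
    have aR: "a i \<in> R" "z i \<in> carrier F" if "i \<in> B" for i using az(1)[OF that] by (auto simp: rep_def)
    have "finsum K (\<lambda>i. a i \<odot>\<^bsub>K\<^esub> i) ?W = sum_map B g"
      unfolding sum_map_def
    proof (rule K.finsum_cong'[OF refl, symmetric])
      show "(\<lambda>i. a i \<odot>\<^bsub>K\<^esub> i) \<in> ?W \<rightarrow> carrier K" using aR B by auto
      fix i assume "i \<in> ?W"
      then have i: "i \<in> B" by simp
      have k: "i \<in> socle" using B i by blast
      show "emb_Quo i (g i) = a i \<odot>\<^bsub>K\<^esub> i"
        using emb_eq[OF k az(1)[OF i]] emb_Quo_cs[OF k aR(2)[OF i]] az(2)[OF i] by simp
    qed
    then have s0: "finsum K (\<lambda>i. a i \<odot>\<^bsub>K\<^esub> i) ?W = \<zero>\<^bsub>K\<^esub>" unfolding zg .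
    have aW: "a \<in> ?W \<rightarrow> R" using aR(1) by blast
    have "\<forall>i\<in>?W. a i \<in> M" using ind W aW s0 unfolding independent_def by blast
    moreover have "a i \<notin> M" if i: "i \<in> B" "g i \<noteq> \<zero>\<^bsub>L\<^esub>" for i
    proof
      assume "a i \<in> M"
      then obtain t where t: "t \<in> S" "a i = x \<otimes> t" using uniformizing[of "a i"] Sunit_R[of "a i"] by (auto elim: sdvdE)
      obtain s where s: "s \<in> S" "x [^] (1::nat) \<otimes> z i = a i \<oplus> x [^] (1::nat) \<otimes> s" using az(1)[OF i(1)] by (elim repE)
      have "x \<otimes> z i = x \<otimes> (t \<oplus> s)" using s t x(1) by (simp add: r_distr)
      then have "z i = t \<oplus> s" using m_lcancel[OF x(2), of "z i" "t \<oplus> s"] aR(2)[OF i(1)] s(1) t(1) x(1) by simp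
      then have "z i \<in> S" using s t by simp
      then have "cs S (z i) = cs S \<zero>" using cs_eq_iff[OF S_rmod, of "z i" \<zero>] aR(2)[OF i(1)] by (simp add: minus_eq)
      then show False using az(2)[OF i(1)] i(2) cs_zero[OF S_rmod] by (simp add: Quo_zero)
    qed
    ultimately have "g i = \<zero>\<^bsub>L\<^esub>" if "i \<in> B" for i using that by blast
    moreover have "g \<in> extensional B" using g by (auto simp: PiE_iff)
    ultimately have "g = \<zero>\<^bsub>?D\<^esub>" by (auto simp: extensional_def fun_eq_iff)
    then show False using gnz by blast
  qed
  have inj: "inj_on (sum_map B) (carrier ?D)"
  proof (rule inj_onI)
    fix f g assume f: "f \<in> carrier ?D" and g: "g \<in> carrier ?D" and eq: "sum_map B f = sum_map B g"
    have mg: "\<ominus>\<^bsub>?D\<^esub> g \<in> carrier ?D" using g by (rule D.M.a_inv_closed)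
    have "sum_map B (f \<oplus>\<^bsub>?D\<^esub> \<ominus>\<^bsub>?D\<^esub> g) = sum_map B (g \<oplus>\<^bsub>?D\<^esub> \<ominus>\<^bsub>?D\<^esub> g)"
      using hadd[OF f mg] hadd[OF g mg] eq by simp
    also have "\<dots> = \<zero>\<^bsub>K\<^esub>"
    proof -
      have "sum_map B \<zero>\<^bsub>?D\<^esub> = \<zero>\<^bsub>K\<^esub>" using mod_hom_zero[OF D.module_axioms K.module_axioms hom] .
      then show ?thesis using D.M.r_neg[OF g] by simp
    qed
    finally have "f \<oplus>\<^bsub>?D\<^esub> \<ominus>\<^bsub>?D\<^esub> g = \<zero>\<^bsub>?D\<^esub>" using ker D.M.a_closed[OF f mg] by blast
    moreover have "g \<oplus>\<^bsub>?D\<^esub> \<ominus>\<^bsub>?D\<^esub> g = \<zero>\<^bsub>?D\<^esub>" using D.M.r_neg[OF g] .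
    ultimately show "f = g" using D.M.add.right_cancel[OF mg f g] by metis
  qed
  \<comment> \<open>surjectivity\<close>
  let ?I = "sum_map B ` carrier ?D"
  have Iadd: "k \<oplus>\<^bsub>K\<^esub> l \<in> ?I" if k: "k \<in> ?I" and l: "l \<in> ?I" for k l
  proof -
    obtain f where f: "k = sum_map B f" "f \<in> carrier ?D" using k by (rule imageE)
    obtain g where g: "l = sum_map B g" "g \<in> carrier ?D" using l by (rule imageE)
    have "sum_map B (f \<oplus>\<^bsub>?D\<^esub> g) \<in> ?I" using D.M.a_closed[OF f(2) g(2)] by (rule imageI)
    then show ?thesis unfolding f(1) g(1) hadd[OF f(2) g(2)] .
  qed
  have Ismult: "r \<odot>\<^bsub>K\<^esub> k \<in> ?I" if "k \<in> ?I" "r \<in> R" for r k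
  proof -
    obtain f where f: "k = sum_map B f" "f \<in> carrier ?D" using \<open>k \<in> ?I\<close> by (rule imageE)
    have "r \<odot>\<^bsub>?D\<^esub> f \<in> carrier ?D" using D.smult_closed[of r f] f \<open>r \<in> R\<close> by (simp del: direct_sum_simps)
    then have "sum_map B (r \<odot>\<^bsub>?D\<^esub> f) \<in> ?I" by (rule imageI)
    then show ?thesis unfolding f(1) hsm[OF f(2) \<open>r \<in> R\<close>] .
  qed
  have Izero: "\<zero>\<^bsub>K\<^esub> \<in> ?I"
    using imageI[OF D.M.zero_closed, of "sum_map B"] unfolding mod_hom_zero[OF D.module_axioms K.module_axioms hom] .
  have Itower: "tower i n \<in> ?I" if i: "i \<in> B" for i n
  proof -
    have k: "i \<in> socle" using B i by blast
    obtain w where w: "w \<in> carrier F" "x [^] n \<otimes> w = \<one>" using inverse_exists[of "x [^] n"] xpow_nonzero x(1) by auto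
    have "rep w n \<one>" using w by (intro repI[of _ _ \<zero>]) auto
    then have e: "emb_Quo i (cs S w) = tower i n" using emb_Quo_cs[OF k w(1)] emb_eq[OF k] tower_closed[OF k] by simp
    have wL: "cs S w \<in> carrier L" using w by (simp add: Quo_carrier)
    show ?thesis using imageI[OF sum_map_single(1)[OF B i wL], of "sum_map B"] unfolding sum_map_single(2)[OF B i wL] e .
  qed
  have "k \<in> ?I" if "k \<in> carrier K" "x [^] (n::nat) \<odot>\<^bsub>K\<^esub> k = \<zero>\<^bsub>K\<^esub>" for n k
    using that
  proof (induction n arbitrary: k)
    case 0
    then show ?case using Izero by simp
  next
    case (Suc n)
    have k: "k \<in> carrier K" using Suc.prems by simp
    have "x [^] n \<odot>\<^bsub>K\<^esub> k \<in> socle"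
    proof -
      have "x \<odot>\<^bsub>K\<^esub> (x [^] n \<odot>\<^bsub>K\<^esub> k) = (x \<otimes> x [^] n) \<odot>\<^bsub>K\<^esub> k" using k by (simp add: smult_assoc)
      also have "x \<otimes> x [^] n = x [^] Suc n" using x(1) by (simp add: m_comm)
      finally show ?thesis using Suc.prems(2) k unfolding socle_def by simp
    qed
    from span[OF this]
    obtain W a where W: "finite W" "W \<subseteq> B" "a \<in> W \<rightarrow> R" "x [^] n \<odot>\<^bsub>K\<^esub> k = finsum K (\<lambda>i. a i \<odot>\<^bsub>K\<^esub> i) W"
      by (elim exE conjE) (rule that)
    define w where "w = finsum K (\<lambda>i. a i \<odot>\<^bsub>K\<^esub> tower i (Suc n)) W"
    have cl: "(\<lambda>i. a i \<odot>\<^bsub>K\<^esub> tower i (Suc n)) \<in> W \<rightarrow> carrier K"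
    proof
      fix i assume "i \<in> W"
      then show "a i \<odot>\<^bsub>K\<^esub> tower i (Suc n) \<in> carrier K" using W(2,3) B tower_closed[of i "Suc n"] by (intro smult_R) blast+
    qed
    then have wK: "w \<in> carrier K" unfolding w_def by (rule K.finsum_closed)
    have wI: "w \<in> ?I"
    proof -
      have "finsum K (\<lambda>i. a i \<odot>\<^bsub>K\<^esub> tower i (Suc n)) V \<in> ?I" if "finite V" "V \<subseteq> W" for V
        using that
      proof (induction V rule: finite_induct)
        case empty
        then show ?case using Izero by simp
      next
        case (insert i V)
        have iB: "i \<in> B" "a i \<in> R" using insert.prems W(2,3) by auto
        have t: "a i \<odot>\<^bsub>K\<^esub> tower i (Suc n) \<in> ?I" by (rule Ismult[OF Itower[OF iB(1)] iB(2)])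
        have VW: "V \<subseteq> W" using insert.prems by simp
        have "finsum K (\<lambda>i. a i \<odot>\<^bsub>K\<^esub> tower i (Suc n)) (insert i V)
           = a i \<odot>\<^bsub>K\<^esub> tower i (Suc n) \<oplus>\<^bsub>K\<^esub> finsum K (\<lambda>i. a i \<odot>\<^bsub>K\<^esub> tower i (Suc n)) V"
        proof (rule K.finsum_insert[OF insert.hyps])
          show "(\<lambda>i. a i \<odot>\<^bsub>K\<^esub> tower i (Suc n)) \<in> V \<rightarrow> carrier K" using cl VW by (rule Pi_anti_mono[THEN subsetD, rotated])
          show "a i \<odot>\<^bsub>K\<^esub> tower i (Suc n) \<in> carrier K" using cl insert.prems by (blast dest: funcset_mem)
        qed
        then show ?case using Iadd[OF t insert.IH[OF VW]] by (simp only:)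
      qed
      then show ?thesis unfolding w_def using W(1) by blast
    qed
    have xw: "x [^] n \<odot>\<^bsub>K\<^esub> w = x [^] n \<odot>\<^bsub>K\<^esub> k"
    proof -
      have "x [^] n \<odot>\<^bsub>K\<^esub> w = finsum K (\<lambda>i. x [^] n \<odot>\<^bsub>K\<^esub> (a i \<odot>\<^bsub>K\<^esub> tower i (Suc n))) W"
        unfolding w_def by (rule K.finsum_smult_ldistr[OF W(1) _ cl]) simp
      also have "\<dots> = finsum K (\<lambda>i. a i \<odot>\<^bsub>K\<^esub> i) W"
      proof (rule K.finsum_cong'[OF refl])
        show "(\<lambda>i. a i \<odot>\<^bsub>K\<^esub> i) \<in> W \<rightarrow> carrier K" using W(2,3) B by (auto simp: Pi_iff subset_iff)
        fix i assume i: "i \<in> W"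
        have k': "i \<in> socle" "a i \<in> R" using i W(2,3) B by auto
        note tc = tower_closed[OF k'(1), of "Suc n"]
        have "x [^] n \<odot>\<^bsub>K\<^esub> (a i \<odot>\<^bsub>K\<^esub> tower i (Suc n)) = (x [^] n \<otimes> a i) \<odot>\<^bsub>K\<^esub> tower i (Suc n)" by (rule smult_assoc[OF xpow_R k'(2) tc, symmetric])
        also have "x [^] n \<otimes> a i = a i \<otimes> x [^] n" using k' x(1) by (simp add: m_comm)
        also have "(a i \<otimes> x [^] n) \<odot>\<^bsub>K\<^esub> tower i (Suc n) = a i \<odot>\<^bsub>K\<^esub> (x [^] n \<odot>\<^bsub>K\<^esub> tower i (Suc n))" by (rule smult_assoc[OF k'(2) xpow_R tc])
        also have "x [^] n \<odot>\<^bsub>K\<^esub> tower i (Suc n) = i" using xpow_tower[OF k'(1), of n 1] by simp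
        finally show "x [^] n \<odot>\<^bsub>K\<^esub> (a i \<odot>\<^bsub>K\<^esub> tower i (Suc n)) = a i \<odot>\<^bsub>K\<^esub> i" .
      qed
      finally show ?thesis using W(4) by simp
    qed
    have mw: "(\<ominus> \<one>) \<odot>\<^bsub>K\<^esub> w \<in> ?I" using Ismult[OF wI, of "\<ominus> \<one>"] by simp
    have mwK: "(\<ominus> \<one>) \<odot>\<^bsub>K\<^esub> w \<in> carrier K" using wK by (intro smult_R) auto
    have w0: "w \<oplus>\<^bsub>K\<^esub> (\<ominus> \<one>) \<odot>\<^bsub>K\<^esub> w = \<zero>\<^bsub>K\<^esub>"
      using smult_ladd[of \<one> "\<ominus> \<one>" w] wK by (simp add: r_neg)
    have "x [^] n \<odot>\<^bsub>K\<^esub> (k \<oplus>\<^bsub>K\<^esub> (\<ominus> \<one>) \<odot>\<^bsub>K\<^esub> w) = x [^] n \<odot>\<^bsub>K\<^esub> k \<oplus>\<^bsub>K\<^esub> x [^] n \<odot>\<^bsub>K\<^esub> ((\<ominus> \<one>) \<odot>\<^bsub>K\<^esub> w)"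
      by (rule smult_radd[OF xpow_R k mwK])
    also have "\<dots> = x [^] n \<odot>\<^bsub>K\<^esub> (w \<oplus>\<^bsub>K\<^esub> (\<ominus> \<one>) \<odot>\<^bsub>K\<^esub> w)" unfolding xw[symmetric] by (rule smult_radd[OF xpow_R wK mwK, symmetric])
    finally have "x [^] n \<odot>\<^bsub>K\<^esub> (k \<oplus>\<^bsub>K\<^esub> (\<ominus> \<one>) \<odot>\<^bsub>K\<^esub> w) = \<zero>\<^bsub>K\<^esub>" unfolding w0 by simp
    then have "k \<oplus>\<^bsub>K\<^esub> (\<ominus> \<one>) \<odot>\<^bsub>K\<^esub> w \<in> ?I" using Suc.IH k mwK by simp
    then have "(k \<oplus>\<^bsub>K\<^esub> (\<ominus> \<one>) \<odot>\<^bsub>K\<^esub> w) \<oplus>\<^bsub>K\<^esub> w \<in> ?I" using Iadd wI by blast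
    moreover have "(k \<oplus>\<^bsub>K\<^esub> (\<ominus> \<one>) \<odot>\<^bsub>K\<^esub> w) \<oplus>\<^bsub>K\<^esub> w = k"
    proof -
      have "(k \<oplus>\<^bsub>K\<^esub> (\<ominus> \<one>) \<odot>\<^bsub>K\<^esub> w) \<oplus>\<^bsub>K\<^esub> w = k \<oplus>\<^bsub>K\<^esub> (w \<oplus>\<^bsub>K\<^esub> (\<ominus> \<one>) \<odot>\<^bsub>K\<^esub> w)"
        using k wK mwK by (simp add: K.M.a_ac del: direct_sum_simps)
      then show ?thesis unfolding w0 using k by simp
    qed
    ultimately show ?case by simp
  qed
  then have "carrier K \<subseteq> ?I" using torsion_K by blast
  then have "?I = carrier K" using hcl by blast
  then show ?thesis using inj by (simp only: bij_betw_def)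
qed

lemma direct_sum_decomposition:
  obtains B where "B \<subseteq> carrier K" "mod_isomorphic A K (direct_sum B (\<lambda>_. L))"
proof -
  obtain B where B: "independent B"
    "\<And>k. k \<in> socle \<Longrightarrow> \<exists>W a. finite W \<and> W \<subseteq> B \<and> a \<in> W \<rightarrow> R \<and> k = finsum K (\<lambda>i. a i \<odot>\<^bsub>K\<^esub> i) W"
    by (rule socle_basis) blast
  have Bs: "B \<subseteq> socle" using B(1) by (simp add: independent_def)
  have "mod_isomorphic A (direct_sum B (\<lambda>_. L)) K"
    unfolding mod_isomorphic_def using sum_map_hom[OF Bs] sum_map_bij[OF B] by blast
  then have "mod_isomorphic A K (direct_sum B (\<lambda>_. L))"
    by (rule mod_isomorphic_sym[OF direct_sum_module[OF A_cring Quo_F_S_module] K.module_axioms])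
  then show ?thesis using that[of B] Bs socle_closed by blast
qed

end

context fraction_field
begin

lemma Quo_carrierE:
  assumes "C \<in> carrier (Quo Z Y)" obtains z where "z \<in> Z" "C = cs Y z"
  using assms by (auto simp: Quo_carrier)

lemma Quo_F_divisible:
  assumes Y: "rmod Y" shows "divisible_mod A (Quo (carrier F) Y)"
proof -
  interpret L: module A "Quo (carrier F) Y" by (rule Quo_module[OF Y carrier_rmod]) (use rmodD(1)[OF Y] in blast)
  have "C \<in> (\<lambda>k. a \<odot>\<^bsub>Quo (carrier F) Y\<^esub> k) ` carrier (Quo (carrier F) Y)"
    if a: "a \<in> R" "a \<noteq> \<zero>" and C: "C \<in> carrier (Quo (carrier F) Y)" for a C
  proof -
    obtain z where z: "z \<in> carrier F" "C = cs Y z" using C by (rule Quo_carrierE)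
    obtain w where w: "w \<in> carrier F" "a \<otimes> w = \<one>" using inverse_exists[of a] a by auto
    have "a \<otimes> (w \<otimes> z) = (a \<otimes> w) \<otimes> z" using a w(1) z by (simp add: m_assoc)
    then have "a \<otimes> (w \<otimes> z) = z" using w z by simp
    then have "C = a \<odot>\<^bsub>Quo (carrier F) Y\<^esub> cs Y (w \<otimes> z)" using Quo_smult[OF Y, of "w \<otimes> z" a "carrier F"] a w z by simp
    moreover have "cs Y (w \<otimes> z) \<in> carrier (Quo (carrier F) Y)" using w z by (simp add: Quo_carrier)
    ultimately show ?thesis by (rule image_eqI)
  qed
  then show ?thesis unfolding divisible_mod_def using L.smult_closed by auto
qed

lemma Quo_nonzero:
  assumes Y: "rmod Y" and sub: "Y \<subset> Z" "Z \<subseteq> carrier F" shows "carrier (Quo Z Y) \<noteq> {\<zero>\<^bsub>Quo Z Y\<^esub>}"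
proof
  assume e: "carrier (Quo Z Y) = {\<zero>\<^bsub>Quo Z Y\<^esub>}"
  obtain z where z: "z \<in> Z" "z \<notin> Y" using sub by blast
  have "cs Y z \<in> carrier (Quo Z Y)" using z by (simp add: Quo_carrier)
  then have "cs Y z = cs Y \<zero>" unfolding e by (simp add: Quo_zero cs_zero[OF Y])
  then show False using cs_eq_iff[OF Y, of z \<zero>] z sub(2) by (auto simp: minus_eq)
qed

end

context infinite_stable_local_ring
begin

lemma R_proper: "\<exists>s\<in>S. s \<notin> R"
proof (rule ccontr)
  assume "\<not> ?thesis"
  then have R: "S \<subseteq> R" by blast
  have "S \<subseteq> span2 \<one> \<one>"
  proof
    fix s assume "s \<in> S"
    then have "s \<in> R" "s = s \<otimes> \<one> \<oplus> \<zero> \<otimes> \<one>" using R by auto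
    then show "s \<in> span2 \<one> \<one>" unfolding span2_def using R_closed(1) by blast
  qed
  moreover have "span2 \<one> \<one> \<subseteq> S" unfolding span2_def by auto
  ultimately show False using not_finite[of \<one>] by auto
qed

lemma power_conducts:
  assumes x: "x \<in> M" "x \<noteq> \<zero>" "\<And>y. y \<in> S \<Longrightarrow> \<not> Sunit y \<Longrightarrow> sdvd x y" and s: "s \<in> S"
  obtains n :: nat where "x [^] n \<otimes> s \<in> R"
proof -
  obtain a b where ab: "a \<in> R" "b \<in> R" "b \<noteq> \<zero>" "s \<otimes> b = a" using fraction[of s] s by auto
  obtain u n where un: "Sunit u" "b = x [^] (n::nat) \<otimes> u" using uniformizer_power[OF x, of b] ab by auto
  obtain v where v: "v \<in> S" "u \<otimes> v = \<one>" using un(1) by (elim SunitE)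
  have xR: "x [^] n \<in> R" using subring_pow[OF subring_R] x by simp
  have "b \<otimes> v = x [^] n \<otimes> (u \<otimes> v)" unfolding un(2) using un(1) v(1) xR by (simp add: m_assoc)
  then have bv: "b \<otimes> v = x [^] n" using v xR by simp
  have "b \<otimes> s \<in> R" using ab s by (simp add: m_comm)
  then have "b \<otimes> (v \<otimes> s) \<in> R" using product_of_conductors[OF v(1) s ab(2)] bv xR by simp
  moreover have "b \<otimes> (v \<otimes> s) = x [^] n \<otimes> s" unfolding bv[symmetric] using ab v(1) s by (simp add: m_assoc)
  ultimately show ?thesis using that by simp
qed

lemma Quo_S_R_decomposition:
  obtains B :: "'a set set" where "B \<noteq> {}" "mod_isomorphic A (Quo S R) (direct_sum B (\<lambda>_. Quo (carrier F) S))"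
proof -
  obtain x where x: "x \<in> M" "x \<noteq> \<zero>" "\<And>y. y \<in> S \<Longrightarrow> \<not> Sunit y \<Longrightarrow> sdvd x y" using uniformizer by metis
  interpret K: module A "Quo S R" by (rule Quo_S_R_module)
  have zero: "\<zero>\<^bsub>Quo S R\<^esub> = cs R \<zero>" by (simp add: Quo_zero cs_zero[OF rmod_R])
  have smult: "r \<odot>\<^bsub>Quo S R\<^esub> cs R s = cs R (r \<otimes> s)" if "r \<in> R" "s \<in> S" for r s
    using Quo_smult[OF rmod_R] that by simp
  have zero_iff: "cs R s = \<zero>\<^bsub>Quo S R\<^esub> \<longleftrightarrow> s \<in> R" if "s \<in> S" for s
    using cs_eq_iff[OF rmod_R, of s \<zero>] that unfolding zero by (simp add: minus_eq)
  have cl: "cs R s \<in> carrier (Quo S R)" if "s \<in> S" for s using that by (simp add: Quo_carrier)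
  have xR: "x [^] (n::nat) \<in> R" for n using subring_pow[OF subring_R] x by simp
  interpret D: divisible_torsion_module F R "Quo S R" x
  proof
    show "\<exists>k'\<in>carrier (Quo S R). x \<odot>\<^bsub>Quo S R\<^esub> k' = k" if k: "k \<in> carrier (Quo S R)" for k
    proof -
      obtain s where s: "s \<in> S" "k = cs R s" using k by (rule Quo_carrierE)
      obtain a t where at: "a \<in> R" "t \<in> S" "s = a \<oplus> x \<otimes> t" using divisible[OF _ x(2) s(1)] x(1) by auto
      have "x \<otimes> t \<ominus> s = \<ominus> a" unfolding at(3) using at(1,2) x(1)
        by (simp add: minus_eq minus_add a_ac r_neg1 r_neg)
      then have "cs R (x \<otimes> t) = k" using cs_eq_iff[OF rmod_R, of "x \<otimes> t" s] at s x(1) by simp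
      then show ?thesis using smult[of x t] x(1) at(2) cl by (intro bexI[of _ "cs R t"]) auto
    qed
    show "\<exists>n::nat. x [^] n \<odot>\<^bsub>Quo S R\<^esub> k = \<zero>\<^bsub>Quo S R\<^esub>" if k: "k \<in> carrier (Quo S R)" for k
    proof -
      obtain s where s: "s \<in> S" "k = cs R s" using k by (rule Quo_carrierE)
      obtain n :: nat where n: "x [^] n \<otimes> s \<in> R" using power_conducts[OF x s(1)] by blast
      then have "x [^] n \<odot>\<^bsub>Quo S R\<^esub> k = \<zero>\<^bsub>Quo S R\<^esub>"
        using smult[OF xR s(1)] zero_iff[of "x [^] n \<otimes> s"] s by auto
      then show ?thesis by blast
    qed
    show "a \<odot>\<^bsub>Quo S R\<^esub> k = \<zero>\<^bsub>Quo S R\<^esub>"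
      if ab: "a \<in> R" "b \<in> R" "s \<in> S" "a = b \<otimes> s" and k: "k \<in> carrier (Quo S R)" "b \<odot>\<^bsub>Quo S R\<^esub> k = \<zero>\<^bsub>Quo S R\<^esub>" for a b s k
    proof -
      obtain v where v: "v \<in> S" "k = cs R v" using k(1) by (rule Quo_carrierE)
      have "b \<otimes> v \<in> R" using k(2) smult[OF ab(2) v(1)] zero_iff[of "b \<otimes> v"] v ab by auto
      then have "b \<otimes> (s \<otimes> v) \<in> R" using product_of_conductors[OF ab(3) v(1) ab(2)] ab by simp
      then have "a \<otimes> v \<in> R" using ab v by (simp add: m_assoc)
      then show ?thesis using smult[OF ab(1) v(1)] zero_iff[of "a \<otimes> v"] v ab(1) by auto
    qed
  qed (use x in auto)
  obtain B :: "'a set set" where B: "mod_isomorphic A (Quo S R) (direct_sum B (\<lambda>_. Quo (carrier F) S))"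
    using D.direct_sum_decomposition by blast
  have "B \<noteq> {}"
  proof
    assume e: "B = {}"
    obtain f where f: "f \<in> mod_hom A (Quo S R) (direct_sum B (\<lambda>_. Quo (carrier F) S))" "inj_on f (carrier (Quo S R))"
      using B unfolding mod_isomorphic_def bij_betw_def by blast
    obtain s where s: "s \<in> S" "s \<notin> R" using R_proper by blast
    have "f C = (\<lambda>_. undefined)" if "C \<in> carrier (Quo S R)" for C
      using f(1) that unfolding mod_hom_def e by auto
    then have "f (cs R s) = f (cs R \<zero>)" using cl s(1) by simp
    then have "cs R s = cs R \<zero>" using inj_onD[OF f(2)] cl s(1) by simp
    then show False using zero_iff[OF s(1)] s(2) zero by simp
  qed
  then show ?thesis using that B by blast
qed

definition preimage :: "'a set set \<Rightarrow> 'a set" where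
  "preimage N = {z \<in> carrier F. cs S z \<in> N}"

lemma preimage_rmod:
  assumes N: "submodule N A (Quo (carrier F) S)"
  shows "rmod (preimage N)" "S \<subseteq> preimage N"
proof -
  interpret L: module A "Quo (carrier F) S" by (rule Quo_F_S_module)
  note ND = L.submoduleE[OF N]
  have zN: "\<zero>\<^bsub>Quo (carrier F) S\<^esub> \<in> N"
  proof -
    obtain C where C: "C \<in> N" using ND(2) by blast
    then have "\<zero> \<odot>\<^bsub>Quo (carrier F) S\<^esub> C \<in> N" using ND(4)[of \<zero> C] by simp
    then show ?thesis using L.smult_l_null[of C] C ND(1) by auto
  qed
  have S_sub: "s \<in> preimage N" if s: "s \<in> S" for s
  proof -
    have "cs S s = \<zero>\<^bsub>Quo (carrier F) S\<^esub>"
      using cs_eq_iff[OF S_rmod, of s \<zero>] s cs_zero[OF S_rmod] by (simp add: minus_eq Quo_zero)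
    then show ?thesis using zN s by (simp add: preimage_def)
  qed
  then show "S \<subseteq> preimage N" by blast
  show "rmod (preimage N)"
    unfolding rmod_def
  proof (intro conjI ballI)
    show "\<zero> \<in> preimage N" using S_sub by simp
    show "y \<oplus> z \<in> preimage N" if "y \<in> preimage N" "z \<in> preimage N" for y z
      using that ND(5)[of "cs S y" "cs S z"] Quo_add[OF S_rmod] unfolding preimage_def by auto
    show "r \<otimes> z \<in> preimage N" if "r \<in> R" "z \<in> preimage N" for r z
      using that ND(4)[of r "cs S z"] Quo_smult[OF S_rmod] unfolding preimage_def by auto
  qed (auto simp: preimage_def)
qed

lemma preimage_S_closed:
  assumes N: "submodule N A (Quo (carrier F) S)" and z: "z \<in> preimage N" and v: "v \<in> S"
  shows "v \<otimes> z \<in> preimage N"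
proof (cases "z \<in> S")
  case True
  then show ?thesis using preimage_rmod(2)[OF N] v by auto
next
  case False
  note PD = rmodD[OF preimage_rmod(1)[OF N]]
  have zF: "z \<in> carrier F" using PD(1) z by blast
  have "z \<noteq> \<zero>" using False S_closed(1) by blast
  then obtain y where y: "y \<in> S" "z \<otimes> y = \<one>" using valuation[OF zF _ False] by blast
  obtain a b where ab: "a \<in> R" "b \<in> R" "b \<noteq> \<zero>" "y \<otimes> b = a" using fraction[of y] y by auto
  have za: "z \<otimes> a = b"
  proof -
    have "z \<otimes> a = (z \<otimes> y) \<otimes> b" unfolding ab(4)[symmetric] using zF y(1) ab(2) by (simp add: m_assoc)
    then show ?thesis using y(2) ab by simp
  qed
  then have "a \<noteq> \<zero>" using ab zF by auto
  then obtain c s where cs: "c \<in> R" "s \<in> S" "v = c \<oplus> a \<otimes> s" using divisible[OF ab(1) _ v] by metis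
  have "v \<otimes> z = c \<otimes> z \<oplus> (z \<otimes> a) \<otimes> s" unfolding cs(3) using cs(1,2) zF ab(1) by (simp add: l_distr r_distr m_ac)
  moreover have "c \<otimes> z \<in> preimage N" using PD(4) cs z by blast
  moreover have "(z \<otimes> a) \<otimes> s \<in> preimage N" unfolding za using preimage_rmod(2)[OF N] ab(2) cs(2) by auto
  ultimately show ?thesis using PD(3) by simp
qed

lemma preimage_subset_imp:
  assumes N: "submodule N A (Quo (carrier F) S)" and sub: "preimage N \<subseteq> preimage N'"
  shows "N \<subseteq> N'"
proof
  fix C assume C: "C \<in> N"
  then have "C \<in> carrier (Quo (carrier F) S)" using module.submoduleE(1)[OF Quo_F_S_module N] by blast
  then obtain z where z: "z \<in> carrier F" "C = cs S z" by (rule Quo_carrierE)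
  then have "z \<in> preimage N'" using C sub by (auto simp: preimage_def)
  then show "C \<in> N'" using z by (simp add: preimage_def)
qed

lemma Quo_F_S_level:
  obtains D :: "'a set set \<Rightarrow> nat set" where
    "\<And>N n m. submodule N A (Quo (carrier F) S) \<Longrightarrow> n \<in> D N \<Longrightarrow> m \<le> n \<Longrightarrow> m \<in> D N"
    "\<And>N N'. submodule N A (Quo (carrier F) S) \<Longrightarrow> submodule N' A (Quo (carrier F) S) \<Longrightarrow> N \<subseteq> N' \<longleftrightarrow> D N \<subseteq> D N'"
proof -
  obtain x where x: "x \<in> M" "x \<noteq> \<zero>" "\<And>y. y \<in> S \<Longrightarrow> \<not> Sunit y \<Longrightarrow> sdvd x y" using uniformizer by metis
  obtain w where w: "w \<in> carrier F" "x \<otimes> w = \<one>" using inverse_exists[of x] x by auto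
  have xw: "x [^] (n::nat) \<otimes> w [^] n = \<one>" for n
    using nat_pow_distrib[of x w n] w x by simp
  have xS: "x [^] (n::nat) \<in> S" for n using subring_pow[OF S_subring] x by simp
  define D where "D N = {n::nat. w [^] n \<in> preimage N}" for N
  have down: "m \<in> D N" if N: "submodule N A (Quo (carrier F) S)" and n: "n \<in> D N" and m: "m \<le> n" for N n m
  proof -
    have "w [^] n = w [^] (n - m) \<otimes> w [^] m" using m w by (simp add: nat_pow_mult)
    then have "x [^] (n - m) \<otimes> w [^] n = (x [^] (n - m) \<otimes> w [^] (n - m)) \<otimes> w [^] m" using w x by (simp add: m_assoc)
    then have "w [^] m = x [^] (n - m) \<otimes> w [^] n" using xw w by simp
    then show ?thesis using preimage_S_closed[OF N _ xS, of "w [^] n" "n - m"] n by (simp add: D_def)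
  qed
  moreover have "N \<subseteq> N' \<longleftrightarrow> D N \<subseteq> D N'"
    if N: "submodule N A (Quo (carrier F) S)" and N': "submodule N' A (Quo (carrier F) S)" for N N'
  proof
    show "D N \<subseteq> D N'" if "N \<subseteq> N'" using that unfolding D_def preimage_def by blast
    assume sub: "D N \<subseteq> D N'"
    have "preimage N \<subseteq> preimage N'"
    proof
      fix z assume z: "z \<in> preimage N"
      show "z \<in> preimage N'"
      proof (cases "z \<in> S")
        case True
        then show ?thesis using preimage_rmod(2)[OF N'] by blast
      next
        case False
        have zF: "z \<in> carrier F" using z by (simp add: preimage_def)
        have z0: "z \<noteq> \<zero>" using False S_closed(1) by blast
        obtain y where y: "y \<in> S" "z \<otimes> y = \<one>" using valuation[OF zF z0 False] by blast
        have "y \<noteq> \<zero>" using y(2) zF by auto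
        then obtain u n where un: "Sunit u" "y = x [^] (n::nat) \<otimes> u" using uniformizer_power[OF x y(1)] by blast
        obtain v where v: "v \<in> S" "u \<otimes> v = \<one>" using un(1) by (elim SunitE)
        have uS: "u \<in> S" using un(1) by simp
        have "w [^] n = w [^] n \<otimes> (z \<otimes> y)" using y w by simp
        also have "\<dots> = (x [^] n \<otimes> w [^] n) \<otimes> (u \<otimes> z)" unfolding un(2) using zF uS w x by (simp add: m_ac)
        finally have wn: "w [^] n = u \<otimes> z" using xw zF uS by simp
        then have "n \<in> D N" using preimage_S_closed[OF N z uS] by (simp add: D_def)
        then have "w [^] n \<in> preimage N'" using sub by (auto simp: D_def)
        then have "v \<otimes> (u \<otimes> z) \<in> preimage N'" using preimage_S_closed[OF N' _ v(1)] wn by simp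
        moreover have "v \<otimes> (u \<otimes> z) = (u \<otimes> v) \<otimes> z" using v(1) uS zF by (simp add: m_ac)
        ultimately show ?thesis using v(2) zF by simp
      qed
    qed
    then show "N \<subseteq> N'" by (rule preimage_subset_imp[OF N])
  qed
  ultimately show ?thesis by (rule that)
qed

lemma Quo_F_S_uniserial: "uniserial A (Quo (carrier F) S)"
proof -
  obtain D :: "'a set set \<Rightarrow> nat set" where
    D: "\<And>N n m. submodule N A (Quo (carrier F) S) \<Longrightarrow> n \<in> D N \<Longrightarrow> m \<le> n \<Longrightarrow> m \<in> D N"
    "\<And>N N'. submodule N A (Quo (carrier F) S) \<Longrightarrow> submodule N' A (Quo (carrier F) S) \<Longrightarrow> N \<subseteq> N' \<longleftrightarrow> D N \<subseteq> D N'"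
    by (rule Quo_F_S_level) blast
  have "N \<subseteq> N' \<or> N' \<subseteq> N"
    if N: "submodule N A (Quo (carrier F) S)" and N': "submodule N' A (Quo (carrier F) S)" for N N'
  proof -
    have "D N \<subseteq> D N' \<or> D N' \<subseteq> D N" using D(1)[OF N] D(1)[OF N'] nat_le_linear by blast
    then show ?thesis using D(2)[OF N N'] D(2)[OF N' N] by blast
  qed
  then show ?thesis unfolding uniserial_def by blast
qed

lemma Quo_F_S_artinian: "artinian_mod A (Quo (carrier F) S)"
proof -
  obtain D :: "'a set set \<Rightarrow> nat set" where
    D: "\<And>N n m. submodule N A (Quo (carrier F) S) \<Longrightarrow> n \<in> D N \<Longrightarrow> m \<le> n \<Longrightarrow> m \<in> D N"
    "\<And>N N'. submodule N A (Quo (carrier F) S) \<Longrightarrow> submodule N' A (Quo (carrier F) S) \<Longrightarrow> N \<subseteq> N' \<longleftrightarrow> D N \<subseteq> D N'"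
    by (rule Quo_F_S_level) blast
  show ?thesis
    unfolding artinian_mod_def
  proof (intro allI impI)
    fix N :: "nat \<Rightarrow> 'a set set"
    assume "\<forall>n. submodule (N n) A (Quo (carrier F) S) \<and> N (Suc n) \<subseteq> N n"
    then have N: "\<And>n. submodule (N n) A (Quo (carrier F) S)" and dec: "\<And>n. N (Suc n) \<subseteq> N n" by auto
    have mono: "N m \<subseteq> N n" if "n \<le> m" for n m using lift_Suc_antimono_le[of N, OF dec that] .
    have Dmono: "D (N m) \<subseteq> D (N n)" if "n \<le> m" for n m using mono[OF that] D(2)[OF N N] by blast
    have eqI: "N n = N k" if "D (N n) = D (N k)" for n k
      using D(2)[OF N[of n] N[of k]] D(2)[OF N[of k] N[of n]] that by blast
    show "\<exists>k. \<forall>n\<ge>k. N n = N k"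
    proof (cases "\<exists>k m. m \<notin> D (N k)")
      case False
      then have "D (N n) = D (N 0)" for n by auto
      then show ?thesis using eqI by blast
    next
      case True
      then obtain k m where m: "m \<notin> D (N k)" by blast
      have "D (N k) \<subseteq> {..<m}"
      proof
        fix j assume "j \<in> D (N k)"
        then show "j \<in> {..<m}" using D(1)[OF N, of j k m] m by (metis lessThan_iff not_le)
      qed
      then have fin: "finite (D (N n))" if "n \<ge> k" for n
        using Dmono[OF that] by (meson finite_lessThan finite_subset)
      obtain l where l: "l \<ge> k" "\<And>n. n \<ge> k \<Longrightarrow> card (D (N l)) \<le> card (D (N n))"
        using ex_has_least_nat[of "\<lambda>n. n \<ge> k" k "\<lambda>n. card (D (N n))"] by blast
      have "N n = N l" if n: "n \<ge> l" for n
      proof (rule eqI)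
        show "D (N n) = D (N l)" using card_seteq[OF fin[OF l(1)] Dmono[OF n]] l(2)[of n] l(1) n by simp
      qed
      then show ?thesis by blast
    qed
  qed
qed

lemma Quo_F_S_nonzero: "carrier (Quo (carrier F) S) \<noteq> {\<zero>\<^bsub>Quo (carrier F) S\<^esub>}"
proof (rule Quo_nonzero[OF S_rmod])
  obtain x where x: "x \<in> M" "x \<noteq> \<zero>" using uniformizer by metis
  obtain w where w: "w \<in> carrier F" "x \<otimes> w = \<one>" using inverse_exists[of x] x by auto
  have "w \<notin> S"
  proof
    assume "w \<in> S"
    then have "Sunit x" using w x by (intro SunitI[of x w]) auto
    then show False using x Sunit_R by simp
  qed
  then show "S \<subset> carrier F" using w(1) by auto
qed simp

theorem imp_direct_sum_of_copies:
  "nonempty_direct_sum_of_copies A (Quo S R) (Quo (carrier F) S)"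
  unfolding nonempty_direct_sum_of_copies_def using Quo_S_R_decomposition by metis

theorem imp_direct_sum_of_artinian_uniserial:
  "nonempty_direct_sum_of_nonzero A (Quo S R) (\<lambda>L. divisible_mod A L \<and> artinian_mod A L \<and> uniserial A L)"
proof -
  obtain B :: "'a set set" where "B \<noteq> {}" "mod_isomorphic A (Quo S R) (direct_sum B (\<lambda>_. Quo (carrier F) S))"
    by (rule Quo_S_R_decomposition)
  then show ?thesis
    unfolding nonempty_direct_sum_of_nonzero_def
    using Quo_F_S_module Quo_F_S_nonzero Quo_F_divisible[OF S_rmod] Quo_F_S_artinian Quo_F_S_uniserial
    by (intro exI[of _ B] exI[of _ "\<lambda>_. Quo (carrier F) S"]) simp
qed

end

lemma (in fraction_field) DVR_subring:
  assumes dvr: "DVR (F\<lparr>carrier := S\<rparr>)" shows "subring S F"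
proof -
  have "ring (F\<lparr>carrier := S\<rparr>)" using dvr unfolding DVR_def quasilocal_def cring_def by blast
  then show ?thesis by (intro ring_incl_imp_subring) auto
qed

locale normalization_DVR = fraction_field +
  assumes dvr: "DVR (F\<lparr>carrier := S\<rparr>)"
    and local: "quasilocal (F\<lparr>carrier := R\<rparr>)"
    and proper: "S \<noteq> R"
    and divisible_cokernel: "\<lbrakk>r \<in> R; r \<noteq> \<zero>; s \<in> S\<rbrakk> \<Longrightarrow> \<exists>a\<in>R. \<exists>t\<in>S. s = a \<oplus> r \<otimes> t"
    and conductors: "\<lbrakk>b \<in> R; v \<in> S; s \<in> S; b \<otimes> v \<in> R; b \<otimes> s \<in> R\<rbrakk> \<Longrightarrow> b \<otimes> (v \<otimes> s) \<in> R"
begin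

abbreviation V :: "('a, 'b) ring_scheme" where
  "V \<equiv> F\<lparr>carrier := S\<rparr>"

lemmas subring_S = DVR_subring[OF dvr]

lemmas S_cl [simp, intro] = subringE(2,3,5-7)[OF subring_S]

lemma rmod_S: "rmod S"
  by (auto simp: rmod_def)

lemma S_principal:
  assumes J: "J \<subseteq> S" "\<zero> \<in> J" "\<And>x y. x \<in> J \<Longrightarrow> y \<in> J \<Longrightarrow> x \<oplus> y \<in> J" "\<And>c x. c \<in> S \<Longrightarrow> x \<in> J \<Longrightarrow> c \<otimes> x \<in> J"
  obtains a where "a \<in> J" "\<And>x. x \<in> J \<Longrightarrow> \<exists>s\<in>S. x = s \<otimes> a"
proof -
  have pd: "principal_domain V" using dvr by (simp add: DVR_def)
  have "ideal J V" unfolding ideal_subring_iff[OF subring_S] using J by blast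
  then obtain a where a: "a \<in> S" "J = PIdl\<^bsub>V\<^esub> a"
    using principal_domain.exists_gen[OF pd] by auto
  have "a \<in> J" unfolding a(2) cgenideal_def using a(1) S_cl(2) by (auto intro!: exI[of _ \<one>])
  moreover have "\<exists>s\<in>S. x = s \<otimes> a" if "x \<in> J" for x using that unfolding a(2) cgenideal_def by auto
  ultimately show ?thesis by (rule that)
qed

lemma nonunits_add:
  assumes x: "x \<in> S" "\<And>v. v \<in> S \<Longrightarrow> x \<otimes> v \<noteq> \<one>" and y: "y \<in> S" "\<And>v. v \<in> S \<Longrightarrow> y \<otimes> v \<noteq> \<one>"
  shows "x \<oplus> y \<noteq> \<one>"
proof
  assume e: "x \<oplus> y = \<one>"
  have q: "quasilocal V" using dvr by (simp add: DVR_def)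
  interpret V: cring V using q by (simp add: quasilocal_def)
  have "x \<oplus>\<^bsub>V\<^esub> y \<notin> Units V"
    by (rule V.quasilocal_nonunit_add[OF q]) (use x y in \<open>auto simp: Units_subring[OF subring_S]\<close>)
  then show False using e by (auto simp: Units_subring[OF subring_S])
qed

lemma divides_total:
  assumes x: "x \<in> S" and y: "y \<in> S"
  shows "(\<exists>s\<in>S. x = s \<otimes> y) \<or> (\<exists>s\<in>S. y = s \<otimes> x)"
proof -
  let ?J = "{s \<otimes> x \<oplus> t \<otimes> y |s t. s \<in> S \<and> t \<in> S}"
  have xy: "x \<in> ?J" "y \<in> ?J"
  proof -
    have "x = \<one> \<otimes> x \<oplus> \<zero> \<otimes> y" "y = \<zero> \<otimes> x \<oplus> \<one> \<otimes> y" using x y by simp_all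
    then show "x \<in> ?J" "y \<in> ?J" using S_cl(1,2) by blast+
  qed
  obtain a where a: "a \<in> ?J" "\<And>z. z \<in> ?J \<Longrightarrow> \<exists>s\<in>S. z = s \<otimes> a"
  proof (rule S_principal[of ?J])
    show "?J \<subseteq> S" using x y by auto
    have "\<zero> = \<zero> \<otimes> x \<oplus> \<zero> \<otimes> y" using x y by simp
    then show "\<zero> \<in> ?J" using S_cl(1) by blast
    show "z \<oplus> w \<in> ?J" if z: "z \<in> ?J" and w: "w \<in> ?J" for z w
    proof -
      obtain s t where st: "s \<in> S" "t \<in> S" "z = s \<otimes> x \<oplus> t \<otimes> y" using z by blast
      obtain s' t' where st': "s' \<in> S" "t' \<in> S" "w = s' \<otimes> x \<oplus> t' \<otimes> y" using w by blast
      have "z \<oplus> w = (s \<oplus> s') \<otimes> x \<oplus> (t \<oplus> t') \<otimes> y" unfolding st(3) st'(3) using st(1,2) st'(1,2) x y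
        by (simp add: l_distr a_ac)
      then show ?thesis using st st' by blast
    qed
    show "c \<otimes> z \<in> ?J" if c: "c \<in> S" and z: "z \<in> ?J" for c z
    proof -
      obtain s t where st: "s \<in> S" "t \<in> S" "z = s \<otimes> x \<oplus> t \<otimes> y" using z by blast
      have "c \<otimes> z = (c \<otimes> s) \<otimes> x \<oplus> (c \<otimes> t) \<otimes> y" unfolding st(3) using st(1,2) c x y by (simp add: r_distr m_assoc)
      then show ?thesis using st c by blast
    qed
  qed blast
  obtain x' where x': "x' \<in> S" "x = x' \<otimes> a" using a(2)[OF xy(1)] by blast
  obtain y' where y': "y' \<in> S" "y = y' \<otimes> a" using a(2)[OF xy(2)] by blast
  obtain s t where st: "s \<in> S" "t \<in> S" "a = s \<otimes> x \<oplus> t \<otimes> y" using a(1) by blast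
  have aS: "a \<in> S" using st x y by simp
  show ?thesis
  proof (cases "a = \<zero>")
    case True
    then have "x = \<zero> \<otimes> y" using x' y by simp
    then show ?thesis using S_cl(1) by blast
  next
    case False
    have "a \<otimes> (s \<otimes> x' \<oplus> t \<otimes> y') = s \<otimes> x \<oplus> t \<otimes> y" unfolding x'(2) y'(2) using aS st(1,2) x'(1) y'(1)
      by (simp add: r_distr m_ac)
    then have "a \<otimes> (s \<otimes> x' \<oplus> t \<otimes> y') = a \<otimes> \<one>" using st(3) aS by simp
    then have one: "s \<otimes> x' \<oplus> t \<otimes> y' = \<one>" using m_lcancel[OF False, of "s \<otimes> x' \<oplus> t \<otimes> y'" \<one>] aS st(1,2) x'(1) y'(1) by simp
    have *: "\<exists>v\<in>S. q' \<otimes> v = \<one>" if "p \<in> S" "q' \<in> S" "v \<in> S" "(p \<otimes> q') \<otimes> v = \<one>" for p q' v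
      using that by (intro bexI[of _ "p \<otimes> v"]) (simp_all add: m_ac)
    have "(\<exists>v\<in>S. x' \<otimes> v = \<one>) \<or> (\<exists>v\<in>S. y' \<otimes> v = \<one>)"
      using nonunits_add[of "s \<otimes> x'" "t \<otimes> y'"] one *[OF st(1) x'(1)] *[OF st(2) y'(1)] st x'(1) y'(1) by blast
    then show ?thesis
    proof
      assume "\<exists>v\<in>S. x' \<otimes> v = \<one>"
      then obtain v where v: "v \<in> S" "x' \<otimes> v = \<one>" by blast
      have "(y' \<otimes> v) \<otimes> x = y' \<otimes> (x' \<otimes> v) \<otimes> a" unfolding x'(2) using y'(1) v(1) x'(1) aS by (simp add: m_ac)
      then have "y = (y' \<otimes> v) \<otimes> x" using v y' by simp
      then show ?thesis using y'(1) v(1) by blast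
    next
      assume "\<exists>v\<in>S. y' \<otimes> v = \<one>"
      then obtain v where v: "v \<in> S" "y' \<otimes> v = \<one>" by blast
      have "(x' \<otimes> v) \<otimes> y = x' \<otimes> (y' \<otimes> v) \<otimes> a" unfolding y'(2) using y'(1) v(1) x'(1) aS by (simp add: m_ac)
      then have "x = (x' \<otimes> v) \<otimes> y" using v x' by simp
      then show ?thesis using x'(1) v(1) by blast
    qed
  qed
qed

lemma ideal_generator:
  assumes I: "I \<subseteq> S" "I \<noteq> {}"
  obtains x where "x \<in> I" "\<And>y. y \<in> I \<Longrightarrow> \<exists>s\<in>S. y = s \<otimes> x"
proof -
  let ?J = "{s \<otimes> i |s i. s \<in> S \<and> i \<in> I}"
  obtain i0 where i0: "i0 \<in> I" using I by blast
  obtain a where a: "a \<in> ?J" "\<And>z. z \<in> ?J \<Longrightarrow> \<exists>s\<in>S. z = s \<otimes> a"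
  proof (rule S_principal[of ?J])
    show "?J \<subseteq> S" using I by auto
    have "\<zero> = \<zero> \<otimes> i0" using I i0 by auto
    then show "\<zero> \<in> ?J" using S_cl(1) i0 by blast
    show "c \<otimes> z \<in> ?J" if c: "c \<in> S" and z: "z \<in> ?J" for c z
    proof -
      obtain s i where s: "s \<in> S" "i \<in> I" "z = s \<otimes> i" using z by blast
      have "c \<otimes> z = (c \<otimes> s) \<otimes> i" unfolding s(3) using s I c by (auto simp: m_assoc)
      then show ?thesis using s c by blast
    qed
    show "z \<oplus> w \<in> ?J" if z: "z \<in> ?J" and w: "w \<in> ?J" for z w
    proof -
      obtain s i where s: "s \<in> S" "i \<in> I" "z = s \<otimes> i" using z by blast
      obtain t j where t: "t \<in> S" "j \<in> I" "w = t \<otimes> j" using w by blast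
      have ij: "i \<in> S" "j \<in> S" using s t I by auto
      from divides_total[OF ij] show ?thesis
      proof
        assume "\<exists>c\<in>S. i = c \<otimes> j"
        then obtain c where c: "c \<in> S" "i = c \<otimes> j" by blast
        have "z \<oplus> w = (s \<otimes> c \<oplus> t) \<otimes> j" unfolding s(3) t(3) c(2) using s(1) t(1) c(1) ij by (simp add: l_distr m_assoc)
        then show ?thesis using s(1) t(1,2) c(1) by blast
      next
        assume "\<exists>c\<in>S. j = c \<otimes> i"
        then obtain c where c: "c \<in> S" "j = c \<otimes> i" by blast
        have "z \<oplus> w = (s \<oplus> t \<otimes> c) \<otimes> i" unfolding s(3) t(3) c(2) using s(1) t(1) c(1) ij by (simp add: l_distr m_assoc)
        then show ?thesis using s(1,2) t(1) c(1) by blast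
      qed
    qed
  qed blast
  obtain s x where s: "s \<in> S" "x \<in> I" "a = s \<otimes> x" using a(1) by blast
  have "\<exists>t\<in>S. y = t \<otimes> x" if y: "y \<in> I" for y
  proof -
    have "y = \<one> \<otimes> y" using y I by auto
    then have "y \<in> ?J" using y S_cl(2) by blast
    from a(2)[OF this] obtain t where t: "t \<in> S" "y = t \<otimes> a" by blast
    then have "y = (t \<otimes> s) \<otimes> x" using s I by (auto simp: m_assoc)
    then show ?thesis using t s by blast
  qed
  then show ?thesis using that s by blast
qed

text \<open>lying over\<close>
lemma nonunit_R_nonunit_S:
  assumes m: "m \<in> M" and w: "w \<in> S" shows "m \<otimes> w \<noteq> \<one>"
proof
  assume mw: "m \<otimes> w = \<one>"
  have mR: "m \<in> R" using m by (rule M_R)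
  have m0: "m \<noteq> \<zero>" using mw w by auto
  have wm: "\<one> = w \<otimes> m" using mw mR w by (simp add: m_comm)
  obtain p where p: "set p \<subseteq> R" "homogenize (\<one> # p) \<one> m = \<zero>"
    by (rule integral_homogeneous_equation[OF w one_closed R_carrier[OF mR] m0 wm])
  define h where "h = homogenize p \<one> m"
  have h: "h \<in> R" unfolding h_def using homogenize_subring[OF subring_R _ _ p(1)] mR by simp
  have "\<one> \<oplus> m \<otimes> h = \<zero>" using p(2) by (simp add: h_def)
  then have "m \<otimes> (\<ominus> h) = \<one>" using mR h by (metis R_carrier m_closed minus_equality minus_minus one_closed r_minus)
  then have "m \<notin> M" using h unfolding M_def by (auto intro!: bexI[of _ "\<ominus> h"])
  then show False using m by simp
qed

lemma power_in_principal:
  assumes r: "r \<in> R" "r \<noteq> \<zero>" and m: "m \<in> M"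
  obtains n :: nat and s where "s \<in> S" "m [^] n = r \<otimes> s"
proof (rule ccontr)
  note given = that
  assume no: "\<not> thesis"
  have mS: "m \<in> S" using m by simp
  have mn: "m [^] (n::nat) \<in> S" for n by (rule subring_pow[OF subring_S mS])
  have rm: "\<exists>v\<in>S. r = m [^] n \<otimes> v" for n :: nat
    using divides_total[OF mn[of n] R_S[OF r(1)]]
  proof
    assume "\<exists>s\<in>S. m [^] n = s \<otimes> r"
    then obtain s where s: "s \<in> S" "m [^] n = s \<otimes> r" by blast
    have "m [^] n = r \<otimes> s" unfolding s(2) using s(1) r(1) by (simp add: m_comm)
    then show ?thesis using no given[OF s(1)] by blast
  next
    assume "\<exists>s\<in>S. r = s \<otimes> m [^] n"
    then obtain s where s: "s \<in> S" "r = s \<otimes> m [^] n" by blast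
    have "s \<otimes> m [^] n = m [^] n \<otimes> s" using s(1) mS by (simp add: m_comm)
    then show ?thesis using s by metis
  qed
  let ?J = "{v \<in> S. \<exists>n::nat. \<exists>u\<in>S. m [^] n \<otimes> v = r \<otimes> u}"
  obtain t where t: "t \<in> ?J" "\<And>z. z \<in> ?J \<Longrightarrow> \<exists>s\<in>S. z = s \<otimes> t"
  proof (rule S_principal[of ?J])
    show "\<zero> \<in> ?J" using r mS by (auto intro!: bexI[of _ \<zero>])
    show "c \<otimes> z \<in> ?J" if c: "c \<in> S" and z: "z \<in> ?J" for c z
    proof -
      obtain n u where u: "u \<in> S" "m [^] (n::nat) \<otimes> z = r \<otimes> u" using z by blast
      have zS: "z \<in> S" using z by blast
      have "m [^] n \<otimes> (c \<otimes> z) = c \<otimes> (m [^] n \<otimes> z)" using c zS mn mS by (simp add: m_lcomm)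
      also have "\<dots> = r \<otimes> (c \<otimes> u)" unfolding u(2) using c u(1) r by (simp add: m_lcomm)
      finally show ?thesis using c zS u(1) by blast
    qed
    show "z \<oplus> w \<in> ?J" if z: "z \<in> ?J" and w: "w \<in> ?J" for z w
    proof -
      obtain n u where u: "u \<in> S" "m [^] (n::nat) \<otimes> z = r \<otimes> u" using z by blast
      obtain k x where x: "x \<in> S" "m [^] (k::nat) \<otimes> w = r \<otimes> x" using w by blast
      have zw: "z \<in> S" "w \<in> S" using z w by auto
      have "m [^] (n + k) \<otimes> (z \<oplus> w) = m [^] k \<otimes> (m [^] n \<otimes> z) \<oplus> m [^] n \<otimes> (m [^] k \<otimes> w)"
        using zw mS by (simp flip: nat_pow_mult add: r_distr m_ac)
      also have "\<dots> = r \<otimes> (m [^] k \<otimes> u \<oplus> m [^] n \<otimes> x)" unfolding u(2) x(2) using u(1) x(1) r mS by (simp add: r_distr m_lcomm)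
      finally show ?thesis using zw u(1) x(1) mn by blast
    qed
  qed blast+
  obtain n u where u: "t \<in> S" "u \<in> S" "m [^] (n::nat) \<otimes> t = r \<otimes> u" using t(1) by blast
  obtain v where v: "v \<in> S" "r = m [^] Suc n \<otimes> v" using rm by blast
  have m0: "m [^] n \<noteq> \<zero>" using r(2) v mS mn by (auto simp: nat_pow_Suc)
  have "m [^] n \<otimes> t = m [^] n \<otimes> (m \<otimes> (v \<otimes> u))" unfolding u(3) v(2) using mS v(1) u(2) by (simp add: m_ac)
  then have t1: "t = m \<otimes> (v \<otimes> u)" using m_lcancel[OF m0, of t "m \<otimes> (v \<otimes> u)"] mS u(1,2) v(1) by simp
  have "m [^] Suc n \<otimes> (v \<otimes> u) = r \<otimes> u" unfolding v(2) using mS v(1) u(2) by (simp add: m_assoc)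
  then have "v \<otimes> u \<in> ?J" using v(1) u(2) S_cl(5) by blast
  from t(2)[OF this] obtain w where w: "w \<in> S" "v \<otimes> u = w \<otimes> t" by blast
  have "t \<otimes> (m \<otimes> w) = m \<otimes> (w \<otimes> t)" using w(1) u(1) mS by (simp add: m_ac)
  also have "\<dots> = t \<otimes> \<one>" unfolding w(2)[symmetric] t1[symmetric] using u(1) by simp
  finally have tm: "t \<otimes> (m \<otimes> w) = t \<otimes> \<one>" .
  have "\<one> \<otimes> r = r \<otimes> \<one>" using r by simp
  then have "r \<in> ?J" using r(1) S_cl(2) by (auto intro!: exI[of _ "0::nat"] bexI[of _ \<one>])
  from t(2)[OF this] obtain s where s: "s \<in> S" "r = s \<otimes> t" by blast
  then have "t \<noteq> \<zero>" using r by auto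
  then have "m \<otimes> w = \<one>" using m_lcancel[of t "m \<otimes> w" \<one>] tm u(1) mS w(1) by simp
  then show False using nonunit_R_nonunit_S[OF m w(1)] by simp
qed

lemma nonzero_prime_eq_M:
  assumes P: "primeideal P A" "P \<noteq> {\<zero>}"
  shows "P = M"
proof
  interpret P: primeideal P A by fact
  have PR: "P \<subseteq> R" using P.a_subset by simp
  have P0: "\<zero> \<in> P" using additive_subgroup.zero_closed[OF P.is_additive_subgroup] by simp
  show "P \<subseteq> M"
  proof
    fix p assume p: "p \<in> P"
    show "p \<in> M"
    proof (rule ccontr)
      assume "p \<notin> M"
      then obtain i where "i \<in> R" "p \<otimes> i = \<one>" using unit_R p PR by blast
      then have "\<one> \<in> P" using P.I_r_closed[OF p, of i] by simp
      then show False using P.one_imp_carrier P.I_notcarr by simp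
    qed
  qed
  show "M \<subseteq> P"
  proof
    fix m assume m: "m \<in> M"
    obtain r where r: "r \<in> P" "r \<noteq> \<zero>" using P(2) P0 by blast
    have rR: "r \<in> R" using r PR by blast
    have mR: "m \<in> R" using m by (rule M_R)
    obtain n s where s: "s \<in> S" "m [^] (n::nat) = r \<otimes> s" using power_in_principal[OF rR r(2) m] by blast
    have mn: "m [^] n \<in> R" by (rule subring_pow[OF subring_R mR])
    have rs: "r \<otimes> s \<in> R" using s mn by simp
    have rss: "r \<otimes> (s \<otimes> s) \<in> R" using conductors[OF rR s(1) s(1) rs rs] .
    have "m [^] (n + n) = r \<otimes> (r \<otimes> (s \<otimes> s))" using s rR mR by (simp flip: nat_pow_mult add: m_ac)
    moreover have "r \<otimes> (r \<otimes> (s \<otimes> s)) \<in> P" using P.I_r_closed[OF r(1), of "r \<otimes> (s \<otimes> s)"] rss by simp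
    ultimately have "m [^] (n + n) \<in> P" by simp
    moreover have "m \<in> P" if "m [^] (k::nat) \<in> P" for k
      using that
    proof (induction k)
      case 0
      then show ?case using P.one_imp_carrier P.I_notcarr by simp
    next
      case (Suc k)
      then have "m [^] k \<otimes>\<^bsub>A\<^esub> m \<in> P" by simp
      then show ?case using P.I_prime[of "m [^] k" m] Suc.IH mR subring_pow[OF subring_R mR] by auto
    qed
    ultimately show "m \<in> P" by blast
  qed
qed

lemma M_nonzero: "M \<noteq> {\<zero>}"
proof
  assume M0: "M = {\<zero>}"
  obtain s where s: "s \<in> S" "s \<notin> R" using proper R_S by blast
  obtain a b where ab: "a \<in> R" "b \<in> R" "b \<noteq> \<zero>" "s \<otimes> b = a" using fraction[of s] s by auto
  then obtain c where c: "c \<in> R" "b \<otimes> c = \<one>" using unit_R[of b] M0 by auto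
  have "a \<otimes> c = s \<otimes> (b \<otimes> c)" unfolding ab(4)[symmetric] using s ab(2) c(1) by (simp add: m_assoc)
  then have "a \<otimes> c = s" using c s by simp
  then show False using ab(1) c(1) s(2) by blast
qed

lemma krull_dim_one: "krull_dim A = 1"
proof -
  interpret A: domain A by (rule A_domain)
  have addM: "m \<oplus> n \<in> M" if "m \<in> M" "n \<in> M" for m n using bad_imp_nonunit_add[OF local that] .
  let ?P = "(\<lambda>i::nat. if i = 0 then {\<zero>} else M)"
  have "\<forall>i\<le>1. primeideal (?P i) A" using A.zeroprimeideal M_prime[OF addM] by auto
  moreover have "\<forall>i<1. ?P i \<subset> ?P (Suc i)" using M_nonzero zero_M by auto
  ultimately have "\<exists>P. (\<forall>i\<le>1. primeideal (P i) A) \<and> (\<forall>i<1. P i \<subset> P (Suc i))" by (intro exI[of _ ?P] conjI)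
  then have "enat 1 \<le> krull_dim A" unfolding krull_dim_def by (intro Sup_upper CollectI exI[of _ 1] conjI refl)
  moreover have "krull_dim A \<le> enat 1"
    unfolding krull_dim_def
  proof (rule Sup_least)
    fix d assume "d \<in> {enat n |n. \<exists>P. (\<forall>i\<le>n. primeideal (P i) A) \<and> (\<forall>i<n. P i \<subset> P (Suc i))}"
    then obtain n P where n: "d = enat n" "\<And>i. i \<le> n \<Longrightarrow> primeideal (P i) A" "\<And>i. i < n \<Longrightarrow> P i \<subset> P (Suc i)" by auto
    have nz: "P (Suc i) = M" if "i < n" for i
    proof (rule nonzero_prime_eq_M)
      show "primeideal (P (Suc i)) A" using n(2) that by simp
      have "primeideal (P i) A" using n(2) that by simp
      then have "\<zero>\<^bsub>A\<^esub> \<in> P i" unfolding primeideal_def ideal_def by (blast intro: additive_subgroup.zero_closed)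
      then show "P (Suc i) \<noteq> {\<zero>}" using n(3)[OF that] by auto
    qed
    have "n \<le> 1"
    proof (rule ccontr)
      assume "\<not> n \<le> 1"
      then have "P (Suc 0) = M" "P (Suc (Suc 0)) = M" "P (Suc 0) \<subset> P (Suc (Suc 0))" using nz[of 0] nz[of "Suc 0"] n(3)[of "Suc 0"] by auto
      then show False by simp
    qed
    then show "d \<le> enat 1" using n(1) by simp
  qed
  ultimately show ?thesis by (simp add: one_enat_def)
qed

lemma common_denominator_finite:
  assumes "finite G" "G \<subseteq> carrier F" shows "\<exists>d\<in>R. d \<noteq> \<zero> \<and> (\<forall>g\<in>G. d \<otimes> g \<in> R)"
  using assms
proof (induction G rule: finite_induct)
  case empty
  then show ?case using R_closed(2) one_not_zero by blast
next
  case (insert g G)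
  then obtain d where d: "d \<in> R" "d \<noteq> \<zero>" "\<forall>g\<in>G. d \<otimes> g \<in> R" by auto
  have gF: "g \<in> carrier F" using insert.prems by simp
  obtain a b where ab: "a \<in> R" "b \<in> R" "b \<noteq> \<zero>" "g \<otimes> b = a" using fraction[OF gF] by metis
  have "d \<otimes> b \<otimes> h \<in> R" if h: "h \<in> insert g G" for h
  proof (cases "h = g")
    case True
    have "d \<otimes> b \<otimes> g = d \<otimes> a" unfolding ab(4)[symmetric] using d(1) ab(2) gF by (simp add: m_ac)
    then show ?thesis using True d(1) ab(1) by simp
  next
    case False
    then have hG: "h \<in> G" "h \<in> carrier F" using h insert.prems by auto
    have "d \<otimes> b \<otimes> h = b \<otimes> (d \<otimes> h)" using d(1) ab(2) hG(2) by (simp add: m_ac)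
    then show ?thesis using d(3) hG(1) ab(2) by simp
  qed
  moreover have "d \<otimes> b \<noteq> \<zero>" using d ab integral[of d b] by auto
  ultimately show ?case using d(1) ab(2) by blast
qed

lemma not_finite_normalization: "\<not> finite_normalization F R"
proof
  assume "finite_normalization F R"
  then obtain G where G: "G \<subseteq> S" "finite G" "\<Inter>{N. submodule N A (module_in F S) \<and> G \<subseteq> N} = S"
    unfolding finite_normalization_def fin_gen_mod_def S_def[symmetric] by auto
  have "G \<subseteq> carrier F" using G(1) by blast
  then obtain d where d: "d \<in> R" "d \<noteq> \<zero>" "\<And>g. g \<in> G \<Longrightarrow> d \<otimes> g \<in> R" using common_denominator_finite[OF G(2)] by blast
  define N where "N = {v \<in> S. d \<otimes> v \<in> R}"
  have "rmod N"
    unfolding rmod_def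
  proof (intro conjI ballI)
    show "N \<subseteq> carrier F" by (auto simp: N_def)
    show "\<zero> \<in> N" using d by (simp add: N_def)
    show "v \<oplus> w \<in> N" if "v \<in> N" "w \<in> N" for v w using that d by (auto simp: N_def r_distr)
    show "r \<otimes> v \<in> N" if "r \<in> R" "v \<in> N" for r v
    proof -
      have v: "v \<in> S" "d \<otimes> v \<in> R" using that by (auto simp: N_def)
      have "d \<otimes> (r \<otimes> v) = r \<otimes> (d \<otimes> v)" using d(1) that(1) v(1) by (simp add: m_lcomm)
      then show ?thesis using that v by (simp add: N_def)
    qed
  qed
  then have "submodule N A (module_in F S)" using submodule_iff_rmod[OF rmod_S] by (auto simp: N_def)
  moreover have "G \<subseteq> N" using G(1) d(3) by (auto simp: N_def)
  ultimately have SN: "S \<subseteq> N" using G(3) by blast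
  have "S \<subseteq> R"
  proof
    fix s assume s: "s \<in> S"
    obtain a t where at: "a \<in> R" "t \<in> S" "s = a \<oplus> d \<otimes> t" using divisible_cokernel[OF d(1,2) s] by blast
    have "d \<otimes> t \<in> R" using SN at(2) by (auto simp: N_def)
    then show "s \<in> R" using at by simp
  qed
  then show False using proper R_S by blast
qed

end

context normalization_DVR
begin

lemma ideal_principal_over_mult_ring:
  assumes I: "rmod I" "I \<subseteq> R" "I \<noteq> {\<zero>}"
  obtains x where "x \<in> I" "x \<noteq> \<zero>" "\<And>y. y \<in> I \<Longrightarrow> \<exists>t\<in>mult_ring I. y = t \<otimes> x"
proof -
  note ID = rmodD[OF I(1)]
  have IS: "I \<subseteq> S" "I \<noteq> {}" using I(2) R_S ID(2) by blast+
  obtain x where x: "x \<in> I" "\<And>y. y \<in> I \<Longrightarrow> \<exists>s\<in>S. y = s \<otimes> x" using ideal_generator[OF IS] by metis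
  have xR: "x \<in> R" using x I by blast
  have x0: "x \<noteq> \<zero>"
  proof
    assume x0: "x = \<zero>"
    have "y = \<zero>" if "y \<in> I" for y using x(2)[OF that] unfolding x0 by auto
    then show False using I(3) ID(2) by blast
  qed
  have xx: "x \<otimes> x \<in> R" using xR by simp
  have split: "\<exists>c\<in>R. \<exists>v'\<in>S. v = c \<oplus> x \<otimes> v' \<and> x \<otimes> x \<otimes> v' \<in> R" if v: "v \<in> S" "v \<otimes> x \<in> I" for v
  proof -
    obtain c v' where c: "c \<in> R" "v' \<in> S" "v = c \<oplus> x \<otimes> v'" using divisible_cokernel[OF xR x0 v(1)] by blast
    have [simp]: "c \<in> carrier F" "v' \<in> carrier F" "x \<in> carrier F" using c xR by auto
    have "x \<otimes> x \<otimes> v' = v \<otimes> x \<ominus> c \<otimes> x" unfolding c(3) by (reify ring_reify, rule ring_identityI, simp, simp, code_simp)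
    moreover have "v \<otimes> x \<in> R" using v(2) I(2) by blast
    ultimately have "x \<otimes> x \<otimes> v' \<in> R" using c(1) xR by simp
    then show ?thesis using c by blast
  qed
  have mult: "v \<otimes> (w \<otimes> x) \<in> I" if v: "v \<in> S" "v \<otimes> x \<in> I" and w: "w \<in> S" "w \<otimes> x \<in> I" for v w
  proof -
    obtain c v' where c: "c \<in> R" "v' \<in> S" "v = c \<oplus> x \<otimes> v'" "x \<otimes> x \<otimes> v' \<in> R" using split[OF v] by blast
    obtain d w' where d: "d \<in> R" "w' \<in> S" "w = d \<oplus> x \<otimes> w'" "x \<otimes> x \<otimes> w' \<in> R" using split[OF w] by blast
    define e where "e = x \<otimes> x \<otimes> (v' \<otimes> w')"
    have e: "e \<in> R" unfolding e_def by (rule conductors[OF xx c(2) d(2) c(4) d(4)])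
    have [simp]: "c \<in> carrier F" "v' \<in> carrier F" "x \<in> carrier F" "d \<in> carrier F" "w' \<in> carrier F" using c d xR by auto
    have "v \<otimes> (w \<otimes> x) = c \<otimes> (w \<otimes> x) \<oplus> d \<otimes> (v \<otimes> x) \<ominus> (c \<otimes> d) \<otimes> x \<oplus> e \<otimes> x"
      unfolding c(3) d(3) e_def by (reify ring_reify, rule ring_identityI, simp, simp, code_simp)
    moreover have "c \<otimes> (w \<otimes> x) \<in> I" "d \<otimes> (v \<otimes> x) \<in> I" "(c \<otimes> d) \<otimes> x \<in> I" "e \<otimes> x \<in> I"
      using ID(4)[OF _ w(2)] ID(4)[OF _ v(2)] ID(4)[OF _ x(1)] c(1) d(1) e by auto
    ultimately show ?thesis by (simp add: ID(3) rmod_minus[OF I(1)])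
  qed
  have "\<exists>t\<in>mult_ring I. y = t \<otimes> x" if y: "y \<in> I" for y
  proof -
    obtain t where t: "t \<in> S" "y = t \<otimes> x" using x(2)[OF y] by blast
    have "t \<otimes> j \<in> I" if j: "j \<in> I" for j
    proof -
      obtain w where w: "w \<in> S" "j = w \<otimes> x" using x(2)[OF j] by blast
      show ?thesis using mult[OF t(1) _ w(1)] t(2) w(2) y j by simp
    qed
    then have "t \<in> mult_ring I" using t(1) by (simp add: mult_ring_def)
    then show ?thesis using t(2) by blast
  qed
  then show ?thesis using that x(1) x0 by blast
qed

end

lemma (in fraction_field) principal_over_mult_ring_imp_stable:
  assumes I: "rmod I" "I \<subseteq> R" and x: "x \<in> I" "x \<noteq> \<zero>" "\<And>y. y \<in> I \<Longrightarrow> \<exists>t\<in>mult_ring I. y = t \<otimes> x"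
  shows "stable_ideal A I"
proof -
  note ID = rmodD[OF I(1)]
  define N where "N = module_in A I"
  define E where "E = End_ring A N"
  define T where "T = mult_ring I"
  define \<mu> where "\<mu> = (\<lambda>t. \<lambda>y\<in>I. t \<otimes> y)"
  have T: "subring T F" unfolding T_def by (rule mult_ring_subring[OF I(1)])
  note TD = subringE[OF T]
  have Tcl: "t \<in> carrier F" if "t \<in> T" for t using that TD(1) by blast
  have TI: "t \<otimes> y \<in> I" if "t \<in> T" "y \<in> I" for t y using that unfolding T_def mult_ring_def by blast
  have xF: "x \<in> carrier F" using ID(1) x(1) .
  have cN: "carrier N = I" by (simp add: N_def)
  have \<mu>E: "\<mu> t \<in> carrier E" if "t \<in> T" for t
    using mult_in_End[OF I] that unfolding \<mu>_def E_def N_def T_def by blast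
  have E\<mu>: "\<exists>t\<in>T. f = \<mu> t" if f: "f \<in> carrier E" for f
  proof -
    have f': "f \<in> carrier (End_ring A (module_in A I))" using f unfolding E_def N_def .
    note Ea = End_apply[OF I f']
    obtain t where t: "t \<in> T" "f x = t \<otimes> x" using x(3)[OF Ea(1)[OF x(1) x(1)]] unfolding T_def by blast
    have "f y = t \<otimes> y" if y: "y \<in> I" for y
    proof -
      have c: "y \<in> carrier F" "f y \<in> carrier F" "t \<in> carrier F" using ID(1) y Ea(1)[OF y y] Tcl t(1) by auto
      have "x \<otimes> f y = y \<otimes> f x" by (rule Ea(2)[OF x(1) y])
      also have "\<dots> = x \<otimes> (t \<otimes> y)" unfolding t(2) using c xF by (simp add: m_ac)
      finally show ?thesis using m_lcancel[OF x(2) xF, of "f y" "t \<otimes> y"] c by simp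
    qed
    moreover have "f \<in> extensional I" using f' by simp
    ultimately have "f = \<mu> t" unfolding \<mu>_def by (auto simp: extensional_def fun_eq_iff)
    then show ?thesis using t(1) by blast
  qed
  have \<mu>_inj: "inj_on \<mu> T"
  proof (rule inj_onI)
    fix t u assume tu: "t \<in> T" "u \<in> T" "\<mu> t = \<mu> u"
    then have "\<mu> t x = \<mu> u x" by simp
    then have "x \<otimes> t = x \<otimes> u" using x(1) xF Tcl tu(1,2) by (simp add: \<mu>_def m_comm)
    then show "t = u" using m_lcancel[OF x(2) xF] Tcl tu(1,2) by simp
  qed
  have \<mu>_mult: "\<mu> (t \<otimes> u) = \<mu> t \<otimes>\<^bsub>E\<^esub> \<mu> u" if "t \<in> T" "u \<in> T" for t u
    using that TI Tcl ID(1) by (auto simp: \<mu>_def E_def cN compose_def m_assoc intro!: restrict_ext)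
  have \<mu>_add: "\<mu> (t \<oplus> u) = \<mu> t \<oplus>\<^bsub>E\<^esub> \<mu> u" if "t \<in> T" "u \<in> T" for t u
    using that Tcl ID(1) by (auto simp: \<mu>_def E_def N_def l_distr intro!: restrict_ext)
  have \<mu>_one: "\<mu> \<one> = \<one>\<^bsub>E\<^esub>" using ID(1) by (auto simp: \<mu>_def E_def N_def intro!: restrict_ext)
  have \<mu>_zero: "\<mu> \<zero> = \<zero>\<^bsub>E\<^esub>" using ID(1) by (auto simp: \<mu>_def E_def N_def intro!: restrict_ext)
  have bij: "bij_betw \<mu> T (carrier E)"
    unfolding bij_betw_def using \<mu>_inj \<mu>E E\<mu> by blast
  have "\<mu> \<in> ring_iso (F\<lparr>carrier := T\<rparr>) E"
    by (rule ring_iso_memI) (use \<mu>E \<mu>_mult \<mu>_add \<mu>_one bij in simp_all)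
  moreover have "cring (F\<lparr>carrier := T\<rparr>)" using subring_is_domain[OF T] by (simp add: domain_def)
  ultimately have "cring (E\<lparr>zero := \<mu> \<zero>\<^bsub>F\<lparr>carrier := T\<rparr>\<^esub>\<rparr>)" by (intro cring.ring_iso_imp_img_cring)
  moreover have "E\<lparr>zero := \<mu> \<zero>\<^bsub>F\<lparr>carrier := T\<rparr>\<^esub>\<rparr> = E" using \<mu>_zero by simp
  ultimately have Ecr: "cring E" by simp
  interpret E: cring E by (rule Ecr)
  interpret N: module A N 
  proof -
    have "N = module_in F I" by (simp add: N_def module_in_def)
    then show "module A N" using rmod_module[OF I(1)] by simp
  qed
  have ag: "abelian_group (over_End N)"
  proof (rule abelian_groupI)
    show "\<exists>z\<in>carrier (over_End N). z \<oplus>\<^bsub>over_End N\<^esub> y = \<zero>\<^bsub>over_End N\<^esub>" if "y \<in> carrier (over_End N)" for y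
      using that N.M.l_neg[of y] N.M.a_inv_closed[of y] by auto
  qed (use N.M.a_assoc N.M.a_comm N.M.l_zero N.M.a_closed N.M.zero_closed in auto)
  have hom: "f \<in> mod_hom A N N" if "f \<in> carrier E" for f using that unfolding E_def by simp
  have O: "module E (over_End N)"
  proof (rule moduleI[OF Ecr ag])
    show "f \<odot>\<^bsub>over_End N\<^esub> y \<in> carrier (over_End N)" if "f \<in> carrier E" "y \<in> carrier (over_End N)" for f y
      using hom[OF that(1)] that(2) by (auto simp: mod_hom_def)
    show "(f \<oplus>\<^bsub>E\<^esub> g) \<odot>\<^bsub>over_End N\<^esub> y = f \<odot>\<^bsub>over_End N\<^esub> y \<oplus>\<^bsub>over_End N\<^esub> g \<odot>\<^bsub>over_End N\<^esub> y"
      if "f \<in> carrier E" "g \<in> carrier E" "y \<in> carrier (over_End N)" for f g y using that(3) by (simp add: E_def)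
    show "f \<odot>\<^bsub>over_End N\<^esub> (y \<oplus>\<^bsub>over_End N\<^esub> z) = f \<odot>\<^bsub>over_End N\<^esub> y \<oplus>\<^bsub>over_End N\<^esub> f \<odot>\<^bsub>over_End N\<^esub> z"
      if "f \<in> carrier E" "y \<in> carrier (over_End N)" "z \<in> carrier (over_End N)" for f y z
      using hom[OF that(1)] that(2,3) by (simp add: mod_hom_def)
    show "(f \<otimes>\<^bsub>E\<^esub> g) \<odot>\<^bsub>over_End N\<^esub> y = f \<odot>\<^bsub>over_End N\<^esub> (g \<odot>\<^bsub>over_End N\<^esub> y)"
      if "f \<in> carrier E" "g \<in> carrier E" "y \<in> carrier (over_End N)" for f g y using that(3) by (simp add: E_def compose_def)
    show "\<one>\<^bsub>E\<^esub> \<odot>\<^bsub>over_End N\<^esub> y = y" if "y \<in> carrier (over_End N)" for y using that by (simp add: E_def)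
  qed
  define D where "D = direct_sum {x} (\<lambda>_. module_in E (carrier E))"
  interpret D: module E D unfolding D_def by (rule direct_sum_module[OF Ecr regular_module[OF Ecr]])
  obtain w where w: "w \<in> carrier F" "x \<otimes> w = \<one>" using inverse_exists[OF xF x(2)] by metis
  have wT: "w \<otimes> y \<in> T" "(w \<otimes> y) \<otimes> x = y" if y: "y \<in> I" for y
  proof -
    obtain t where t: "t \<in> T" "y = t \<otimes> x" using x(3)[OF y] unfolding T_def by blast
    have "w \<otimes> y = t \<otimes> (x \<otimes> w)" unfolding t(2) using w(1) Tcl[OF t(1)] xF by (simp add: m_ac)
    then have "w \<otimes> y = t" using w(2) Tcl[OF t(1)] by simp
    then show "w \<otimes> y \<in> T" "(w \<otimes> y) \<otimes> x = y" using t by simp_all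
  qed
  define g where "g = (\<lambda>y. \<lambda>_\<in>{x}. \<mu> (w \<otimes> y))"
  have gD: "g y \<in> carrier D" if "y \<in> I" for y
    unfolding D_def direct_sum_simps g_def using \<mu>E[OF wT(1)[OF that]] by auto
  have g_add: "g (y \<oplus> z) = g y \<oplus>\<^bsub>D\<^esub> g z" if yz: "y \<in> I" "z \<in> I" for y z
  proof -
    have "w \<otimes> (y \<oplus> z) = w \<otimes> y \<oplus> w \<otimes> z" using w(1) ID(1) yz by (simp add: r_distr)
    then have "\<mu> (w \<otimes> (y \<oplus> z)) = \<mu> (w \<otimes> y) \<oplus>\<^bsub>E\<^esub> \<mu> (w \<otimes> z)" using \<mu>_add wT(1) yz by simp
    then show ?thesis unfolding D_def direct_sum_simps g_def by (auto intro!: restrict_ext)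
  qed
  have g_smult: "g (f y) = f \<odot>\<^bsub>D\<^esub> g y" if f: "f \<in> carrier E" and y: "y \<in> I" for f y
  proof -
    obtain t where t: "t \<in> T" "f = \<mu> t" using E\<mu>[OF f] by blast
    have "w \<otimes> f y = t \<otimes> (w \<otimes> y)" unfolding t(2) \<mu>_def using y w(1) ID(1)[OF y] Tcl[OF t(1)] by (simp add: m_lcomm)
    then have "\<mu> (w \<otimes> f y) = f \<otimes>\<^bsub>E\<^esub> \<mu> (w \<otimes> y)" using \<mu>_mult[OF t(1) wT(1)[OF y]] t(2) by simp
    then show ?thesis unfolding D_def direct_sum_simps g_def by (auto intro!: restrict_ext)
  qed
  have g_hom: "g \<in> mod_hom E (over_End N) D"
    unfolding mod_hom_def using gD g_add g_smult by (auto simp: N_def)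
  have g_inj: "inj_on g I"
  proof (rule inj_onI)
    fix y z assume yz: "y \<in> I" "z \<in> I" "g y = g z"
    then have "g y x = g z x" by simp
    then have "\<mu> (w \<otimes> y) = \<mu> (w \<otimes> z)" by (simp add: g_def)
    then have "w \<otimes> y = w \<otimes> z" using inj_onD[OF \<mu>_inj] wT(1) yz(1,2) by blast
    then have "(w \<otimes> y) \<otimes> x = (w \<otimes> z) \<otimes> x" by (rule arg_cong)
    then show "y = z" unfolding wT(2)[OF yz(1)] wT(2)[OF yz(2)] .
  qed
  have g_surj: "\<exists>y\<in>I. d = g y" if d: "d \<in> carrier D" for d
  proof -
    have dx: "d x \<in> carrier E" "d \<in> extensional {x}" using d unfolding D_def direct_sum_simps by (auto simp: PiE_iff)
    obtain t where t: "t \<in> T" "d x = \<mu> t" using E\<mu>[OF dx(1)] by blast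
    have "w \<otimes> (t \<otimes> x) = t \<otimes> (x \<otimes> w)" using w(1) xF Tcl[OF t(1)] by (simp add: m_ac)
    then have "w \<otimes> (t \<otimes> x) = t" using w(2) Tcl[OF t(1)] by simp
    then have "d = g (t \<otimes> x)" using dx(2) t(2) unfolding g_def by (auto simp: extensional_def fun_eq_iff)
    then show ?thesis using TI[OF t(1) x(1)] by blast
  qed
  have g_bij: "bij_betw g (carrier (over_End N)) (carrier D)"
    unfolding bij_betw_def using g_inj gD g_surj by (auto simp: cN)
  have iso: "mod_isomorphic E (over_End N) (D\<lparr>carrier := carrier D\<rparr>)"
    unfolding mod_isomorphic_def using g_hom g_bij by auto
  have Z: "submodule {\<zero>\<^bsub>D\<^esub>} E D" by (rule D.submoduleI) auto
  have sum: "carrier D <+>\<^bsub>D\<^esub> {\<zero>\<^bsub>D\<^esub>} = carrier D" by (auto simp: set_add_def')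
  have meet: "carrier D \<inter> {\<zero>\<^bsub>D\<^esub>} = {\<zero>\<^bsub>D\<^esub>}" using D.M.zero_closed by blast
  note summands = D.carrier_is_submodule Z sum meet iso
  have "projective_mod E (over_End N)"
    unfolding projective_mod_def Let_def
    by (rule conjI[OF O], rule exI[of _ "{x}"], rule exI[of _ "carrier D"], rule exI[of _ "{\<zero>\<^bsub>D\<^esub>}"],
      intro conjI; unfold D_def; rule summands[unfolded D_def])
  then show ?thesis unfolding stable_ideal_def ideal_A_iff E_def N_def using I by blast
qed

context normalization_DVR
begin

lemma stable: "stable_domain A"
  unfolding stable_domain_def
proof (intro conjI allI impI A_domain)
  fix J assume J: "ideal J A" "J \<noteq> {\<zero>\<^bsub>A\<^esub>}"
  then have J': "rmod J" "J \<subseteq> R" "J \<noteq> {\<zero>}" using ideal_A_iff by auto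
  obtain x where "x \<in> J" "x \<noteq> \<zero>" "\<And>y. y \<in> J \<Longrightarrow> \<exists>t\<in>mult_ring J. y = t \<otimes> x"
    using ideal_principal_over_mult_ring[OF J'] by metis
  then show "stable_ideal A J" by (rule principal_over_mult_ring_imp_stable[OF J'(1,2)])
qed

theorem bad_stable: "bad_stable_domain F R"
  unfolding bad_stable_domain_def using local stable krull_dim_one not_finite_normalization by blast

end

context fraction_field
begin

lemma subring_S_rmod:
  assumes C: "subring S F" shows "rmod S"
  unfolding rmod_def
proof (intro conjI ballI)
  note SE = subringE[OF C]
  show "S \<subseteq> carrier F" "\<zero> \<in> S" using SE(1,2) .
  show "x \<oplus> y \<in> S" if "x \<in> S" "y \<in> S" for x y using SE(7)[OF that] .
  show "r \<otimes> x \<in> S" if "r \<in> R" "x \<in> S" for r x using SE(6)[OF R_S[OF that(1)] that(2)] .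
qed

lemma annihilated_submodule:
  assumes L: "module A L" and c: "c \<in> R"
  shows "submodule {l \<in> carrier L. c \<odot>\<^bsub>L\<^esub> l = \<zero>\<^bsub>L\<^esub>} A L"
proof -
  interpret L: module A L by fact
  have comm: "c \<odot>\<^bsub>L\<^esub> (a \<odot>\<^bsub>L\<^esub> l) = a \<odot>\<^bsub>L\<^esub> (c \<odot>\<^bsub>L\<^esub> l)" if "a \<in> R" "l \<in> carrier L" for a l
    using L.smult_assoc1[of c a l] L.smult_assoc1[of a c l] c that by (simp add: m_comm)
  show ?thesis
  proof (rule L.submoduleI)
    fix l assume l: "l \<in> {l \<in> carrier L. c \<odot>\<^bsub>L\<^esub> l = \<zero>\<^bsub>L\<^esub>}"
    then have "c \<odot>\<^bsub>L\<^esub> (\<ominus>\<^bsub>L\<^esub> l) = \<zero>\<^bsub>L\<^esub>" using L.smult_r_minus[of c l] c by simp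
    then show "\<ominus>\<^bsub>L\<^esub> l \<in> {l \<in> carrier L. c \<odot>\<^bsub>L\<^esub> l = \<zero>\<^bsub>L\<^esub>}" using l by simp
  next
    show "a \<odot>\<^bsub>L\<^esub> l \<in> {l \<in> carrier L. c \<odot>\<^bsub>L\<^esub> l = \<zero>\<^bsub>L\<^esub>}"
      if "a \<in> carrier A" "l \<in> {l \<in> carrier L. c \<odot>\<^bsub>L\<^esub> l = \<zero>\<^bsub>L\<^esub>}" for a l
      using that comm[of a l] L.smult_closed[of a l] L.smult_r_null[of a] by simp
  qed (use c L.smult_r_null L.smult_r_distr in auto)
qed

lemma uniserial_S_linear:
  assumes L: "module A L" and div: "divisible_mod A L" and uni: "uniserial A L"
    and a: "a \<in> R" and b: "b \<in> R" "b \<noteq> \<zero>" and v: "v \<in> S" "a = b \<otimes> v"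
    and l: "l \<in> carrier L" "b \<odot>\<^bsub>L\<^esub> l = \<zero>\<^bsub>L\<^esub>"
  shows "a \<odot>\<^bsub>L\<^esub> l = \<zero>\<^bsub>L\<^esub>"
proof (rule ccontr)
  assume al: "a \<odot>\<^bsub>L\<^esub> l \<noteq> \<zero>\<^bsub>L\<^esub>"
  interpret L: module A L by fact
  have sm: "c \<odot>\<^bsub>L\<^esub> k \<in> carrier L" if "c \<in> R" "k \<in> carrier L" for c k using L.smult_closed that by simp
  have assoc: "(c \<otimes> d) \<odot>\<^bsub>L\<^esub> k = c \<odot>\<^bsub>L\<^esub> (d \<odot>\<^bsub>L\<^esub> k)" if "c \<in> R" "d \<in> R" "k \<in> carrier L" for c d k
    using L.smult_assoc1[of c d k] that by simp
  have distr: "(c \<oplus> d) \<odot>\<^bsub>L\<^esub> k = c \<odot>\<^bsub>L\<^esub> k \<oplus>\<^bsub>L\<^esub> d \<odot>\<^bsub>L\<^esub> k" if "c \<in> R" "d \<in> R" "k \<in> carrier L" for c d k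
    using L.smult_l_distr[of c d k] that by simp
  have null: "c \<odot>\<^bsub>L\<^esub> \<zero>\<^bsub>L\<^esub> = \<zero>\<^bsub>L\<^esub>" if "c \<in> R" for c using L.smult_r_null that by simp
  have an: "a [^] (n::nat) \<in> R" for n by (rule subring_pow[OF subring_R a])
  have sub: "b \<odot>\<^bsub>L\<^esub> k = \<zero>\<^bsub>L\<^esub>" if k: "k \<in> carrier L" "a \<odot>\<^bsub>L\<^esub> k = \<zero>\<^bsub>L\<^esub>" for k
    using uni annihilated_submodule[OF L a] annihilated_submodule[OF L b(1)] l al k unfolding uniserial_def by blast
  have kill: "(b \<otimes> homogenize p a b) \<odot>\<^bsub>L\<^esub> u = \<zero>\<^bsub>L\<^esub>"
    if "set p \<subseteq> R" "u \<in> carrier L" "p \<noteq> [] \<Longrightarrow> (b \<otimes> a [^] (length p - 1)) \<odot>\<^bsub>L\<^esub> u = \<zero>\<^bsub>L\<^esub>" for p u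
    using that
  proof (induction p arbitrary: u)
    case Nil
    then show ?case using b L.smult_l_null[of u] by simp
  next
    case (Cons c p)
    have c: "c \<in> R" and p: "set p \<subseteq> R" and u: "u \<in> carrier L" using Cons.prems by auto
    have hR: "homogenize p a b \<in> R" by (rule homogenize_subring[OF subring_R a b(1) p])
    have bu: "b \<odot>\<^bsub>L\<^esub> u \<in> carrier L" by (rule sm[OF b(1) u])
    have bak: "(b \<otimes> a [^] length p) \<odot>\<^bsub>L\<^esub> u = \<zero>\<^bsub>L\<^esub>" using Cons.prems(3) by simp
    have "(b \<otimes> a [^] (length p - 1)) \<odot>\<^bsub>L\<^esub> (b \<odot>\<^bsub>L\<^esub> u) = \<zero>\<^bsub>L\<^esub>" if ne: "p \<noteq> []"
    proof -
      obtain n where n: "length p = Suc n" using ne by (cases p) auto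
      have "a \<odot>\<^bsub>L\<^esub> (a [^] n \<odot>\<^bsub>L\<^esub> (b \<odot>\<^bsub>L\<^esub> u)) = (a \<otimes> (a [^] n \<otimes> b)) \<odot>\<^bsub>L\<^esub> u"
        using a b(1) an u sm by (simp add: assoc)
      also have "a \<otimes> (a [^] n \<otimes> b) = b \<otimes> a [^] length p" using a b(1) an by (simp add: n m_ac)
      finally have "a \<odot>\<^bsub>L\<^esub> (a [^] n \<odot>\<^bsub>L\<^esub> (b \<odot>\<^bsub>L\<^esub> u)) = \<zero>\<^bsub>L\<^esub>" using bak by simp
      then have "b \<odot>\<^bsub>L\<^esub> (a [^] n \<odot>\<^bsub>L\<^esub> (b \<odot>\<^bsub>L\<^esub> u)) = \<zero>\<^bsub>L\<^esub>" by (intro sub sm an bu)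
      then show ?thesis using assoc[OF b(1) an bu, of n] n by simp
    qed
    from Cons.IH[OF p bu this] have IH: "(b \<otimes> homogenize p a b) \<odot>\<^bsub>L\<^esub> (b \<odot>\<^bsub>L\<^esub> u) = \<zero>\<^bsub>L\<^esub>" .
    have "b \<otimes> homogenize (c # p) a b = c \<otimes> (b \<otimes> a [^] length p) \<oplus> (b \<otimes> homogenize p a b) \<otimes> b"
      using a b(1) c an hR by (simp add: r_distr m_ac)
    also have "\<dots> \<odot>\<^bsub>L\<^esub> u = c \<odot>\<^bsub>L\<^esub> ((b \<otimes> a [^] length p) \<odot>\<^bsub>L\<^esub> u) \<oplus>\<^bsub>L\<^esub> (b \<otimes> homogenize p a b) \<odot>\<^bsub>L\<^esub> (b \<odot>\<^bsub>L\<^esub> u)"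
      using b(1) c an hR u by (simp add: distr assoc[of c] assoc[of "b \<otimes> homogenize p a b"])
    finally show ?case unfolding bak IH using null[OF c] by simp
  qed
  have av: "a = v \<otimes> b" using v b(1) by (simp add: m_comm)
  obtain p where p: "set p \<subseteq> R" "homogenize (\<one> # p) a b = \<zero>"
    by (rule integral_homogeneous_equation[OF v(1) R_carrier[OF a] R_carrier[OF b(1)] b(2) av])
  have a0: "a \<noteq> \<zero>" using al L.smult_l_null[OF l(1)] by auto
  then have an0: "a [^] (n::nat) \<noteq> \<zero>" for n using a by (induction n) (auto dest: integral)
  let ?n = "length p"
  obtain y where y: "y \<in> carrier L" "a [^] ?n \<odot>\<^bsub>L\<^esub> y = a \<odot>\<^bsub>L\<^esub> l"
  proof -
    have "a \<odot>\<^bsub>L\<^esub> l \<in> (\<lambda>k. a [^] ?n \<odot>\<^bsub>L\<^esub> k) ` carrier L"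
      using div an an0 sm[OF a l(1)] unfolding divisible_mod_def by simp
    then show ?thesis using that by auto
  qed
  have "(b \<otimes> a [^] (?n - 1)) \<odot>\<^bsub>L\<^esub> y = \<zero>\<^bsub>L\<^esub>" if ne: "p \<noteq> []"
  proof -
    obtain n where n: "length p = Suc n" using ne by (cases p) auto
    define k where "k = a [^] n \<odot>\<^bsub>L\<^esub> y"
    have k: "k \<in> carrier L" unfolding k_def by (rule sm[OF an y(1)])
    have ak: "a \<odot>\<^bsub>L\<^esub> k = a \<odot>\<^bsub>L\<^esub> l"
    proof -
      have "a \<otimes> a [^] n = a [^] Suc n" using a by (simp add: m_comm)
      then show ?thesis unfolding k_def using assoc[OF a an y(1), of n] y(2) by (simp add: n)
    qed
    have "a \<odot>\<^bsub>L\<^esub> (k \<ominus>\<^bsub>L\<^esub> l) = \<zero>\<^bsub>L\<^esub>"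
      using L.smult_r_distr[of a k "\<ominus>\<^bsub>L\<^esub> l"] L.smult_r_minus[of a l] a k l(1) ak sm[OF a l(1)] by (simp add: a_minus_def L.M.r_neg)
    then have "b \<odot>\<^bsub>L\<^esub> (k \<ominus>\<^bsub>L\<^esub> l) = \<zero>\<^bsub>L\<^esub>" using k l(1) by (intro sub) auto
    moreover have "k = (k \<ominus>\<^bsub>L\<^esub> l) \<oplus>\<^bsub>L\<^esub> l" using k l(1) by (simp add: a_minus_def L.M.a_assoc L.M.l_neg)
    ultimately have "b \<odot>\<^bsub>L\<^esub> k = \<zero>\<^bsub>L\<^esub>"
      using L.smult_r_distr[of b "k \<ominus>\<^bsub>L\<^esub> l" l] b(1) k l by simp
    then show ?thesis using assoc[OF b(1) an y(1), of n] by (simp add: n k_def)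
  qed
  from kill[OF p(1) y(1) this] have hy: "(b \<otimes> homogenize p a b) \<odot>\<^bsub>L\<^esub> y = \<zero>\<^bsub>L\<^esub>" .
  have hR: "homogenize p a b \<in> R" by (rule homogenize_subring[OF subring_R a b(1) p(1)])
  have "a [^] ?n \<oplus> b \<otimes> homogenize p a b = \<zero>" using p(2) an by simp
  then have "(a [^] ?n \<oplus> b \<otimes> homogenize p a b) \<odot>\<^bsub>L\<^esub> y = \<zero>\<^bsub>L\<^esub>" using L.smult_l_null[OF y(1)] by simp
  then have "a [^] ?n \<odot>\<^bsub>L\<^esub> y = \<zero>\<^bsub>L\<^esub>" using distr[OF an _ y(1), of "b \<otimes> homogenize p a b" ?n] hy hR b(1) sm[OF an y(1)] by simp
  then show False using y(2) al by simp
qed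

lemma direct_sum_imp_bad:
  assumes dvr: "DVR (F\<lparr>carrier := S\<rparr>)" and local: "quasilocal A"
    and iso: "mod_isomorphic A (Quo S R) (direct_sum I L)" and I: "I \<noteq> {}"
    and mod: "\<And>i. i \<in> I \<Longrightarrow> module A (L i)"
    and nonzero: "\<And>i. i \<in> I \<Longrightarrow> carrier (L i) \<noteq> {\<zero>\<^bsub>L i\<^esub>}"
    and div: "\<And>i. i \<in> I \<Longrightarrow> divisible_mod A (L i)"
    and lin: "\<And>i a b v l. \<lbrakk>i \<in> I; a \<in> R; b \<in> R; b \<noteq> \<zero>; v \<in> S; a = b \<otimes> v; l \<in> carrier (L i); b \<odot>\<^bsub>L i\<^esub> l = \<zero>\<^bsub>L i\<^esub>\<rbrakk>
      \<Longrightarrow> a \<odot>\<^bsub>L i\<^esub> l = \<zero>\<^bsub>L i\<^esub>"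
  shows "bad_stable_domain F R"
proof -
  note SE = subringE[OF DVR_subring[OF dvr]]
  have RS: "R \<subseteq> S" by (rule subsetI) (rule R_S)
  have rS: "rmod S" by (rule subring_S_rmod[OF DVR_subring[OF dvr]])
  let ?K = "Quo S R" and ?D = "direct_sum I L"
  interpret K: module A ?K by (rule Quo_module[OF rmod_R rS RS])
  interpret D: module A ?D by (rule direct_sum_module[OF A_cring mod])
  obtain f where f: "f \<in> mod_hom A ?K ?D" and bij: "bij_betw f (carrier ?K) (carrier ?D)"
    using iso unfolding mod_isomorphic_def by blast
  have f0: "f \<zero>\<^bsub>?K\<^esub> = \<zero>\<^bsub>?D\<^esub>" by (rule mod_hom_zero[OF K.module_axioms D.module_axioms f])
  have inj: "C = C'" if "C \<in> carrier ?K" "C' \<in> carrier ?K" "f C = f C'" for C C'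
    using bij that unfolding bij_betw_def by (auto dest: inj_onD)
  have surj: "\<exists>s\<in>S. d = f (cs R s)" if d: "d \<in> carrier ?D" for d
  proof -
    obtain C where "C \<in> carrier ?K" "d = f C" using bij d unfolding bij_betw_def by blast
    then show ?thesis by (auto elim: Quo_carrierE)
  qed
  have cl: "cs R s \<in> carrier ?K" if "s \<in> S" for s using that by (simp add: Quo_carrier)
  have smult: "r \<odot>\<^bsub>?K\<^esub> cs R s = cs R (r \<otimes> s)" if "r \<in> R" "s \<in> S" for r s
    using Quo_smult[OF rmod_R] that by simp
  have fsm: "f (cs R (r \<otimes> s)) = r \<odot>\<^bsub>?D\<^esub> f (cs R s)" if "r \<in> R" "s \<in> S" for r s
    using f cl[OF that(2)] that(1) unfolding smult[OF that, symmetric] mod_hom_def by simp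
  have zero: "\<zero>\<^bsub>?K\<^esub> = cs R \<zero>" by (simp add: Quo_zero cs_zero[OF rmod_R])
  have zero_iff: "f (cs R s) = \<zero>\<^bsub>?D\<^esub> \<longleftrightarrow> s \<in> R" if s: "s \<in> S" for s
  proof -
    have "f (cs R s) = \<zero>\<^bsub>?D\<^esub> \<longleftrightarrow> cs R s = \<zero>\<^bsub>?K\<^esub>" using inj[OF cl[OF s] K.M.zero_closed] f0 by auto
    also have "\<dots> \<longleftrightarrow> s \<in> R" using cs_eq_iff[OF rmod_R, of s \<zero>] s unfolding zero by (simp add: minus_eq)
    finally show ?thesis .
  qed
  have DS: "f (cs R s) \<in> carrier ?D" if "s \<in> S" for s using f cl[OF that] unfolding mod_hom_def by blast
  interpret normalization_DVR F R
  proof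
    show "S \<noteq> R"
    proof
      assume e: "S = R"
      obtain i where i: "i \<in> I" using I by blast
      interpret Li: module A "L i" by (rule mod[OF i])
      obtain l where l: "l \<in> carrier (L i)" "l \<noteq> \<zero>\<^bsub>L i\<^esub>" using nonzero[OF i] Li.M.zero_closed by blast
      define d where "d = (\<lambda>j\<in>I. if j = i then l else \<zero>\<^bsub>L j\<^esub>)"
      have z: "\<zero>\<^bsub>L j\<^esub> \<in> carrier (L j)" if "j \<in> I" for j
      proof -
        interpret Lj: module A "L j" by (rule mod[OF that])
        show ?thesis by simp
      qed
      have "{j \<in> I. d j \<noteq> \<zero>\<^bsub>L j\<^esub>} \<subseteq> {i}" by (auto simp: d_def)
      then have "finite {j \<in> I. d j \<noteq> \<zero>\<^bsub>L j\<^esub>}" by (rule finite_subset) simp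
      then have "d \<in> carrier ?D" using l(1) z by (auto simp: d_def)
      then obtain s where s: "s \<in> S" "d = f (cs R s)" using surj by blast
      then have "d = \<zero>\<^bsub>?D\<^esub>" using zero_iff[OF s(1)] e by simp
      then have "d i = \<zero>\<^bsub>L i\<^esub>" using i by simp
      then show False using l(2) i by (simp add: d_def)
    qed
    show "\<exists>a\<in>R. \<exists>t\<in>S. s = a \<oplus> r \<otimes> t" if r: "r \<in> R" "r \<noteq> \<zero>" and s: "s \<in> S" for r s
    proof -
      let ?d = "f (cs R s)"
      have d: "?d i \<in> carrier (L i)" if "i \<in> I" for i using DS[OF s] that by (auto simp: PiE_iff)
      have ex: "\<exists>k\<in>carrier (L i). r \<odot>\<^bsub>L i\<^esub> k = ?d i \<and> (?d i = \<zero>\<^bsub>L i\<^esub> \<longrightarrow> k = \<zero>\<^bsub>L i\<^esub>)" if i: "i \<in> I" for i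
      proof (cases "?d i = \<zero>\<^bsub>L i\<^esub>")
        case True
        interpret Li: module A "L i" by (rule mod[OF i])
        show ?thesis using True Li.smult_r_null[of r] r(1) by (intro bexI[of _ "\<zero>\<^bsub>L i\<^esub>"]) auto
      next
        case False
        have "?d i \<in> (\<lambda>k. r \<odot>\<^bsub>L i\<^esub> k) ` carrier (L i)" using div[OF i] r d[OF i] unfolding divisible_mod_def by simp
        then show ?thesis using False by auto
      qed
      then obtain e where e: "\<And>i. i \<in> I \<Longrightarrow> e i \<in> carrier (L i)" "\<And>i. i \<in> I \<Longrightarrow> r \<odot>\<^bsub>L i\<^esub> e i = ?d i"
        "\<And>i. i \<in> I \<Longrightarrow> ?d i = \<zero>\<^bsub>L i\<^esub> \<Longrightarrow> e i = \<zero>\<^bsub>L i\<^esub>" by metis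
      define e' where "e' = restrict e I"
      have "{i \<in> I. e' i \<noteq> \<zero>\<^bsub>L i\<^esub>} \<subseteq> {i \<in> I. ?d i \<noteq> \<zero>\<^bsub>L i\<^esub>}" using e(3) by (auto simp: e'_def)
      then have "finite {i \<in> I. e' i \<noteq> \<zero>\<^bsub>L i\<^esub>}" by (rule finite_subset) (use DS[OF s] in simp)
      then have "e' \<in> carrier ?D" using e(1) by (auto simp: e'_def)
      then obtain t where t: "t \<in> S" "e' = f (cs R t)" using surj by blast
      have "r \<odot>\<^bsub>?D\<^esub> e' = ?d"
      proof
        fix i show "(r \<odot>\<^bsub>?D\<^esub> e') i = ?d i"
          using DS[OF s] e(2) by (cases "i \<in> I") (auto simp: e'_def PiE_iff extensional_def)
      qed
      then have "f (cs R (r \<otimes> t)) = f (cs R s)" using fsm[OF r(1) t(1)] t(2) by simp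
      moreover have rt: "r \<otimes> t \<in> S" using SE(6)[OF R_S[OF r(1)] t(1)] .
      ultimately have "cs R (r \<otimes> t) = cs R s" using inj cl s by blast
      then have "r \<otimes> t \<ominus> s \<in> R" using cs_eq_iff[OF rmod_R, of "r \<otimes> t" s] rt s by simp
      then have "\<ominus> (r \<otimes> t \<ominus> s) \<in> R" by simp
      moreover have "s = \<ominus> (r \<otimes> t \<ominus> s) \<oplus> r \<otimes> t"
      proof -
        have [simp]: "r \<in> carrier F" "t \<in> carrier F" "s \<in> carrier F" using r t s by auto
        show ?thesis by (reify ring_reify, rule ring_identityI, simp, simp, code_simp)
      qed
      ultimately show ?thesis using t(1) by blast
    qed
    show "b \<otimes> (v \<otimes> s) \<in> R" if b: "b \<in> R" "v \<in> S" "s \<in> S" "b \<otimes> v \<in> R" "b \<otimes> s \<in> R" for b v s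
    proof (cases "b = \<zero>")
      case True
      then show ?thesis using b by simp
    next
      case False
      let ?d = "f (cs R s)"
      have bd: "b \<odot>\<^bsub>?D\<^esub> ?d = \<zero>\<^bsub>?D\<^esub>"
        using zero_iff[of "b \<otimes> s"] b R_S fsm[OF b(1,3)] by simp
      have "(b \<otimes> v) \<odot>\<^bsub>?D\<^esub> ?d = \<zero>\<^bsub>?D\<^esub>"
      proof
        fix i show "((b \<otimes> v) \<odot>\<^bsub>?D\<^esub> ?d) i = \<zero>\<^bsub>?D\<^esub> i"
        proof (cases "i \<in> I")
          case True
          have "?d i \<in> carrier (L i)" using DS[OF b(3)] True by (auto simp: PiE_iff)
          moreover have "b \<odot>\<^bsub>L i\<^esub> ?d i = \<zero>\<^bsub>L i\<^esub>" using fun_cong[OF bd, of i] True by simp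
          ultimately show ?thesis using lin[OF True b(4,1) False b(2) refl] True by simp
        qed simp
      qed
      then have "f (cs R (b \<otimes> v \<otimes> s)) = \<zero>\<^bsub>?D\<^esub>" using fsm[OF b(4,3)] by simp
      moreover have "b \<otimes> v \<otimes> s \<in> S" using SE(6)[OF R_S[OF b(4)] b(3)] .
      ultimately have "b \<otimes> v \<otimes> s \<in> R" using zero_iff by blast
      then show ?thesis using b by (simp add: m_assoc)
    qed
  qed (use dvr local in auto)
  show ?thesis by (rule bad_stable)
qed

lemma copies_imp_bad:
  assumes dvr: "DVR (F\<lparr>carrier := S\<rparr>)" and local: "quasilocal A"
    and copies: "nonempty_direct_sum_of_copies A (Quo S R) (Quo (carrier F) S)"
  shows "bad_stable_domain F R"
proof -
  note SE = subringE[OF DVR_subring[OF dvr]]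
  have rS: "rmod S" by (rule subring_S_rmod[OF DVR_subring[OF dvr]])
  have SF: "S \<subset> carrier F"
  proof -
    have "S \<noteq> carrier F"
    proof
      assume "S = carrier F"
      then have "F\<lparr>carrier := S\<rparr> = F" by simp
      then show False using dvr F.field_axioms unfolding DVR_def by simp
    qed
    then show ?thesis using SE(1) by blast
  qed
  obtain I :: "'a set set" where I: "I \<noteq> {}" "mod_isomorphic A (Quo S R) (direct_sum I (\<lambda>_. Quo (carrier F) S))"
    using copies unfolding nonempty_direct_sum_of_copies_def by blast
  show ?thesis
  proof (rule direct_sum_imp_bad[OF dvr local I(2,1)])
    show "module A (Quo (carrier F) S)" by (rule Quo_module[OF rS carrier_rmod SE(1)])
    show "carrier (Quo (carrier F) S) \<noteq> {\<zero>\<^bsub>Quo (carrier F) S\<^esub>}" by (rule Quo_nonzero[OF rS SF subset_refl])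
    show "divisible_mod A (Quo (carrier F) S)" by (rule Quo_F_divisible[OF rS])
    fix a b v C
    assume ab: "a \<in> R" "b \<in> R" "v \<in> S" "a = b \<otimes> v" and C: "C \<in> carrier (Quo (carrier F) S)"
      "b \<odot>\<^bsub>Quo (carrier F) S\<^esub> C = \<zero>\<^bsub>Quo (carrier F) S\<^esub>"
    obtain z where z: "z \<in> carrier F" "C = cs S z" using C(1) by (rule Quo_carrierE)
    have zero_iff: "r \<odot>\<^bsub>Quo (carrier F) S\<^esub> C = \<zero>\<^bsub>Quo (carrier F) S\<^esub> \<longleftrightarrow> r \<otimes> z \<in> S" if "r \<in> R" for r
    proof -
      have "r \<odot>\<^bsub>Quo (carrier F) S\<^esub> C = cs S (r \<otimes> z)" unfolding z(2) by (rule Quo_smult[OF rS z(1) that])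
      then show ?thesis using cs_eq_iff[OF rS, of "r \<otimes> z" \<zero>] cs_zero[OF rS] that z(1) by (simp add: Quo_zero minus_eq)
    qed
    have "v \<otimes> (b \<otimes> z) \<in> S" using SE(6) ab(3) C(2) zero_iff[OF ab(2)] by blast
    moreover have "v \<otimes> (b \<otimes> z) = a \<otimes> z" unfolding ab(4) using ab(2,3) z(1) by (simp add: m_ac)
    ultimately show "a \<odot>\<^bsub>Quo (carrier F) S\<^esub> C = \<zero>\<^bsub>Quo (carrier F) S\<^esub>" using zero_iff[OF ab(1)] by simp
  qed
qed

lemma divisible_uniserial_imp_bad:
  assumes dvr: "DVR (F\<lparr>carrier := S\<rparr>)" and local: "quasilocal A"
    and sum: "nonempty_direct_sum_of_nonzero A (Quo S R) (\<lambda>L. divisible_mod A L \<and> artinian_mod A L \<and> uniserial A L)"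
  shows "bad_stable_domain F R"
proof -
  from sum[unfolded nonempty_direct_sum_of_nonzero_def]
  obtain I :: "'a set set" and L :: "'a set \<Rightarrow> ('a, 'a set) module" where I: "I \<noteq> {}"
    and L: "\<forall>i\<in>I. module A (L i) \<and> carrier (L i) \<noteq> {\<zero>\<^bsub>L i\<^esub>} \<and>
      divisible_mod A (L i) \<and> artinian_mod A (L i) \<and> uniserial A (L i)"
    and iso: "mod_isomorphic A (Quo S R) (direct_sum I L)"
    by (elim exE conjE) (rule that)
  show ?thesis
  proof (rule direct_sum_imp_bad[OF dvr local iso I])
    fix i assume i: "i \<in> I"
    then show mod: "module A (L i)" and "carrier (L i) \<noteq> {\<zero>\<^bsub>L i\<^esub>}" and div: "divisible_mod A (L i)"
      using L by auto
    have uni: "uniserial A (L i)" using L i by blast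
    fix a b v l
    assume "a \<in> R" "b \<in> R" "b \<noteq> \<zero>" "v \<in> S" "a = b \<otimes> v" "l \<in> carrier (L i)" "b \<odot>\<^bsub>L i\<^esub> l = \<zero>\<^bsub>L i\<^esub>"
    then show "a \<odot>\<^bsub>L i\<^esub> l = \<zero>\<^bsub>L i\<^esub>" by (rule uniserial_S_linear[OF mod div uni])
  qed
qed

end

theorem theorem4p2:
  fixes F :: "('a, 'b) ring_scheme" and R :: "'a set"
  defines "A \<equiv> F\<lparr>carrier := R\<rparr>"
    and "Rbar \<equiv> integral_closure F R"
  assumes "quotient_field_of F R"
    and "quasilocal A"
  shows "(bad_stable_domain F R \<longleftrightarrow>
            DVR (F\<lparr>carrier := Rbar\<rparr>) \<and>
            nonempty_direct_sum_of_copies A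
              (quotient_mod (module_in F Rbar) R)
              (quotient_mod (module_in F (carrier F)) Rbar)) \<and>
         (bad_stable_domain F R \<longleftrightarrow>
            DVR (F\<lparr>carrier := Rbar\<rparr>) \<and>
            nonempty_direct_sum_of_nonzero A
              (quotient_mod (module_in F Rbar) R)
              (\<lambda>L. divisible_mod A L \<and> artinian_mod A L \<and> uniserial A L))"
proof -
  have "field F" using assms(3) by (simp add: quotient_field_of_def)
  then interpret fraction_field F R using assms(3) by (simp add: fraction_field_def fraction_field_axioms_def)
  have local: "quasilocal (F\<lparr>carrier := R\<rparr>)" using assms(4) unfolding A_def .
  have forward: "DVR (F\<lparr>carrier := S\<rparr>) \<and>
      nonempty_direct_sum_of_copies (F\<lparr>carrier := R\<rparr>) (Quo S R) (Quo (carrier F) S) \<and>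
      nonempty_direct_sum_of_nonzero (F\<lparr>carrier := R\<rparr>) (Quo S R)
        (\<lambda>L. divisible_mod (F\<lparr>carrier := R\<rparr>) L \<and> artinian_mod (F\<lparr>carrier := R\<rparr>) L \<and> uniserial (F\<lparr>carrier := R\<rparr>) L)"
    if "bad_stable_domain F R"
  proof -
    interpret infinite_stable_local_ring F R by (rule bad_imp_infinite_stable_local_ring[OF that])
    show ?thesis using S_DVR imp_direct_sum_of_copies imp_direct_sum_of_artinian_uniserial by blast
  qed
  show ?thesis
    unfolding A_def Rbar_def S_def[symmetric]
    using forward copies_imp_bad[OF _ local] divisible_uniserial_imp_bad[OF _ local] by blast
qed

end
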